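(* Let $n=1$. For $d\in\frac12\mathbb Z$ and $k\ge1$, the numerical invariants $N_{d,k}=N^{M_1}_{d,k}$ of the object $M_1$ are $$N_{d,k}=\begin{cases}2,& d=\tfrac12\ \text{and}\ k\ \text{even},\\0,&\text{otherwise.}\end{cases}$$
   Context: Tensor products and direct sums are completed with respect to the relevant valuations. $R=R_1=\{\sum_{i\ge0}a_iT^{\beta_i}\mid a_i\in\mathbb R,\beta_i\in\frac12\mathbb Z,\lim\beta_i=\infty\}$, $|T^\beta|=4\beta$, trivial differential, $\nu_R(\sum a_iT^{\beta_i})=\inf_{a_i\ne0}\beta_i$. $S=R\langle z_0,z_1\rangle/\langle z_0z_1-T\rangle$ (quotient of the Tate algebra), $|z_i|=2$; for $\zeta=(\zeta_0,\zeta_1)$ with $\zeta_0+\zeta_1=1$, $\zeta_i>0$, $\nu_\zeta^S$ is the valuation with $\nu^S_\zeta(z_i)=\zeta_i$ and the monomials $z_0^a,z_1^a$ orthogonal over $R$. $W=-z_0+z_1=z_1-T/z_1$. $\mathrm{Cl}$ is the $S$-algebra generated by $e_0,e_1$ ($|e_i|=1$) with $e_0^2=-z_0$, $e_1^2=z_1$, $e_0e_1+e_1e_0=0$, with valuations $\nu_\zeta$ determined by $\nu_\zeta(e_i)=\frac12\zeta_i$ and $1,e_0,e_1,e_0e_1$ orthogonal over $S$. $M=M_1=\mathrm{Cl}/\langle e_0e_1-T^{1/2}\rangle$ (quotient by the left ideal), a free $S$-module with basis $1,e_1$ and induced valuations $\nu^M_\zeta$; $D$ is left multiplication by $e_0+e_1$,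 so $D^2=W$. $\mathrm{End}(M)$ (the $S$-linear endomorphisms) has differential $\delta(\Phi)=D\Phi-(-1)^{|\Phi|}\Phi D$ and norm $\nu_M(\Phi)=\inf_\zeta\inf_{m\ne0}\{\nu^M_\zeta(\Phi m)-\nu^M_\zeta(m)\}$. $s$ is a formal variable of degree $1-n=0$; $R^s=\mathbb R[[s]]\otimes R$, $\mathrm{End}(M)^s=\mathbb R[[s]]\otimes\mathrm{End}(M)$, with $\nu(s^ix)=i+\nu(x)$. A bounding cochain is $b\in\mathrm{End}(M)^s$ of degree $1$ with $\nu(b)>0$ and $\delta(b)-b^2=c\cdot\mathrm{id}$ for some $c\in R^s$ of degree $2$ with $\nu(c)>0$; $c$ is called its potential. Cyclic complex of $A=\mathrm{End}(M)^s$: $C_l(A)=A\otimes A[1]^{\otimes(l-1)}$ (over $R^s$), $C_*=\bigoplus_{l\ge1}C_l$. With $|sa|=|a|-1$ and $\epsilon_i=\sum_{j\ge i}|sa_j|$, $d_{cc}=b(\mu_1)+b(\mu_2)$, $b(\mu_1)(a_l\otimes\cdots\otimes a_1)=\delta(a_l)\otimes\cdots\otimes a_1+\sum_{i=1}^{l-1}(-1)^{\epsilon_{i+1}}a_l\otimes\cdots\otimes\delta(a_i)\otimes\cdots\otimes a_1$, $b(\mu_2)(a_l\otimes\cdots\otimes a_1)=(-1)^{|a_l|}a_la_{l-1}\otimes a_{l-2}\otimes\cdots\otimes a_1-\sum_{i=1}^{l-2}(-1)^{\epsilon_{i+1}}a_l\otimes\cdots\otimes a_{i+1}a_i\otimes\cdots\otimes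 a_1-(-1)^{|sa_1|(\epsilon_2+1)}a_1a_l\otimes a_{l-1}\otimes\cdots\otimes a_2$ ($0$ for $l=1$); $t(a_l\otimes\cdots\otimes a_1)=(-1)^{|sa_l|(\epsilon_1-|sa_l|)}a_{l-1}\otimes\cdots\otimes a_1\otimes a_l$; $C^\lambda_*(A)=C_*(A)/\mathrm{Im}(\mathrm{id}-t)$. $\mathcal R^\lambda_*\subset C^\lambda_*(A)$ is the subcomplex of (infinite) sums of elements $a_l\otimes\cdots\otimes a_1$ with some $a_i\in R^s$, and $C^\lambda_*(R^s)$ is the $R^s$-span of the $\mathrm{id}^{\otimes l}$. For a bounding cochain $b$, $\exp(b)=\mathrm{id}+\sum_{k\ge1}\frac1kb^{\otimes k}$ and $\widetilde{\exp}(b)=\exp(b)-y_b$, where $y_b\in\mathcal R^\lambda_*$ satisfies $d_{cc}(y_b)-d_{cc}(\exp(b))\in C^\lambda_*(R^s)$; such $y_b$ exists and $\Theta(\widetilde{\exp}(b))$ does not depend on its choice. $\Theta=\sum_{l\ge1}\Theta_l:C^\lambda_*(A)\to R^s$ is the $R^s$-multilinear extension of $\Theta_l(\Phi_l\otimes\cdots\otimes\Phi_1)=-\sum_{x=\pm iT^{1/2}}\mathrm{Res}_{z_1=x}\frac{\mathrm{str}(\Phi_l\,\partial_1D\cdots\Phi_1\,\partial_1D)}{(\partial_1W)^l}\frac{dz_1}{z_1}$, where endomorphisms are written as $2\times2$ matrices in the basis $1,e_1$ (even, odd), $z_0=T/z_1$, $\partial_1=\partial/\partial z_1$ acts entrywise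 on the matrix of $D$, and $\mathrm{str}$ is the supertrace. A bounding cochain is point-like if $\Theta(\widetilde{\exp}(b))=s$. Point-like bounding cochains exist and their potential $c$ is independent of the choice. The numerical invariants $N^{M}_{d,k}\in\mathbb R$ ($d\in\frac12\mathbb Z$, $k\ge1$) are defined by $c=\sum_{k\ge0}\sum_{d}N^M_{d,k+1}\frac{s^k}{k!}T^d$. *)

theory Defs
  imports
    "HOL-Library.Extended_Real"
    "HOL-Library.Groups_Big_Fun"
    "HOL-Library.Poly_Mapping"
    "HOL-Computational_Algebra.Formal_Laurent_Series"
    Complex_Main
begin

unbundle Formal_Power_Series.fps_syntax and Formal_Laurent_Series.fps_syntax
lifting_forget fls.lifting

section \<open>The Novikov ring\<close>

text \<open>
  Since all exponents lie in \<open>\<half>\<int>\<close>, the ring \<open>R\<close> is the field of formal Laurent series in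
  \<open>T\<^sup>1\<^sup>/\<^sup>2\<close>, i.e. \<^typ>\<open>real fls\<close> with \<^term>\<open>fls_X\<close> playing the role of \<open>T\<^sup>1\<^sup>/\<^sup>2\<close>.
  The residues below live in its complexification \<^typ>\<open>complex fls\<close>.
\<close>

abbreviation Thalf :: "'a::{zero,one} fls" where "Thalf \<equiv> fls_X"
abbreviation TT :: "'a::comm_semiring_1 fls" where "TT \<equiv> Thalf ^ 2"

definition nov_val :: "'a::zero fls \<Rightarrow> ereal" where
  "nov_val f = (INF m\<in>{m. f $$ m \<noteq> 0}. ereal (of_int m / 2))"

(* T^(m/2) has degree 4 * (m/2) *)
definition nov_hom :: "int \<Rightarrow> real fls \<Rightarrow> bool" where
  "nov_hom j f \<longleftrightarrow> (\<forall>m. f $$ m \<noteq> 0 \<longrightarrow> 2 * m = j)"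

definition nov_complex :: "real fls \<Rightarrow> complex fls" where
  "nov_complex f = Abs_fls (\<lambda>m. complex_of_real (f $$ m))"

text \<open>The sum of a \<open>T\<close>-adically summable family, computed coefficient by coefficient.\<close>

definition nov_sum :: "('i \<Rightarrow> 'a::comm_monoid_add fls) \<Rightarrow> 'a fls" where
  "nov_sum f = Abs_fls (\<lambda>m. Sum_any (\<lambda>i. f i $$ m))"

lemma nov_val_0 [simp]: "nov_val 0 = \<infinity>"
  by (simp add: nov_val_def top_ereal_def)

lemma nov_val_nonzero:
  assumes "f \<noteq> 0"
  shows "nov_val f = ereal (of_int (fls_subdegree f) / 2)"
  unfolding nov_val_def
proof (rule INF_eqI)
  fix m assume "m \<in> {m. f $$ m \<noteq> 0}"
  then show "ereal (of_int (fls_subdegree f) / 2) \<le> ereal (of_int m / 2)"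
    using fls_subdegree_leI[of f m] by simp
next
  fix y assume "\<And>m. m \<in> {m. f $$ m \<noteq> 0} \<Longrightarrow> y \<le> ereal (of_int m / 2)"
  then show "y \<le> ereal (of_int (fls_subdegree f) / 2)" using assms by simp
qed

lemma nov_val_le_iff: "nov_val f \<le> ereal B \<longleftrightarrow> (\<exists>m\<le>\<lfloor>2 * B\<rfloor>. f $$ m \<noteq> 0)"
proof (cases "f = 0")
  case False
  have "nov_val f \<le> ereal B \<longleftrightarrow> of_int (fls_subdegree f) \<le> 2 * B"
    using nov_val_nonzero[OF False] by auto
  also have "\<dots> \<longleftrightarrow> fls_subdegree f \<le> \<lfloor>2 * B\<rfloor>" by (simp add: le_floor_iff)
  also have "\<dots> \<longleftrightarrow> (\<exists>m\<le>\<lfloor>2 * B\<rfloor>. f $$ m \<noteq> 0)"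
    using False fls_subdegree_leI[of f] nth_fls_subdegree_nonzero[OF False]
    by (meson order_trans)
  finally show ?thesis .
qed simp

lemma fls_mult_nth_nonzeroD:
  fixes f g :: "'a::semiring_0 fls"
  assumes "(f * g) $$ m \<noteq> 0"
  shows "\<exists>i. f $$ i \<noteq> 0 \<and> g $$ (m - i) \<noteq> 0"
proof (rule ccontr)
  assume "\<nexists>i. f $$ i \<noteq> 0 \<and> g $$ (m - i) \<noteq> 0"
  then have "\<And>i. f $$ i * g $$ (m - i) = 0" by (metis mult_zero_left mult_zero_right)
  then have "(f * g) $$ m = 0" by (simp add: fls_times_nth(2))
  with assms show False by simp
qed

lemma fls_X_square_power_times_nth:
  "((f :: 'a::comm_ring_1 fls) * TT ^ i) $$ m = f $$ (m - 2 * int i)"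
proof -
  have "f * TT ^ i = fls_shift (- int (2 * i)) f"
    by (simp add: fls_X_power_times_conv_shift(2) flip: power_mult)
  then show ?thesis by simp
qed

section \<open>The Tate algebra and the ring \<open>S\<close>\<close>

text \<open>
  \<open>R\<langle>z\<^sub>0, z\<^sub>1\<rangle>\<close> consists of those power series in \<open>R[[z\<^sub>1]][[z\<^sub>0]]\<close> whose coefficients tend to \<open>0\<close>;
  \<open>F $ a $ b\<close> is the coefficient of \<open>z\<^sub>0\<^sup>a z\<^sub>1\<^sup>b\<close>.
\<close>

definition is_tate :: "real fls fps fps \<Rightarrow> bool" where
  "is_tate F \<longleftrightarrow> (\<forall>B::real. finite {(a, b). nov_val (F $ a $ b) \<le> ereal B})"

definition tate_supp :: "int \<Rightarrow> real fls fps fps \<Rightarrow> (nat \<times> nat) set" where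
  "tate_supp N F = {(a, b). \<exists>m\<le>N. F $ a $ b $$ m \<noteq> 0}"

lemma is_tate_iff: "is_tate F \<longleftrightarrow> (\<forall>N. finite (tate_supp N F))"
proof
  assume *: "is_tate F"
  show "\<forall>N. finite (tate_supp N F)"
  proof
    fix N :: int
    have "finite {(a, b). nov_val (F $ a $ b) \<le> ereal (of_int N / 2)}"
      using * unfolding is_tate_def by blast
    then show "finite (tate_supp N F)"
      unfolding nov_val_le_iff tate_supp_def by simp
  qed
next
  assume "\<forall>N. finite (tate_supp N F)"
  then show "is_tate F"
    unfolding is_tate_def nov_val_le_iff tate_supp_def by blast
qed

lemma tate_lower_bound:
  assumes "is_tate F"
  obtains L where "\<And>a b m. F $ a $ b $$ m \<noteq> 0 \<Longrightarrow> L \<le> m"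
proof -
  have fin: "finite (tate_supp 0 F)" using assms is_tate_iff by blast
  define L where "L = Min (insert 0 ((\<lambda>(a, b). fls_subdegree (F $ a $ b)) ` tate_supp 0 F))"
  have "L \<le> m" if "F $ a $ b $$ m \<noteq> 0" for a b m
  proof (cases "m \<le> 0")
    case True
    then have "(a, b) \<in> tate_supp 0 F" using that by (auto simp: tate_supp_def)
    then have "L \<le> fls_subdegree (F $ a $ b)" unfolding L_def using fin by (intro Min_le) force+
    then show ?thesis using fls_subdegree_leI[OF that] by linarith
  next
    case False
    have "L \<le> 0" unfolding L_def using fin by (intro Min_le) auto
    then show ?thesis using False by linarith
  qed
  then show ?thesis using that by blast
qed

lemma fls_sum_nth: "(\<Sum>i\<in>A. f i) $$ n = (\<Sum>i\<in>A. (f i :: 'a::comm_monoid_add fls) $$ n)"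
  by (induction A rule: infinite_finite_induct) auto

lemma is_tate_mult:
  assumes F: "is_tate F" and G: "is_tate G"
  shows "is_tate (F * G)"
  unfolding is_tate_iff
proof
  fix N
  obtain L where L: "\<And>a b m. F $ a $ b $$ m \<noteq> 0 \<Longrightarrow> L \<le> m" by (rule tate_lower_bound[OF F]) blast
  obtain K where K: "\<And>a b m. G $ a $ b $$ m \<noteq> 0 \<Longrightarrow> K \<le> m" by (rule tate_lower_bound[OF G]) blast
  let ?P = "(\<lambda>((a, b), (c, d)). (a + c, b + d)) ` (tate_supp (N - K) F \<times> tate_supp (N - L) G)"
  have "tate_supp N (F * G) \<subseteq> ?P"
  proof
    fix p assume "p \<in> tate_supp N (F * G)"
    then obtain a b m where p: "p = (a, b)" "m \<le> N" and nz: "(F * G) $ a $ b $$ m \<noteq> 0"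
      by (auto simp: tate_supp_def)
    have "(F * G) $ a $ b $$ m
        = (\<Sum>i=0..a. \<Sum>j=0..b. (F $ i $ j * G $ (a - i) $ (b - j)) $$ m)"
      by (simp add: fps_mult_nth fps_sum_nth fls_sum_nth)
    with nz obtain i where i: "i \<in> {0..a}"
      "(\<Sum>j=0..b. (F $ i $ j * G $ (a - i) $ (b - j)) $$ m) \<noteq> 0"
      by (metis (no_types, lifting) sum.neutral)
    then obtain j where j: "j \<in> {0..b}" "(F $ i $ j * G $ (a - i) $ (b - j)) $$ m \<noteq> 0"
      by (metis (no_types, lifting) sum.neutral)
    then obtain k where k: "F $ i $ j $$ k \<noteq> 0" "G $ (a - i) $ (b - j) $$ (m - k) \<noteq> 0"
      using fls_mult_nth_nonzeroD by blast
    have "(i, j) \<in> tate_supp (N - K) F"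
      unfolding tate_supp_def using k K[OF k(2)] p(2) by (auto intro!: exI[of _ k])
    moreover have "(a - i, b - j) \<in> tate_supp (N - L) G"
      unfolding tate_supp_def using k L[OF k(1)] p(2) by (auto intro!: exI[of _ "m - k"])
    ultimately have "((i, j), (a - i, b - j)) \<in> tate_supp (N - K) F \<times> tate_supp (N - L) G"
      by blast
    then show "p \<in> ?P"
      using i(1) j(1) p(1) by (intro image_eqI[where x = "((i, j), (a - i, b - j))"]) auto
  qed
  moreover have "finite ?P"
    using F G unfolding is_tate_iff by (intro finite_imageI finite_cartesian_product) auto
  ultimately show "finite (tate_supp N (F * G))" by (rule finite_subset)
qed

lemma is_tate_add: "is_tate F \<Longrightarrow> is_tate G \<Longrightarrow> is_tate (F + G)"
proof -
  assume "is_tate F" "is_tate G"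
  moreover have "tate_supp N (F + G) \<subseteq> tate_supp N F \<union> tate_supp N G" for N
    unfolding tate_supp_def by fastforce
  ultimately show ?thesis unfolding is_tate_iff by (meson finite_UnI finite_subset)
qed

lemma is_tate_uminus: "is_tate F \<Longrightarrow> is_tate (- F)"
  unfolding is_tate_iff tate_supp_def by simp

lemma is_tate_diff: "is_tate F \<Longrightarrow> is_tate G \<Longrightarrow> is_tate (F - G)"
  using is_tate_add[of F "- G"] is_tate_uminus[of G] by simp

lemma is_tate_monom:
  assumes "\<And>a b. (a, b) \<noteq> p \<Longrightarrow> F $ a $ b = 0"
  shows "is_tate F"
proof -
  have "tate_supp N F \<subseteq> {p}" for N
    unfolding tate_supp_def using assms by fastforce
  then show ?thesis unfolding is_tate_iff by (meson finite.simps finite_subset)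
qed

lemma is_tate_const: "is_tate (fps_const (fps_const r))"
  by (rule is_tate_monom[where p = "(0, 0)"]) auto

typedef tate = "{F. is_tate F}"
  morphisms tate_fps Abs_tate
  using is_tate_const by blast

setup_lifting type_definition_tate

instantiation tate :: comm_ring_1
begin
lift_definition zero_tate :: tate is 0 using is_tate_const[of 0] by simp
lift_definition one_tate :: tate is 1 using is_tate_const[of 1] by simp
lift_definition plus_tate :: "tate \<Rightarrow> tate \<Rightarrow> tate" is "(+)" by (rule is_tate_add)
lift_definition minus_tate :: "tate \<Rightarrow> tate \<Rightarrow> tate" is "(-)" by (rule is_tate_diff)
lift_definition uminus_tate :: "tate \<Rightarrow> tate" is uminus by (rule is_tate_uminus)
lift_definition times_tate :: "tate \<Rightarrow> tate \<Rightarrow> tate" is "(*)" by (rule is_tate_mult)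
instance by standard (transfer; simp add: algebra_simps)+
end

lift_definition tate_const :: "real fls \<Rightarrow> tate" is "\<lambda>r. fps_const (fps_const r)"
  by (rule is_tate_const)
lift_definition tate_z0 :: tate is "fps_X"
  by (rule is_tate_monom[where p = "(1, 0)"]) (auto simp: fps_X_def)
lift_definition tate_z1 :: tate is "fps_const fps_X"
  by (rule is_tate_monom[where p = "(0, 1)"]) (auto simp: fps_X_def)

lift_definition tate_coeff :: "tate \<Rightarrow> nat \<Rightarrow> nat \<Rightarrow> real fls" is "\<lambda>F a b. F $ a $ b" .

lemma is_tate_d0: "is_tate F \<Longrightarrow> is_tate (fps_deriv F)"
proof -
  assume F: "is_tate F"
  have nat: "of_nat n * (f :: real fls) = fls_const (of_nat n) * f" for n f
    by (simp add: fls_of_nat)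
  have "tate_supp N (fps_deriv F) \<subseteq> (\<lambda>(a, b). (a - 1, b)) ` tate_supp N F" for N
  proof
    fix p assume "p \<in> tate_supp N (fps_deriv F)"
    then obtain a b m where p: "p = (a, b)" "m \<le> N" "fps_deriv F $ a $ b $$ m \<noteq> 0"
      by (auto simp: tate_supp_def)
    have "fps_deriv F $ a $ b $$ m = of_nat (a + 1) * F $ (a + 1) $ b $$ m"
      by (simp add: nat fps_of_nat[symmetric] del: of_nat_add of_nat_Suc)
    with p have "F $ (a + 1) $ b $$ m \<noteq> 0" by auto
    then have "(a + 1, b) \<in> tate_supp N F" using p(2) by (auto simp: tate_supp_def)
    then show "p \<in> (\<lambda>(a, b). (a - 1, b)) ` tate_supp N F" using p(1) by force
  qed
  then show ?thesis using F unfolding is_tate_iff by (meson finite_imageI finite_subset)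
qed

lemma is_tate_d1: "is_tate F \<Longrightarrow> is_tate (Abs_fps (\<lambda>a. fps_deriv (F $ a)))"
proof -
  assume F: "is_tate F"
  have nat: "of_nat n * (f :: real fls) = fls_const (of_nat n) * f" for n f
    by (simp add: fls_of_nat)
  have "tate_supp N (Abs_fps (\<lambda>a. fps_deriv (F $ a))) \<subseteq> (\<lambda>(a, b). (a, b - 1)) ` tate_supp N F" for N
  proof
    fix p assume "p \<in> tate_supp N (Abs_fps (\<lambda>a. fps_deriv (F $ a)))"
    then obtain a b m where p: "p = (a, b)" "m \<le> N" "of_nat (b + 1) * F $ a $ (b + 1) $$ m \<noteq> 0"
      by (auto simp: tate_supp_def nat simp del: of_nat_add of_nat_Suc)
    then have "(a, b + 1) \<in> tate_supp N F" by (auto simp: tate_supp_def)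
    then show "p \<in> (\<lambda>(a, b). (a, b - 1)) ` tate_supp N F" using p(1) by force
  qed
  then show ?thesis using F unfolding is_tate_iff by (meson finite_imageI finite_subset)
qed

lift_definition tate_d0 :: "tate \<Rightarrow> tate" is fps_deriv by (rule is_tate_d0)
lift_definition tate_d1 :: "tate \<Rightarrow> tate" is "\<lambda>F. Abs_fps (\<lambda>a. fps_deriv (F $ a))"
  by (rule is_tate_d1)

lemma tate_eqI: "(\<And>a b. tate_coeff F a b = tate_coeff G a b) \<Longrightarrow> F = G"
  by transfer (simp add: fps_eq_iff)

lemma tate_coeff_simps [simp]:
  "tate_coeff 0 a b = 0"
  "tate_coeff (F + G) a b = tate_coeff F a b + tate_coeff G a b"
  "tate_coeff (F - G) a b = tate_coeff F a b - tate_coeff G a b"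
  "tate_coeff (- F) a b = - tate_coeff F a b"
  "tate_coeff (tate_const r * F) a b = r * tate_coeff F a b"
  "tate_coeff (tate_z0 * F) a b = (if a = 0 then 0 else tate_coeff F (a - 1) b)"
  "tate_coeff (tate_z1 * F) a b = (if b = 0 then 0 else tate_coeff F a (b - 1))"
  "tate_coeff 1 a b = (if a = 0 \<and> b = 0 then 1 else 0)"
  by (transfer; simp)+

lemma tate_coeff_const: "tate_coeff (tate_const r) a b = (if a = 0 \<and> b = 0 then r else 0)"
  by transfer simp

lemma tate_const_hom:
  "tate_const (r + s) = tate_const r + tate_const s"
  "tate_const (r * s) = tate_const r * tate_const s"
  "tate_const 1 = 1" "tate_const 0 = 0"
  by (transfer; simp)+

text \<open>
  \<open>S\<close> is the quotient of the Tate algebra by the ideal generated by \<open>z\<^sub>0 z\<^sub>1 - T\<close>, that is, by the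
  multiples of this element.
\<close>

definition tate_rel_gen :: tate where
  "tate_rel_gen = tate_z0 * tate_z1 - tate_const TT"

definition tate_eq :: "tate \<Rightarrow> tate \<Rightarrow> bool" where
  "tate_eq F G \<longleftrightarrow> tate_rel_gen dvd F - G"

definition tate_reduced :: "tate \<Rightarrow> bool" where
  "tate_reduced F \<longleftrightarrow> (\<forall>a b. a > 0 \<and> b > 0 \<longrightarrow> tate_coeff F a b = 0)"

lemma tate_coeff_gen_mult:
  "tate_coeff (tate_rel_gen * G) a b
    = (if a = 0 \<or> b = 0 then 0 else tate_coeff G (a - 1) (b - 1)) - TT * tate_coeff G a b"
  by (simp add: tate_rel_gen_def left_diff_distrib mult.assoc)

lemma tate_reduced_dvd_imp_0:
  assumes "tate_reduced F" "tate_rel_gen dvd F"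
  shows "F = 0"
proof -
  obtain G where F: "F = tate_rel_gen * G" using assms(2) by (rule dvdE)
  have step: "tate_coeff G a b = TT * tate_coeff G (Suc a) (Suc b)" for a b
  proof -
    have "tate_coeff F (Suc a) (Suc b) = 0" using assms(1) by (simp add: tate_reduced_def)
    then show ?thesis by (simp add: F tate_coeff_gen_mult)
  qed
  have iter: "tate_coeff G a b = tate_coeff G (a + n) (b + n) * TT ^ n" for a b n
  proof (induction n)
    case (Suc n)
    then show ?case using step[of "a + n" "b + n"] by (simp add: mult_ac)
  qed simp
  have "G = 0"
  proof (rule tate_eqI, rule ccontr)
    fix a b assume "tate_coeff G a b \<noteq> tate_coeff 0 a b"
    then obtain m where m: "tate_coeff G a b $$ m \<noteq> 0"
      by (metis fls_eqI fls_zero_nth tate_coeff_simps(1))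
    have "tate_coeff G (a + n) (b + n) $$ (m - 2 * int n) \<noteq> 0" for n
      using m iter[of a b n] by (simp add: fls_X_square_power_times_nth)
    then have "(a + n, b + n) \<in> tate_supp m (tate_fps G)" for n
      unfolding tate_supp_def tate_coeff.rep_eq by (auto intro!: exI[of _ "m - 2 * int n"])
    then have "range (\<lambda>n. (a + n, b + n)) \<subseteq> tate_supp m (tate_fps G)" by blast
    moreover have "finite (tate_supp m (tate_fps G))"
      using tate_fps[of G] is_tate_iff by simp
    ultimately have "finite (range (\<lambda>n::nat. (a + n, b + n)))" by (rule finite_subset)
    moreover have "inj (\<lambda>n::nat. (a + n, b + n))" by (auto simp: inj_on_def)
    ultimately show False using finite_imageD by blast
  qed
  then show ?thesis by (simp add: F)
qed

lemma tate_reduced_exists: "\<exists>G. tate_reduced G \<and> tate_eq F G"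
proof -
  let ?c = "\<lambda>a b. tate_coeff F a b"
  have supp: "finite (tate_supp N (tate_fps F))" for N
    using tate_fps[of F] is_tate_iff by simp
  obtain L where L: "\<And>a b m. ?c a b $$ m \<noteq> 0 \<Longrightarrow> L \<le> m"
    by (rule tate_lower_bound[of "tate_fps F"]) (use tate_fps[of F] in \<open>auto simp: tate_coeff.rep_eq\<close>)
  define h where "h = (\<lambda>a b m. Sum_any (\<lambda>i. ?c (a + i) (b + i) $$ (m - 2 * int i)))"
  have mem: "(a + i, b + i) \<in> tate_supp m (tate_fps F)"
    if "?c (a + i) (b + i) $$ (m - 2 * int i) \<noteq> 0" for a b i m
    using that unfolding tate_supp_def tate_coeff.rep_eq by (auto intro!: exI[of _ "m - 2 * int i"])
  have fin: "finite {i. ?c (a + i) (b + i) $$ (m - 2 * int i) \<noteq> 0}" for a b m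
  proof (rule finite_imageD)
    show "finite ((\<lambda>i. (a + i, b + i)) ` {i. ?c (a + i) (b + i) $$ (m - 2 * int i) \<noteq> 0})"
      by (rule finite_subset[OF _ supp[of m]]) (use mem in blast)
  qed (auto simp: inj_on_def)
  have hD: "\<exists>i. ?c (a + i) (b + i) $$ (m - 2 * int i) \<noteq> 0" if "h a b m \<noteq> 0" for a b m
  proof (rule ccontr)
    assume "\<nexists>i. ?c (a + i) (b + i) $$ (m - 2 * int i) \<noteq> 0"
    then have "h a b m = 0" unfolding h_def by simp
    with that show False by simp
  qed
  define H where "H = (\<lambda>a b. Abs_fls (h a b))"
  have H: "H a b $$ m = h a b m" for a b m
    unfolding H_def
  proof (rule nth_Abs_fls_ex_lower_bound, intro exI allI impI)
    fix n assume "n < L"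
    then show "h a b n = 0" using hD[of a b n] L by fastforce
  qed
  have rec: "H a b = ?c a b + TT * H (Suc a) (Suc b)" for a b
  proof (rule fls_eqI)
    fix m
    define g where "g = (\<lambda>i. ?c (a + i) (b + i) $$ (m - 2 * int i))"
    have fg: "finite {i. g i \<noteq> 0}" unfolding g_def by (rule fin)
    define J where "J = insert 0 {i. g i \<noteq> 0}"
    obtain n where n: "J \<subseteq> {..<Suc n}"
      using fg finite_nat_set_iff_bounded[of J] unfolding J_def
      by (metis finite_insert lessThan_iff less_SucI subsetI)
    have "h a b m = sum g {..<Suc n}"
      unfolding h_def g_def[symmetric] by (rule Sum_any.expand_superset) (use n J_def in auto)
    also have "\<dots> = g 0 + (\<Sum>i<n. g (Suc i))" by (rule sum.lessThan_Suc_shift)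
    also have "(\<Sum>i<n. g (Suc i)) = Sum_any (\<lambda>i. g (Suc i))"
      by (rule Sum_any.expand_superset[symmetric]) (use n J_def in auto)
    also have "\<dots> = h (Suc a) (Suc b) (m - 2)"
      unfolding h_def g_def by (simp add: algebra_simps)
    finally show "H a b $$ m = (?c a b + TT * H (Suc a) (Suc b)) $$ m"
      using fls_X_square_power_times_nth[of "H (Suc a) (Suc b)" 1 m]
      by (simp add: H g_def mult.commute)
  qed
  have tate: "is_tate (Abs_fps (\<lambda>a. Abs_fps (\<lambda>b. if P a b then H (a + k) (b + k) else 0)))" for P k
    unfolding is_tate_iff
  proof
    fix N
    let ?G = "Abs_fps (\<lambda>a. Abs_fps (\<lambda>b. if P a b then H (a + k) (b + k) else 0))"
    let ?I = "\<Union>(x, y)\<in>tate_supp N (tate_fps F). {..x} \<times> {..y}"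
    have "tate_supp N ?G \<subseteq> ?I"
    proof
      fix p assume "p \<in> tate_supp N ?G"
      then obtain a b m where p: "p = (a, b)" "m \<le> N" "h (a + k) (b + k) m \<noteq> 0"
        by (auto simp: tate_supp_def H split: if_splits)
      then obtain i where "?c (a + k + i) (b + k + i) $$ (m - 2 * int i) \<noteq> 0" using hD by blast
      from mem[OF this] have "(a + k + i, b + k + i) \<in> tate_supp N (tate_fps F)"
        using p(2) by (simp add: tate_supp_def) (meson order_trans)
      then show "p \<in> ?I" unfolding p(1) by fastforce
    qed
    moreover have "finite ?I" using supp by auto
    ultimately show "finite (tate_supp N ?G)" by (rule finite_subset)
  qed
  define mk where "mk = (\<lambda>P k. Abs_tate (Abs_fps (\<lambda>a. Abs_fps (\<lambda>b. if P a b then H (a + k) (b + k) else 0))))"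
  have mk: "tate_coeff (mk P k) a b = (if P a b then H (a + k) (b + k) else 0)" for P k a b
    unfolding mk_def tate_coeff.rep_eq using tate[of P k] by (simp add: Abs_tate_inverse)
  define G where "G = mk (\<lambda>a b. a = 0 \<or> b = 0) 0"
  have "F - G = tate_rel_gen * mk (\<lambda>_ _. True) 1"
  proof (rule tate_eqI)
    fix a b
    show "tate_coeff (F - G) a b = tate_coeff (tate_rel_gen * mk (\<lambda>_ _. True) 1) a b"
      using rec[of a b] by (cases a; cases b) (simp_all add: tate_coeff_gen_mult G_def mk)
  qed
  then have "tate_eq F G" by (simp add: tate_eq_def)
  moreover have "tate_reduced G" by (simp add: tate_reduced_def G_def mk)
  ultimately show ?thesis by blast
qed

quotient_type sring = tate / tate_eq
proof (rule equivpI)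
  show "reflp tate_eq" by (simp add: reflp_def tate_eq_def)
  show "symp tate_eq" unfolding symp_def tate_eq_def by (metis dvd_minus_iff minus_diff_eq)
  show "transp tate_eq"
  proof (rule transpI)
    fix F G H assume "tate_eq F G" "tate_eq G H"
    then have "tate_rel_gen dvd (F - G) + (G - H)" unfolding tate_eq_def by (rule dvd_add)
    then show "tate_eq F H" by (simp add: tate_eq_def)
  qed
qed

instantiation sring :: comm_ring_1
begin
lift_definition zero_sring :: sring is 0 .
lift_definition one_sring :: sring is 1 .
lift_definition plus_sring :: "sring \<Rightarrow> sring \<Rightarrow> sring" is "(+)"
proof -
  fix a b c d assume "tate_eq a b" "tate_eq c d"
  then have "tate_rel_gen dvd (a - b) + (c - d)" unfolding tate_eq_def by (rule dvd_add)
  then show "tate_eq (a + c) (b + d)" by (simp add: tate_eq_def algebra_simps)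
qed
lift_definition minus_sring :: "sring \<Rightarrow> sring \<Rightarrow> sring" is "(-)"
proof -
  fix a b c d assume "tate_eq a b" "tate_eq c d"
  then have "tate_rel_gen dvd (a - b) - (c - d)" unfolding tate_eq_def by (rule dvd_diff)
  then show "tate_eq (a - c) (b - d)" by (simp add: tate_eq_def algebra_simps)
qed
lift_definition uminus_sring :: "sring \<Rightarrow> sring" is uminus
proof -
  fix a b assume "tate_eq a b"
  then have "tate_rel_gen dvd - (a - b)" unfolding tate_eq_def by (simp only: dvd_minus_iff)
  then show "tate_eq (- a) (- b)" by (simp add: tate_eq_def algebra_simps)
qed
lift_definition times_sring :: "sring \<Rightarrow> sring \<Rightarrow> sring" is "(*)"
proof -
  fix a b c d assume "tate_eq a b" "tate_eq c d"
  then have "tate_rel_gen dvd (a - b) * c + b * (c - d)"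
    unfolding tate_eq_def by (intro dvd_add dvd_mult dvd_mult2)
  then show "tate_eq (a * c) (b * d)" by (simp add: tate_eq_def algebra_simps)
qed
instance
proof
  show "(0 :: sring) \<noteq> 1"
  proof (transfer, rule notI)
    assume "tate_eq 0 1"
    then have "tate_rel_gen dvd 1" unfolding tate_eq_def
      by (metis diff_0 dvd_minus_iff)
    moreover have "tate_reduced 1" by (simp add: tate_reduced_def)
    ultimately have "(1 :: tate) = 0" using tate_reduced_dvd_imp_0 by blast
    then have "tate_coeff 1 0 0 = tate_coeff 0 0 0" by simp
    then show False by simp
  qed
qed (transfer; simp add: tate_eq_def algebra_simps)+
end

lift_definition s_const :: "real fls \<Rightarrow> sring" is tate_const .
lift_definition z0 :: sring is tate_z0 .
lift_definition z1 :: sring is tate_z1 .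

lemma z0_z1: "z0 * z1 = s_const TT"
  by transfer (simp add: tate_eq_def flip: tate_rel_gen_def)

lemma s_const_hom:
  "s_const (r + s) = s_const r + s_const s"
  "s_const (r * s) = s_const r * s_const s"
  "s_const 1 = 1" "s_const 0 = 0"
  by (transfer; simp add: tate_const_hom tate_eq_def)+

text \<open>
  Every class in \<open>S\<close> has a unique representative involving only the monomials \<open>z\<^sub>0\<^sup>a\<close> and \<open>z\<^sub>1\<^sup>a\<close>.
  That these monomials are orthogonal means that the valuation is the minimum over its terms.
\<close>

lemma s_reduced_unique: "\<exists>!F. tate_reduced F \<and> abs_sring F = f"
proof -
  obtain F where F: "abs_sring F = f" by (metis Quotient3_abs_rep Quotient3_sring)
  obtain G where "tate_reduced G" "abs_sring G = f"
    using tate_reduced_exists[of F] F by (metis sring.abs_eq_iff)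
  moreover have "G = G'" if "tate_reduced G" "tate_reduced G'" "abs_sring G = abs_sring G'" for G G'
  proof -
    have "tate_reduced (G - G')" using that(1,2) by (simp add: tate_reduced_def)
    moreover have "tate_rel_gen dvd G - G'" using that(3) by (simp add: sring.abs_eq_iff tate_eq_def)
    ultimately show ?thesis using tate_reduced_dvd_imp_0 by fastforce
  qed
  ultimately show ?thesis by blast
qed

definition s_reduced :: "sring \<Rightarrow> tate" where
  "s_reduced f = (THE F. tate_reduced F \<and> abs_sring F = f)"

definition s_coeff :: "sring \<Rightarrow> nat \<Rightarrow> nat \<Rightarrow> real fls" where
  "s_coeff f = tate_coeff (s_reduced f)"

definition simplex :: "(real \<times> real) set" where
  "simplex = {(\<zeta>0, \<zeta>1). \<zeta>0 + \<zeta>1 = 1 \<and> \<zeta>0 > 0 \<and> \<zeta>1 > 0}"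

definition s_val :: "real \<times> real \<Rightarrow> sring \<Rightarrow> ereal" where
  "s_val \<zeta> f = (INF (a, b). nov_val (s_coeff f a b) + ereal (of_nat a * fst \<zeta> + of_nat b * snd \<zeta>))"

definition tate_hom :: "int \<Rightarrow> tate \<Rightarrow> bool" where
  "tate_hom j F \<longleftrightarrow> (\<forall>a b. nov_hom (j - 2 * int a - 2 * int b) (tate_coeff F a b))"

definition s_hom :: "int \<Rightarrow> sring \<Rightarrow> bool" where
  "s_hom j f \<longleftrightarrow> (\<exists>F. abs_sring F = f \<and> tate_hom j F)"

definition W_M :: sring where "W_M = - z0 + z1"

text \<open>
  The derivation \<open>\<partial>\<^sub>1\<close> of \<open>S\<close> is differentiation in \<open>z\<^sub>1\<close> subject to \<open>z\<^sub>0 = T / z\<^sub>1\<close>, so that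
  \<open>\<partial>\<^sub>1 z\<^sub>0 = - T / z\<^sub>1\<^sup>2 = - z\<^sub>0\<^sup>2 / T\<close>.
\<close>

lemma tate_d_mult:
  "tate_d0 (F * G) = tate_d0 F * G + F * tate_d0 G"
  "tate_d1 (F * G) = tate_d1 F * G + F * tate_d1 G"
proof -
  show "tate_d0 (F * G) = tate_d0 F * G + F * tate_d0 G"
    by transfer simp
  have *: "Abs_fps (\<lambda>a. fps_deriv ((F * G) $ a)) =
     Abs_fps (\<lambda>a. fps_deriv (F $ a)) * G + F * Abs_fps (\<lambda>a. fps_deriv (G $ a))"
    for F G :: "real fls fps fps"
    by (rule fps_ext)
      (simp add: fps_mult_nth sum.distrib[symmetric] fps_deriv_sum add.commute)
  show "tate_d1 (F * G) = tate_d1 F * G + F * tate_d1 G"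
    by transfer (rule *)
qed

lift_definition s_d1 :: "sring \<Rightarrow> sring" is
  "\<lambda>F. tate_d1 F - tate_const (inverse TT) * tate_z0\<^sup>2 * tate_d0 F"
proof -
  fix F G assume "tate_eq F G"
  then obtain H where H: "F - G = tate_rel_gen * H" unfolding tate_eq_def by (rule dvdE)
  let ?d = "\<lambda>F. tate_d1 F - tate_const (inverse TT) * tate_z0\<^sup>2 * tate_d0 F"
  have TT: "tate_const TT * tate_const (inverse TT) = 1"
    by (simp add: tate_const_hom flip: tate_const_hom(2))
  have gen: "tate_d0 tate_rel_gen = tate_z1" "tate_d1 tate_rel_gen = tate_z0"
    unfolding tate_rel_gen_def
    by (transfer; simp; fail)
      (transfer; rule fps_ext; simp add: fps_X_def fps_eq_iff; fail)
  have "?d (F - G) = ?d tate_rel_gen * H + tate_rel_gen * ?d H"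
    unfolding H tate_d_mult by (simp add: algebra_simps)
  also have "?d tate_rel_gen = - tate_const (inverse TT) * tate_z0 * tate_rel_gen"
  proof -
    have "- ti * x * (x * y - t) = x * (t * ti) - ti * x\<^sup>2 * y" for ti t x y :: tate
      by (simp add: algebra_simps power2_eq_square)
    from this[of "tate_const (inverse TT)" tate_z0 tate_z1 "tate_const TT"]
    have "- tate_const (inverse TT) * tate_z0 * tate_rel_gen
       = tate_z0 * (tate_const TT * tate_const (inverse TT)) - tate_const (inverse TT) * tate_z0\<^sup>2 * tate_z1"
      by (simp only: tate_rel_gen_def)
    then show ?thesis unfolding gen TT by simp
  qed
  finally have "tate_rel_gen dvd ?d (F - G)"
    by (metis dvd_add dvd_mult2 dvd_triv_left dvd_triv_right)
  moreover have "?d (F - G) = ?d F - ?d G"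
  proof -
    have "tate_d0 (F - G) = tate_d0 F - tate_d0 G" "tate_d1 (F - G) = tate_d1 F - tate_d1 G"
      by (transfer; simp add: fps_eq_iff)+
    then show ?thesis by (simp only: right_diff_distrib) simp
  qed
  ultimately show "tate_eq (?d F) (?d G)" by (simp add: tate_eq_def)
qed

section \<open>The Clifford algebra and the module \<open>M\<close>\<close>

text \<open>
  \<open>Cl a b c d\<close> stands for \<open>a + b e\<^sub>0 + c e\<^sub>1 + d e\<^sub>0 e\<^sub>1\<close>.  The product is the one determined by
  \<open>S\<close>-bilinearity and \<open>e\<^sub>0\<^sup>2 = - z\<^sub>0\<close>, \<open>e\<^sub>1\<^sup>2 = z\<^sub>1\<close>, \<open>e\<^sub>0 e\<^sub>1 + e\<^sub>1 e\<^sub>0 = 0\<close>.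
\<close>

datatype cl = Cl (cl_1: sring) (cl_e0: sring) (cl_e1: sring) (cl_e01: sring)

instantiation cl :: ring_1
begin
definition "0 = Cl 0 0 0 0"
definition "1 = Cl 1 0 0 0"
definition "x + y = Cl (cl_1 x + cl_1 y) (cl_e0 x + cl_e0 y) (cl_e1 x + cl_e1 y) (cl_e01 x + cl_e01 y)"
definition "x - y = Cl (cl_1 x - cl_1 y) (cl_e0 x - cl_e0 y) (cl_e1 x - cl_e1 y) (cl_e01 x - cl_e01 y)"
definition "- x = Cl (- cl_1 x) (- cl_e0 x) (- cl_e1 x) (- cl_e01 x)"
definition "x * y = Cl
  (cl_1 x * cl_1 y - z0 * cl_e0 x * cl_e0 y + z1 * cl_e1 x * cl_e1 y + z0 * z1 * cl_e01 x * cl_e01 y)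
  (cl_1 x * cl_e0 y + cl_e0 x * cl_1 y - z1 * cl_e1 x * cl_e01 y + z1 * cl_e01 x * cl_e1 y)
  (cl_1 x * cl_e1 y + cl_e1 x * cl_1 y - z0 * cl_e0 x * cl_e01 y + z0 * cl_e01 x * cl_e0 y)
  (cl_1 x * cl_e01 y + cl_e01 x * cl_1 y + cl_e0 x * cl_e1 y - cl_e1 x * cl_e0 y)"
instance
  by standard
    (simp_all add: zero_cl_def one_cl_def plus_cl_def minus_cl_def uminus_cl_def times_cl_def
      cl.expand algebra_simps)
end

lemma cl_sel_simps [simp]:
  "cl_1 0 = 0" "cl_e0 0 = 0" "cl_e1 0 = 0" "cl_e01 0 = 0"
  "cl_1 1 = 1" "cl_e0 1 = 0" "cl_e1 1 = 0" "cl_e01 1 = 0"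
  "cl_1 (x + y) = cl_1 x + cl_1 y" "cl_e0 (x + y) = cl_e0 x + cl_e0 y"
  "cl_e1 (x + y) = cl_e1 x + cl_e1 y" "cl_e01 (x + y) = cl_e01 x + cl_e01 y"
  "cl_1 (x - y) = cl_1 x - cl_1 y" "cl_e0 (x - y) = cl_e0 x - cl_e0 y"
  "cl_e1 (x - y) = cl_e1 x - cl_e1 y" "cl_e01 (x - y) = cl_e01 x - cl_e01 y"
  "cl_1 (- x) = - cl_1 x" "cl_e0 (- x) = - cl_e0 x"
  "cl_e1 (- x) = - cl_e1 x" "cl_e01 (- x) = - cl_e01 x"
  by (simp_all add: zero_cl_def one_cl_def plus_cl_def minus_cl_def uminus_cl_def)

definition cl_s :: "sring \<Rightarrow> cl" where "cl_s f = Cl f 0 0 0"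
definition e0 :: cl where "e0 = Cl 0 1 0 0"
definition e1 :: cl where "e1 = Cl 0 0 1 0"

lemma cl_relations:
  "e0 * e0 = - cl_s z0" "e1 * e1 = cl_s z1" "e0 * e1 + e1 * e0 = 0"
  "cl_s f * x = x * cl_s f"
  "Cl a b c d = cl_s a + cl_s b * e0 + cl_s c * e1 + cl_s d * (e0 * e1)"
  by (simp_all add: cl.expand times_cl_def cl_s_def e0_def e1_def mult.commute)

definition cl_val :: "real \<times> real \<Rightarrow> cl \<Rightarrow> ereal" where
  "cl_val \<zeta> x = Min {s_val \<zeta> (cl_1 x),
    s_val \<zeta> (cl_e0 x) + ereal (fst \<zeta> / 2),
    s_val \<zeta> (cl_e1 x) + ereal (snd \<zeta> / 2),
    s_val \<zeta> (cl_e01 x) + ereal (fst \<zeta> / 2 + snd \<zeta> / 2)}"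

definition cl_hom :: "int \<Rightarrow> cl \<Rightarrow> bool" where
  "cl_hom j x \<longleftrightarrow> s_hom j (cl_1 x) \<and> s_hom (j - 1) (cl_e0 x) \<and> s_hom (j - 1) (cl_e1 x)
     \<and> s_hom (j - 2) (cl_e01 x)"

definition cl_ideal_gen :: cl where
  "cl_ideal_gen = e0 * e1 - cl_s (s_const Thalf)"

definition cl_eq :: "cl \<Rightarrow> cl \<Rightarrow> bool" where
  "cl_eq x y \<longleftrightarrow> (\<exists>a. x - y = a * cl_ideal_gen)"

text \<open>
  Modulo the left ideal, \<open>e\<^sub>0 e\<^sub>1 = T\<^sup>1\<^sup>/\<^sup>2\<close> and hence \<open>e\<^sub>0 = - T\<^sup>-\<^sup>1\<^sup>/\<^sup>2 z\<^sub>0 e\<^sub>1\<close>.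
\<close>

lemma s_const_Thalf:
  "s_const Thalf * s_const (inverse Thalf) = 1" "z0 * z1 = s_const Thalf * s_const Thalf"
  by (simp_all add: s_const_hom z0_z1 power2_eq_square flip: s_const_hom(2))

lemma cl_eq_iff:
  "cl_eq x y \<longleftrightarrow>
     cl_1 x + s_const Thalf * cl_e01 x = cl_1 y + s_const Thalf * cl_e01 y \<and>
     cl_e1 x - s_const (inverse Thalf) * z0 * cl_e0 x = cl_e1 y - s_const (inverse Thalf) * z0 * cl_e0 y"
proof -
  let ?q = "s_const Thalf" and ?p = "s_const (inverse Thalf)"
  note q = s_const_Thalf
  have p: "?p * ?q = 1" using q(1) by (simp add: mult.commute)
  have mult: "a * cl_ideal_gen = Cl (z0 * z1 * cl_e01 a - ?q * cl_1 a) (- ?q * cl_e0 a - z1 * cl_e1 a)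
       (- ?q * cl_e1 a - z0 * cl_e0 a) (cl_1 a - ?q * cl_e01 a)" for a
    by (simp add: cl_ideal_gen_def e0_def e1_def cl_s_def times_cl_def cl.expand algebra_simps)
  have *: "(\<exists>a. d = a * cl_ideal_gen) \<longleftrightarrow>
      cl_1 d + ?q * cl_e01 d = 0 \<and> cl_e1 d - ?p * z0 * cl_e0 d = 0" (is "?L \<longleftrightarrow> ?R") for d
  proof
    assume ?L
    then obtain a where a: "d = a * cl_ideal_gen" by blast
    have "?p * z0 * (- ?q * cl_e0 a - z1 * cl_e1 a)
        = - (?p * ?q) * z0 * cl_e0 a - ?p * (z0 * z1) * cl_e1 a"
      by (simp add: algebra_simps)
    also have "\<dots> = - z0 * cl_e0 a - (?p * ?q) * ?q * cl_e1 a"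
      unfolding q(2) p using p by (simp flip: mult.assoc)
    finally show ?R unfolding a mult by (simp add: p) (simp add: q(2) algebra_simps)
  next
    assume R: ?R
    have "?q * (?p * cl_e0 d) = cl_e0 d"
      using q(1) by (simp flip: mult.assoc)
    moreover have "cl_1 d = - (?q * cl_e01 d)" "cl_e1 d = ?p * z0 * cl_e0 d"
      using R by (simp_all add: eq_neg_iff_add_eq_0)
    ultimately have "d = Cl (cl_e01 d) (- ?p * cl_e0 d) 0 0 * cl_ideal_gen"
      unfolding mult by (simp add: cl.expand mult_ac)
    then show ?L by blast
  qed
  show ?thesis unfolding cl_eq_def * by (simp add: algebra_simps)
qed

quotient_type mmod = cl / cl_eq
  by (rule equivpI) (auto simp: reflp_def symp_def transp_def cl_eq_iff)

instantiation mmod :: ab_group_add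
begin
lift_definition zero_mmod :: mmod is 0 .
lift_definition plus_mmod :: "mmod \<Rightarrow> mmod \<Rightarrow> mmod" is "(+)"
  unfolding cl_eq_def by (metis add_diff_add distrib_right)
lift_definition minus_mmod :: "mmod \<Rightarrow> mmod \<Rightarrow> mmod" is "(-)"
  unfolding cl_eq_def by (metis diff_diff_eq2 diff_diff_eq add.commute add_diff_eq left_diff_distrib diff_add_eq)
lift_definition uminus_mmod :: "mmod \<Rightarrow> mmod" is uminus
  unfolding cl_eq_def by (metis minus_diff_minus minus_mult_left)
instance by standard (transfer; simp add: cl_eq_iff algebra_simps)+
end

lift_definition cl_act :: "cl \<Rightarrow> mmod \<Rightarrow> mmod" is "(*)"
  unfolding cl_eq_def by (metis mult.assoc right_diff_distrib)

definition m_scale :: "sring \<Rightarrow> mmod \<Rightarrow> mmod" where "m_scale f = cl_act (cl_s f)"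

lift_definition m_1 :: mmod is 1 .
lift_definition m_e1 :: mmod is e1 .

lift_definition m_coord_1 :: "mmod \<Rightarrow> sring" is "\<lambda>x. cl_1 x + s_const Thalf * cl_e01 x"
  by (simp add: cl_eq_iff)
lift_definition m_coord_e1 :: "mmod \<Rightarrow> sring" is
  "\<lambda>x. cl_e1 x - s_const (inverse Thalf) * z0 * cl_e0 x"
  by (simp add: cl_eq_iff)

lemma m_basis:
  "m = m_scale f m_1 + m_scale g m_e1 \<longleftrightarrow> f = m_coord_1 m \<and> g = m_coord_e1 m"
  unfolding m_scale_def
  by transfer (auto simp: cl_eq_iff times_cl_def cl_s_def e1_def)

text \<open>The quotient valuation and the quotient grading on \<open>M\<close>.\<close>

definition m_val :: "real \<times> real \<Rightarrow> mmod \<Rightarrow> ereal" where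
  "m_val \<zeta> m = (SUP x\<in>{x. abs_mmod x = m}. cl_val \<zeta> x)"

definition m_hom :: "int \<Rightarrow> mmod \<Rightarrow> bool" where
  "m_hom j m \<longleftrightarrow> (\<exists>x. abs_mmod x = m \<and> cl_hom j x)"

section \<open>The endomorphism algebra\<close>

lemma cl_eq_refl [simp]: "cl_eq x x"
  by (simp add: cl_eq_iff)

lemma cl_act_simps [simp]:
  "cl_act x 0 = 0"
  "cl_act x (m + m') = cl_act x m + cl_act x m'"
  "cl_act x (m - m') = cl_act x m - cl_act x m'"
  "cl_act x (- m) = - cl_act x m"
  by (transfer; simp add: algebra_simps)+

lemma cl_act_add: "cl_act (x + y) m = cl_act x m + cl_act y m"
  by transfer (simp add: algebra_simps)

lemma cl_act_mult: "cl_act (x * y) m = cl_act x (cl_act y m)"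
  by transfer (simp add: algebra_simps)

lemma cl_act_m_scale: "cl_act x (m_scale f m) = m_scale f (cl_act x m)"
  unfolding m_scale_def by (metis cl_act_mult cl_relations(4))

typedef endo = "{\<phi>. (\<forall>m m'. \<phi> (m + m') = \<phi> m + \<phi> m') \<and> (\<forall>f m. \<phi> (m_scale f m) = m_scale f (\<phi> m))}"
  morphisms endo_app Abs_endo
  by (rule exI[of _ "\<lambda>m. m"]) simp

setup_lifting type_definition_endo

lemma endo_eqI: "(\<And>m. endo_app \<phi> m = endo_app \<psi> m) \<Longrightarrow> \<phi> = \<psi>"
  by (metis endo_app_inject ext)

lemma endo_app_add: "endo_app \<phi> (m + m') = endo_app \<phi> m + endo_app \<phi> m'"
  and endo_app_scale: "endo_app \<phi> (m_scale f m) = m_scale f (endo_app \<phi> m)"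
  using endo_app[of \<phi>] by blast+

instantiation endo :: ring_1
begin
lift_definition zero_endo :: endo is "\<lambda>_. 0"
  by (simp add: m_scale_def)
lift_definition one_endo :: endo is "\<lambda>m. m" by simp
lift_definition plus_endo :: "endo \<Rightarrow> endo \<Rightarrow> endo" is "\<lambda>\<phi> \<psi> m. \<phi> m + \<psi> m"
  by (simp add: m_scale_def)
lift_definition uminus_endo :: "endo \<Rightarrow> endo" is "\<lambda>\<phi> m. - \<phi> m"
  by (simp add: m_scale_def)
lift_definition minus_endo :: "endo \<Rightarrow> endo \<Rightarrow> endo" is "\<lambda>\<phi> \<psi> m. \<phi> m - \<psi> m"
  by (simp add: m_scale_def)
lift_definition times_endo :: "endo \<Rightarrow> endo \<Rightarrow> endo" is "\<lambda>\<phi> \<psi> m. \<phi> (\<psi> m)" by simp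
instance
proof
  have m_1: "m_1 \<noteq> 0"
  proof
    assume "m_1 = 0"
    then have "m_coord_1 m_1 = m_coord_1 0" by simp
    then show False by transfer simp
  qed
  show "(0 :: endo) \<noteq> 1"
  proof
    assume "(0 :: endo) = 1"
    then have "endo_app 0 m_1 = endo_app 1 m_1" by simp
    then show False using m_1 by (simp add: zero_endo.rep_eq one_endo.rep_eq)
  qed
qed (rule endo_eqI; simp add: zero_endo.rep_eq one_endo.rep_eq plus_endo.rep_eq minus_endo.rep_eq
      uminus_endo.rep_eq times_endo.rep_eq endo_app_add)+
end

lift_definition endo_act :: "cl \<Rightarrow> endo" is cl_act
  by (simp add: cl_act_m_scale)

definition D_M :: endo where "D_M = endo_act (e0 + e1)"

lift_definition endo_scalar :: "sring \<Rightarrow> endo" is m_scale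
  unfolding m_scale_def by (metis cl_act_simps(2) cl_act_mult cl_relations(4))

lemma D_square: "D_M * D_M = endo_scalar W_M"
proof -
  have "(e0 + e1) * (e0 + e1) = cl_s W_M"
    by (simp add: e0_def e1_def cl_s_def W_M_def times_cl_def cl.expand)
  then show ?thesis
    unfolding D_M_def m_scale_def
    by (intro endo_eqI) (simp add: times_endo.rep_eq endo_act.rep_eq endo_scalar.rep_eq m_scale_def
        flip: cl_act_mult)
qed

definition endo_val :: "endo \<Rightarrow> ereal" where
  "endo_val \<phi> = (INF \<zeta>\<in>simplex. INF m\<in>{m. m \<noteq> 0}. m_val \<zeta> (endo_app \<phi> m) - m_val \<zeta> m)"

definition endo_hom :: "int \<Rightarrow> endo \<Rightarrow> bool" where
  "endo_hom j \<phi> \<longleftrightarrow> (\<forall>i m. m_hom i m \<longrightarrow> m_hom (i + j) (endo_app \<phi> m))"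

text \<open>
  Matrices with respect to the basis \<open>1\<close> (even), \<open>e\<^sub>1\<close> (odd): the endomorphism with matrix
  \<open>((a, b), (c, d))\<close> sends \<open>1\<close> to \<open>a + c e\<^sub>1\<close> and \<open>e\<^sub>1\<close> to \<open>b + d e\<^sub>1\<close>.
\<close>

type_synonym mat2 = "(sring \<times> sring) \<times> (sring \<times> sring)"

definition endo_mat :: "endo \<Rightarrow> mat2" where
  "endo_mat \<phi> = ((m_coord_1 (endo_app \<phi> m_1), m_coord_1 (endo_app \<phi> m_e1)),
                 (m_coord_e1 (endo_app \<phi> m_1), m_coord_e1 (endo_app \<phi> m_e1)))"

lemma m_coord_simps:
  "m_coord_1 (m + m') = m_coord_1 m + m_coord_1 m'"
  "m_coord_e1 (m + m') = m_coord_e1 m + m_coord_e1 m'"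
  "m_coord_1 (m_scale f m) = f * m_coord_1 m" "m_coord_e1 (m_scale f m) = f * m_coord_e1 m"
  unfolding m_scale_def by (transfer; simp add: times_cl_def cl_s_def algebra_simps)+

lemma m_scale_simps:
  "m_scale (f + g) m = m_scale f m + m_scale g m"
  "m_scale f (m + m') = m_scale f m + m_scale f m'"
  "m_scale (f * g) m = m_scale f (m_scale g m)"
proof -
  have "cl_s (f + g) = cl_s f + cl_s g" "cl_s (f * g) = cl_s f * cl_s g"
    by (simp_all add: cl_s_def plus_cl_def times_cl_def)
  then show "m_scale (f + g) m = m_scale f m + m_scale g m"
    "m_scale f (m + m') = m_scale f m + m_scale f m'"
    "m_scale (f * g) m = m_scale f (m_scale g m)"
    by (simp_all add: m_scale_def cl_act_add cl_act_mult)
qed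

lemma m_scale_left_commute: "m_scale f (m_scale g m) = m_scale g (m_scale f m)"
  by (metis m_scale_simps(3) mult.commute)

lift_definition mat_endo :: "mat2 \<Rightarrow> endo" is
  "\<lambda>((a, b), (c, d)) m. m_scale (a * m_coord_1 m + b * m_coord_e1 m) m_1
                       + m_scale (c * m_coord_1 m + d * m_coord_e1 m) m_e1"
  by (auto simp: m_coord_simps m_scale_simps m_scale_left_commute distrib_left add_ac)

lemma mat_endo_endo_mat: "mat_endo (endo_mat \<phi>) = \<phi>"
proof (rule endo_eqI)
  fix m
  have b: "m = m_scale (m_coord_1 m) m_1 + m_scale (m_coord_e1 m) m_e1" for m
    using m_basis by blast
  define x y where "x = m_coord_1 m" and "y = m_coord_e1 m"
  have "m = m_scale x m_1 + m_scale y m_e1" unfolding x_def y_def by (rule b)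
  then have *: "endo_app \<phi> m = m_scale x (endo_app \<phi> m_1) + m_scale y (endo_app \<phi> m_e1)"
    by (simp add: endo_app_add endo_app_scale)
  show "endo_app (mat_endo (endo_mat \<phi>)) m = endo_app \<phi> m"
    using b[of "endo_app \<phi> m"]
    by (simp add: * m_coord_simps mat_endo.rep_eq endo_mat_def mult.commute flip: x_def y_def)
qed

lemma endo_mat_D:
  "endo_mat D_M = ((0, s_const Thalf + z1), (1 - s_const (inverse Thalf) * z0, 0))"
  by (simp add: endo_mat_def D_M_def endo_act.rep_eq m_1.abs_eq m_e1.abs_eq cl_act.abs_eq
      m_coord_1.abs_eq m_coord_e1.abs_eq)
    (simp add: times_cl_def e0_def e1_def)

definition str :: "endo \<Rightarrow> sring" where
  "str \<phi> = (case endo_mat \<phi> of ((a, b), (c, d)) \<Rightarrow> a - d)"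

definition d1D :: endo where
  "d1D = mat_endo (case endo_mat D_M of ((a, b), (c, d)) \<Rightarrow> ((s_d1 a, s_d1 b), (s_d1 c, s_d1 d)))"

section \<open>Residues at the critical points of \<open>W\<close>\<close>

text \<open>
  For \<open>x\<close> algebraic over \<open>R\<close> of valuation \<open>1/2\<close>, an element of \<open>S\<close> is expanded at \<open>z\<^sub>1 = x\<close> by
  substituting \<open>z\<^sub>1 = x + u\<close> and \<open>z\<^sub>0 = T / (x + u)\<close>.  This gives a power series in the local
  parameter \<open>u\<close> over the complexified Novikov field, and residues are coefficients of
  \<open>u\<^sup>-\<^sup>1\<close> in formal Laurent series in \<open>u\<close>.
\<close>

definition s_taylor :: "complex fls \<Rightarrow> sring \<Rightarrow> complex fls fps" where
  "s_taylor x f = Abs_fps (\<lambda>k. nov_sum (\<lambda>(a, b). nov_complex (s_coeff f a b) *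
     (((fps_const TT * inverse (fps_const x + fps_X)) ^ a * (fps_const x + fps_X) ^ b) $ k)))"

text \<open>The residue at \<open>z\<^sub>1 = x\<close> of \<open>f / (\<partial>\<^sub>1 W)\<^sup>l dz\<^sub>1 / z\<^sub>1\<close>.\<close>

definition res_at :: "complex fls \<Rightarrow> sring \<Rightarrow> nat \<Rightarrow> complex fls" where
  "res_at x f l = fls_residue
     (fps_to_fls (s_taylor x f) / fps_to_fls (s_taylor x (s_d1 W_M)) ^ l
       * (1 / (fls_const x + fls_X)))"

definition crit_points :: "complex fls set" where
  "crit_points = {fls_const \<i> * Thalf, - (fls_const \<i> * Thalf)}"

section \<open>Extension by the formal variable \<open>s\<close>\<close>

text \<open>
  The completed tensor products \<open>R\<^sup>s\<close> and \<open>End(M)\<^sup>s\<close> consist of the power series in \<open>s\<close> whose terms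
  tend to \<open>0\<close> in the valuation \<open>\<nu>(s\<^sup>i x) = i + \<nu>(x)\<close>.
\<close>

type_synonym ends = "endo fps"

definition Rs :: "real fls fps set" where
  "Rs = {r. \<forall>B::real. finite {k. ereal (real k) + nov_val (r $ k) \<le> ereal B}}"

definition Rs_val :: "'a::zero fls fps \<Rightarrow> ereal" where
  "Rs_val r = (INF k. ereal (real k) + nov_val (r $ k))"

definition Rs_hom :: "int \<Rightarrow> real fls fps \<Rightarrow> bool" where
  "Rs_hom j r \<longleftrightarrow> (\<forall>k. nov_hom j (r $ k))"

definition Ends :: "ends set" where
  "Ends = {a. \<forall>B::real. finite {k. ereal (real k) + endo_val (a $ k) \<le> ereal B}}"

definition ends_val :: "ends \<Rightarrow> ereal" where
  "ends_val a = (INF k. ereal (real k) + endo_val (a $ k))"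

definition ends_hom :: "int \<Rightarrow> ends \<Rightarrow> bool" where
  "ends_hom j a \<longleftrightarrow> (\<forall>k. endo_hom j (a $ k))"

definition ends_scalar :: "real fls fps \<Rightarrow> ends" where
  "ends_scalar r = Abs_fps (\<lambda>k. endo_scalar (s_const (r $ k)))"

text \<open>
  The degree of a homogeneous element; it is only ever used inside signs, for homogeneous elements.
\<close>

definition deg :: "ends \<Rightarrow> int" where
  "deg a = (SOME j. ends_hom j a)"

definition sign :: "int \<Rightarrow> int" where
  "sign n = (if even n then 1 else - 1)"

definition delta :: "ends \<Rightarrow> ends" where
  "delta a = fps_const D_M * a - of_int (sign (deg a)) * a * fps_const D_M"

definition is_potential :: "ends \<Rightarrow> real fls fps \<Rightarrow> bool" where
  "is_potential b c \<longleftrightarrow>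
     c \<in> Rs \<and> Rs_hom 2 c \<and> Rs_val c > 0 \<and> delta b - b * b = ends_scalar c"

definition bounding_cochain :: "ends \<Rightarrow> bool" where
  "bounding_cochain b \<longleftrightarrow>
     b \<in> Ends \<and> ends_hom 1 b \<and> ends_val b > 0 \<and> (\<exists>c. is_potential b c)"

section \<open>The cyclic complex\<close>

text \<open>
  The list \<open>[a\<^sub>l, \<dots>, a\<^sub>1]\<close> stands for \<open>a\<^sub>l \<otimes> \<dots> \<otimes> a\<^sub>1\<close>.  The algebraic tensor products over \<open>R\<^sup>s\<close> are
  presented by formal integral combinations of words with homogeneous entries, modulo
  additivity in each entry and the balancing relations over \<open>R\<^sup>s\<close>, which carry no sign because
  \<open>R\<^sup>s\<close> is evenly graded.  Restricting to homogeneous entries is harmless, since every element is a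
  convergent sum of homogeneous ones and only the completion is used.
\<close>

type_synonym pre_chain = "ends list \<Rightarrow>\<^sub>0 int"

definition is_word :: "ends list \<Rightarrow> bool" where
  "is_word w \<longleftrightarrow> w \<noteq> [] \<and> (\<forall>a\<in>set w. a \<in> Ends \<and> (\<exists>j. ends_hom j a))"

definition word_val :: "ends list \<Rightarrow> ereal" where
  "word_val w = (\<Sum>a\<leftarrow>w. ends_val a)"

inductive_set tensor_relations :: "pre_chain set" where
  zero: "0 \<in> tensor_relations"
| diff: "x \<in> tensor_relations \<Longrightarrow> y \<in> tensor_relations \<Longrightarrow> x - y \<in> tensor_relations"
| additive: "is_word (u @ [a] @ v) \<Longrightarrow> is_word (u @ [a'] @ v) \<Longrightarrow> ends_hom j a \<Longrightarrow> ends_hom j a' \<Longrightarrow>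
    frag_of (u @ [a + a'] @ v) - frag_of (u @ [a] @ v) - frag_of (u @ [a'] @ v) \<in> tensor_relations"
| balanced: "is_word (u @ [a] @ v @ [a'] @ w) \<Longrightarrow> r \<in> Rs \<Longrightarrow> Rs_hom j r \<Longrightarrow>
    frag_of (u @ [ends_scalar r * a] @ v @ [a'] @ w)
      - frag_of (u @ [a] @ v @ [ends_scalar r * a'] @ w) \<in> tensor_relations"

text \<open>
  An element of the completion \<open>C\<^sub>*\<close> (of the tensor products and of the direct sum over the length)
  is represented by a series whose terms are combinations of words of valuation tending to \<open>\<infinity>\<close>.
  Such a series is zero in the completion iff its partial sums tend to \<open>0\<close> in the valuation on the
  algebraic tensor product, where an element has valuation \<open>\<ge> B\<close> as soon as it can be written as
  a combination of words of valuation \<open>\<ge> B\<close>.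
\<close>

definition words_ge :: "real \<Rightarrow> pre_chain set" where
  "words_ge B = {x. \<forall>w\<in>Poly_Mapping.keys x. is_word w \<and> word_val w \<ge> ereal B}"

definition is_chain :: "(nat \<Rightarrow> pre_chain) \<Rightarrow> bool" where
  "is_chain X \<longleftrightarrow> (\<forall>k. \<forall>w\<in>Poly_Mapping.keys (X k). is_word w) \<and>
     (\<forall>B. eventually (\<lambda>k. X k \<in> words_ge B) sequentially)"

definition chain_null :: "(nat \<Rightarrow> pre_chain) \<Rightarrow> bool" where
  "chain_null X \<longleftrightarrow>
     (\<forall>B. eventually (\<lambda>n. \<exists>y\<in>words_ge B. (\<Sum>k<n. X k) - y \<in> tensor_relations) sequentially)"

text \<open>The sum of the shifted degrees \<open>|sa| = |a| - 1\<close> of the entries of a word.\<close>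

definition sdeg :: "ends list \<Rightarrow> int" where
  "sdeg w = (\<Sum>a\<leftarrow>w. deg a - 1)"

definition b_mu1 :: "ends list \<Rightarrow> pre_chain" where
  "b_mu1 w = (\<Sum>p<length w. frag_cmul (sign (sdeg (take p w))) (frag_of (w[p := delta (w ! p)])))"

text \<open>
  In the sum below the term \<open>p = 0\<close> is \<open>(-1)\<^sup>|\<^sup>a\<^sub>l\<^sup>| a\<^sub>l a\<^sub>l\<^sub>-\<^sub>1 \<otimes> a\<^sub>l\<^sub>-\<^sub>2 \<otimes> \<dots> \<otimes> a\<^sub>1\<close>.
\<close>

definition b_mu2 :: "ends list \<Rightarrow> pre_chain" where
  "b_mu2 w = (if length w \<le> 1 then 0 else
     - (\<Sum>p<length w - 1. frag_cmul (sign (sdeg (take (Suc p) w)))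
          (frag_of (take p w @ [w ! p * w ! Suc p] @ drop (Suc (Suc p)) w)))
     - frag_cmul (sign ((deg (last w) - 1) * (sdeg (butlast w) + 1)))
          (frag_of ((last w * hd w) # butlast (tl w))))"

definition d_cc :: "pre_chain \<Rightarrow> pre_chain" where
  "d_cc = frag_extend (\<lambda>w. b_mu1 w + b_mu2 w)"

definition cyc_t :: "pre_chain \<Rightarrow> pre_chain" where
  "cyc_t = frag_extend (\<lambda>w. frag_cmul (sign ((deg (hd w) - 1) * sdeg (tl w))) (frag_of (tl w @ [hd w])))"

text \<open>Vanishing in \<open>C\<^sup>\<lambda>\<^sub>* = C\<^sub>* / Im(id - t)\<close>.\<close>

definition cyclic_null :: "(nat \<Rightarrow> pre_chain) \<Rightarrow> bool" where
  "cyclic_null X \<longleftrightarrow> (\<exists>U. is_chain U \<and> chain_null (\<lambda>k. X k - (U k - cyc_t (U k))))"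

definition in_R_lambda :: "(nat \<Rightarrow> pre_chain) \<Rightarrow> bool" where
  "in_R_lambda Y \<longleftrightarrow> is_chain Y \<and>
     (\<forall>k. \<forall>w\<in>Poly_Mapping.keys (Y k). \<exists>a\<in>set w. a \<in> ends_scalar ` Rs)"

definition in_C_lambda_Rs :: "(nat \<Rightarrow> pre_chain) \<Rightarrow> bool" where
  "in_C_lambda_Rs Z \<longleftrightarrow> is_chain Z \<and>
     (\<forall>k. \<forall>w\<in>Poly_Mapping.keys (Z k). \<exists>r\<in>Rs. \<exists>l. w = ends_scalar r # replicate l 1)"

definition exp_chain :: "ends \<Rightarrow> nat \<Rightarrow> pre_chain" where
  "exp_chain b k = (if k = 0 then frag_of [1]
     else frag_of (ends_scalar (fps_const (fls_const (1 / real k))) * b # replicate (k - 1) b))"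

definition is_correction :: "ends \<Rightarrow> (nat \<Rightarrow> pre_chain) \<Rightarrow> bool" where
  "is_correction b Y \<longleftrightarrow> in_R_lambda Y \<and>
     (\<exists>Z. in_C_lambda_Rs Z \<and> cyclic_null (\<lambda>k. d_cc (Y k) - d_cc (exp_chain b k) - Z k))"

section \<open>The map \<open>\<Theta>\<close> and the numerical invariants\<close>

text \<open>
  \<open>\<Theta>\<close> is computed in the complexification of \<open>R\<^sup>s\<close>, where the individual residues live.
\<close>

definition Theta_word :: "ends list \<Rightarrow> complex fls fps" where
  "Theta_word w = Abs_fps (\<lambda>k.
     - (\<Sum>x\<in>crit_points. res_at x (str (prod_list (map (\<lambda>a. a * fps_const d1D) w) $ k)) (length w)))"

definition Theta :: "pre_chain \<Rightarrow> complex fls fps" where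
  "Theta x = (\<Sum>w\<in>Poly_Mapping.keys x. of_int (Poly_Mapping.lookup x w) * Theta_word w)"

definition Theta_sums :: "(nat \<Rightarrow> pre_chain) \<Rightarrow> complex fls fps \<Rightarrow> bool" where
  "Theta_sums X v \<longleftrightarrow>
     (\<forall>B::real. eventually (\<lambda>n. Rs_val ((\<Sum>k<n. Theta (X k)) - v) \<ge> ereal B) sequentially)"

definition point_like :: "ends \<Rightarrow> bool" where
  "point_like b \<longleftrightarrow> bounding_cochain b \<and>
     (\<exists>Y. is_correction b Y \<and> Theta_sums (\<lambda>k. exp_chain b k - Y k) fps_X)"

definition point_potential :: "real fls fps" where
  "point_potential = (THE c. \<exists>b. point_like b \<and> is_potential b c)"

text \<open>\<open>N\<^sub>d\<^sub>,\<^sub>k\<close> is read off from \<open>c = \<Sum> N\<^sub>d\<^sub>,\<^sub>k\<^sub>+\<^sub>1 s\<^sup>k / k! T\<^sup>d\<close>.\<close>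

definition num_inv :: "rat \<Rightarrow> nat \<Rightarrow> real" where
  "num_inv d k = fact (k - 1) * (point_potential $ (k - 1) $$ \<lfloor>2 * d\<rfloor>)"

end

theory Submission
  imports Defs "HOL-Computational_Algebra.Computational_Algebra"
begin

text \<open>
  Expanding at the two ends of the annulus, where \<open>z\<^sub>1\<close> resp. \<open>z\<^sub>0\<close> is large, turns the sum of the residues in
  \<open>\<Theta>\<close> into a difference of constant terms of the supertrace of words in \<open>H = \<partial>\<^sub>1D / \<partial>\<^sub>1W\<close>, which is a
  contraction of \<open>D\<close>.  Moving \<open>H\<close> linearly to a strictly triangular contraction changes the trace by a
  homotopy that vanishes on scalar words, and the trace at the far end kills all words containing a scalar.
  So the correction drops out, and \<open>\<Theta>\<close> of the corrected exponential of \<open>b\<close> is a difference of constant terms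
  of logarithms of \<open>1 - \<beta>\<close>, with \<open>\<beta>\<close> the product of one entry of \<open>b\<close> with the entry of the contraction.

  The matrix of \<open>D - b\<close> is off-diagonal, and the product of its entries \<open>P\<close> and \<open>Q\<close> is \<open>W - c\<close>.  Up to a unit,
  \<open>P\<close> is \<open>z\<^sub>1 - T\<^sup>1\<^sup>/\<^sup>2 \<rho>\<close> with \<open>\<rho>\<^sup>2 - c' \<rho> - 1 = 0\<close>, \<open>\<rho>(0) = - 1\<close> and \<open>c = T\<^sup>1\<^sup>/\<^sup>2 c'\<close>, and the \<open>s\<close>-derivative of
  \<open>\<Theta>\<close> is \<open>- \<rho>' / \<rho>\<close>.  Hence a point-like \<open>b\<close> has \<open>\<rho> = - e\<^sup>-\<^sup>s\<close> and \<open>c = T\<^sup>1\<^sup>/\<^sup>2 (e\<^sup>s - e\<^sup>-\<^sup>s)\<close>.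

  Conversely, such a \<open>b\<close> can be written down.  For any bounding cochain \<open>b\<close> with potential \<open>c\<close>, the corrected
  exponential is \<open>\<Sum>\<^sub>r 1/r (\<kappa> \<otimes> b)\<^sup>r\<close> with \<open>\<kappa> = \<Sum>\<^sub>a C\<^sub>a c\<^sup>a id\<^sup>2\<^sup>a\<close>, where the \<open>C\<^sub>a\<close> are the Catalan
  numbers: their recursion makes the words with an odd block of units cancel.
\<close>

section \<open>Additive extension from words to chains\<close>

text \<open>The correction is known only through its boundary, and only up to convergent sums.
  Therefore \<open>Theta\<close> must be compared, using nothing but that boundary, with a trace
  that kills every word containing a scalar. An auxiliary polynomial variable t makes this
  algebraic: the t-derivative of the trace along the path of contractions factors through
  \<open>d_cc\<close>, and characteristic 0 recovers the difference of the values at t = 1 and t =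
  0. The triangular contraction inverts the entry z1 + T^(1/2) of \<open>D\<close>. This entry has a
  zero in the annulus and is no unit of \<open>S\<close>, but it becomes invertible in the expansion
  at either end. The whole value of \<open>Theta\<close> comes from the disagreement of these two
  inverses: whatever is invertible over \<open>S\<close> has equal constant terms at both ends and
  cancels. Scalar words in the boundary are not small, but the primitive raises the exponent of y at
  both ends, so they have no constant term. The potential is a definite description, hence both
  halves are needed: all point-like cochains share one potential, and one of them exists. The two
  factors of W - c for the root - e^(-s) give the explicit cochain.\<close>

definition chain_ext :: "(ends list \<Rightarrow> 'm::ring_1) \<Rightarrow> pre_chain \<Rightarrow> 'm" where
  "chain_ext f x = (\<Sum>w\<in>Poly_Mapping.keys x. of_int (Poly_Mapping.lookup x w) * f w)"

lemma chain_ext_superset: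
  assumes "finite A" "Poly_Mapping.keys x \<subseteq> A"
  shows "chain_ext f x = (\<Sum>w\<in>A. of_int (Poly_Mapping.lookup x w) * f w)"
  unfolding chain_ext_def
  by (rule sum.mono_neutral_left) (use assms in \<open>auto simp: in_keys_iff\<close>)

lemma chain_ext_zero [simp]: "chain_ext f 0 = 0"
  by (simp add: chain_ext_def)

lemma chain_ext_add: "chain_ext f (x + y) = chain_ext f x + chain_ext f y"
proof -
  let ?A = "Poly_Mapping.keys x \<union> Poly_Mapping.keys y"
  have "Poly_Mapping.keys (x + y) \<subseteq> ?A" by (rule Poly_Mapping.keys_add)
  then show ?thesis
    using chain_ext_superset[of ?A x f] chain_ext_superset[of ?A y f] chain_ext_superset[of ?A "x + y" f]
    by (simp add: lookup_add sum.distrib distrib_right)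
qed

lemma chain_ext_uminus: "chain_ext f (- x) = - chain_ext f x"
  by (simp add: chain_ext_def sum_negf)

lemma chain_ext_diff: "chain_ext f (x - y) = chain_ext f x - chain_ext f y"
  using chain_ext_add[of f x "- y"] by (simp add: chain_ext_uminus)

lemma chain_ext_of [simp]: "chain_ext f (frag_of w) = f w"
  by (simp add: chain_ext_def)

lemma chain_ext_cmul: "chain_ext f (frag_cmul n x) = of_int n * chain_ext f x"
proof -
  have "Poly_Mapping.keys (frag_cmul n x) \<subseteq> Poly_Mapping.keys x" by (rule keys_cmul)
  then show ?thesis
    using chain_ext_superset[of "Poly_Mapping.keys x" "frag_cmul n x" f]
    by (simp add: chain_ext_def sum_distrib_left mult.assoc)
qed

lemma chain_ext_sum: "chain_ext f (\<Sum>i\<in>I. g i) = (\<Sum>i\<in>I. chain_ext f (g i))"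
  by (induction I rule: infinite_finite_induct) (auto simp: chain_ext_add)

lemma chain_ext_frag_extend:
  "chain_ext f (frag_extend g x) = chain_ext (\<lambda>w. chain_ext f (g w)) x"
  unfolding frag_extend_def chain_ext_sum chain_ext_cmul by (simp add: chain_ext_def)

lemma chain_ext_cong: "(\<And>w. w \<in> Poly_Mapping.keys x \<Longrightarrow> f w = g w) \<Longrightarrow> chain_ext f x = chain_ext g x"
  by (simp add: chain_ext_def)

section \<open>Signs and degrees\<close>

lemma sign_cases: "sign n = 1 \<or> sign n = - 1"
  by (simp add: sign_def)

lemma sign_0 [simp]: "sign 0 = 1"
  by (simp add: sign_def)

lemma sign_add: "sign (m + n) = sign m * sign n"
  by (auto simp: sign_def)

lemma sign_diff_one: "sign (m - 1) = - sign m"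
  by (auto simp: sign_def)

lemma sdeg_Cons: "sdeg (a # w) = deg a - 1 + sdeg w"
  by (simp add: sdeg_def)

lemma sdeg_append: "sdeg (u @ v) = sdeg u + sdeg v"
  by (simp add: sdeg_def)

lemma sdeg_Nil [simp]: "sdeg [] = 0"
  by (simp add: sdeg_def)

definition homog :: "ends \<Rightarrow> bool" where "homog a \<longleftrightarrow> (\<exists>j. ends_hom j a)"

text \<open>\<open>deg\<close> is a choice, and zero is homogeneous of every degree; sign arguments
  about general words use only that the chosen degree is a possible one.\<close>

lemma ends_hom_deg: "homog a \<Longrightarrow> ends_hom (deg a) a"
  unfolding homog_def deg_def by (rule someI_ex)

lemma is_word_homog: "is_word w \<Longrightarrow> a \<in> set w \<Longrightarrow> homog a"
  by (auto simp: is_word_def homog_def)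

section \<open>The homotopy between residue traces\<close>

text \<open>
  \<open>E = D s\<close> with \<open>s\<close> the parity operator turns the graded commutator with \<open>D\<close> into an ordinary one.
  \<open>H\<close> is a contraction of \<open>D\<close>, \<open>h\<close> an infinitesimal change of it, and \<open>K\<close> a primitive of that change.
\<close>

locale trace_homotopy =
  fixes ev :: "ends \<Rightarrow> 'r::ring_1" and s E H K h :: 'r and tr :: "'r \<Rightarrow> 'm::idom"
  assumes ss: "s * s = 1"
    and sE: "s * E = - (E * s)"
    and sH: "s * H = - (H * s)"
    and sK: "s * K = K * s"
    and EH: "E * H = H * E - s"
    and EK: "E * K = h - K * E"
    and ev_mult: "ev (a * b) = ev a * ev b"
    and ev_add: "ev (a + b) = ev a + ev b"
    and ev_central: "ev (ends_scalar r) * x = x * ev (ends_scalar r)"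
    and ev_parity: "ends_hom j a \<Longrightarrow> s * ev a = of_int (sign j) * (ev a * s)"
    and ev_delta: "homog a \<Longrightarrow> s * ev (delta a) = ev a * E - E * ev a"
    and tr_add: "tr (x + y) = tr x + tr y"
    and tr_comm: "tr (x * y) = tr (y * x)"
    and two_nz: "(2::'m) \<noteq> 0"
begin

lemma tr_0 [simp]: "tr 0 = 0"
  using tr_add[of 0 0] by (metis add_0 add_cancel_right_right)

lemma tr_uminus: "tr (- x) = - tr x"
  using tr_add[of x "- x"] by (simp add: eq_neg_iff_add_eq_0 add.commute)

lemma tr_diff: "tr (x - y) = tr x - tr y"
  using tr_add[of x "- y"] by (simp add: tr_uminus)

lemma tr_sum: "tr (\<Sum>i\<in>I. f i) = (\<Sum>i\<in>I. tr (f i))"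
  by (induction I rule: infinite_finite_induct) (auto simp: tr_add)

lemma tr_sign: "tr (of_int (sign n) * x) = of_int (sign n) * tr x"
  using sign_cases[of n] by (auto simp: tr_uminus)

definition wprod :: "ends list \<Rightarrow> 'r" where "wprod w = prod_list (map (\<lambda>a. ev a * H) w)"

text \<open>Unfolded, this is the sum over all positions of the product with the \<open>H\<close>
  there replaced by \<open>K\<close>. Likewise \<open>wprod_h\<close> is the derivative of
  \<open>wprod\<close> when \<open>H\<close> moves with velocity \<open>h\<close>.\<close>

fun wprod_K :: "ends list \<Rightarrow> 'r" where
  "wprod_K [] = 0"
| "wprod_K (a # w) = ev a * K * wprod w + ev a * H * wprod_K w"

fun wprod_h :: "ends list \<Rightarrow> 'r" where
  "wprod_h [] = 0"
| "wprod_h (a # w) = ev a * h * wprod w + ev a * H * wprod_h w"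

lemma wprod_simps [simp]: "wprod [] = 1" "wprod (a # w) = ev a * H * wprod w"
  by (simp_all add: wprod_def)

lemma wprod_append: "wprod (u @ v) = wprod u * wprod v"
  by (simp add: wprod_def)

lemma wprod_K_append: "wprod_K (u @ v) = wprod_K u * wprod v + wprod u * wprod_K v"
  by (induction u) (simp_all add: wprod_append algebra_simps)

text \<open>\<open>H\<close> is odd, so a letter followed by \<open>H\<close> has the parity of its
  shifted degree, which is how the signs of the cyclic complex arise. \<open>K\<close> is even and
  costs one more sign.\<close>

lemma ev_letter:
  assumes "homog a"
  shows "s * (ev a * H) = of_int (sign (deg a - 1)) * (ev a * H * s)"
    and "s * (ev a * K) = - of_int (sign (deg a - 1)) * (ev a * K * s)"
proof -
  have *: "s * ev a = of_int (sign (deg a)) * (ev a * s)"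
    using ev_parity ends_hom_deg assms by blast
  have "s * (ev a * H) = of_int (sign (deg a)) * (ev a * (s * H))"
    by (simp add: * mult.assoc flip: mult.assoc[of s])
  then show "s * (ev a * H) = of_int (sign (deg a - 1)) * (ev a * H * s)"
    by (simp add: sH sign_diff_one mult.assoc)
  have "s * (ev a * K) = of_int (sign (deg a)) * (ev a * (s * K))"
    by (simp add: * mult.assoc flip: mult.assoc[of s])
  then show "s * (ev a * K) = - of_int (sign (deg a - 1)) * (ev a * K * s)"
    by (simp add: sK sign_diff_one mult.assoc)
qed

lemma sign_left_commute: "(x :: 'r) * (of_int (sign n) * y) = of_int (sign n) * (x * y)"
  using sign_cases[of n] by auto

lemma s_wprod:
  assumes "\<forall>a\<in>set w. homog a"
  shows "s * wprod w = of_int (sign (sdeg w)) * (wprod w * s)"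
  using assms
proof (induction w)
  case Nil
  then show ?case by (simp add: sign_def)
next
  case (Cons a w)
  have "s * wprod (a # w) = (s * (ev a * H)) * wprod w" by (simp add: mult.assoc)
  also have "\<dots> = of_int (sign (deg a - 1)) * (ev a * H * (s * wprod w))"
    using ev_letter(1)[of a] Cons.prems by (simp add: mult.assoc)
  also have "s * wprod w = of_int (sign (sdeg w)) * (wprod w * s)" using Cons by simp
  also have "of_int (sign (deg a - 1)) * (ev a * H * (of_int (sign (sdeg w)) * (wprod w * s)))
     = of_int (sign (deg a - 1)) * of_int (sign (sdeg w)) * (ev a * H * wprod w * s)"
    using sign_cases[of "sdeg w"] by (auto simp: mult.assoc)
  finally show ?case by (simp add: sdeg_Cons sign_add)
qed

lemma s_wprod_K:
  assumes "\<forall>a\<in>set w. homog a"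
  shows "s * wprod_K w = - of_int (sign (sdeg w)) * (wprod_K w * s)"
  using assms
proof (induction w)
  case (Cons a w)
  have a: "homog a" using Cons.prems by simp
  have w: "s * wprod w = of_int (sign (sdeg w)) * (wprod w * s)" using s_wprod Cons.prems by simp
  have k: "s * wprod_K w = - of_int (sign (sdeg w)) * (wprod_K w * s)" using Cons by simp
  have "s * wprod_K (a # w) = (s * (ev a * K)) * wprod w + (s * (ev a * H)) * wprod_K w"
    by (simp add: algebra_simps)
  also have "\<dots> = - of_int (sign (deg a - 1)) * (ev a * K * (s * wprod w))
      + of_int (sign (deg a - 1)) * (ev a * H * (s * wprod_K w))"
    unfolding ev_letter[OF a] by (simp add: mult.assoc)
  also have "\<dots> = - of_int (sign (deg a - 1)) * of_int (sign (sdeg w)) * (wprod_K (a # w) * s)"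
    unfolding w k using sign_cases[of "sdeg w"] by (auto simp: algebra_simps)
  finally show ?case by (simp add: sdeg_Cons sign_add)
qed simp

text \<open>Conjugation by the involution \<open>s\<close> preserves the trace and negates
  \<open>x\<close>.\<close>

lemma tr_s_anticomm: "s * x = - (x * s) \<Longrightarrow> tr x = 0"
proof -
  assume a: "s * x = - (x * s)"
  have "tr x = tr (s * (s * x))" by (simp add: ss flip: mult.assoc)
  also have "\<dots> = tr (s * x * s)" by (rule tr_comm)
  also have "\<dots> = - tr x" by (simp add: a ss mult.assoc tr_uminus)
  finally have "2 * tr x = 0" by simp
  then show ?thesis using two_nz by simp
qed

lemma tr_wprod_K_even:
  assumes "\<forall>a\<in>set w. homog a" "even (sdeg w)"
  shows "tr (wprod_K w) = 0"
  by (rule tr_s_anticomm) (use s_wprod_K[OF assms(1)] assms(2) in \<open>simp add: sign_def\<close>)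

definition delta_sum :: "(ends list \<Rightarrow> 'r) \<Rightarrow> ends list \<Rightarrow> 'r" where
  "delta_sum f w = (\<Sum>p<length w. of_int (sign (sdeg (take p w))) * f (w[p := delta (w ! p)]))"

text \<open>The wrap-around summand of \<open>b_mu2\<close> is left out; it arises only under the
  trace, from the boundary term of the Leibniz formulas.\<close>

definition merge_sum :: "(ends list \<Rightarrow> 'r) \<Rightarrow> ends list \<Rightarrow> 'r" where
  "merge_sum f w = (\<Sum>p<length w - 1. of_int (sign (sdeg (take (Suc p) w))) *
     f (take p w @ [w ! p * w ! Suc p] @ drop (Suc (Suc p)) w))"

lemma delta_sum_Cons:
  "delta_sum f (a # w) = f (delta a # w) +
     of_int (sign (deg a - 1)) * delta_sum (\<lambda>w. f (a # w)) w"
  unfolding delta_sum_def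
  by (simp add: sum.lessThan_Suc_shift sdeg_Cons sign_add sum_distrib_left mult.assoc
      del: sum.lessThan_Suc)

lemma merge_sum_Cons:
  "merge_sum f (a # b # v) = of_int (sign (deg a - 1)) *
     (f ((a * b) # v) + merge_sum (\<lambda>w. f (a # w)) (b # v))"
  unfolding merge_sum_def
  by (simp add: sum.lessThan_Suc_shift sdeg_Cons sign_add sum_distrib_left mult.assoc distrib_left
      del: sum.lessThan_Suc)

lemma delta_sum_wprod: "delta_sum (\<lambda>w. wprod (a # w)) w = ev a * H * delta_sum wprod w"
  unfolding delta_sum_def by (simp add: sum_distrib_left sign_left_commute)

lemma merge_sum_wprod: "merge_sum (\<lambda>w. wprod (a # w)) w = ev a * H * merge_sum wprod w"
  unfolding merge_sum_def by (simp add: sum_distrib_left sign_left_commute)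

lemma delta_sum_wprod_K:
  "delta_sum (\<lambda>w. wprod_K (a # w)) w = ev a * K * delta_sum wprod w + ev a * H * delta_sum wprod_K w"
  unfolding delta_sum_def
  by (simp add: sum_distrib_left sum.distrib[symmetric] distrib_left sign_left_commute)

lemma merge_sum_wprod_K:
  "merge_sum (\<lambda>w. wprod_K (a # w)) w = ev a * K * merge_sum wprod w + ev a * H * merge_sum wprod_K w"
  unfolding merge_sum_def
  by (simp add: sum_distrib_left sum.distrib[symmetric] distrib_left sign_left_commute)

lemma ev_delta': "homog a \<Longrightarrow> ev (delta a) = s * (ev a * E - E * ev a)"
  using ev_delta[of a] ss by (metis mult.assoc mult_1)

lemma ev_pass: "homog a \<Longrightarrow> s * ev a * s = - of_int (sign (deg a - 1)) * ev a"
  using ev_parity[OF ends_hom_deg, of a] by (simp add: sign_diff_one mult.assoc ss)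

text \<open>Moving \<open>E\<close> through the product produces \<open>delta\<close> at each letter
  and, by \<open>EH\<close>, the operator \<open>s\<close> in place of each \<open>H\<close>. Where
  \<open>H\<close> is lost the two neighbours multiply; the last \<open>H\<close> has no right
  neighbour and leaves the boundary term.\<close>

lemma leibniz_wprod:
  assumes "\<forall>a\<in>set w. homog a" "w \<noteq> []"
  shows "delta_sum wprod w - merge_sum wprod w
      - of_int (sign (sdeg w)) * (wprod (butlast w) * ev (last w))
    = s * (wprod w * E - E * wprod w)"
  using assms
proof (induction w rule: induct_list012)
  case (2 a)
  have a: "homog a" using 2 by simp
  have "H * E = E * H + s" using EH by simp
  then have e: "ev a * (H * E) = ev a * E * H + ev a * s" by (simp add: distrib_left mult.assoc)
  have "s * (wprod [a] * E - E * wprod [a]) = s * (ev a * E - E * ev a) * H + s * ev a * s"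
    using e by (simp add: algebra_simps)
  then show ?case
    using ev_pass[OF a]
    by (simp add: delta_sum_def merge_sum_def sdeg_Cons ev_delta'[OF a])
next
  case (3 a b v)
  let ?w = "b # v" and ?\<epsilon> = "of_int (sign (deg a - 1)) :: 'r"
  have a: "homog a" using 3 by simp
  have IH: "delta_sum wprod ?w - merge_sum wprod ?w
      - of_int (sign (sdeg ?w)) * (wprod (butlast ?w) * ev (last ?w))
    = s * (wprod ?w * E - E * wprod ?w)" using 3 by simp
  have e: "H * E = E * H + s" using EH by simp
  have "delta_sum wprod (a # ?w) - merge_sum wprod (a # ?w)
      - of_int (sign (sdeg (a # ?w))) * (wprod (butlast (a # ?w)) * ev (last (a # ?w)))
    = ev (delta a) * H * wprod ?w - ?\<epsilon> * ev a * wprod ?w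
      + ?\<epsilon> * (ev a * H) * (delta_sum wprod ?w - merge_sum wprod ?w
         - of_int (sign (sdeg ?w)) * (wprod (butlast ?w) * ev (last ?w)))"
    unfolding delta_sum_Cons merge_sum_Cons delta_sum_wprod merge_sum_wprod sdeg_Cons[of a] sign_add
    using sign_cases[of "sdeg ?w"] by (auto simp: ev_mult algebra_simps)
  also have "\<dots> = ev (delta a) * H * wprod ?w + s * ev a * s * wprod ?w
      + (s * (ev a * H) * s) * (s * (wprod ?w * E - E * wprod ?w))"
    unfolding IH ev_letter(1)[OF a] ev_pass[OF a] by (simp add: mult.assoc ss)
  also have "\<dots> = s * (wprod (a # ?w) * E - E * wprod (a # ?w))"
  proof -
    have "(s * (ev a * H) * s) * (s * x) = s * (ev a * H) * x" for x
      by (metis mult.assoc mult_1 ss)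
    moreover have "ev a * H * E = ev a * E * H + ev a * s" using e by (simp add: mult.assoc distrib_left)
    then have "ev a * H * (E * x) = ev a * E * H * x + ev a * s * x" for x
      by (metis mult.assoc distrib_right)
    ultimately show ?thesis unfolding ev_delta'[OF a]
      by (simp add: left_diff_distrib right_diff_distrib distrib_left distrib_right mult.assoc) (simp add: mult.assoc[symmetric])?
  qed
  finally show ?case .
qed simp

text \<open>Replacing one \<open>H\<close> by \<open>K\<close> flips the parity, so the commutator
  with \<open>E\<close> turns into an anticommutator, and \<open>E\<close> meeting \<open>K\<close>
  yields \<open>h\<close> by \<open>EK\<close>.\<close>

lemma leibniz_wprod_K:
  assumes "\<forall>a\<in>set w. homog a" "w \<noteq> []"
  shows "delta_sum wprod_K w - merge_sum wprod_K w
      - of_int (sign (sdeg w)) * (wprod_K (butlast w) * ev (last w))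
    = s * (wprod_h w - E * wprod_K w - wprod_K w * E)"
  using assms
proof (induction w rule: induct_list012)
  case (2 a)
  have a: "homog a" using 2 by simp
  have "ev a * (E * K) = ev a * h - ev a * (K * E)"
    by (simp add: EK right_diff_distrib)
  then show ?case
    by (simp add: delta_sum_def merge_sum_def ev_delta'[OF a] left_diff_distrib right_diff_distrib mult.assoc)
next
  case (3 a b v)
  let ?w = "b # v" and ?\<epsilon> = "of_int (sign (deg a - 1)) :: 'r"
  have a: "homog a" using 3 by simp
  have IH: "delta_sum wprod_K ?w - merge_sum wprod_K ?w
      - of_int (sign (sdeg ?w)) * (wprod_K (butlast ?w) * ev (last ?w))
    = s * (wprod_h ?w - E * wprod_K ?w - wprod_K ?w * E)" using 3 by simp
  note T = leibniz_wprod[of ?w]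
  have T: "delta_sum wprod ?w - merge_sum wprod ?w
      - of_int (sign (sdeg ?w)) * (wprod (butlast ?w) * ev (last ?w))
    = s * (wprod ?w * E - E * wprod ?w)" using 3 by (intro leibniz_wprod) auto
  have "delta_sum wprod_K (a # ?w) - merge_sum wprod_K (a # ?w)
      - of_int (sign (sdeg (a # ?w))) * (wprod_K (butlast (a # ?w)) * ev (last (a # ?w)))
    = ev (delta a) * K * wprod ?w + ev (delta a) * H * wprod_K ?w - ?\<epsilon> * ev a * wprod_K ?w
      + ?\<epsilon> * (ev a * K) * (delta_sum wprod ?w - merge_sum wprod ?w
         - of_int (sign (sdeg ?w)) * (wprod (butlast ?w) * ev (last ?w)))
      + ?\<epsilon> * (ev a * H) * (delta_sum wprod_K ?w - merge_sum wprod_K ?w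
         - of_int (sign (sdeg ?w)) * (wprod_K (butlast ?w) * ev (last ?w)))"
    unfolding delta_sum_Cons merge_sum_Cons delta_sum_wprod_K merge_sum_wprod_K sdeg_Cons[of a] sign_add
    using sign_cases[of "sdeg ?w"] by (auto simp: ev_mult algebra_simps)
  also have "\<dots> = ev (delta a) * K * wprod ?w + ev (delta a) * H * wprod_K ?w + s * ev a * s * wprod_K ?w
      - (s * (ev a * K) * s) * (s * (wprod ?w * E - E * wprod ?w))
      + (s * (ev a * H) * s) * (s * (wprod_h ?w - E * wprod_K ?w - wprod_K ?w * E))"
    unfolding IH T ev_letter[OF a] ev_pass[OF a] by (simp add: mult.assoc ss)
  also have "\<dots> = s * (wprod_h (a # ?w) - E * wprod_K (a # ?w) - wprod_K (a # ?w) * E)"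
  proof -
    have 1: "(s * (ev a * H) * s) * (s * x) = s * (ev a * H) * x"
        "(s * (ev a * K) * s) * (s * x) = s * (ev a * K) * x" for x
      by (metis mult.assoc mult_1 ss)+
    have "H * E = E * H + s" using EH by simp
    then have 2: "H * (E * x) = E * (H * x) + s * x" for x
      by (metis mult.assoc distrib_right)
    have 3: "E * (K * x) = h * x - K * (E * x)" for x
      using EK by (metis mult.assoc left_diff_distrib)
    show ?thesis unfolding ev_delta'[OF a] 1
      by (simp add: 2 3 left_diff_distrib right_diff_distrib distrib_left distrib_right mult.assoc)
  qed
  finally show ?case .
qed simp

text \<open>Under the trace the boundary term of \<open>leibniz_wprod_K\<close> becomes the
  wrap-around summand of \<open>b_mu2\<close>, and the anticommutator with \<open>E\<close>
  disappears because \<open>s\<close> anticommutes with \<open>E\<close>.\<close>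

theorem homotopy_formula:
  assumes "\<forall>a\<in>set w. homog a" "w \<noteq> []"
  shows "chain_ext (\<lambda>w. tr (wprod_K w)) (b_mu1 w + b_mu2 w) = tr (s * wprod_h w)"
proof -
  have 1: "chain_ext (\<lambda>w. tr (wprod_K w)) (b_mu1 w) = tr (delta_sum wprod_K w)"
    unfolding b_mu1_def delta_sum_def tr_sum by (simp add: chain_ext_sum chain_ext_cmul tr_sign)
  have 2: "chain_ext (\<lambda>w. tr (wprod_K w)) (b_mu2 w)
     = - tr (merge_sum wprod_K w) - tr (of_int (sign (sdeg w)) * (wprod_K (butlast w) * ev (last w)))"
  proof (cases "length w \<le> 1")
    case True
    then obtain a where "w = [a]" using assms(2) by (cases w) auto
    then show ?thesis by (simp add: b_mu2_def merge_sum_def)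
  next
    case False
    then obtain x v where v: "w = x # v" "v \<noteq> []" by (cases w) auto
    then obtain u y where w: "w = x # u @ [y]" by (metis append_butlast_last_id)
    let ?c = "(last w * hd w) # butlast (tl w)"
    have c: "tr (wprod_K ?c) = tr (wprod_K (butlast w) * ev (last w))"
    proof -
      have "wprod_K ?c = ev y * wprod_K (x # u)" by (simp add: w ev_mult algebra_simps)
      then show ?thesis using tr_comm[of "ev y" "wprod_K (x # u)"] by (simp add: w flip: append_Cons)
    qed
    have "of_int (sign ((deg (last w) - 1) * (sdeg (butlast w) + 1))) * tr (wprod_K ?c)
       = of_int (sign (sdeg w)) * tr (wprod_K (butlast w) * ev (last w))"
    proof (cases "even (sdeg w)")
      case True
      have "sdeg w = sdeg (butlast w) + (deg (last w) - 1)"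
        by (simp add: w sdeg_Cons sdeg_append)
      then have "sign ((deg (last w) - 1) * (sdeg (butlast w) + 1)) = 1" "sign (sdeg w) = 1"
        using True by (auto simp: sign_def)
      then show ?thesis using c by simp
    next
      case False
      let ?z = "wprod_K (x # u) * ev y"
      \<comment> \<open>For odd total shifted degree the two signs need not agree, but
        \<open>?z\<close> is then odd and has trace zero.\<close>
      have "tr ?z = 0"
      proof (rule tr_s_anticomm)
        have h: "homog y" "\<forall>a\<in>set (x # u). homog a" using assms w by auto
        have "s * ?z = (s * wprod_K (x # u)) * ev y" by (simp only: mult.assoc)
        also have "\<dots> = - of_int (sign (sdeg (x # u))) * (wprod_K (x # u) * (s * ev y))"
          unfolding s_wprod_K[OF h(2)] by (simp only: mult.assoc)
        also have "\<dots> = - (of_int (sign (sdeg (x # u))) * of_int (sign (deg y)) * (?z * s))"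
          using ev_parity[OF ends_hom_deg[OF h(1)]] sign_cases[of "deg y"] sign_cases[of "sdeg (x # u)"]
          by (auto simp: mult.assoc)
        also have "of_int (sign (sdeg (x # u))) * of_int (sign (deg y)) = (of_int (sign (sdeg (x # u) + deg y)) :: 'r)"
          by (simp add: sign_add)
        also have "sign (sdeg (x # u) + deg y) = 1"
          using False by (auto simp: w sdeg_Cons sdeg_append sign_def)
        finally show "s * ?z = - (?z * s)" by simp
      qed
      then have "tr (wprod_K (butlast w) * ev (last w)) = 0" by (simp add: w flip: append_Cons)
      then show ?thesis using c by simp
    qed
    moreover have "chain_ext (\<lambda>w. tr (wprod_K w)) (b_mu2 w) = - tr (merge_sum wprod_K w)
       - of_int (sign ((deg (last w) - 1) * (sdeg (butlast w) + 1))) * tr (wprod_K ?c)"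
      using False unfolding b_mu2_def merge_sum_def tr_sum
      by (simp add: chain_ext_sum chain_ext_cmul tr_sign chain_ext_diff chain_ext_uminus)
    ultimately show ?thesis by (simp add: tr_sign)
  qed
  have "chain_ext (\<lambda>w. tr (wprod_K w)) (b_mu1 w + b_mu2 w)
     = tr (delta_sum wprod_K w - merge_sum wprod_K w
         - of_int (sign (sdeg w)) * (wprod_K (butlast w) * ev (last w)))"
    by (simp add: chain_ext_add 1 2 tr_diff)
  also have "\<dots> = tr (s * wprod_h w) - tr (s * E * wprod_K w + s * wprod_K w * E)"
    unfolding leibniz_wprod_K[OF assms] by (simp add: tr_diff[symmetric] algebra_simps)
  also have "tr (s * E * wprod_K w + s * wprod_K w * E) = 0"
  proof -
    have "tr (s * wprod_K w * E) = tr (E * s * wprod_K w)"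
      using tr_comm[of "s * wprod_K w" E] by (simp only: mult.assoc)
    then show ?thesis by (simp only: tr_add sE) (simp add: tr_uminus mult.assoc)
  qed
  finally show ?thesis by simp
qed

lemma tr_wprod_K_tensor:
  assumes "x \<in> tensor_relations"
  shows "chain_ext (\<lambda>w. tr (wprod_K w)) x = 0"
  using assms
proof induction
  case (additive u a v a' j)
  then show ?case
    by (simp only: chain_ext_diff chain_ext_of)
      (simp add: wprod_K_append wprod_append ev_add tr_add algebra_simps)
next
  case (balanced u a v a' w r j)
  let ?c = "ev (ends_scalar r)"
  have c: "?c * x = x * ?c" for x by (rule ev_central)
  have c': "x * (?c * y) = ?c * (x * y)" for x y by (metis c mult.assoc)
  show ?case
    by (simp add: chain_ext_diff wprod_K_append wprod_append ev_mult mult.assoc c' distrib_left)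
qed (simp_all add: chain_ext_diff)

text \<open>Cyclicity of the trace gives invariance up to the sign in \<open>cyc_t\<close>. That
  sign is 1 for odd shifted degree, and for even shifted degree both sides vanish.\<close>

lemma tr_wprod_K_cyclic:
  assumes "\<forall>w\<in>Poly_Mapping.keys x. is_word w"
  shows "chain_ext (\<lambda>w. tr (wprod_K w)) (cyc_t x) = chain_ext (\<lambda>w. tr (wprod_K w)) x"
  unfolding cyc_t_def chain_ext_frag_extend
proof (rule chain_ext_cong)
  fix w assume "w \<in> Poly_Mapping.keys x"
  then have w: "is_word w" using assms by blast
  then obtain a u where au: "w = a # u" by (cases w) (auto simp: is_word_def)
  have h: "\<forall>a\<in>set w. homog a" using w is_word_homog by blast
  have e: "tr (wprod_K (u @ [a])) = tr (wprod_K w)"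
    using tr_comm[of "wprod u" "ev a * K"] tr_comm[of "wprod_K u" "ev a * H"]
    by (simp add: au wprod_K_append tr_add)
  show "chain_ext (\<lambda>w. tr (wprod_K w))
      (frag_cmul (sign ((deg (hd w) - 1) * sdeg (tl w))) (frag_of (tl w @ [hd w]))) = tr (wprod_K w)"
  proof (cases "even (sdeg w)")
    case True
    then show ?thesis using tr_wprod_K_even[OF h] e by (simp add: au chain_ext_cmul)
  next
    case False
    then have "sign ((deg (hd w) - 1) * sdeg (tl w)) = 1"
      by (auto simp: au sdeg_Cons sign_def)
    then show ?thesis using e by (simp add: au)
  qed
qed

end

section \<open>Expansions at the two ends of the annulus\<close>

text \<open>
  \<open>cfls2\<close> is a field of Laurent series in \<open>q = T\<^sup>1\<^sup>/\<^sup>2\<close> over Laurent series in \<open>y\<close>.  The expansion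
  \<open>expand True\<close> substitutes \<open>z\<^sub>1 = 1 / y\<close>, \<open>z\<^sub>0 = q\<^sup>2 y\<close>, and \<open>expand False\<close> substitutes \<open>z\<^sub>0 = 1 / y\<close>,
  \<open>z\<^sub>1 = q\<^sup>2 y\<close>.
\<close>

type_synonym cfls2 = "complex fls fls"

text \<open>Arbitrary lower bounds replace the exact subdegrees, since widening the range only adds
  zeros. One range then serves a whole family of series.\<close>

lemma fls_times_nth_interval:
  fixes f g :: "'a::semiring_0 fls"
  assumes "\<And>i. i < A \<Longrightarrow> f $$ i = 0" "\<And>i. i < B \<Longrightarrow> g $$ i = 0"
  shows "(f * g) $$ n = (\<Sum>i\<in>{A..n - B}. f $$ i * g $$ (n - i))"
  unfolding fls_times_nth(2)
proof (rule sum.mono_neutral_cong)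
  fix i assume "i \<in> {A..n - B} - {fls_subdegree f..n - fls_subdegree g}"
  then have "i < fls_subdegree f \<or> n - i < fls_subdegree g" by auto
  then show "f $$ i * g $$ (n - i) = 0" by auto
next
  fix i assume "i \<in> {fls_subdegree f..n - fls_subdegree g} - {A..n - B}"
  then have "i < A \<or> n - i < B" by auto
  then show "f $$ i * g $$ (n - i) = 0" using assms by auto
qed auto

text \<open>The monomial q^N y^n; q is the outer variable.\<close>

definition qy :: "int \<Rightarrow> int \<Rightarrow> cfls2" where
  "qy N n = fls_const (fls_X_intpow n) * fls_X_intpow N"

lemma fls_const_mult_nth: "(fls_const c * f) $$ n = (c :: 'a::comm_ring_1) * f $$ n"
  by (simp add: fls_times_nth_interval[where A = 0 and B = "fls_subdegree f"])

lemma qy_mult_nth: "(qy N n * G) $$ M $$ m = G $$ (M - N) $$ (m - n)"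
proof -
  have "qy N n * G = fls_const (fls_X_intpow n) * (fls_X_intpow N * G)"
    by (simp only: qy_def mult.assoc)
  then show ?thesis by (simp add: fls_const_mult_nth fls_X_intpow_times_conv_shift(1))
qed

lemma qy_nth: "qy N n $$ M $$ m = (if M = N \<and> m = n then 1 else 0)"
  using qy_mult_nth[of N n 1 M m] by (auto split: if_splits)

lemma qy_mult: "qy N n * qy M m = qy (N + M) (n + m)"
  by (rule fls_eqI, rule fls_eqI) (auto simp: qy_mult_nth qy_nth)

lemma qy_0 [simp]: "qy 0 0 = 1"
  by (simp add: qy_def)

definition emb :: "real fls \<Rightarrow> cfls2" where
  "emb r = Abs_fls (\<lambda>m. fls_const (complex_of_real (r $$ m)))"

lemma emb_nth: "emb r $$ m = fls_const (complex_of_real (r $$ m))"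
  unfolding emb_def by (rule nth_Abs_fls_lower_bound[of "fls_subdegree r"]) auto

lemma emb_add: "emb (r + r') = emb r + emb r'"
  by (rule fls_eqI, rule fls_eqI) (simp add: emb_nth)

lemma emb_mult_nth:
  assumes "\<And>i. i < A \<Longrightarrow> r $$ i = 0" "\<And>i. i < B \<Longrightarrow> G $$ i = 0"
  shows "(emb r * G) $$ N $$ n = (\<Sum>i\<in>{A..N - B}. complex_of_real (r $$ i) * G $$ (N - i) $$ n)"
  using assms
  by (subst fls_times_nth_interval[where A = A and B = B])
    (auto simp: emb_nth fls_sum_nth fls_const_mult_nth)

text \<open>The substitution turns z0^a z1^b into q^\<open>mon_wt\<close>
  y^\<open>mon_ex\<close>.\<close>

definition mon_wt :: "bool \<Rightarrow> nat \<Rightarrow> nat \<Rightarrow> int" where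
  "mon_wt d a b = 2 * int (if d then a else b)"

definition mon_ex :: "bool \<Rightarrow> nat \<Rightarrow> nat \<Rightarrow> int" where
  "mon_ex d a b = (if d then int a - int b else int b - int a)"

lemma mon_wt_nonneg: "0 \<le> mon_wt d a b"
  by (simp add: mon_wt_def)

text \<open>Infinitely many monomials share an exponent of y, but weights are nonnegative, so only
  those with a coefficient of order at most \<open>N\<close> reach q^N; Tate convergence makes them
  finite in number.\<close>

definition expand_coeff :: "bool \<Rightarrow> tate \<Rightarrow> int \<Rightarrow> int \<Rightarrow> complex" where
  "expand_coeff d F N n = (\<Sum>(a, b)\<in>tate_supp N (tate_fps F).
     if mon_ex d a b = n then complex_of_real (tate_coeff F a b $$ (N - mon_wt d a b)) else 0)"

lemma finite_tate_supp: "finite (tate_supp N (tate_fps F))"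
  using tate_fps[of F] is_tate_iff by simp

lemma tate_supp_mono: "N \<le> M \<Longrightarrow> tate_supp N F \<subseteq> tate_supp M F"
  unfolding tate_supp_def by (auto intro: order_trans)

lemma tate_supp_iff: "(a, b) \<in> tate_supp N (tate_fps F) \<longleftrightarrow> (\<exists>m\<le>N. tate_coeff F a b $$ m \<noteq> 0)"
  by (simp add: tate_supp_def tate_coeff.rep_eq)

lemma tate_suppI: "tate_coeff F a b $$ m \<noteq> 0 \<Longrightarrow> m \<le> N \<Longrightarrow> (a, b) \<in> tate_supp N (tate_fps F)"
  by (auto simp: tate_supp_def tate_coeff.rep_eq)

lemma expand_coeff_superset:
  assumes "finite A" "tate_supp N (tate_fps F) \<subseteq> A"
  shows "expand_coeff d F N n = (\<Sum>(a, b)\<in>A.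
     if mon_ex d a b = n then complex_of_real (tate_coeff F a b $$ (N - mon_wt d a b)) else 0)"
  unfolding expand_coeff_def
proof (rule sum.mono_neutral_left[OF assms], rule ballI)
  fix p assume p: "p \<in> A - tate_supp N (tate_fps F)"
  obtain a b where ab: "p = (a, b)" by force
  have "tate_coeff F a b $$ (N - mon_wt d a b) = 0"
    using p tate_suppI[of F a b "N - mon_wt d a b" N] mon_wt_nonneg[of d a b] ab by auto
  then show "(case p of (a, b) \<Rightarrow>
     if mon_ex d a b = n then complex_of_real (tate_coeff F a b $$ (N - mon_wt d a b)) else 0) = 0"
    by (simp add: ab)
qed

lemma expand_coeff_nonzero:
  assumes "expand_coeff d F N n \<noteq> 0"
  obtains a b where "mon_ex d a b = n" "tate_coeff F a b $$ (N - mon_wt d a b) \<noteq> 0"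
proof -
  from assms obtain p where "p \<in> tate_supp N (tate_fps F)" "(case p of (a, b) \<Rightarrow>
     if mon_ex d a b = n then complex_of_real (tate_coeff F a b $$ (N - mon_wt d a b)) else 0) \<noteq> 0"
    unfolding expand_coeff_def by (meson sum.neutral)
  then show ?thesis using that by (auto split: prod.splits if_splits)
qed

definition texpand :: "bool \<Rightarrow> tate \<Rightarrow> cfls2" where
  "texpand d F = Abs_fls (\<lambda>N. Abs_fls (\<lambda>n. expand_coeff d F N n))"

text \<open>The nested \<open>Abs_fls\<close> needs two lower bounds: for fixed \<open>N\<close>
  only finitely many monomials occur, and \<open>N\<close> is bounded below because the Tate
  coefficients are.\<close>

lemma texpand_nth: "texpand d F $$ N $$ n = expand_coeff d F N n"
proof -
  have inner: "Abs_fls (\<lambda>n. expand_coeff d F N n) $$ n = expand_coeff d F N n" for N n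
  proof -
    let ?I = "insert 0 ((\<lambda>(a, b). mon_ex d a b) ` tate_supp N (tate_fps F))"
    have fin: "finite ?I" using finite_tate_supp by simp
    have "expand_coeff d F N n = 0" if "n < Min ?I" for n
    proof (rule ccontr)
      assume "expand_coeff d F N n \<noteq> 0"
      then obtain a b where ab: "mon_ex d a b = n" "tate_coeff F a b $$ (N - mon_wt d a b) \<noteq> 0"
        by (rule expand_coeff_nonzero)
      then have "(a, b) \<in> tate_supp N (tate_fps F)"
        using tate_suppI mon_wt_nonneg[of d a b] by (metis diff_ge_0_iff_ge diff_le_eq le_add_same_cancel1)
      then have "n \<in> ?I" using ab(1) by force
      then show False using that fin Min_le by (meson linorder_not_less)
    qed
    then show ?thesis by (intro nth_Abs_fls_lower_bound[of "Min ?I"]) auto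
  qed
  obtain L where L: "\<And>a b m. tate_fps F $ a $ b $$ m \<noteq> 0 \<Longrightarrow> L \<le> m"
    by (rule tate_lower_bound[of "tate_fps F"]) (use tate_fps[of F] in auto)
  have "Abs_fls (\<lambda>n. expand_coeff d F N n) = 0" if "N < L" for N
  proof (rule fls_eqI)
    fix n
    have "expand_coeff d F N n = 0"
    proof (rule ccontr)
      assume "expand_coeff d F N n \<noteq> 0"
      then obtain a b where "tate_coeff F a b $$ (N - mon_wt d a b) \<noteq> 0" by (rule expand_coeff_nonzero)
      then show False using L[of a b "N - mon_wt d a b"] that mon_wt_nonneg[of d a b]
        by (auto simp: tate_coeff.rep_eq)
    qed
    then show "Abs_fls (\<lambda>n. expand_coeff d F N n) $$ n = 0 $$ n" using inner by simp
  qed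
  then have "texpand d F $$ N = Abs_fls (\<lambda>n. expand_coeff d F N n)"
    unfolding texpand_def by (intro nth_Abs_fls_lower_bound[of L]) auto
  then show ?thesis using inner by simp
qed

lemma texpand_add: "texpand d (F + G) = texpand d F + texpand d G"
proof (rule fls_eqI, rule fls_eqI)
  fix N n
  let ?A = "tate_supp N (tate_fps F) \<union> tate_supp N (tate_fps G) \<union> tate_supp N (tate_fps (F + G))"
  have A: "finite ?A" using finite_tate_supp by blast
  let ?t = "\<lambda>X (a, b). if mon_ex d a b = n then complex_of_real (tate_coeff X a b $$ (N - mon_wt d a b)) else 0"
  have "expand_coeff d F N n = sum (?t F) ?A" "expand_coeff d G N n = sum (?t G) ?A"
    "expand_coeff d (F + G) N n = sum (?t (F + G)) ?A"
    by (rule expand_coeff_superset[OF A], blast)+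
  moreover have "sum (?t (F + G)) ?A = sum (?t F) ?A + sum (?t G) ?A"
    unfolding sum.distrib[symmetric] by (rule sum.cong) auto
  ultimately have "expand_coeff d (F + G) N n = expand_coeff d F N n + expand_coeff d G N n" by simp
  then show "texpand d (F + G) $$ N $$ n = (texpand d F + texpand d G) $$ N $$ n"
    by (simp add: texpand_nth)
qed

lemma texpand_uminus: "texpand d (- F) = - texpand d F"
  using texpand_add[of d F "- F"] texpand_add[of d 0 0]
  by (simp add: eq_neg_iff_add_eq_0 add.commute)

lemma texpand_diff: "texpand d (F - G) = texpand d F - texpand d G"
  using texpand_add[of d F "- G"] by (simp add: texpand_uminus)

lemma texpand_sum: "texpand d (\<Sum>i\<in>I. f i) = (\<Sum>i\<in>I. texpand d (f i))"
proof -
  have "texpand d 0 = 0" using texpand_add[of d 0 0] by simp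
  then show ?thesis by (induction I rule: infinite_finite_induct) (auto simp: texpand_add)
qed

lemma texpand_z0: "texpand d (tate_z0 * F) = qy (mon_wt d 1 0) (mon_ex d 1 0) * texpand d F"
proof (rule fls_eqI, rule fls_eqI)
  fix N n
  define N' n' where N': "N' = N - mon_wt d 1 0" and n': "n' = n - mon_ex d 1 0"
  let ?S = "tate_supp N (tate_fps F)"
  let ?f = "\<lambda>(a, b). (Suc a, b)"
  have "tate_supp N (tate_fps (tate_z0 * F)) \<subseteq> ?f ` ?S"
  proof
    fix p assume "p \<in> tate_supp N (tate_fps (tate_z0 * F))"
    then obtain a b m where p: "p = (a, b)" "m \<le> N" "tate_coeff (tate_z0 * F) a b $$ m \<noteq> 0"
      by (auto simp: tate_supp_def tate_coeff.rep_eq)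
    then have "a \<noteq> 0" "tate_coeff F (a - 1) b $$ m \<noteq> 0" by (auto split: if_splits)
    then have "p = ?f (a - 1, b)" "(a - 1, b) \<in> ?S" using p tate_suppI by auto
    then show "p \<in> ?f ` ?S" by blast
  qed
  then have "expand_coeff d (tate_z0 * F) N n = (\<Sum>(a, b)\<in>?f ` ?S.
     if mon_ex d a b = n then complex_of_real (tate_coeff (tate_z0 * F) a b $$ (N - mon_wt d a b)) else 0)"
    using finite_tate_supp by (intro expand_coeff_superset) auto
  also have "\<dots> = (\<Sum>(a, b)\<in>?S.
     if mon_ex d a b = n' then complex_of_real (tate_coeff F a b $$ (N' - mon_wt d a b)) else 0)"
  proof -
    have e: "mon_ex d (Suc a) b = n \<longleftrightarrow> mon_ex d a b = n'" "N - mon_wt d (Suc a) b = N' - mon_wt d a b" for a b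
      by (auto simp: mon_ex_def mon_wt_def N' n')
    have "inj_on ?f ?S" by (auto simp: inj_on_def)
    then show ?thesis
      unfolding sum.reindex[OF \<open>inj_on ?f ?S\<close>]
      by (intro sum.cong refl) (simp add: case_prod_unfold e)
  qed
  also have "\<dots> = expand_coeff d F N' n'"
  proof (rule expand_coeff_superset[symmetric])
    show "tate_supp N' (tate_fps F) \<subseteq> ?S"
      using mon_wt_nonneg[of d 1 0] by (intro tate_supp_mono) (simp add: N')
  qed (rule finite_tate_supp)
  finally show "texpand d (tate_z0 * F) $$ N $$ n
      = (qy (mon_wt d 1 0) (mon_ex d 1 0) * texpand d F) $$ N $$ n"
    by (simp add: texpand_nth qy_mult_nth N' n')
qed

lemma texpand_z1: "texpand d (tate_z1 * F) = qy (mon_wt d 0 1) (mon_ex d 0 1) * texpand d F"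
proof (rule fls_eqI, rule fls_eqI)
  fix N n
  define N' n' where N': "N' = N - mon_wt d 0 1" and n': "n' = n - mon_ex d 0 1"
  let ?S = "tate_supp N (tate_fps F)"
  let ?f = "\<lambda>(a, b). (a, Suc b)"
  have "tate_supp N (tate_fps (tate_z1 * F)) \<subseteq> ?f ` ?S"
  proof
    fix p assume "p \<in> tate_supp N (tate_fps (tate_z1 * F))"
    then obtain a b m where p: "p = (a, b)" "m \<le> N" "tate_coeff (tate_z1 * F) a b $$ m \<noteq> 0"
      by (auto simp: tate_supp_def tate_coeff.rep_eq)
    then have "b \<noteq> 0" "tate_coeff F a (b - 1) $$ m \<noteq> 0" by (auto split: if_splits)
    then have "p = ?f (a, b - 1)" "(a, b - 1) \<in> ?S" using p tate_suppI by auto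
    then show "p \<in> ?f ` ?S" by blast
  qed
  then have "expand_coeff d (tate_z1 * F) N n = (\<Sum>(a, b)\<in>?f ` ?S.
     if mon_ex d a b = n then complex_of_real (tate_coeff (tate_z1 * F) a b $$ (N - mon_wt d a b)) else 0)"
    using finite_tate_supp by (intro expand_coeff_superset) auto
  also have "\<dots> = (\<Sum>(a, b)\<in>?S.
     if mon_ex d a b = n' then complex_of_real (tate_coeff F a b $$ (N' - mon_wt d a b)) else 0)"
  proof -
    have e: "mon_ex d a (Suc b) = n \<longleftrightarrow> mon_ex d a b = n'" "N - mon_wt d a (Suc b) = N' - mon_wt d a b" for a b
      by (auto simp: mon_ex_def mon_wt_def N' n')
    have "inj_on ?f ?S" by (auto simp: inj_on_def)
    then show ?thesis
      unfolding sum.reindex[OF \<open>inj_on ?f ?S\<close>]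
      by (intro sum.cong refl) (simp add: case_prod_unfold e)
  qed
  also have "\<dots> = expand_coeff d F N' n'"
  proof (rule expand_coeff_superset[symmetric])
    show "tate_supp N' (tate_fps F) \<subseteq> ?S"
      using mon_wt_nonneg[of d 0 1] by (intro tate_supp_mono) (simp add: N')
  qed (rule finite_tate_supp)
  finally show "texpand d (tate_z1 * F) $$ N $$ n
      = (qy (mon_wt d 0 1) (mon_ex d 0 1) * texpand d F) $$ N $$ n"
    by (simp add: texpand_nth qy_mult_nth N' n')
qed

section \<open>Multiplicativity of the expansion by truncation\<close>

definition tate_ord_ge :: "int \<Rightarrow> tate \<Rightarrow> bool" where
  "tate_ord_ge M F \<longleftrightarrow> (\<forall>a b m. tate_coeff F a b $$ m \<noteq> 0 \<longrightarrow> M \<le> m)"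

lemma tate_ord_ge_exists: "\<exists>M. tate_ord_ge M F"
  by (rule tate_lower_bound[of "tate_fps F"])
    (use tate_fps[of F] in \<open>auto simp: tate_ord_ge_def tate_coeff.rep_eq\<close>)

lemma texpand_ord:
  assumes "tate_ord_ge M F" "N < M"
  shows "texpand d F $$ N = 0"
proof (rule fls_eqI)
  fix n
  have "expand_coeff d F N n = 0"
  proof (rule ccontr)
    assume "expand_coeff d F N n \<noteq> 0"
    then obtain a b where "tate_coeff F a b $$ (N - mon_wt d a b) \<noteq> 0" by (rule expand_coeff_nonzero)
    then show False using assms mon_wt_nonneg[of d a b] unfolding tate_ord_ge_def by fastforce
  qed
  then show "texpand d F $$ N $$ n = 0 $$ n" by (simp add: texpand_nth)
qed

lemma tate_coeff_mult:
  "tate_coeff (F * G) a b = (\<Sum>i=0..a. \<Sum>j=0..b. tate_coeff F i j * tate_coeff G (a - i) (b - j))"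
  by transfer (simp add: fps_mult_nth fps_sum_nth)

lemma tate_ord_ge_mult:
  assumes "tate_ord_ge M F" "tate_ord_ge L G"
  shows "tate_ord_ge (M + L) (F * G)"
  unfolding tate_ord_ge_def
proof (intro allI impI)
  fix a b m assume "tate_coeff (F * G) a b $$ m \<noteq> 0"
  then have "(\<Sum>i=0..a. \<Sum>j=0..b. (tate_coeff F i j * tate_coeff G (a - i) (b - j)) $$ m) \<noteq> 0"
    by (simp add: tate_coeff_mult fls_sum_nth)
  then obtain i j where "(tate_coeff F i j * tate_coeff G (a - i) (b - j)) $$ m \<noteq> 0"
    by (meson sum.neutral)
  then obtain k where "tate_coeff F i j $$ k \<noteq> 0" "tate_coeff G (a - i) (b - j) $$ (m - k) \<noteq> 0"
    using fls_mult_nth_nonzeroD by blast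
  then have "M \<le> k" "L \<le> m - k" using assms unfolding tate_ord_ge_def by blast+
  then show "M + L \<le> m" by simp
qed

lemma texpand_const: "texpand d (tate_const r * F) = emb r * texpand d F"
proof (rule fls_eqI, rule fls_eqI)
  fix N n
  obtain L where L: "tate_ord_ge L F" using tate_ord_ge_exists by blast
  let ?R = "fls_subdegree r"
  let ?A = "tate_supp (N - ?R) (tate_fps F)"
  have c: "(r * tate_coeff F a b) $$ M = (\<Sum>i\<in>{?R..N - L}. r $$ i * tate_coeff F a b $$ (M - i))"
    if "M \<le> N" for a b M
  proof -
    have "tate_coeff F a b $$ i = 0" if "i < L" for i
      using L that by (force simp: tate_ord_ge_def)
    then have "(r * tate_coeff F a b) $$ M = (\<Sum>i\<in>{?R..M - (L - (N - M))}. r $$ i * tate_coeff F a b $$ (M - i))"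
      by (intro fls_times_nth_interval) (use that in auto)
    moreover have "M - (L - (N - M)) = N - L" by simp
    ultimately show ?thesis by (simp only:)
  qed
  have sub: "tate_supp (N - i) (tate_fps F) \<subseteq> ?A" if "i \<ge> ?R" for i
    using that by (intro tate_supp_mono) simp
  have "tate_supp N (tate_fps (tate_const r * F)) \<subseteq> ?A"
  proof
    fix p assume "p \<in> tate_supp N (tate_fps (tate_const r * F))"
    then obtain a b m where p: "p = (a, b)" "m \<le> N" "(r * tate_coeff F a b) $$ m \<noteq> 0"
      by (cases p) (auto simp: tate_supp_iff)
    then obtain i where "r $$ i \<noteq> 0" "tate_coeff F a b $$ (m - i) \<noteq> 0"
      using fls_mult_nth_nonzeroD by blast
    moreover from this have "?R \<le> i" by (simp add: fls_subdegree_leI)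
    ultimately show "p \<in> ?A" using p tate_suppI[of F a b "m - i" "N - ?R"] by auto
  qed
  then have "expand_coeff d (tate_const r * F) N n = (\<Sum>(a, b)\<in>?A. if mon_ex d a b = n
      then complex_of_real ((r * tate_coeff F a b) $$ (N - mon_wt d a b)) else 0)"
    by (simp only: expand_coeff_superset[OF finite_tate_supp] tate_coeff_simps)
  also have "\<dots> = (\<Sum>(a, b)\<in>?A. \<Sum>i\<in>{?R..N - L}. complex_of_real (r $$ i) *
      (if mon_ex d a b = n then complex_of_real (tate_coeff F a b $$ (N - i - mon_wt d a b)) else 0))"
    by (intro sum.cong refl) (auto simp: c mon_wt_nonneg algebra_simps)
  also have "\<dots> = (\<Sum>i\<in>{?R..N - L}. complex_of_real (r $$ i) * expand_coeff d F (N - i) n)"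
    unfolding case_prod_unfold
    by (subst sum.swap, intro sum.cong refl)
      (subst expand_coeff_superset[OF finite_tate_supp sub], auto simp: sum_distrib_left case_prod_unfold)
  also have "\<dots> = (emb r * texpand d F) $$ N $$ n"
    by (subst emb_mult_nth[where A = ?R and B = L]) (auto simp: texpand_ord[OF L] texpand_nth)
  finally show "texpand d (tate_const r * F) $$ N $$ n = (emb r * texpand d F) $$ N $$ n"
    by (simp add: texpand_nth)
qed

lemma texpand_one [simp]: "texpand d 1 = 1"
proof (rule fls_eqI, rule fls_eqI)
  fix N n
  have "expand_coeff d 1 N n = (\<Sum>(a, b)\<in>{(0, 0)}. if mon_ex d a b = n
      then complex_of_real (tate_coeff 1 a b $$ (N - mon_wt d a b)) else 0)"
    by (rule expand_coeff_superset) (auto simp: tate_supp_iff split: if_splits)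
  then show "texpand d 1 $$ N $$ n = 1 $$ N $$ n"
    by (simp add: texpand_nth mon_ex_def mon_wt_def)
qed

lemma texpand_monom_mult:
  "texpand d (tate_const r * (tate_z0 ^ a * (tate_z1 ^ b * F)))
     = texpand d (tate_const r * (tate_z0 ^ a * tate_z1 ^ b)) * texpand d F"
proof -
  have 1: "texpand d (tate_z1 ^ b * F) = qy (mon_wt d 0 1) (mon_ex d 0 1) ^ b * texpand d F" for F
    by (induction b) (simp_all add: texpand_z1 mult.assoc)
  have 0: "texpand d (tate_z0 ^ a * F) = qy (mon_wt d 1 0) (mon_ex d 1 0) ^ a * texpand d F" for F
    by (induction a) (simp_all add: texpand_z0 mult.assoc)
  show ?thesis using 1[of 1] by (simp add: texpand_const 0 1 mult.assoc)
qed

lemma tate_coeff_sum: "tate_coeff (\<Sum>i\<in>I. f i) a b = (\<Sum>i\<in>I. tate_coeff (f i) a b)"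
  by (induction I rule: infinite_finite_induct) auto

lemma tate_coeff_monom:
  "tate_coeff (tate_const r * (tate_z0 ^ i * tate_z1 ^ j)) a b = (if a = i \<and> b = j then r else 0)"
proof -
  have 1: "tate_coeff (tate_z1 ^ j) a b = (if a = 0 \<and> b = j then 1 else 0)" for a b
    by (induction j arbitrary: b) auto
  have "tate_coeff (tate_z0 ^ i * tate_z1 ^ j) a b = (if a = i \<and> b = j then 1 else 0)"
    by (induction i arbitrary: a) (auto simp: 1 mult.assoc)
  then show ?thesis by simp
qed

lemma tate_truncate:
  obtains A P where "finite A" "P = (\<Sum>(a, b)\<in>A. tate_const (tate_coeff F a b) * (tate_z0 ^ a * tate_z1 ^ b))"
    "tate_ord_ge M (F - P)"
proof
  let ?A = "tate_supp M (tate_fps F)"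
  let ?P = "\<Sum>(a, b)\<in>?A. tate_const (tate_coeff F a b) * (tate_z0 ^ a * tate_z1 ^ b)"
  show "finite ?A" by (rule finite_tate_supp)
  have "tate_coeff ?P a b = (if (a, b) \<in> ?A then tate_coeff F a b else 0)" for a b
  proof -
    have "tate_coeff ?P a b = (\<Sum>p\<in>?A. if p = (a, b) then tate_coeff F a b else 0)"
      unfolding tate_coeff_sum case_prod_unfold tate_coeff_monom by (intro sum.cong) auto
    then show ?thesis using finite_tate_supp by simp
  qed
  then have c: "tate_coeff (F - ?P) a b = (if (a, b) \<in> ?A then 0 else tate_coeff F a b)" for a b by simp
  show "tate_ord_ge M (F - ?P)"
    unfolding tate_ord_ge_def c using tate_suppI[of F _ _ _ M]
    by (metis fls_zero_nth linorder_linear)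
qed simp

text \<open>Multiplicativity is clear for a monomial factor, hence for polynomials. A general
  \<open>F\<close> is replaced by a polynomial up to order N - L + 1; since \<open>G\<close> has
  order at least \<open>L\<close>, the remainder does not reach q^N.\<close>

lemma texpand_mult: "texpand d (F * G) = texpand d F * texpand d G"
proof (rule fls_eqI)
  fix N
  obtain L where L: "tate_ord_ge L G" using tate_ord_ge_exists by blast
  obtain A P where P: "P = (\<Sum>(a, b)\<in>A. tate_const (tate_coeff F a b) * (tate_z0 ^ a * tate_z1 ^ b))"
      and R: "tate_ord_ge (N - L + 1) (F - P)"
    by (rule tate_truncate)
  have "texpand d (P * G) = texpand d P * texpand d G"
    unfolding P sum_distrib_right texpand_sum case_prod_unfold
    by (intro sum.cong refl) (simp add: texpand_monom_mult mult.assoc)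
  then have "texpand d (F * G) - texpand d F * texpand d G
     = texpand d ((F - P) * G) - texpand d (F - P) * texpand d G"
    by (simp add: texpand_diff left_diff_distrib)
  moreover have "texpand d ((F - P) * G) $$ N = 0"
    by (rule texpand_ord[OF tate_ord_ge_mult[OF R L]]) simp
  moreover have "(texpand d (F - P) * texpand d G) $$ N = 0"
    by (subst fls_times_nth_interval[where A = "N - L + 1" and B = L])
      (auto simp: texpand_ord[OF R] texpand_ord[OF L])
  ultimately have "(texpand d (F * G) - texpand d F * texpand d G) $$ N = 0" by simp
  then show "texpand d (F * G) $$ N = (texpand d F * texpand d G) $$ N" by simp
qed

text \<open>Both substitutions send z0 z1 to q^2, the image of T, so they descend to the
  quotient.\<close>

lift_definition expand :: "bool \<Rightarrow> sring \<Rightarrow> cfls2" is texpand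
proof -
  fix d F G assume "tate_eq F G"
  then obtain H where H: "F - G = tate_rel_gen * H" unfolding tate_eq_def by (rule dvdE)
  have T: "emb TT = qy 2 0"
    by (rule fls_eqI, rule fls_eqI)
      (auto simp: emb_nth qy_nth fls_X_power_conv_shift_1)
  have "texpand d tate_rel_gen = texpand d (tate_z0 * (tate_z1 * 1)) - texpand d (tate_const TT * 1)"
    by (simp add: tate_rel_gen_def texpand_diff)
  also have "\<dots> = 0"
    unfolding texpand_z0 texpand_z1 texpand_const T
    by (simp add: qy_mult mon_wt_def mon_ex_def)
  finally have "texpand d (F - G) = 0" unfolding H texpand_mult by simp
  then show "texpand d F = texpand d G" by (simp add: texpand_diff)
qed

lemma expand_add: "expand d (f + g) = expand d f + expand d g"
  by transfer (rule texpand_add)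

lemma expand_diff: "expand d (f - g) = expand d f - expand d g"
  by transfer (rule texpand_diff)

lemma expand_uminus: "expand d (- f) = - expand d f"
  by transfer (rule texpand_uminus)

lemma expand_mult: "expand d (f * g) = expand d f * expand d g"
  by transfer (rule texpand_mult)

lemma expand_1 [simp]: "expand d 1 = 1"
  by transfer (rule texpand_one)

lemma expand_0 [simp]: "expand d 0 = 0"
  using expand_add[of d 0 0] by simp

lemma expand_power: "expand d (f ^ n) = expand d f ^ n"
  by (induction n) (auto simp: expand_mult)

lemma expand_const: "expand d (s_const r) = emb r"
proof transfer
  fix d r show "texpand d (tate_const r) = emb r" using texpand_const[of d r 1] by simp
qed

lemma expand_z0: "expand d z0 = (if d then qy 2 1 else qy 0 (- 1))"
proof transfer
  fix d show "texpand d tate_z0 = (if d then qy 2 1 else qy 0 (- 1))"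
    using texpand_z0[of d 1] by (simp add: mon_wt_def mon_ex_def)
qed

lemma expand_z1: "expand d z1 = (if d then qy 0 (- 1) else qy 2 1)"
proof transfer
  fix d show "texpand d tate_z1 = (if d then qy 0 (- 1) else qy 2 1)"
    using texpand_z1[of d 1] by (simp add: mon_wt_def mon_ex_def)
qed

lemma s_reduced: "tate_reduced (s_reduced f)" "abs_sring (s_reduced f) = f"
  using theI'[OF s_reduced_unique[of f]] unfolding s_reduced_def by auto

lemma s_coeff_abs: "tate_reduced F \<Longrightarrow> s_coeff (abs_sring F) = tate_coeff F"
  unfolding s_coeff_def s_reduced_def by (simp add: the1_equality[OF s_reduced_unique])

lemma s_coeff_reduced: "a > 0 \<Longrightarrow> b > 0 \<Longrightarrow> s_coeff f a b = 0"
  using s_reduced(1)[of f] by (simp add: s_coeff_def tate_reduced_def)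

text \<open>In reduced form each power of y comes from one monomial: nonnegative powers from the
  variable substituted by q^2 y, whence the shift by 2n, and negative ones from the variable 1 / y.
  In particular the constant term in y is the same at both ends.\<close>

lemma expand_nth:
  "expand d f $$ N $$ n = complex_of_real
     ((let k = nat \<bar>n\<bar> in if d = (n \<ge> 0) then s_coeff f k 0 else s_coeff f 0 k) $$ (if n \<ge> 0 then N - 2 * n else N))"
proof -
  let ?F = "s_reduced f" and ?k = "nat \<bar>n\<bar>"
  let ?p = "if d = (n \<ge> 0) then (?k, 0) else (0, ?k)"
  have ex: "mon_ex d a b = n \<longleftrightarrow> (a, b) = ?p" if "a = 0 \<or> b = 0" for a b
    using that unfolding mon_ex_def by (cases d; cases "n \<ge> 0") auto
  have "expand d f = texpand d ?F" by (metis expand.abs_eq s_reduced(2))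
  then have "expand d f $$ N $$ n = expand_coeff d ?F N n" by (simp add: texpand_nth)
  also have "\<dots> = (\<Sum>(a, b)\<in>insert ?p (tate_supp N (tate_fps ?F)).
     if mon_ex d a b = n then complex_of_real (tate_coeff ?F a b $$ (N - mon_wt d a b)) else 0)"
    by (rule expand_coeff_superset) (auto simp: finite_tate_supp)
  also have "\<dots> = (\<Sum>p\<in>{?p}. case p of (a, b) \<Rightarrow> if mon_ex d a b = n
       then complex_of_real (tate_coeff ?F a b $$ (N - mon_wt d a b)) else 0)"
  proof (rule sum.mono_neutral_right)
    show "\<forall>p\<in>insert ?p (tate_supp N (tate_fps ?F)) - {?p}. (case p of (a, b) \<Rightarrow> if mon_ex d a b = n
       then complex_of_real (tate_coeff ?F a b $$ (N - mon_wt d a b)) else 0) = 0"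
    proof
      fix p assume p: "p \<in> insert ?p (tate_supp N (tate_fps ?F)) - {?p}"
      obtain a b where ab: "p = (a, b)" by force
      show "(case p of (a, b) \<Rightarrow> if mon_ex d a b = n
       then complex_of_real (tate_coeff ?F a b $$ (N - mon_wt d a b)) else 0) = 0"
      proof (cases "a = 0 \<or> b = 0")
        case True
        then show ?thesis using ex[OF True] p ab by auto
      next
        case False
        then show ?thesis using s_coeff_reduced[of a b f] by (simp add: ab s_coeff_def)
      qed
    qed
  qed (auto simp: finite_tate_supp)
  also have "\<dots> = complex_of_real
     ((let k = nat \<bar>n\<bar> in if d = (n \<ge> 0) then s_coeff f k 0 else s_coeff f 0 k) $$ (if n \<ge> 0 then N - 2 * n else N))"
    unfolding s_coeff_def mon_ex_def mon_wt_def Let_def by (cases d; cases "n \<ge> 0") auto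
  finally show ?thesis .
qed

lemma expand_ct: "expand d f $$ N $$ 0 = complex_of_real (s_coeff f 0 0 $$ N)"
  by (simp add: expand_nth)

lemma s_eqI: "(\<And>a b. s_coeff f a b = s_coeff g a b) \<Longrightarrow> f = g"
  by (metis s_coeff_def s_reduced(2) tate_eqI)

lemma expand_inject: "expand d f = 0 \<Longrightarrow> f = 0"
proof -
  assume 0: "expand d f = 0"
  have ab: "s_coeff f a 0 = 0 \<and> s_coeff f 0 a = 0" for a
  proof -
    have "s_coeff f a 0 $$ m = 0 \<and> s_coeff f 0 a $$ m = 0" for m
      using arg_cong[OF 0, of "\<lambda>F. F $$ (m + 2 * int a) $$ int a"]
        arg_cong[OF 0, of "\<lambda>F. F $$ m $$ (- int a)"] arg_cong[OF 0, of "\<lambda>F. F $$ m $$ 0"]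
      by (cases d; cases "a = 0") (auto simp: expand_nth Let_def)
    then show ?thesis by (auto intro: fls_eqI)
  qed
  have "s_coeff 0 a b = 0" for a b
    using s_coeff_abs[of 0] by (simp add: tate_reduced_def zero_sring.abs_eq[symmetric])
  then show "f = 0"
    using ab s_coeff_reduced by (intro s_eqI) (metis bot_nat_0.not_eq_extremum)
qed

section \<open>Residues at the critical points as differences of constant terms\<close>

definition inv_sq :: "complex fls" where
  "inv_sq = inverse (1 + fls_X ^ 2)"

text \<open>The constant term of x^m / (1 + x^(-2))^l at infinity minus the one at 0, which by the
  residue theorem is the sum of its residues against dx / x at x = i and x = - i.\<close>

definition res_coeff :: "nat \<Rightarrow> int \<Rightarrow> complex" where
  "res_coeff l m = (inv_sq ^ l) $$ m - (inv_sq ^ l) $$ (- m - 2 * int l)"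

lemma one_plus_X_sq_nonzero: "(1 :: complex fls) + fls_X ^ 2 \<noteq> 0"
proof
  assume "(1 :: complex fls) + fls_X ^ 2 = 0"
  then have "((1 :: complex fls) + fls_X ^ 2) $$ 0 = 0 $$ 0" by simp
  then show False by (simp add: fls_X_power_nth)
qed

lemma inv_sq_eq: "inv_sq + fls_X ^ 2 * inv_sq = 1"
proof -
  have "(1 + fls_X ^ 2) * inv_sq = 1" using one_plus_X_sq_nonzero by (simp add: inv_sq_def)
  then show ?thesis by (simp add: distrib_right)
qed

lemma X_sq_mult_nth: "(fls_X ^ 2 * (f :: complex fls)) $$ m = f $$ (m - 2)"
  using fls_X_square_power_times_nth[of f 1 m] by (simp add: mult.commute)

lemma inv_sq_neg:
  assumes "m < 0"
  shows "inv_sq $$ m = 0"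
proof -
  have "inv_sq = fps_to_fls (inverse (1 + fps_X ^ 2))"
    unfolding inv_sq_def
    by (subst fls_inverse_fps_to_fls[symmetric])
      (auto simp: fps_to_fls_power intro!: subdegreeI)
  then have "inv_sq $$ m = fps_to_fls (inverse (1 + fps_X ^ 2)) $$ m" by (simp only:)
  then show ?thesis using assms by (simp only: fps_to_fls_nth if_True)
qed

lemma inv_sq_shift: "inv_sq $$ m + inv_sq $$ (m - 2) = (if m = 0 then 1 else 0)"
  using arg_cong[OF inv_sq_eq, of "\<lambda>f. f $$ m"] by (simp add: X_sq_mult_nth)

lemma inv_sq_power_shift:
  "(inv_sq ^ Suc l) $$ (m - 2) = (inv_sq ^ l) $$ m - (inv_sq ^ Suc l) $$ m"
proof -
  have "fls_X ^ 2 * inv_sq ^ Suc l = (fls_X ^ 2 * inv_sq) * inv_sq ^ l" by (simp add: mult.assoc)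
  also have "fls_X ^ 2 * inv_sq = 1 - inv_sq" using inv_sq_eq by (simp add: algebra_simps)
  finally have "fls_X ^ 2 * inv_sq ^ Suc l = inv_sq ^ l - inv_sq ^ Suc l" by (simp add: algebra_simps)
  from arg_cong[OF this, of "\<lambda>f. f $$ m"] show ?thesis by (simp add: X_sq_mult_nth)
qed

lemma inv_sq_deriv: "fls_X * fls_deriv (inv_sq ^ l) = of_nat (2 * l) * (inv_sq ^ Suc l - inv_sq ^ l)"
proof -
  have X: "fls_X ^ 2 * inv_sq = 1 - inv_sq" using inv_sq_eq by (simp add: algebra_simps)
  have d: "fls_deriv ((1::complex fls) + fls_X ^ 2) = 2 * fls_X"
    by (simp add: fls_deriv_power)
  have "fls_deriv (inv_sq * (1 + fls_X ^ 2)) = fls_deriv (1 :: complex fls)"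
    using one_plus_X_sq_nonzero by (simp add: inv_sq_def)
  then have "fls_deriv inv_sq * (1 + fls_X ^ 2) = - 2 * fls_X * inv_sq"
    using d by (simp only: fls_deriv_mult fls_deriv_one) (simp add: algebra_simps eq_neg_iff_add_eq_0)
  then have "fls_deriv inv_sq * ((1 + fls_X ^ 2) * inv_sq) = - 2 * fls_X * inv_sq * inv_sq"
    by (simp only: mult.assoc[symmetric])
  moreover have "(1 + fls_X ^ 2) * inv_sq = 1" using inv_sq_eq by (simp add: distrib_right)
  ultimately have "fls_deriv inv_sq = - 2 * fls_X * inv_sq * inv_sq" by simp
  then have "fls_X * fls_deriv inv_sq = - 2 * (fls_X ^ 2 * inv_sq) * inv_sq"
    by (simp add: power2_eq_square algebra_simps)
  then have 1: "fls_X * fls_deriv inv_sq = 2 * (inv_sq * inv_sq - inv_sq)"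
    unfolding X by (simp add: algebra_simps)
  show ?thesis
  proof (induction l)
    case (Suc l)
    have "fls_X * fls_deriv (inv_sq ^ Suc l)
        = inv_sq * (fls_X * fls_deriv (inv_sq ^ l)) + (fls_X * fls_deriv inv_sq) * inv_sq ^ l"
      by (simp add: algebra_simps)
    also have "\<dots> = of_nat (2 * Suc l) * (inv_sq ^ Suc (Suc l) - inv_sq ^ Suc l)"
      unfolding Suc 1 by (simp add: algebra_simps)
    finally show ?case .
  qed simp
qed

lemma inv_sq_power_step:
  "of_nat (2 * l) * (inv_sq ^ Suc l) $$ m = (of_int m + of_nat (2 * l)) * (inv_sq ^ l) $$ m"
proof -
  have X: "(fls_X * f) $$ m = f $$ (m - 1)" for f :: "complex fls"
    by (simp add: fls_X_times_conv_shift(1))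
  have c: "(of_nat n * f) $$ m = of_nat n * f $$ m" for n and f :: "complex fls"
    by (simp add: fls_of_nat fls_const_mult_nth)
  from arg_cong[OF inv_sq_deriv, of "\<lambda>f. f $$ m" l]
  show ?thesis by (simp add: X c del: of_nat_mult power_Suc) (simp add: algebra_simps)
qed

text \<open>The Euler operator X d/dX on powers of \<open>inv_sq\<close> relates consecutive
  exponents. \<open>loc_residue_Suc\<close> is the same recursion for the residues, so only exponent
  1 has to be computed directly.\<close>

lemma res_coeff_Suc:
  "of_nat (2 * l) * res_coeff (Suc l) m = (of_int m + of_nat (2 * l)) * res_coeff l m"
proof -
  let ?k = "- m - 2 * int l"
  have "(inv_sq ^ Suc l) $$ (- m - 2 * int (Suc l)) = (inv_sq ^ l) $$ ?k - (inv_sq ^ Suc l) $$ ?k"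
    using inv_sq_power_shift[of l ?k] by (simp add: algebra_simps del: power_Suc)
  then have "of_nat (2 * l) * (inv_sq ^ Suc l) $$ (- m - 2 * int (Suc l))
      = of_nat (2 * l) * ((inv_sq ^ l) $$ ?k - (inv_sq ^ Suc l) $$ ?k)"
    by (simp only:)
  also have "\<dots> = (of_int m + of_nat (2 * l)) * (inv_sq ^ l) $$ ?k"
    unfolding right_diff_distrib inv_sq_power_step by (simp add: algebra_simps)
  finally show ?thesis
    unfolding res_coeff_def right_diff_distrib by (simp only: inv_sq_power_step)
qed

text \<open>Both sides change sign under m -> m - 2, since i and - i have square - 1, so the values
  at m = 0 and m = 1 decide.\<close>

lemma res_coeff_1: "res_coeff 1 m = (\<i> powi m + (- \<i>) powi m) / 2"
proof -
  define g where "g m = inv_sq $$ m - inv_sq $$ (- m - 2) - (\<i> powi m + (- \<i>) powi m) / 2" for m :: int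
  have p: "x powi m = - (x powi (m - 2))" if "x = \<i> \<or> x = - \<i>" for x m
  proof -
    have "x powi m = x powi (m - 2) * x powi 2"
      using that by (subst power_int_add[symmetric]) auto
    moreover have "x powi 2 = - 1" using that by (auto simp: power_int_def power2_eq_square)
    ultimately show ?thesis by simp
  qed
  have rec: "g m = - g (m - 2)" for m
  proof -
    have "inv_sq $$ m - inv_sq $$ (- m - 2) = - (inv_sq $$ (m - 2) - inv_sq $$ (- m))"
      using inv_sq_shift[of m] inv_sq_shift[of "- m"] by (simp add: algebra_simps split: if_splits)
    moreover have "- (m - 2) - 2 = - m" by simp
    moreover have "\<i> powi m + (- \<i>) powi m = - (\<i> powi (m - 2) + (- \<i>) powi (m - 2))"
      using p[of \<i> m] p[of "- \<i>" m] by simp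
    moreover have "a - b / 2 = - (a' - b' / 2)" if "a = - a'" "b = - b'" for a b a' b' :: complex
      using that by simp
    ultimately show ?thesis unfolding g_def by metis
  qed
  have 0: "g 0 = 0" "g 1 = 0"
    using inv_sq_shift[of 0] inv_sq_shift[of 1] by (simp_all add: g_def inv_sq_neg)
  have pos: "g (int n) = 0 \<and> g (int n + 1) = 0" for n
    by (induction n) (use 0 rec[of "int _ + 2"] in \<open>auto simp: algebra_simps\<close>)
  have neg: "g (- int n) = 0 \<and> g (1 - int n) = 0" for n
  proof (induction n)
    case (Suc n)
    have "1 - int n - 2 = - int (Suc n)" by simp
    then have "g (- int (Suc n)) = 0" using rec[of "1 - int n"] Suc by simp
    then show ?case using Suc by simp
  qed (use 0 in auto)
  have "g m = 0" using pos[of "nat m"] neg[of "nat (- m)"] by (cases "0 \<le> m") auto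
  then show ?thesis by (simp add: res_coeff_def g_def)
qed

text \<open>The local expansions, in the field of Laurent series in \<open>u = z\<^sub>1 - x\<close> over the Novikov field.\<close>

definition loc_z :: "complex fls \<Rightarrow> complex fls fls" where "loc_z x = fls_const x + fls_X"

definition loc_dW :: "complex fls \<Rightarrow> complex fls fls" where
  "loc_dW x = 1 + fls_const TT * inverse (loc_z x) ^ 2"

lemma fls_deriv_inverse':
  fixes f :: "'a::field fls"
  assumes "f \<noteq> 0"
  shows "fls_deriv (inverse f) = - fls_deriv f * inverse f ^ 2"
proof -
  have "fls_deriv (inverse f * f) = 0" using assms by simp
  then have "fls_deriv (inverse f) * f = - (inverse f * fls_deriv f)"
    by (simp only: fls_deriv_mult) (simp add: eq_neg_iff_add_eq_0 add.commute)
  then show ?thesis using assms by (simp add: field_simps power2_eq_square)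
qed

lemma fls_deriv_power_int:
  fixes f :: "'a::field fls"
  assumes "f \<noteq> 0"
  shows "f * fls_deriv (f powi m) = of_int m * fls_deriv f * f powi m"
proof -
  have pos: "g * fls_deriv (g ^ n) = of_nat n * fls_deriv g * g ^ n" for g :: "'a fls" and n
  proof (induction n)
    case (Suc n)
    have "g * fls_deriv (g ^ Suc n) = g * (g * fls_deriv (g ^ n)) + fls_deriv g * g ^ Suc n"
      by (simp add: algebra_simps)
    then show ?case unfolding Suc by (simp add: algebra_simps)
  qed simp
  show ?thesis
  proof (cases "m \<ge> 0")
    case True
    then show ?thesis using pos[of f "nat m"] by (simp add: power_int_def)
  next
    case False
    define n where "n = nat (- m)"
    have m: "m = - int n" "f powi m = inverse f ^ n" using False by (simp_all add: n_def power_int_def)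
    have "f * fls_deriv (inverse f ^ n) = f\<^sup>2 * (inverse f * fls_deriv (inverse f ^ n))"
      using assms by (simp add: power2_eq_square)
    also have "\<dots> = - of_nat n * fls_deriv f * inverse f ^ n"
      unfolding pos fls_deriv_inverse'[OF assms] using assms by (simp add: power2_eq_square field_simps)
    finally show ?thesis by (simp only: m(2)) (simp add: m(1))
  qed
qed

context
  fixes x :: "complex fls"
  assumes x: "x \<noteq> 0" "x ^ 2 = - TT"
begin

lemma loc_z_nonzero: "loc_z x \<noteq> 0"
proof
  assume "loc_z x = 0"
  then have "loc_z x $$ 0 = 0 $$ 0" by simp
  then show False using x by (simp add: loc_z_def)
qed

text \<open>By x^2 = - T the left side z^2 + T vanishes at u = 0, and only to first order: the
  critical points are nondegenerate.\<close>

lemma loc_z_square: "loc_z x ^ 2 * loc_dW x = fls_X * (fls_const (2 * x) + fls_X)"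
proof -
  have "loc_z x ^ 2 * loc_dW x = loc_z x ^ 2 + fls_const TT"
    using loc_z_nonzero by (simp add: loc_dW_def field_simps)
  also have "fls_const TT = - fls_const x * fls_const x"
    using x by (simp add: power2_eq_square)
  finally show ?thesis
    by (simp add: loc_z_def power2_eq_square algebra_simps flip: fls_const_mult_const)
qed

lemma const_2x: "fls_const (2 * x) + fls_X \<noteq> (0 :: complex fls fls)"
proof
  assume "fls_const (2 * x) + fls_X = (0 :: complex fls fls)"
  then have "(fls_const (2 * x) + fls_X) $$ 0 = (0 :: complex fls fls) $$ 0" by simp
  then show False using x by simp
qed

lemma loc_dW_nonzero: "loc_dW x \<noteq> 0"
  using loc_z_square const_2x by auto

text \<open>The residue of the derivative of z^m / V^l vanishes, and z V' = - 2 (V - 1) rewrites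
  that derivative in terms of the integrands for l and l + 1.\<close>

lemma loc_residue_Suc:
  "of_nat (2 * l) * fls_residue (loc_z x powi m / loc_dW x ^ Suc l * (1 / loc_z x))
     = (of_int m + of_nat (2 * l)) * fls_residue (loc_z x powi m / loc_dW x ^ l * (1 / loc_z x))"
proof -
  let ?z = "loc_z x" and ?V = "loc_dW x" and ?G = "inverse (loc_dW x)"
  note nz = loc_z_nonzero loc_dW_nonzero
  have dz: "fls_deriv ?z = 1" by (simp add: loc_z_def)
  have "?z * fls_deriv ?V = - 2 * (?V - 1)"
  proof -
    have "fls_deriv (inverse ?z ^ 2) = inverse ?z * fls_deriv (inverse ?z) + fls_deriv (inverse ?z) * inverse ?z"
      by (simp only: power2_eq_square fls_deriv_mult)
    moreover have "fls_deriv (inverse ?z) = - (inverse ?z ^ 2)"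
      by (simp only: fls_deriv_inverse'[OF nz(1)] dz) simp
    ultimately have "?z * fls_deriv (inverse ?z ^ 2) = - 2 * inverse ?z ^ 2"
      using nz by (simp add: power2_eq_square field_simps)
    then show ?thesis
      by (simp add: loc_dW_def fls_deriv_mult_const_left mult.left_commute[of ?z])
  qed
  then have "?z * fls_deriv ?G = 2 * (?V - 1) * ?G ^ 2"
    using nz by (simp add: fls_deriv_inverse' mult.assoc[symmetric]) (simp add: algebra_simps)
  also have "\<dots> = 2 * (?G - ?G ^ 2)"
    using nz by (simp add: field_simps power2_eq_square)
  finally have dG: "?z * fls_deriv ?G = 2 * (?G - ?G ^ 2)" .
  have dGl: "?z * fls_deriv (?G ^ l) = of_nat (2 * l) * (?G ^ l - ?G ^ Suc l)"
  proof (induction l)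
    case (Suc l)
    have "?z * fls_deriv (?G ^ Suc l) = ?G * (?z * fls_deriv (?G ^ l)) + (?z * fls_deriv ?G) * ?G ^ l"
      by (simp add: algebra_simps)
    then show ?case unfolding Suc dG by (simp add: algebra_simps power2_eq_square)
  qed simp
  have "?z * fls_deriv (?z powi m * ?G ^ l)
      = ?z powi m * (?z * fls_deriv (?G ^ l)) + (?z * fls_deriv (?z powi m)) * ?G ^ l"
    by (simp add: algebra_simps)
  also have "\<dots> = (of_int m + of_nat (2 * l)) * (?z powi m * ?G ^ l) - of_nat (2 * l) * (?z powi m * ?G ^ Suc l)"
    unfolding dGl fls_deriv_power_int[OF nz(1)] dz by (simp add: algebra_simps)
  finally have "fls_deriv (?z powi m * ?G ^ l)
    = ((of_int m + of_nat (2 * l)) * (?z powi m * ?G ^ l) - of_nat (2 * l) * (?z powi m * ?G ^ Suc l)) / ?z"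
    using nz by (simp add: field_simps)
  also have "\<dots> = (of_int m + of_nat (2 * l)) * (?z powi m / ?V ^ l * (1 / ?z))
      - of_nat (2 * l) * (?z powi m / ?V ^ Suc l * (1 / ?z))"
  proof -
    have "?z powi m * ?G ^ k / ?z = ?z powi m / ?V ^ k * (1 / ?z)" for k
      by (simp add: power_inverse divide_inverse)
    then show ?thesis by (simp only: diff_divide_distrib times_divide_eq_right[symmetric])
  qed
  finally have e: "fls_deriv (?z powi m * ?G ^ l)
    = (of_int m + of_nat (2 * l)) * (?z powi m / ?V ^ l * (1 / ?z))
      - of_nat (2 * l) * (?z powi m / ?V ^ Suc l * (1 / ?z))" .
  have c: "(of_nat n * f) $$ k = of_nat n * f $$ k" "(of_int i * f) $$ k = of_int i * f $$ k"
    for n i k and f :: "complex fls fls"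
    by (simp_all add: fls_of_nat fls_of_int fls_const_mult_nth)
  have "fls_residue (fls_deriv (?z powi m * ?G ^ l)) = 0" by (rule fls_residue_deriv)
  then show ?thesis unfolding e distrib_right fls_residue_def fls_minus_nth fls_plus_nth c by simp
qed

text \<open>By \<open>loc_z_square\<close> the integrand is z^(m+1) / (u (2x + u)), with a simple
  pole of residue x^(m+1) / (2x).\<close>

lemma loc_residue_1:
  "fls_residue (loc_z x powi m / loc_dW x ^ 1 * (1 / loc_z x)) = x powi m / 2"
proof -
  let ?z = "loc_z x"
  let ?f = "fps_const x + fps_X" and ?g = "fps_const (2 * x) + fps_X"
  have zf: "?z = fps_to_fls ?f" by (intro fls_eqI) (auto simp: loc_z_def fps_to_fls_def)
  have gf: "fls_const (2 * x) + fls_X = fps_to_fls ?g" by (intro fls_eqI) auto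
  have inv: "inverse (fps_to_fls ?f) = fps_to_fls (inverse ?f)" "inverse (fps_to_fls ?g) = fps_to_fls (inverse ?g)"
    using x by (intro fls_inverse_fps_to_fls subdegreeI; simp)+
  obtain E where E: "?z powi (m + 1) = fps_to_fls E" "E $ 0 = x powi (m + 1)"
  proof (cases "m + 1 \<ge> 0")
    case True
    then show ?thesis
      by (intro that[of "?f ^ nat (m + 1)"]) (auto simp: zf power_int_def fps_to_fls_power fps_nth_power_0)
  next
    case False
    then have "?z powi (m + 1) = inverse ?z ^ nat (- (m + 1))" by (simp add: power_int_def)
    also have "\<dots> = fps_to_fls (inverse ?f ^ nat (- (m + 1)))" by (simp only: zf inv fps_to_fls_power)
    finally show ?thesis
      by (rule that) (use False in \<open>simp add: fps_nth_power_0 power_int_def\<close>)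
  qed
  have "?z powi m / loc_dW x ^ 1 * (1 / ?z) = ?z powi (m + 1) / (?z ^ 2 * loc_dW x)"
    using loc_z_nonzero loc_dW_nonzero by (simp add: power_int_add field_simps power2_eq_square)
  also have "\<dots> = fls_X_inv * fps_to_fls (E * inverse ?g)"
    unfolding loc_z_square gf E
    by (simp only: divide_inverse inverse_mult_distrib inv fls_times_fps_to_fls fls_inverse_X mult.left_commute)
  also have "fls_residue \<dots> = (E * inverse ?g) $ 0"
    by (simp add: fls_X_inv_times_conv_shift(1))
  also have "\<dots> = x powi (m + 1) / (2 * x)"
  proof -
    have "?g $ 0 = 2 * x" by simp
    then show ?thesis by (simp only: fps_mult_nth_0 fps_inverse_nth_0 E divide_inverse)
  qed
  also have "\<dots> = x powi m / 2"
  proof -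
    have "x powi (m + 1) = x powi m * x" using x by (intro power_int_add_1) simp
    moreover have "a * x / (2 * x) = a / 2" for a
      by (rule nonzero_mult_divide_mult_cancel_right[OF x(1)])
    ultimately show ?thesis by (simp only:)
  qed
  finally show ?thesis .
qed

end

lemma crit_points: "x \<in> crit_points \<Longrightarrow> x \<noteq> 0 \<and> x ^ 2 = - TT"
proof -
  have "fls_const \<i> * fls_const \<i> = (- 1 :: complex fls)"
    by (simp only: fls_const_mult_const) (simp del: fls_const_mult_const)
  then have "(fls_const \<i> * Thalf) ^ 2 = (- TT :: complex fls)"
    by (simp add: power2_eq_square mult_ac)
  moreover have "fls_const \<i> * Thalf \<noteq> (0 :: complex fls)" by simp
  ultimately show "x \<in> crit_points \<Longrightarrow> x \<noteq> 0 \<and> x ^ 2 = - TT" by (auto simp: crit_points_def)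
qed

lemma sum_residues:
  "(\<Sum>x\<in>crit_points. fls_residue (loc_z x powi m / loc_dW x ^ Suc l * (1 / loc_z x)))
     = fls_const (res_coeff (Suc l) m) * fls_X powi m"
proof (induction l)
  case 0
  let ?i = "fls_const \<i> :: complex fls"
  have ne: "?i * Thalf \<noteq> - (?i * Thalf)"
  proof
    assume "?i * Thalf = - (?i * Thalf)"
    then have "(?i * Thalf) $$ 1 = (- (?i * Thalf)) $$ 1" by simp
    then show False by (simp add: fls_const_mult_nth)
  qed
  have "(\<Sum>x\<in>crit_points. fls_residue (loc_z x powi m / loc_dW x ^ Suc 0 * (1 / loc_z x)))
     = (\<Sum>x\<in>crit_points. x powi m / 2)"
  proof (intro sum.cong refl)
    fix x :: "complex fls" assume "x \<in> crit_points"
    then show "fls_residue (loc_z x powi m / loc_dW x ^ Suc 0 * (1 / loc_z x)) = x powi m / 2"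
      using loc_residue_1[of x m] crit_points[of x] by (metis One_nat_def)
  qed
  also have "\<dots> = ((?i * Thalf) powi m + (- (?i * Thalf)) powi m) / 2"
    using ne by (simp add: crit_points_def add_divide_distrib)
  also have "- (?i * Thalf) = fls_const (- \<i>) * Thalf" by simp
  also have "((?i * Thalf) powi m + (fls_const (- \<i>) * Thalf) powi m) / 2
     = fls_const ((\<i> powi m + (- \<i>) powi m) / 2) * fls_X powi m"
  proof -
    have 1: "(fls_const c * Thalf) powi m = fls_const (c powi m) * fls_X powi m" for c :: complex
      by (simp add: power_int_mult_distrib fls_const_power_int del: fls_X_power_int)
    have 2: "fls_const (a + b) / 2 = (fls_const ((a + b) / 2) :: complex fls)" for a b
      by (metis fls_const_divide_const fls_const_numeral)
    have 3: "fls_const (a + b) = (fls_const a + fls_const b :: complex fls)" for a b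
      by (intro fls_eqI) auto
    show ?thesis
      by (simp only: 1 distrib_right[symmetric] 3[symmetric] times_divide_eq_left[symmetric] 2)
  qed
  finally show ?case by (simp only: res_coeff_1[unfolded One_nat_def])
next
  case (Suc l)
  let ?S = "\<lambda>l. \<Sum>x\<in>crit_points. fls_residue (loc_z x powi m / loc_dW x ^ l * (1 / loc_z x))"
  have "of_nat (2 * Suc l) * ?S (Suc (Suc l)) = (of_int m + of_nat (2 * Suc l)) * ?S (Suc l)"
    unfolding sum_distrib_left
    by (intro sum.cong refl loc_residue_Suc) (use crit_points in auto)
  also have "\<dots> = fls_const ((of_int m + of_nat (2 * Suc l)) * res_coeff (Suc l) m) * fls_X powi m"
  proof -
    have "of_int m + of_nat (2 * Suc l) = (fls_const (of_int m + of_nat (2 * Suc l)) :: complex fls)"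
      by (intro fls_eqI) (auto simp: fls_of_int fls_of_nat simp del: of_nat_mult)
    then show ?thesis unfolding Suc by (simp add: mult.assoc del: fls_X_power_int flip: fls_const_mult_const)
  qed
  also have "\<dots> = of_nat (2 * Suc l) * (fls_const (res_coeff (Suc (Suc l)) m) * fls_X powi m)"
    unfolding res_coeff_Suc[symmetric]
    by (simp only: fls_of_nat mult.assoc flip: fls_const_mult_const)
  finally show ?case by (simp del: of_nat_Suc of_nat_mult fls_X_power_int)
qed

section \<open>Laurent polynomials in \<open>S\<close>\<close>

lemma s_abs_simps:
  "abs_sring (F + G) = abs_sring F + abs_sring G"
  "abs_sring (F * G) = abs_sring F * abs_sring G"
  "abs_sring 1 = 1" "abs_sring 0 = 0" "abs_sring tate_z0 = z0" "abs_sring tate_z1 = z1"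
  "abs_sring (tate_const r) = s_const r"
  by (simp_all add: plus_sring.abs_eq times_sring.abs_eq one_sring.abs_eq zero_sring.abs_eq
      z0.abs_eq z1.abs_eq s_const.abs_eq)

lemma s_abs_power: "abs_sring (F ^ n) = abs_sring F ^ n"
  by (induction n) (auto simp: s_abs_simps)

lemma s_abs_sum: "abs_sring (\<Sum>i\<in>I. f i) = (\<Sum>i\<in>I. abs_sring (f i))"
  by (induction I rule: infinite_finite_induct) (auto simp: s_abs_simps)

lemma s_coeff_add: "s_coeff (f + g) a b = s_coeff f a b + s_coeff g a b"
proof -
  have "tate_reduced (s_reduced f + s_reduced g)"
    using s_reduced(1) by (simp add: tate_reduced_def)
  from s_coeff_abs[OF this] show ?thesis
    by (simp add: s_abs_simps s_reduced(2)) (simp add: s_coeff_def)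
qed

lemma s_coeff_z0_power: "s_coeff (s_const r * z0 ^ n) a b = (if a = n \<and> b = 0 then r else 0)"
proof -
  have "tate_reduced (tate_const r * (tate_z0 ^ n * tate_z1 ^ 0))"
    unfolding tate_reduced_def tate_coeff_monom by auto
  from s_coeff_abs[OF this] show ?thesis
    unfolding tate_coeff_monom[abs_def] by (simp add: s_abs_simps s_abs_power)
qed

lemma s_coeff_z1_power: "s_coeff (s_const r * z1 ^ n) a b = (if a = 0 \<and> b = n then r else 0)"
proof -
  have "tate_reduced (tate_const r * (tate_z0 ^ 0 * tate_z1 ^ n))"
    unfolding tate_reduced_def tate_coeff_monom by auto
  from s_coeff_abs[OF this] show ?thesis
    unfolding tate_coeff_monom[abs_def] by (simp add: s_abs_simps s_abs_power)
qed

text \<open>Homogeneous elements of \<open>S\<close> are of this kind, so \<open>s_taylor\<close>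
  becomes a finite sum for them, and statements linear over \<open>R\<close> can be proved by
  induction over monomials.\<close>

inductive_set laurent_polys :: "sring set" where
  z0: "s_const r * z0 ^ n \<in> laurent_polys"
| z1: "s_const r * z1 ^ n \<in> laurent_polys"
| add: "f \<in> laurent_polys \<Longrightarrow> g \<in> laurent_polys \<Longrightarrow> f + g \<in> laurent_polys"

lemma s_const_power: "s_const (r ^ n) = s_const r ^ n"
  by (induction n) (auto simp: s_const_hom)

lemma laurent_monom: "s_const r * (z0 ^ a * z1 ^ b) \<in> laurent_polys"
proof (cases "a \<ge> b")
  case True
  have "z0 ^ a * z1 ^ b = z0 ^ (a - b) * (z0 * z1) ^ b"
    using True by (simp add: power_mult_distrib mult.assoc[symmetric] flip: power_add)
  then have "s_const r * (z0 ^ a * z1 ^ b) = s_const (r * TT ^ b) * z0 ^ (a - b)"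
    by (simp add: z0_z1 s_const_hom s_const_power mult_ac)
  then show ?thesis by (simp only: laurent_polys.z0)
next
  case False
  then have "z1 ^ b = z1 ^ a * z1 ^ (b - a)" by (simp flip: power_add)
  then have "z0 ^ a * z1 ^ b = (z0 * z1) ^ a * z1 ^ (b - a)"
    by (simp add: power_mult_distrib mult.assoc)
  then have "s_const r * (z0 ^ a * z1 ^ b) = s_const (r * TT ^ a) * z1 ^ (b - a)"
    by (simp add: z0_z1 s_const_hom s_const_power mult_ac)
  then show ?thesis by (simp only: laurent_polys.z1)
qed

lemma laurent_const: "s_const r \<in> laurent_polys"
  using laurent_polys.z0[of r 0] by simp

lemma laurent_0: "0 \<in> laurent_polys"
  using laurent_const[of 0] by (simp add: s_const_hom)

lemma laurent_sum: "(\<And>i. i \<in> I \<Longrightarrow> f i \<in> laurent_polys) \<Longrightarrow> (\<Sum>i\<in>I. f i) \<in> laurent_polys"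
  by (induction I rule: infinite_finite_induct) (auto intro: laurent_0 laurent_polys.add)

lemma laurent_mult:
  assumes "f \<in> laurent_polys" "g \<in> laurent_polys"
  shows "f * g \<in> laurent_polys"
proof -
  have m: "s_const r * (z0 ^ a * z1 ^ b) * g \<in> laurent_polys" if "g \<in> laurent_polys" for r a b g
    using that
  proof induction
    case (z0 r' n)
    have "s_const r * (z0 ^ a * z1 ^ b) * (s_const r' * z0 ^ n)
        = s_const (r * r') * (z0 ^ (a + n) * z1 ^ b)"
      by (simp add: s_const_hom power_add mult_ac)
    then show ?case by (simp only: laurent_monom)
  next
    case (z1 r' n)
    have "s_const r * (z0 ^ a * z1 ^ b) * (s_const r' * z1 ^ n)
        = s_const (r * r') * (z0 ^ a * z1 ^ (b + n))"
      by (simp add: s_const_hom power_add mult_ac)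
    then show ?case by (simp only: laurent_monom)
  qed (simp add: distrib_left laurent_polys.add)
  from assms(1) show ?thesis
  proof induction
    case (z0 r n)
    then show ?case using m[OF assms(2), of r n 0] by simp
  next
    case (z1 r n)
    then show ?case using m[OF assms(2), of r 0 n] by simp
  qed (simp add: distrib_right laurent_polys.add)
qed

text \<open>T^(1/2) and the variables all have degree 2, so in degree j every coefficient carries a
  power of T^(1/2) with exponent at most \<bar>j\<bar>. Tate convergence leaves finitely many such
  monomials.\<close>

lemma s_hom_laurent:
  assumes "s_hom j f"
  shows "f \<in> laurent_polys"
proof -
  obtain F where F: "abs_sring F = f" "tate_hom j F" using assms by (auto simp: s_hom_def)
  let ?A = "tate_supp \<bar>j\<bar> (tate_fps F)"
  let ?P = "\<Sum>(a, b)\<in>?A. tate_const (tate_coeff F a b) * (tate_z0 ^ a * tate_z1 ^ b)"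
  have "F = ?P"
  proof (rule tate_eqI)
    fix a b
    have "tate_coeff ?P a b = (\<Sum>p\<in>?A. if p = (a, b) then tate_coeff F a b else 0)"
      unfolding tate_coeff_sum case_prod_unfold tate_coeff_monom by (intro sum.cong) auto
    then have P: "tate_coeff ?P a b = (if (a, b) \<in> ?A then tate_coeff F a b else 0)"
      using finite_tate_supp by simp
    show "tate_coeff F a b = tate_coeff ?P a b"
    proof (cases "(a, b) \<in> ?A")
      case False
      have "tate_coeff F a b $$ m = 0" for m
      proof (rule ccontr)
        assume nz: "tate_coeff F a b $$ m \<noteq> 0"
        then have "2 * m = j - 2 * int a - 2 * int b"
          using F(2) by (auto simp: tate_hom_def nov_hom_def)
        then have "m \<le> \<bar>j\<bar>" by linarith
        then show False using False nz tate_suppI by blast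
      qed
      then have "tate_coeff F a b = 0" by (auto intro: fls_eqI)
      then show ?thesis using False P by simp
    qed (use P in simp)
  qed
  then have "f = abs_sring ?P" using F(1) by simp
  also have "\<dots> \<in> laurent_polys"
    unfolding s_abs_sum case_prod_unfold s_abs_simps s_abs_power
    by (intro laurent_sum laurent_monom)
  finally show ?thesis .
qed

lemma laurent_finite_support: "f \<in> laurent_polys \<Longrightarrow> finite {(a, b). s_coeff f a b \<noteq> 0}"
proof (induction rule: laurent_polys.induct)
  case (z0 r n)
  have "{(a, b). s_coeff (s_const r * z0 ^ n) a b \<noteq> 0} \<subseteq> {(n, 0)}"
    by (auto simp: s_coeff_z0_power)
  then show ?case by (meson finite.simps finite_subset)
next
  case (z1 r n)
  have "{(a, b). s_coeff (s_const r * z1 ^ n) a b \<noteq> 0} \<subseteq> {(0, n)}"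
    by (auto simp: s_coeff_z1_power)
  then show ?case by (meson finite.simps finite_subset)
next
  case (add f g)
  have "{(a, b). s_coeff (f + g) a b \<noteq> 0}
     \<subseteq> {(a, b). s_coeff f a b \<noteq> 0} \<union> {(a, b). s_coeff g a b \<noteq> 0}"
    by (auto simp: s_coeff_add)
  then show ?case by (rule finite_subset) (use add.IH in simp)
qed

lemma s_d1_mult: "s_d1 (f * g) = s_d1 f * g + f * s_d1 g"
proof transfer
  fix F G
  show "tate_eq (tate_d1 (F * G) - tate_const (inverse TT) * tate_z0\<^sup>2 * tate_d0 (F * G))
     ((tate_d1 F - tate_const (inverse TT) * tate_z0\<^sup>2 * tate_d0 F) * G +
       F * (tate_d1 G - tate_const (inverse TT) * tate_z0\<^sup>2 * tate_d0 G))"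
    unfolding tate_d_mult tate_eq_def by (simp add: algebra_simps)
qed

lemma s_d1_add: "s_d1 (f + g) = s_d1 f + s_d1 g"
proof transfer
  fix F G
  have "tate_d0 (F + G) = tate_d0 F + tate_d0 G" "tate_d1 (F + G) = tate_d1 F + tate_d1 G"
    by (transfer; simp add: fps_eq_iff)+
  then show "tate_eq (tate_d1 (F + G) - tate_const (inverse TT) * tate_z0\<^sup>2 * tate_d0 (F + G))
     ((tate_d1 F - tate_const (inverse TT) * tate_z0\<^sup>2 * tate_d0 F) +
       (tate_d1 G - tate_const (inverse TT) * tate_z0\<^sup>2 * tate_d0 G))"
    unfolding tate_eq_def by (simp add: algebra_simps)
qed

lemma tate_eq_refl: "tate_eq F F"
  by (simp add: tate_eq_def)

lemma s_d1_const: "s_d1 (s_const r) = 0"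
proof transfer
  fix r
  have "tate_d0 (tate_const r) = 0" "tate_d1 (tate_const r) = 0"
    by (transfer; simp add: fps_eq_iff)+
  then show "tate_eq (tate_d1 (tate_const r) - tate_const (inverse TT) * tate_z0\<^sup>2 * tate_d0 (tate_const r)) 0"
    by (simp add: tate_eq_refl)
qed

lemma s_d1_1: "s_d1 1 = 0"
  using s_d1_const[of 1] by (simp add: s_const_hom)

lemma s_d1_z1: "s_d1 z1 = 1"
proof transfer
  have "tate_d0 tate_z1 = 0" "tate_d1 tate_z1 = 1"
    by (transfer; simp add: fps_eq_iff fps_X_def)+
  then show "tate_eq (tate_d1 tate_z1 - tate_const (inverse TT) * tate_z0\<^sup>2 * tate_d0 tate_z1) 1"
    by (simp add: tate_eq_refl)
qed

lemma s_d1_z0: "s_d1 z0 = - (s_const (inverse TT) * z0\<^sup>2)"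
proof -
  have "s_d1 z0 = abs_sring (tate_d1 tate_z0 - tate_const (inverse TT) * tate_z0\<^sup>2 * tate_d0 tate_z0)"
    by (simp add: z0.abs_eq s_d1.abs_eq)
  also have "tate_d0 tate_z0 = 1" by (transfer; simp add: fps_eq_iff fps_X_def)
  also have "tate_d1 tate_z0 = 0" by (transfer; simp add: fps_eq_iff fps_X_def)
  also have "abs_sring (0 - tate_const (inverse TT) * tate_z0\<^sup>2 * 1)
      = 0 - abs_sring (tate_const (inverse TT) * tate_z0\<^sup>2)"
    by (simp only: minus_sring.abs_eq[symmetric] s_abs_simps(4)[symmetric] mult_1_right)
  finally show ?thesis by (simp add: s_abs_simps s_abs_power)
qed

lemma s_d1_uminus: "s_d1 (- f) = - s_d1 f"
proof -
  have "s_d1 0 = 0" using s_d1_const[of 0] by (simp add: s_const_hom)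
  then show ?thesis using s_d1_add[of f "- f"] by (simp add: eq_neg_iff_add_eq_0 add.commute)
qed

lemma s_d1_W: "s_d1 W_M = s_const (inverse TT) * z0 ^ 2 + s_const 1 * z1 ^ 0"
  unfolding W_M_def s_d1_add s_d1_uminus s_d1_z0 s_d1_z1 by (simp add: s_const_hom)

section \<open>The sum of the residues of a Laurent polynomial\<close>

definition taylor_monom :: "complex fls \<Rightarrow> nat \<Rightarrow> nat \<Rightarrow> complex fls fps" where
  "taylor_monom x a b = (fps_const TT * inverse (fps_const x + fps_X)) ^ a * (fps_const x + fps_X) ^ b"

lemma nov_complex_nth: "nov_complex r $$ m = complex_of_real (r $$ m)"
  unfolding nov_complex_def by (rule nth_Abs_fls_lower_bound[of "fls_subdegree r"]) auto

lemma nov_complex_0 [simp]: "nov_complex 0 = 0"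
  by (rule fls_eqI) (simp add: nov_complex_nth)

lemma nov_complex_add: "nov_complex (r + r') = nov_complex r + nov_complex r'"
  by (rule fls_eqI) (simp add: nov_complex_nth)

lemma nov_sum_finite:
  assumes "finite A" "\<And>i. i \<notin> A \<Longrightarrow> f i = 0"
  shows "nov_sum f = (\<Sum>i\<in>A. f i)"
proof -
  have "Sum_any (\<lambda>i. f i $$ m) = (\<Sum>i\<in>A. f i) $$ m" for m
  proof -
    have "{i. f i $$ m \<noteq> 0} \<subseteq> A"
    proof
      fix i assume "i \<in> {i. f i $$ m \<noteq> 0}"
      then show "i \<in> A" using assms(2)[of i] by (cases "i \<in> A") auto
    qed
    then show ?thesis by (simp add: Sum_any.expand_superset[OF assms(1)] fls_sum_nth)
  qed
  then have "nov_sum f = Abs_fls (\<lambda>m. (\<Sum>i\<in>A. f i) $$ m)" by (simp add: nov_sum_def)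
  also have "\<dots> = (\<Sum>i\<in>A. f i)"
    by (rule fls_eqI, rule nth_Abs_fls_lower_bound[of "fls_subdegree (\<Sum>i\<in>A. f i)"]) auto
  finally show ?thesis .
qed

lemma s_taylor_eq:
  assumes "finite A" "{(a, b). s_coeff f a b \<noteq> 0} \<subseteq> A"
  shows "s_taylor x f = (\<Sum>(a, b)\<in>A. fps_const (nov_complex (s_coeff f a b)) * taylor_monom x a b)"
proof (rule fps_ext)
  fix k
  have "s_taylor x f $ k = (\<Sum>p\<in>A. (\<lambda>(a, b). nov_complex (s_coeff f a b) * (taylor_monom x a b $ k)) p)"
    unfolding s_taylor_def fps_nth_Abs_fps taylor_monom_def
  proof (subst nov_sum_finite[OF assms(1)])
    fix p assume "p \<notin> A"
    moreover obtain a b where p: "p = (a, b)" by force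
    ultimately have "s_coeff f a b = 0" using assms(2) by blast
    then show "(case p of (a, b) \<Rightarrow> nov_complex (s_coeff f a b) *
        (((fps_const TT * inverse (fps_const x + fps_X)) ^ a * (fps_const x + fps_X) ^ b) $ k)) = 0"
      by (simp add: p)
  qed simp
  then show "s_taylor x f $ k
      = (\<Sum>(a, b)\<in>A. fps_const (nov_complex (s_coeff f a b)) * taylor_monom x a b) $ k"
    by (simp add: fps_sum_nth case_prod_unfold)
qed

lemma s_taylor_add:
  assumes "f \<in> laurent_polys" "g \<in> laurent_polys"
  shows "s_taylor x (f + g) = s_taylor x f + s_taylor x g"
proof -
  let ?S = "\<lambda>f. {(a, b). s_coeff f a b \<noteq> 0}"
  let ?A = "?S f \<union> ?S g \<union> ?S (f + g)"
  have A: "finite ?A"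
    using assms by (intro finite_UnI laurent_finite_support laurent_polys.add)
  have e: "s_taylor x h = (\<Sum>(a, b)\<in>?A. fps_const (nov_complex (s_coeff h a b)) * taylor_monom x a b)"
    if "?S h \<subseteq> ?A" for h using s_taylor_eq[OF A that] .
  have "s_taylor x (f + g) = (\<Sum>(a, b)\<in>?A. fps_const (nov_complex (s_coeff (f + g) a b)) * taylor_monom x a b)"
    by (rule e) blast
  also have "\<dots> = (\<Sum>(a, b)\<in>?A. fps_const (nov_complex (s_coeff f a b)) * taylor_monom x a b)
     + (\<Sum>(a, b)\<in>?A. fps_const (nov_complex (s_coeff g a b)) * taylor_monom x a b)"
    unfolding sum.distrib[symmetric] s_coeff_add nov_complex_add
    by (intro sum.cong refl) (auto simp: distrib_right simp flip: fps_const_add)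
  also have "\<dots> = s_taylor x f + s_taylor x g"
  proof -
    have "?S f \<subseteq> ?A" "?S g \<subseteq> ?A" by blast+
    then show ?thesis by (simp only: e)
  qed
  finally show ?thesis .
qed

lemma s_taylor_z0: "s_taylor x (s_const r * z0 ^ n) = fps_const (nov_complex r) * taylor_monom x n 0"
  by (subst s_taylor_eq[of "{(n, 0)}"]) (auto simp: s_coeff_z0_power split: if_splits)

lemma s_taylor_z1: "s_taylor x (s_const r * z1 ^ n) = fps_const (nov_complex r) * taylor_monom x 0 n"
  by (subst s_taylor_eq[of "{(0, n)}"]) (auto simp: s_coeff_z1_power split: if_splits)

lemma loc_z_fps: "loc_z x = fps_to_fls (fps_const x + fps_X)"
  by (intro fls_eqI) (auto simp: loc_z_def)

lemma taylor_monom_loc: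
  assumes "x \<noteq> 0"
  shows "fps_to_fls (taylor_monom x a b) = fls_const (TT ^ a) * inverse (loc_z x) ^ a * loc_z x ^ b"
proof -
  have "inverse (fps_to_fls (fps_const x + fps_X)) = fps_to_fls (inverse (fps_const x + fps_X))"
    using assms by (intro fls_inverse_fps_to_fls subdegreeI) auto
  then show ?thesis
    unfolding loc_z_fps taylor_monom_def fls_times_fps_to_fls fps_to_fls_power power_mult_distrib
    by (simp only: fls_const_power fps_const_to_fls)
qed

lemma taylor_dW:
  assumes "x \<noteq> 0"
  shows "fps_to_fls (s_taylor x (s_d1 W_M)) = loc_dW x"
proof -
  have 1: "nov_complex (inverse TT) * TT ^ 2 = TT"
  proof -
    have "nov_complex (inverse TT) = inverse TT"
      by (rule fls_eqI) (simp add: nov_complex_nth fls_inverse_X_power)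
    moreover have "inverse TT * TT = (1 :: complex fls)" by simp
    ultimately show ?thesis by (metis mult.assoc mult_1 power2_eq_square)
  qed
  have 2: "nov_complex 1 = 1" by (rule fls_eqI) (simp add: nov_complex_nth)
  have "s_taylor x (s_d1 W_M) = fps_const (nov_complex (inverse TT)) * taylor_monom x 2 0
      + fps_const (nov_complex 1) * taylor_monom x 0 0"
    unfolding s_d1_W by (subst s_taylor_add)
      (simp_all only: s_taylor_z0 s_taylor_z1 laurent_polys.z0 laurent_polys.z1)
  then have "fps_to_fls (s_taylor x (s_d1 W_M))
      = fls_const (nov_complex (inverse TT) * TT ^ 2) * inverse (loc_z x) ^ 2 + 1"
    by (simp only: fps_to_fls_plus fls_times_fps_to_fls taylor_monom_loc[OF assms] fps_const_to_fls)
      (simp add: mult.assoc[symmetric] 2)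
  then show ?thesis unfolding 1 by (simp add: loc_dW_def)
qed

section \<open>Constant terms at the two ends\<close>

definition ct :: "cfls2 \<Rightarrow> complex fls" where "ct F = Abs_fls (\<lambda>N. F $$ N $$ 0)"

lemma ct_nth: "ct F $$ N = F $$ N $$ 0"
  unfolding ct_def by (rule nth_Abs_fls_lower_bound[of "fls_subdegree F"]) auto

lemma ct_add: "ct (F + G) = ct F + ct G"
  by (rule fls_eqI) (simp add: ct_nth)

lemma ct_emb: "ct (emb r * F) = nov_complex r * ct F"
proof (rule fls_eqI)
  fix N
  show "ct (emb r * F) $$ N = (nov_complex r * ct F) $$ N"
    by (simp add: ct_nth emb_mult_nth[of "fls_subdegree r" r "fls_subdegree F"]
      fls_times_nth_interval[of "fls_subdegree r" "nov_complex r" "fls_subdegree F" "ct F"] nov_complex_nth)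
qed

text \<open>The substitution \<open>X \<mapsto> q y\<close>; all the series that are inverted below are of this form.\<close>

definition diag :: "complex fls \<Rightarrow> cfls2" where
  "diag f = Abs_fls (\<lambda>N. fls_const (f $$ N) * fls_X_intpow N)"

lemma diag_nth': "diag f $$ N = fls_const (f $$ N) * fls_X_intpow N"
  unfolding diag_def by (rule nth_Abs_fls_lower_bound[of "fls_subdegree f"]) auto

lemma diag_nth: "diag f $$ N $$ n = (if n = N then f $$ N else 0)"
  unfolding diag_nth' fls_const_mult_nth by auto

lemma diag_mult: "diag (f * g) = diag f * diag g"
proof (rule fls_eqI)
  fix N
  let ?A = "fls_subdegree f" and ?B = "fls_subdegree g"
  have "(diag f * diag g) $$ N = (\<Sum>i\<in>{?A..N - ?B}. diag f $$ i * diag g $$ (N - i))"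
    by (rule fls_times_nth_interval) (auto simp: diag_nth')
  also have "\<dots> = (\<Sum>i\<in>{?A..N - ?B}. fls_const (f $$ i * g $$ (N - i)) * fls_X_intpow N)"
  proof (intro sum.cong refl)
    fix i
    have "fls_X_intpow N = (fls_X_intpow i * fls_X_intpow (N - i) :: complex fls)"
      by (simp only: fls_X_intpow_times_fls_X_intpow) simp
    then show "diag f $$ i * diag g $$ (N - i) = fls_const (f $$ i * g $$ (N - i)) * fls_X_intpow N"
      unfolding diag_nth' fls_const_mult_const[symmetric] by (simp only: mult_ac)
  qed
  also have "\<dots> = fls_const (\<Sum>i\<in>{?A..N - ?B}. f $$ i * g $$ (N - i)) * fls_X_intpow N"
  proof -
    have "(\<Sum>i\<in>I. fls_const (h i)) = fls_const (\<Sum>i\<in>I. h i)" for I and h :: "int \<Rightarrow> complex"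
      by (rule fls_eqI) (simp add: fls_sum_nth)
    then show ?thesis by (simp only: sum_distrib_right[symmetric])
  qed
  also have "(\<Sum>i\<in>{?A..N - ?B}. f $$ i * g $$ (N - i)) = (f * g) $$ N"
    by (rule fls_times_nth_interval[symmetric]) auto
  finally show "diag (f * g) $$ N = (diag f * diag g) $$ N" by (simp add: diag_nth')
qed

lemma diag_1 [simp]: "diag 1 = 1"
  by (rule fls_eqI, rule fls_eqI) (auto simp: diag_nth)

lemma diag_add: "diag (f + g) = diag f + diag g"
  by (rule fls_eqI, rule fls_eqI) (simp add: diag_nth)

lemma diag_power: "diag (f ^ n) = diag f ^ n"
  by (induction n) (auto simp: diag_mult)

lemma diag_X_power: "diag (fls_X ^ n) = qy (int n) (int n)"
  by (rule fls_eqI, rule fls_eqI) (auto simp: diag_nth qy_nth fls_X_power_nth)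

lemma qy_power: "qy N n ^ k = qy (int k * N) (int k * n)"
  by (induction k) (auto simp: qy_mult algebra_simps)

lemma emb_X_power: "emb (fls_X_intpow n) = qy n 0"
  by (rule fls_eqI, rule fls_eqI) (auto simp: emb_nth qy_nth)

lemma emb_1 [simp]: "emb 1 = 1"
  by (rule fls_eqI) (simp add: emb_nth)

lemma emb_inverse_TT: "emb (inverse TT) = qy (- 2) 0"
proof -
  have "TT = (fls_X_intpow 2 :: real fls)" by (rule fls_eqI) (simp add: fls_X_power_nth)
  then have "TT * fls_X_intpow (- 2) = (1 :: real fls)"
    by (simp only: fls_X_intpow_times_fls_X_intpow) simp
  then have "inverse TT = (fls_X_intpow (- 2) :: real fls)" by (rule inverse_unique)
  then show ?thesis by (simp only: emb_X_power)
qed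

lemma diag_inv_sq: "diag inv_sq * (1 + qy 2 2) = 1"
proof -
  have "diag inv_sq * (1 + qy 2 2) = diag (inv_sq * (1 + fls_X ^ 2))"
    using diag_X_power[of 2] by (simp add: diag_mult diag_add)
  also have "inv_sq * (1 + fls_X ^ 2) = 1" using inv_sq_eq by (simp add: distrib_left mult.commute)
  finally show ?thesis by simp
qed

text \<open>The derivative of W expands as 1 + (qy)^2 at one end and 1 + (qy)^(-2) at the other, so
  both inverses reduce to 1 / (1 + X^2) at X = qy.\<close>

lemma inverse_expand_dW:
  "inverse (expand d (s_d1 W_M)) = (if d then 1 else qy 2 2) * diag inv_sq"
proof (rule inverse_unique)
  have True: "expand True (s_d1 W_M) = 1 + qy 2 2"
    by (simp add: s_d1_W expand_add expand_mult expand_const expand_power expand_z0 emb_inverse_TT qy_mult qy_power)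
  have "expand False (s_d1 W_M) = 1 + qy (- 2) (- 2)"
    by (simp add: s_d1_W expand_add expand_mult expand_const expand_power expand_z0 emb_inverse_TT qy_mult qy_power)
  then have "expand False (s_d1 W_M) * qy 2 2 = 1 + qy 2 2"
    by (simp add: distrib_right qy_mult)
  then show "expand d (s_d1 W_M) * ((if d then 1 else qy 2 2) * diag inv_sq) = 1"
    using True diag_inv_sq by (cases d) (simp_all add: mult.commute[of _ "diag inv_sq"] mult.left_commute[of _ "diag inv_sq"])
qed

lemma ct_monom:
  "ct (qy M m * diag (inv_sq ^ l)) $$ N = (if N = M - m then (inv_sq ^ l) $$ (- m) else 0)"
  by (auto simp: ct_nth qy_mult_nth diag_nth)

text \<open>\<open>P d\<close> is the expansion of z1^m for m \<ge> 0 and of z0^(-m) for m < 0. The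
  two constant terms are the two terms of \<open>res_coeff\<close>.\<close>

lemma ct_difference_monom:
  fixes m :: int
  defines "P \<equiv> \<lambda>d. if d then qy (if m < 0 then - 2 * m else 0) (- m) else qy (if m < 0 then 0 else 2 * m) m"
  shows "ct (P True * inverse (expand True (s_d1 W_M)) ^ l) - ct (P False * inverse (expand False (s_d1 W_M)) ^ l)
     = fls_const (res_coeff l m) * fls_X_intpow \<bar>m\<bar>"
proof (rule fls_eqI)
  fix N
  have "P True * inverse (expand True (s_d1 W_M)) ^ l = qy (if m < 0 then - 2 * m else 0) (- m) * diag (inv_sq ^ l)"
    by (simp add: P_def inverse_expand_dW diag_power)
  moreover have "P False * inverse (expand False (s_d1 W_M)) ^ l
      = qy ((if m < 0 then 0 else 2 * m) + 2 * int l) (m + 2 * int l) * diag (inv_sq ^ l)"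
    by (simp add: P_def inverse_expand_dW diag_power power_mult_distrib qy_power qy_mult
        mult.assoc[symmetric] mult.commute[of 2])
  ultimately show "(ct (P True * inverse (expand True (s_d1 W_M)) ^ l)
       - ct (P False * inverse (expand False (s_d1 W_M)) ^ l)) $$ N
     = (fls_const (res_coeff l m) * fls_X_intpow \<bar>m\<bar>) $$ N"
    by (simp add: ct_monom fls_const_mult_nth res_coeff_def) 
qed

text \<open>The residue theorem on the annulus: between the ends the integrand has poles only at the
  zeros of the derivative of W. On monomials both sides are given by
  \<open>res_coeff\<close>.\<close>

theorem sum_res_at:
  assumes "f \<in> laurent_polys"
  shows "(\<Sum>x\<in>crit_points. res_at x f (Suc l))
     = ct (expand True f * inverse (expand True (s_d1 W_M)) ^ Suc l)
       - ct (expand False f * inverse (expand False (s_d1 W_M)) ^ Suc l)"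
  using assms
proof induction
  case (z0 r n)
  have e: "expand d (s_const r * z0 ^ n) = emb r * (if d then qy (2 * int n) (int n) else qy 0 (- int n))" for d
    by (simp add: expand_mult expand_const expand_power expand_z0 qy_power mult.commute)
  have "res_at x (s_const r * z0 ^ n) (Suc l) = nov_complex r * TT ^ n *
      fls_residue (loc_z x powi (- int n) / loc_dW x ^ Suc l * (1 / loc_z x))" if "x \<in> crit_points" for x
  proof -
    have x: "x \<noteq> 0" using crit_points that by blast
    have "fps_to_fls (s_taylor x (s_const r * z0 ^ n)) / loc_dW x ^ Suc l * (1 / loc_z x)
      = fls_const (nov_complex r * TT ^ n) * (loc_z x powi (- int n) / loc_dW x ^ Suc l * (1 / loc_z x))"
      unfolding s_taylor_z0 fls_times_fps_to_fls taylor_monom_loc[OF x] fps_const_to_fls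
      by (simp add: power_int_minus power_inverse mult_ac divide_inverse del: power_Suc flip: fls_const_mult_const)
    then show ?thesis unfolding res_at_def taylor_dW[OF x] loc_z_def[symmetric]
      by (simp only: fls_residue_def fls_const_mult_nth)
  qed
  then have "(\<Sum>x\<in>crit_points. res_at x (s_const r * z0 ^ n) (Suc l))
     = nov_complex r * (TT ^ n * (fls_const (res_coeff (Suc l) (- int n)) * fls_X powi (- int n)))"
    unfolding sum_residues[symmetric] sum_distrib_left by (intro sum.cong refl) (simp only: mult.assoc)
  also have "TT ^ n * (fls_const (res_coeff (Suc l) (- int n)) * fls_X powi (- int n))
     = fls_const (res_coeff (Suc l) (- int n)) * fls_X_intpow \<bar>- int n\<bar>"
  proof -
    have "TT ^ n * fls_X_intpow (- int n) = (fls_X_intpow (int n) :: complex fls)"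
    proof -
      have "TT ^ n = (fls_X_intpow (2 * int n) :: complex fls)"
        unfolding power_mult[symmetric] by (rule fls_eqI) (simp add: fls_X_power_nth)
      then show ?thesis by (simp only: fls_X_intpow_times_fls_X_intpow) simp
    qed
    then show ?thesis by (simp add: mult.left_commute)
  qed
  finally show ?case unfolding e ct_difference_monom[where l = "Suc l" and m = "- int n", symmetric]
    by (cases n) (simp_all add: mult.assoc ct_emb right_diff_distrib del: power_Suc of_nat_Suc)
next
  case (z1 r n)
  have e: "expand d (s_const r * z1 ^ n) = emb r * (if d then qy 0 (- int n) else qy (2 * int n) (int n))" for d
    by (simp add: expand_mult expand_const expand_power expand_z1 qy_power mult.commute)
  have "res_at x (s_const r * z1 ^ n) (Suc l) = nov_complex r *
      fls_residue (loc_z x powi (int n) / loc_dW x ^ Suc l * (1 / loc_z x))" if "x \<in> crit_points" for x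
  proof -
    have x: "x \<noteq> 0" using crit_points that by blast
    have "fps_to_fls (s_taylor x (s_const r * z1 ^ n)) / loc_dW x ^ Suc l * (1 / loc_z x)
      = fls_const (nov_complex r) * (loc_z x powi (int n) / loc_dW x ^ Suc l * (1 / loc_z x))"
      unfolding s_taylor_z1 fls_times_fps_to_fls taylor_monom_loc[OF x] fps_const_to_fls
      by (simp add: mult_ac divide_inverse del: power_Suc)
    then show ?thesis unfolding res_at_def taylor_dW[OF x] loc_z_def[symmetric]
      by (simp only: fls_residue_def fls_const_mult_nth)
  qed
  then have "(\<Sum>x\<in>crit_points. res_at x (s_const r * z1 ^ n) (Suc l))
     = nov_complex r * (fls_const (res_coeff (Suc l) (int n)) * fls_X powi (int n))"
    unfolding sum_residues[symmetric] sum_distrib_left by (intro sum.cong refl) (simp only: mult.assoc)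
  also have "fls_X powi (int n) = (fls_X_intpow \<bar>int n\<bar> :: complex fls)" by (simp only: fls_X_power_int abs_of_nat)
  finally show ?case unfolding e ct_difference_monom[where l = "Suc l" and m = "int n", symmetric]
    by (simp add: mult.assoc ct_emb right_diff_distrib del: power_Suc)
next
  case (add f g)
  have "res_at x (f + g) (Suc l) = res_at x f (Suc l) + res_at x g (Suc l)" for x
    unfolding res_at_def s_taylor_add[OF add.hyps] fps_to_fls_plus add_divide_distrib distrib_right
    by (rule fls_residue_add)
  then show ?case
    by (simp add: sum.distrib add.IH expand_add distrib_right ct_add del: power_Suc)
qed

section \<open>Gradings\<close>

lemma nov_hom_0 [simp]: "nov_hom j 0"
  by (simp add: nov_hom_def)

lemma nov_hom_add: "nov_hom j r \<Longrightarrow> nov_hom j r' \<Longrightarrow> nov_hom j (r + r')"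
  unfolding nov_hom_def by (metis add.right_neutral fls_plus_nth)

lemma nov_hom_sum: "(\<And>i. i \<in> I \<Longrightarrow> nov_hom j (f i)) \<Longrightarrow> nov_hom j (\<Sum>i\<in>I. f i)"
  by (induction I rule: infinite_finite_induct) (auto intro: nov_hom_add)

lemma nov_hom_mult: "nov_hom i r \<Longrightarrow> nov_hom j r' \<Longrightarrow> nov_hom (i + j) (r * r')"
  unfolding nov_hom_def using fls_mult_nth_nonzeroD[of r r'] by force

lemma s_hom_add: "s_hom j f \<Longrightarrow> s_hom j g \<Longrightarrow> s_hom j (f + g)"
proof -
  assume "s_hom j f" "s_hom j g"
  then obtain F G where "abs_sring F = f" "tate_hom j F" "abs_sring G = g" "tate_hom j G"
    by (auto simp: s_hom_def)
  then have "abs_sring (F + G) = f + g" "tate_hom j (F + G)"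
    by (auto simp: tate_hom_def s_abs_simps nov_hom_add)
  then show ?thesis by (auto simp: s_hom_def)
qed

lemma s_hom_uminus: "s_hom j f \<Longrightarrow> s_hom j (- f)"
proof -
  assume "s_hom j f"
  then obtain F where "abs_sring F = f" "tate_hom j F" by (auto simp: s_hom_def)
  then have "abs_sring (- F) = - f" "tate_hom j (- F)"
    by (auto simp: tate_hom_def nov_hom_def uminus_sring.abs_eq)
  then show ?thesis by (auto simp: s_hom_def)
qed

lemma s_hom_diff: "s_hom j f \<Longrightarrow> s_hom j g \<Longrightarrow> s_hom j (f - g)"
  using s_hom_add[of j f "- g"] s_hom_uminus[of j g] by simp

lemma s_hom_0 [simp]: "s_hom j 0"
  unfolding s_hom_def by (rule exI[of _ 0]) (simp add: tate_hom_def s_abs_simps)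

lemma s_hom_mult: "s_hom i f \<Longrightarrow> s_hom j g \<Longrightarrow> s_hom (i + j) (f * g)"
proof -
  assume "s_hom i f" "s_hom j g"
  then obtain F G where F: "abs_sring F = f" "tate_hom i F" and G: "abs_sring G = g" "tate_hom j G"
    by (auto simp: s_hom_def)
  have "tate_hom (i + j) (F * G)"
    unfolding tate_hom_def
  proof (intro allI)
    fix a b
    show "nov_hom (i + j - 2 * int a - 2 * int b) (tate_coeff (F * G) a b)"
      unfolding tate_coeff_mult
    proof (intro nov_hom_sum)
      fix p q assume pq: "p \<in> {0..a}" "q \<in> {0..b}"
      have "nov_hom ((i - 2 * int p - 2 * int q) + (j - 2 * int (a - p) - 2 * int (b - q)))
          (tate_coeff F p q * tate_coeff G (a - p) (b - q))"
        using F(2) G(2) by (intro nov_hom_mult) (auto simp: tate_hom_def)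
      moreover have "(i - 2 * int p - 2 * int q) + (j - 2 * int (a - p) - 2 * int (b - q))
          = i + j - 2 * int a - 2 * int b" using pq by (simp add: of_nat_diff)
      ultimately show "nov_hom (i + j - 2 * int a - 2 * int b) (tate_coeff F p q * tate_coeff G (a - p) (b - q))"
        by (simp only:)
    qed
  qed
  then show ?thesis using F(1) G(1) unfolding s_hom_def by (metis s_abs_simps(2))
qed

lemma s_hom_monom: "nov_hom (j - 2 * int a - 2 * int b) r \<Longrightarrow> s_hom j (s_const r * (z0 ^ a * z1 ^ b))"
  unfolding s_hom_def
  by (rule exI[of _ "tate_const r * (tate_z0 ^ a * tate_z1 ^ b)"])
    (auto simp: s_abs_simps s_abs_power tate_hom_def tate_coeff_monom simp del: tate_coeff_simps)

lemma s_hom_const: "nov_hom j r \<Longrightarrow> s_hom j (s_const r)"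
  using s_hom_monom[of j 0 0 r] by simp

lemma s_hom_z: "s_hom 2 z0" "s_hom 2 z1" "s_hom 0 1"
  using s_hom_monom[of 2 1 0 1] s_hom_monom[of 2 0 1 1] s_hom_monom[of 0 0 0 1]
  by (simp_all add: s_const_hom nov_hom_def)

lemma inverse_Thalf: "(inverse Thalf :: real fls) = fls_X_intpow (- 1)"
  using fls_X_power_int[of "- 1"] by (simp add: power_int_minus del: fls_X_power_int)

lemma s_hom_Thalf: "s_hom 2 (s_const Thalf)" "s_hom (- 2) (s_const (inverse Thalf))"
  by (intro s_hom_const; simp add: nov_hom_def inverse_Thalf)+

lemma s_hom_odd:
  assumes "s_hom j f" "odd j"
  shows "f = 0"
proof -
  obtain F where F: "abs_sring F = f" "tate_hom j F" using assms by (auto simp: s_hom_def)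
  have "tate_coeff F a b = 0" for a b
  proof (rule fls_eqI, rule ccontr)
    fix m assume "tate_coeff F a b $$ m \<noteq> 0 $$ m"
    then have "2 * m = j - 2 * int a - 2 * int b" using F(2) by (auto simp: tate_hom_def nov_hom_def)
    then have "j = 2 * (m + int a + int b)" by simp
    then show False using assms(2) by simp
  qed
  then have "F = 0" by (intro tate_eqI) simp
  then show ?thesis using F(1) s_abs_simps(4) by simp
qed

section \<open>Coordinates of the module and matrix entries\<close>

lemma abs_mmod_coords: "abs_mmod (Cl (m_coord_1 m) 0 (m_coord_e1 m) 0) = m"
proof -
  let ?x = "Cl (m_coord_1 m) 0 (m_coord_e1 m) 0"
  obtain y where y: "m = abs_mmod y" by (metis Quotient3_abs_rep Quotient3_mmod)
  have "cl_eq ?x y" unfolding cl_eq_iff y by (simp add: m_coord_1.abs_eq m_coord_e1.abs_eq)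
  then show ?thesis unfolding y mmod.abs_eq_iff .
qed

text \<open>The relations are homogeneous: T^(1/2), replacing e0 e1, has degree 2, and T^(-1/2) z0,
  relating e0 to e1, has degree 0. Passing to coordinates therefore preserves degrees.\<close>

lemma m_hom_iff: "m_hom i m \<longleftrightarrow> s_hom i (m_coord_1 m) \<and> s_hom (i - 1) (m_coord_e1 m)"
proof
  assume "m_hom i m"
  then obtain x where x: "abs_mmod x = m" "cl_hom i x" by (auto simp: m_hom_def)
  have "s_hom (2 + (i - 2)) (s_const Thalf * cl_e01 x)"
    using x(2) s_hom_Thalf(1) by (intro s_hom_mult) (simp_all add: cl_hom_def)
  moreover have "s_hom (- 2 + 2 + (i - 1)) (s_const (inverse Thalf) * z0 * cl_e0 x)"
    using x(2) s_hom_Thalf(2) s_hom_z(1) by (intro s_hom_mult) (simp_all add: cl_hom_def)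
  ultimately show "s_hom i (m_coord_1 m) \<and> s_hom (i - 1) (m_coord_e1 m)"
    using x(2) unfolding x(1)[symmetric] m_coord_1.abs_eq m_coord_e1.abs_eq cl_hom_def
    by (auto intro: s_hom_add s_hom_diff)
next
  assume h: "s_hom i (m_coord_1 m) \<and> s_hom (i - 1) (m_coord_e1 m)"
  let ?x = "Cl (m_coord_1 m) 0 (m_coord_e1 m) 0"
  have "abs_mmod ?x = m" by (rule abs_mmod_coords)
  then show "m_hom i m" using h unfolding m_hom_def cl_hom_def
    by (intro exI[of _ ?x]) simp
qed


lemma m_coord_basis [simp]:
  "m_coord_1 m_1 = 1" "m_coord_e1 m_1 = 0" "m_coord_1 m_e1 = 0" "m_coord_e1 m_e1 = 1"
  by (simp_all add: m_1.abs_eq m_e1.abs_eq m_coord_1.abs_eq m_coord_e1.abs_eq e1_def)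

lemma m_coord_0 [simp]: "m_coord_1 0 = 0" "m_coord_e1 0 = 0"
  using m_coord_simps(1)[of 0 0] m_coord_simps(2)[of 0 0] by simp_all

lemma endo_app_coords:
  "m_coord_1 (endo_app \<phi> m) = m_coord_1 m * m_coord_1 (endo_app \<phi> m_1) + m_coord_e1 m * m_coord_1 (endo_app \<phi> m_e1)"
  "m_coord_e1 (endo_app \<phi> m) = m_coord_1 m * m_coord_e1 (endo_app \<phi> m_1) + m_coord_e1 m * m_coord_e1 (endo_app \<phi> m_e1)"
proof -
  have "m = m_scale (m_coord_1 m) m_1 + m_scale (m_coord_e1 m) m_e1" using m_basis by blast
  then have "endo_app \<phi> m = m_scale (m_coord_1 m) (endo_app \<phi> m_1) + m_scale (m_coord_e1 m) (endo_app \<phi> m_e1)"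
    by (metis endo_app_add endo_app_scale)
  then show "m_coord_1 (endo_app \<phi> m) = m_coord_1 m * m_coord_1 (endo_app \<phi> m_1) + m_coord_e1 m * m_coord_1 (endo_app \<phi> m_e1)"
  "m_coord_e1 (endo_app \<phi> m) = m_coord_1 m * m_coord_e1 (endo_app \<phi> m_1) + m_coord_e1 m * m_coord_e1 (endo_app \<phi> m_e1)"
    by (simp_all add: m_coord_simps)
qed

definition en11 where "en11 \<phi> = m_coord_1 (endo_app \<phi> m_1)"
definition en12 where "en12 \<phi> = m_coord_1 (endo_app \<phi> m_e1)"
definition en21 where "en21 \<phi> = m_coord_e1 (endo_app \<phi> m_1)"
definition en22 where "en22 \<phi> = m_coord_e1 (endo_app \<phi> m_e1)"

lemmas en_defs = en11_def en12_def en21_def en22_def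

lemma endo_mat_en: "endo_mat \<phi> = ((en11 \<phi>, en12 \<phi>), (en21 \<phi>, en22 \<phi>))"
  by (simp add: endo_mat_def en_defs)

lemma en_mult:
  "en11 (\<phi> * \<psi>) = en11 \<phi> * en11 \<psi> + en12 \<phi> * en21 \<psi>"
  "en12 (\<phi> * \<psi>) = en11 \<phi> * en12 \<psi> + en12 \<phi> * en22 \<psi>"
  "en21 (\<phi> * \<psi>) = en21 \<phi> * en11 \<psi> + en22 \<phi> * en21 \<psi>"
  "en22 (\<phi> * \<psi>) = en21 \<phi> * en12 \<psi> + en22 \<phi> * en22 \<psi>"
  by (simp_all add: en_defs times_endo.rep_eq endo_app_coords[of \<phi> "endo_app \<psi> _"] mult.commute)

lemma en_add:
  "en11 (\<phi> + \<psi>) = en11 \<phi> + en11 \<psi>" "en12 (\<phi> + \<psi>) = en12 \<phi> + en12 \<psi>"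
  "en21 (\<phi> + \<psi>) = en21 \<phi> + en21 \<psi>" "en22 (\<phi> + \<psi>) = en22 \<phi> + en22 \<psi>"
  by (simp_all add: en_defs plus_endo.rep_eq m_coord_simps)

lemma en_1 [simp]: "en11 1 = 1" "en12 1 = 0" "en21 1 = 0" "en22 1 = 1"
  by (simp_all add: en_defs one_endo.rep_eq)

lemma en_0 [simp]: "en11 0 = 0" "en12 0 = 0" "en21 0 = 0" "en22 0 = 0"
  by (simp_all add: en_defs zero_endo.rep_eq)

lemma en_scalar [simp]:
  "en11 (endo_scalar f) = f" "en12 (endo_scalar f) = 0" "en21 (endo_scalar f) = 0" "en22 (endo_scalar f) = f"
  by (simp_all add: en_defs endo_scalar.rep_eq m_coord_simps)

lemma en_mat_endo [simp]:
  "en11 (mat_endo ((a, b), (c, d))) = a" "en12 (mat_endo ((a, b), (c, d))) = b"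
  "en21 (mat_endo ((a, b), (c, d))) = c" "en22 (mat_endo ((a, b), (c, d))) = d"
  by (simp_all add: en_defs mat_endo.rep_eq m_coord_simps)

lemma en_eqI: "en11 \<phi> = en11 \<psi> \<Longrightarrow> en12 \<phi> = en12 \<psi> \<Longrightarrow> en21 \<phi> = en21 \<psi> \<Longrightarrow> en22 \<phi> = en22 \<psi> \<Longrightarrow> \<phi> = \<psi>"
  by (metis endo_mat_en mat_endo_endo_mat)

lemma en_D:
  "en11 D_M = 0" "en12 D_M = s_const Thalf + z1" "en21 D_M = 1 - s_const (inverse Thalf) * z0" "en22 D_M = 0"
  using endo_mat_D unfolding endo_mat_en by simp_all

lemma en_d1D:
  "en11 d1D = 0" "en12 d1D = 1" "en21 d1D = s_const (inverse Thalf * inverse TT) * z0 ^ 2" "en22 d1D = 0"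
proof -
  have "s_d1 (s_const r * f) = s_const r * s_d1 f" for r f by (simp add: s_d1_mult s_d1_const)
  moreover have "s_d1 (f - g) = s_d1 f - s_d1 g" for f g
    using s_d1_add[of f "- g"] by (simp add: s_d1_uminus)
  moreover have "s_d1 0 = 0" using s_d1_const[of 0] by (simp add: s_const_hom)
  ultimately show "en11 d1D = 0" "en12 d1D = 1" "en21 d1D = s_const (inverse Thalf * inverse TT) * z0 ^ 2" "en22 d1D = 0"
    unfolding d1D_def endo_mat_D
    by (simp_all only: prod.case en_mat_endo s_d1_add s_d1_const s_d1_z1 s_d1_1 s_d1_z0)
      (simp_all add: s_const_hom mult.assoc)
qed

lemma endo_hom_iff:
  "endo_hom j \<phi> \<longleftrightarrow> s_hom j (en11 \<phi>) \<and> s_hom (j + 1) (en12 \<phi>) \<and> s_hom (j - 1) (en21 \<phi>) \<and> s_hom j (en22 \<phi>)"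
proof
  assume h: "endo_hom j \<phi>"
  have "m_hom 0 m_1" "m_hom 1 m_e1" by (simp_all add: m_hom_iff s_hom_z)
  then have "m_hom (0 + j) (endo_app \<phi> m_1)" "m_hom (1 + j) (endo_app \<phi> m_e1)"
    using h unfolding endo_hom_def by blast+
  then show "s_hom j (en11 \<phi>) \<and> s_hom (j + 1) (en12 \<phi>) \<and> s_hom (j - 1) (en21 \<phi>) \<and> s_hom j (en22 \<phi>)"
    by (simp add: m_hom_iff en_defs add.commute)
next
  assume h: "s_hom j (en11 \<phi>) \<and> s_hom (j + 1) (en12 \<phi>) \<and> s_hom (j - 1) (en21 \<phi>) \<and> s_hom j (en22 \<phi>)"
  show "endo_hom j \<phi>"
    unfolding endo_hom_def
  proof (intro allI impI)
    fix i m assume m: "m_hom i m"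
    let ?x = "m_coord_1 m" and ?y = "m_coord_e1 m"
    have h': "s_hom (i + j) (?x * en11 \<phi>)" "s_hom ((i - 1) + (j + 1)) (?y * en12 \<phi>)"
      "s_hom (i + (j - 1)) (?x * en21 \<phi>)" "s_hom ((i - 1) + j) (?y * en22 \<phi>)"
      using m h s_hom_mult[of i ?x j "en11 \<phi>"] s_hom_mult[of "i - 1" ?y "j + 1" "en12 \<phi>"]
        s_hom_mult[of i ?x "j - 1" "en21 \<phi>"] s_hom_mult[of "i - 1" ?y j "en22 \<phi>"]
      unfolding m_hom_iff by blast+
    have e: "(i - 1) + (j + 1) = i + j" "i + (j - 1) = i + j - 1" "(i - 1) + j = i + j - 1" by simp_all
    show "m_hom (i + j) (endo_app \<phi> m)"
      unfolding m_hom_iff endo_app_coords[of \<phi> m] en_defs[symmetric]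
      by (intro conjI s_hom_add h'[unfolded e])
  qed
qed

lemma endo_hom_laurent:
  assumes "endo_hom j \<phi>"
  shows "en11 \<phi> \<in> laurent_polys" "en12 \<phi> \<in> laurent_polys" "en21 \<phi> \<in> laurent_polys" "en22 \<phi> \<in> laurent_polys"
proof -
  have "s_hom j (en11 \<phi>)" "s_hom (j + 1) (en12 \<phi>)" "s_hom (j - 1) (en21 \<phi>)" "s_hom j (en22 \<phi>)"
    using assms unfolding endo_hom_iff by simp_all
  then show "en11 \<phi> \<in> laurent_polys" "en12 \<phi> \<in> laurent_polys" "en21 \<phi> \<in> laurent_polys" "en22 \<phi> \<in> laurent_polys"
    using s_hom_laurent[of j "en11 \<phi>"] s_hom_laurent[of "j + 1" "en12 \<phi>"]
      s_hom_laurent[of "j - 1" "en21 \<phi>"] s_hom_laurent[of j "en22 \<phi>"] by blast+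
qed

text \<open>\<open>S\<close> is evenly graded, so even endomorphisms are diagonal and odd ones
  off-diagonal.\<close>

lemma endo_hom_parity:
  assumes "endo_hom j \<phi>"
  shows "even j \<Longrightarrow> en12 \<phi> = 0 \<and> en21 \<phi> = 0" "odd j \<Longrightarrow> en11 \<phi> = 0 \<and> en22 \<phi> = 0"
  using assms s_hom_odd[of "j + 1" "en12 \<phi>"] s_hom_odd[of "j - 1" "en21 \<phi>"]
    s_hom_odd[of j "en11 \<phi>"] s_hom_odd[of j "en22 \<phi>"]
  unfolding endo_hom_iff by auto

section \<open>Valuations\<close>

lemma nov_val_ge_iff: "ereal B \<le> nov_val f \<longleftrightarrow> (\<forall>m. f $$ m \<noteq> 0 \<longrightarrow> B \<le> of_int m / 2)"
  by (auto simp: nov_val_def le_INF_iff)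

lemma s_val_ge_coeff:
  "ereal B \<le> s_val \<zeta> f \<longleftrightarrow>
     (\<forall>a b m. s_coeff f a b $$ m \<noteq> 0 \<longrightarrow> B \<le> of_int m / 2 + of_nat a * fst \<zeta> + of_nat b * snd \<zeta>)"
proof -
  have "ereal B \<le> nov_val r + ereal C \<longleftrightarrow> ereal (B - C) \<le> nov_val r" for C and r :: "real fls"
    by (cases "nov_val r") auto
  then have e: "ereal B \<le> nov_val r + ereal C \<longleftrightarrow> (\<forall>m. r $$ m \<noteq> 0 \<longrightarrow> B \<le> of_int m / 2 + C)"
    for C and r :: "real fls"
    unfolding nov_val_ge_iff by (simp only: diff_le_eq)
  show ?thesis unfolding s_val_def le_INF_iff
    by (simp only: Ball_def UNIV_I simp_thms split_paired_All prod.case e add.assoc)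
qed

text \<open>The variable that is large at end \<open>d\<close> becomes 1 / y, which gives y minus
  its weight. The other variable q^2 y then has the right weight because the two components of zeta
  add up to 1.\<close>

lemma s_val_ge_iff:
  assumes "\<zeta> \<in> simplex"
  shows "ereal B \<le> s_val \<zeta> f \<longleftrightarrow>
     (\<forall>N n. expand d f $$ N $$ n \<noteq> 0 \<longrightarrow> B \<le> of_int N / 2 - of_int n * (if d then snd \<zeta> else fst \<zeta>))"
    (is "?L \<longleftrightarrow> ?R")
proof -
  obtain x y where zx: "fst \<zeta> = x" and zy: "snd \<zeta> = y" and z2: "x + y = 1"
    using assms by (auto simp: simplex_def)
  note zxy = zx zy
  show ?thesis
  proof
    assume L: ?L
    show ?R
    proof (intro allI impI)
      fix N n assume nz: "expand d f $$ N $$ n \<noteq> 0"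
      define k where "k = nat \<bar>n\<bar>"
      from nz have "(if d = (n \<ge> 0) then s_coeff f k 0 else s_coeff f 0 k) $$ (if n \<ge> 0 then N - 2 * n else N) \<noteq> 0"
        unfolding expand_nth k_def Let_def by simp
      then have "B \<le> of_int (if n \<ge> 0 then N - 2 * n else N) / 2 + of_nat k * (if d = (n \<ge> 0) then x else y)"
        using L[unfolded s_val_ge_coeff zxy, rule_format, of k 0 "if n \<ge> 0 then N - 2 * n else N"]
          L[unfolded s_val_ge_coeff zxy, rule_format, of 0 k "if n \<ge> 0 then N - 2 * n else N"]
        by (cases "d = (n \<ge> 0)") simp_all
      moreover have "real k = of_int \<bar>n\<bar>" by (simp add: k_def)
      moreover have "of_int n * x + of_int n * y = (of_int n :: real)"
        using z2 by (simp flip: distrib_left)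
      ultimately show "B \<le> of_int N / 2 - of_int n * (if d then snd \<zeta> else fst \<zeta>)"
        unfolding zxy by (cases d; cases "n \<ge> 0"; simp add: diff_divide_distrib; linarith)
    qed
  next
    assume R: ?R
    show ?L
      unfolding s_val_ge_coeff
    proof (intro allI impI)
      fix a b m assume nz: "s_coeff f a b $$ m \<noteq> 0"
      then have ab: "a = 0 \<or> b = 0" by (metis fls_zero_nth not_gr_zero s_coeff_reduced)
      define n where "n = (if d then int a - int b else int b - int a)"
      define N where "N = (if n \<ge> 0 then m + 2 * n else m)"
      have "expand d f $$ N $$ n = complex_of_real (s_coeff f a b $$ m)"
        unfolding expand_nth Let_def using ab by (cases d) (auto simp: n_def N_def)
      then have "B \<le> of_int N / 2 - of_int n * (if d then y else x)"
        using R[unfolded zxy, rule_format, of N n] nz by simp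
      moreover have "of_nat a * x + of_nat a * y = (of_nat a :: real)" "of_nat b * x + of_nat b * y = (of_nat b :: real)"
        using z2 by (simp_all flip: distrib_left)
      ultimately show "B \<le> of_int m / 2 + of_nat a * fst \<zeta> + of_nat b * snd \<zeta>"
        unfolding zxy N_def n_def using ab
        by (cases d; elim disjE; simp add: add_divide_distrib split: if_splits; linarith)
    qed
  qed
qed

lemma s_val_add_ge: "ereal B \<le> s_val \<zeta> f \<Longrightarrow> ereal B \<le> s_val \<zeta> g \<Longrightarrow> ereal B \<le> s_val \<zeta> (f + g)"
  unfolding s_val_ge_coeff s_coeff_add by (metis add.right_neutral fls_plus_nth)

lemma s_val_uminus_ge:
  assumes "\<zeta> \<in> simplex" "ereal B \<le> s_val \<zeta> f"
  shows "ereal B \<le> s_val \<zeta> (- f)"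
  using assms(2) unfolding s_val_ge_iff[OF assms(1), of _ _ True] by (simp add: expand_uminus)

text \<open>Products mix the reduced monomials, but in the expansion they are convolutions, on which
  the weight of q^N y^n is additive.\<close>

lemma s_val_mult_ge:
  assumes "\<zeta> \<in> simplex" "ereal B \<le> s_val \<zeta> f" "ereal C \<le> s_val \<zeta> g"
  shows "ereal (B + C) \<le> s_val \<zeta> (f * g)"
  unfolding s_val_ge_iff[OF assms(1), of _ _ True] expand_mult
proof (intro allI impI)
  fix N n assume nz: "(expand True f * expand True g) $$ N $$ n \<noteq> 0"
  have "(expand True f * expand True g) $$ N
     = (\<Sum>i=fls_subdegree (expand True f)..N - fls_subdegree (expand True g). expand True f $$ i * expand True g $$ (N - i))"
    by (rule fls_times_nth(2))
  with nz have "(\<Sum>i=fls_subdegree (expand True f)..N - fls_subdegree (expand True g).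
      (expand True f $$ i * expand True g $$ (N - i)) $$ n) \<noteq> 0" by (simp add: fls_sum_nth)
  then obtain i where "(expand True f $$ i * expand True g $$ (N - i)) $$ n \<noteq> 0" by (meson sum.neutral)
  then obtain k where "expand True f $$ i $$ k \<noteq> 0" "expand True g $$ (N - i) $$ (n - k) \<noteq> 0"
    using fls_mult_nth_nonzeroD by blast
  then have "B \<le> of_int i / 2 - of_int k * snd \<zeta>" "C \<le> of_int (N - i) / 2 - of_int (n - k) * snd \<zeta>"
    using assms(2)[unfolded s_val_ge_iff[OF assms(1), of _ _ True], rule_format, of i k]
      assms(3)[unfolded s_val_ge_iff[OF assms(1), of _ _ True], rule_format, of "N - i" "n - k"] by simp_all
  then show "B + C \<le> of_int N / 2 - of_int n * (if True then snd \<zeta> else fst \<zeta>)"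
    by (simp add: field_simps)
qed

lemma s_val_const_ge: "ereal B \<le> nov_val r \<Longrightarrow> ereal B \<le> s_val \<zeta> (s_const r)"
  using s_coeff_z0_power[of r 0] unfolding s_val_ge_coeff nov_val_ge_iff by auto

lemma s_val_z0_ge: "ereal (fst \<zeta>) \<le> s_val \<zeta> z0"
  using s_coeff_z0_power[of 1 1] unfolding s_val_ge_coeff by (auto simp: s_const_hom split: if_splits)

lemma s_val_Thalf: "ereal (1 / 2) \<le> s_val \<zeta> (s_const Thalf)" "ereal (- 1 / 2) \<le> s_val \<zeta> (s_const (inverse Thalf))"
proof -
  show "ereal (- 1 / 2) \<le> s_val \<zeta> (s_const (inverse Thalf))"
    unfolding inverse_Thalf by (intro s_val_const_ge) (auto simp: nov_val_ge_iff)
  show "ereal (1 / 2) \<le> s_val \<zeta> (s_const Thalf)"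
    by (intro s_val_const_ge) (auto simp: nov_val_ge_iff)
qed

lemma s_val_0 [simp]: "s_val \<zeta> 0 = \<infinity>"
proof -
  have "s_coeff 0 a b = 0" for a b
    using s_coeff_abs[of 0] by (simp add: tate_reduced_def zero_sring.abs_eq[symmetric])
  then show ?thesis by (simp add: s_val_def)
qed

text \<open>Reducing to the basis 1, e1 costs no valuation: T^(1/2) has the valuation (zeta0 +
  zeta1) / 2 of e0 e1, and T^(-1/2) z0 e1 has the valuation zeta0 / 2 of e0.\<close>

lemma m_val_ge_iff:
  assumes "\<zeta> \<in> simplex"
  shows "ereal B \<le> m_val \<zeta> m \<longleftrightarrow>
     ereal B \<le> s_val \<zeta> (m_coord_1 m) \<and> ereal (B - snd \<zeta> / 2) \<le> s_val \<zeta> (m_coord_e1 m)"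
proof -
  obtain x y where zx: "fst \<zeta> = x" and zy: "snd \<zeta> = y" and z2: "x + y = 1"
    using assms by (auto simp: simplex_def)
  note zxy = zx zy
  have sh: "ereal C \<le> s_val \<zeta> f + ereal e \<longleftrightarrow> ereal (C - e) \<le> s_val \<zeta> f" for C e f
    by (cases "s_val \<zeta> f") auto
  have le: "ereal C \<le> s_val \<zeta> (m_coord_1 m) \<and> ereal (C - y / 2) \<le> s_val \<zeta> (m_coord_e1 m)"
    if a: "abs_mmod a = m" and C: "ereal C \<le> cl_val \<zeta> a" for a C
  proof -
    have c: "ereal C \<le> s_val \<zeta> (cl_1 a)" "ereal (C - x / 2) \<le> s_val \<zeta> (cl_e0 a)"
      "ereal (C - y / 2) \<le> s_val \<zeta> (cl_e1 a)" "ereal (C - (x / 2 + y / 2)) \<le> s_val \<zeta> (cl_e01 a)"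
      using C by (simp_all add: cl_val_def sh zxy)
    have "ereal (1 / 2 + (C - (x / 2 + y / 2))) \<le> s_val \<zeta> (s_const Thalf * cl_e01 a)"
      by (intro s_val_mult_ge assms s_val_Thalf c)
    moreover have "1 / 2 + (C - (x / 2 + y / 2)) = C" using z2 by (simp add: field_simps)
    ultimately have 1: "ereal C \<le> s_val \<zeta> (m_coord_1 m)"
      unfolding a[symmetric] m_coord_1.abs_eq using c(1) by (intro s_val_add_ge) simp_all
    have "ereal (- 1 / 2 + x + (C - x / 2)) \<le> s_val \<zeta> (s_const (inverse Thalf) * z0 * cl_e0 a)"
      using s_val_z0_ge[of \<zeta>] by (intro s_val_mult_ge assms s_val_Thalf c) (simp add: zxy)
    moreover have "- 1 / 2 + x + (C - x / 2) = C - y / 2" using z2 by (simp add: field_simps)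
    ultimately have "ereal (C - y / 2) \<le> s_val \<zeta> (s_const (inverse Thalf) * z0 * cl_e0 a)"
      by (simp only:)
    then have "ereal (C - y / 2) \<le> s_val \<zeta> (- (s_const (inverse Thalf) * z0 * cl_e0 a))"
      by (rule s_val_uminus_ge[OF assms])
    then have "ereal (C - y / 2) \<le> s_val \<zeta> (cl_e1 a + - (s_const (inverse Thalf) * z0 * cl_e0 a))"
      using c(3) by (intro s_val_add_ge)
    then show ?thesis using 1 unfolding a[symmetric] m_coord_e1.abs_eq by simp
  qed
  show ?thesis
  proof
    assume B: "ereal B \<le> m_val \<zeta> m"
    \<comment> \<open>The quotient valuation is a supremum, so a representative is available only
      for each C < B; the bound for B follows by density.\<close>
    have *: "ereal C \<le> s_val \<zeta> (m_coord_1 m) \<and> ereal (C - y / 2) \<le> s_val \<zeta> (m_coord_e1 m)" if "C < B" for C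
    proof -
      have "ereal C < m_val \<zeta> m" using that B by (meson less_ereal.simps(1) order_less_le_trans)
      then obtain a where "abs_mmod a = m" "ereal C < cl_val \<zeta> a"
        unfolding m_val_def less_SUP_iff by auto
      then show ?thesis using le[of a C] by simp
    qed
    have "ereal B \<le> s_val \<zeta> (m_coord_1 m)"
      unfolding s_val_ge_coeff
    proof (intro allI impI)
      fix a b k assume "s_coeff (m_coord_1 m) a b $$ k \<noteq> 0"
      then have "C \<le> of_int k / 2 + of_nat a * fst \<zeta> + of_nat b * snd \<zeta>" if "C < B" for C
        using *[OF that] unfolding s_val_ge_coeff by blast
      then show "B \<le> of_int k / 2 + of_nat a * fst \<zeta> + of_nat b * snd \<zeta>"
        by (rule dense_le)
    qed
    moreover have "ereal (B - y / 2) \<le> s_val \<zeta> (m_coord_e1 m)"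
      unfolding s_val_ge_coeff
    proof (intro allI impI)
      fix a b k assume "s_coeff (m_coord_e1 m) a b $$ k \<noteq> 0"
      then have "C \<le> of_int k / 2 + of_nat a * fst \<zeta> + of_nat b * snd \<zeta> + y / 2" if "C < B" for C
        using *[OF that] unfolding s_val_ge_coeff by (metis diff_le_eq)
      then have "B \<le> of_int k / 2 + of_nat a * fst \<zeta> + of_nat b * snd \<zeta> + y / 2"
        by (rule dense_le)
      then show "B - y / 2 \<le> of_int k / 2 + of_nat a * fst \<zeta> + of_nat b * snd \<zeta>" by simp
    qed
    ultimately show "ereal B \<le> s_val \<zeta> (m_coord_1 m) \<and> ereal (B - snd \<zeta> / 2) \<le> s_val \<zeta> (m_coord_e1 m)"
      by (simp add: zxy)
  next
    assume "ereal B \<le> s_val \<zeta> (m_coord_1 m) \<and> ereal (B - snd \<zeta> / 2) \<le> s_val \<zeta> (m_coord_e1 m)"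
    then have "ereal B \<le> cl_val \<zeta> (Cl (m_coord_1 m) 0 (m_coord_e1 m) 0)"
      by (simp add: cl_val_def sh zxy)
    also have "\<dots> \<le> m_val \<zeta> m"
      unfolding m_val_def using abs_mmod_coords by (intro SUP_upper) simp
    finally show "ereal B \<le> m_val \<zeta> m" .
  qed
qed

lemma endo_val_le:
  assumes "\<zeta> \<in> simplex" "m \<noteq> 0" "ereal C \<le> endo_val \<phi>" "ereal B \<le> m_val \<zeta> m"
  shows "ereal (B + C) \<le> m_val \<zeta> (endo_app \<phi> m)"
proof -
  have "endo_val \<phi> \<le> m_val \<zeta> (endo_app \<phi> m) - m_val \<zeta> m"
    unfolding endo_val_def using assms(1,2) by (intro INF_lower2[of \<zeta>] INF_lower2[of m]) auto
  then have "ereal C \<le> m_val \<zeta> (endo_app \<phi> m) - m_val \<zeta> m" using assms(3) by simp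
  then show ?thesis using assms(4)
    by (cases "m_val \<zeta> (endo_app \<phi> m)"; cases "m_val \<zeta> m") (auto)
qed

section \<open>Matrices over commutative rings\<close>

datatype 'a mat22 = Mat22 (mat_11: 'a) (mat_12: 'a) (mat_21: 'a) (mat_22: 'a)

instantiation mat22 :: (comm_ring_1) ring_1
begin
definition "0 = Mat22 0 0 0 0"
definition "1 = Mat22 1 0 0 1"
definition "A + B = Mat22 (mat_11 A + mat_11 B) (mat_12 A + mat_12 B) (mat_21 A + mat_21 B) (mat_22 A + mat_22 B)"
definition "A - B = Mat22 (mat_11 A - mat_11 B) (mat_12 A - mat_12 B) (mat_21 A - mat_21 B) (mat_22 A - mat_22 B)"
definition "- A = Mat22 (- mat_11 A) (- mat_12 A) (- mat_21 A) (- mat_22 A)"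
definition "A * B = Mat22
  (mat_11 A * mat_11 B + mat_12 A * mat_21 B) (mat_11 A * mat_12 B + mat_12 A * mat_22 B)
  (mat_21 A * mat_11 B + mat_22 A * mat_21 B) (mat_21 A * mat_12 B + mat_22 A * mat_22 B)"
instance
  by standard
    (simp_all add: zero_mat22_def one_mat22_def plus_mat22_def minus_mat22_def uminus_mat22_def
      times_mat22_def mat22.expand algebra_simps)
end

lemma mat22_sel [simp]:
  "mat_11 0 = 0" "mat_12 0 = 0" "mat_21 0 = 0" "mat_22 0 = 0"
  "mat_11 1 = 1" "mat_12 1 = 0" "mat_21 1 = 0" "mat_22 1 = 1"
  "mat_11 (A + B) = mat_11 A + mat_11 B" "mat_12 (A + B) = mat_12 A + mat_12 B"
  "mat_21 (A + B) = mat_21 A + mat_21 B" "mat_22 (A + B) = mat_22 A + mat_22 B"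
  "mat_11 (A - B) = mat_11 A - mat_11 B" "mat_12 (A - B) = mat_12 A - mat_12 B"
  "mat_21 (A - B) = mat_21 A - mat_21 B" "mat_22 (A - B) = mat_22 A - mat_22 B"
  "mat_11 (- A) = - mat_11 A" "mat_12 (- A) = - mat_12 A"
  "mat_21 (- A) = - mat_21 A" "mat_22 (- A) = - mat_22 A"
  "mat_11 (A * B) = mat_11 A * mat_11 B + mat_12 A * mat_21 B"
  "mat_12 (A * B) = mat_11 A * mat_12 B + mat_12 A * mat_22 B"
  "mat_21 (A * B) = mat_21 A * mat_11 B + mat_22 A * mat_21 B"
  "mat_22 (A * B) = mat_21 A * mat_12 B + mat_22 A * mat_22 B"
  by (simp_all add: zero_mat22_def one_mat22_def plus_mat22_def minus_mat22_def uminus_mat22_def times_mat22_def)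

lemma mat22_eqI:
  "mat_11 A = mat_11 B \<Longrightarrow> mat_12 A = mat_12 B \<Longrightarrow> mat_21 A = mat_21 B \<Longrightarrow> mat_22 A = mat_22 B \<Longrightarrow> A = B"
  by (rule mat22.expand) simp

definition trace22 :: "'a::comm_ring_1 mat22 \<Rightarrow> 'a" where "trace22 A = mat_11 A + mat_22 A"
definition par22 :: "'a::comm_ring_1 mat22" where "par22 = Mat22 1 0 0 (- 1)"
definition map22 :: "('a \<Rightarrow> 'b) \<Rightarrow> 'a mat22 \<Rightarrow> 'b mat22" where
  "map22 f A = Mat22 (f (mat_11 A)) (f (mat_12 A)) (f (mat_21 A)) (f (mat_22 A))"

lemma map22_sel [simp]:
  "mat_11 (map22 f A) = f (mat_11 A)" "mat_12 (map22 f A) = f (mat_12 A)"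
  "mat_21 (map22 f A) = f (mat_21 A)" "mat_22 (map22 f A) = f (mat_22 A)"
  by (simp_all add: map22_def)

lemma par22_sel [simp]: "mat_11 par22 = 1" "mat_12 par22 = 0" "mat_21 par22 = 0" "mat_22 par22 = - 1"
  by (simp_all add: par22_def)

lemma trace22_comm: "trace22 (A * B) = trace22 (B * A)"
  by (simp add: trace22_def algebra_simps)

lemma trace22_add: "trace22 (A + B) = trace22 A + trace22 B"
  by (simp add: trace22_def)

lemma map22_mult:
  assumes "\<And>x y. f (x + y) = f x + f y" "\<And>x y. f (x * y) = f x * f y"
  shows "map22 f (A * B) = map22 f A * map22 f B"
  by (rule mat22_eqI) (simp_all add: assms)

section \<open>Matrices of endomorphisms at the two ends\<close>

text \<open>The basis \<open>1, e\<^sub>1\<close> is rescaled so that both elements have valuation \<open>0\<close> at the end in question.\<close>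

definition kap :: "bool \<Rightarrow> int" where "kap d = (if d then 0 else 1)"

definition emat :: "bool \<Rightarrow> endo \<Rightarrow> cfls2 mat22" where
  "emat d \<phi> = Mat22 (expand d (en11 \<phi>)) (qy (- kap d) 0 * expand d (en12 \<phi>))
     (qy (kap d) 0 * expand d (en21 \<phi>)) (expand d (en22 \<phi>))"

lemma emat_sel [simp]:
  "mat_11 (emat d \<phi>) = expand d (en11 \<phi>)" "mat_12 (emat d \<phi>) = qy (- kap d) 0 * expand d (en12 \<phi>)"
  "mat_21 (emat d \<phi>) = qy (kap d) 0 * expand d (en21 \<phi>)" "mat_22 (emat d \<phi>) = expand d (en22 \<phi>)"
  by (simp_all add: emat_def)

lemma emat_add: "emat d (\<phi> + \<psi>) = emat d \<phi> + emat d \<psi>"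
  by (rule mat22_eqI) (simp_all add: en_add expand_add distrib_left)

lemma emat_0 [simp]: "emat d 0 = 0"
  by (rule mat22_eqI) simp_all

lemma emat_sum: "emat d (\<Sum>i\<in>I. f i) = (\<Sum>i\<in>I. emat d (f i))"
  by (induction I rule: infinite_finite_induct) (auto simp: emat_add)

lemma emat_1 [simp]: "emat d 1 = 1"
  by (rule mat22_eqI) simp_all

lemma emat_mult: "emat d (\<phi> * \<psi>) = emat d \<phi> * emat d \<psi>"
proof -
  have qq: "qy (kap d) 0 * qy (- kap d) 0 = 1" by (simp add: qy_mult)
  have q: "qy (- kap d) 0 * (x * (qy (kap d) 0 * y)) = x * y" "qy (kap d) 0 * (x * (qy (- kap d) 0 * y)) = x * y"
    for x y
  proof -
    from qq show "qy (- kap d) 0 * (x * (qy (kap d) 0 * y)) = x * y" "qy (kap d) 0 * (x * (qy (- kap d) 0 * y)) = x * y"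
      by (metis mult.assoc mult.commute mult_1)+
  qed
  show ?thesis
    by (rule mat22_eqI) (simp_all add: en_mult expand_add expand_mult q qq mult.assoc distrib_left mult.left_commute)
qed

text \<open>The coordinates at the two ends are related by y -> 1 / (q^2 y).\<close>

lemma expand_flip: "expand True f $$ N $$ n = expand False f $$ (N - 2 * n) $$ (- n)"
  unfolding expand_nth Let_def by (cases "n > 0"; cases "n = 0") auto

lemma s_hom_expand:
  assumes "s_hom j f" "expand d f $$ N $$ n \<noteq> 0"
  shows "2 * (N - n) = j"
proof -
  obtain F where F: "abs_sring F = f" "tate_hom j F" using assms(1) by (auto simp: s_hom_def)
  have "expand_coeff d F N n \<noteq> 0"
    using assms(2) unfolding F(1)[symmetric] expand.abs_eq texpand_nth .
  then obtain a b where ab: "mon_ex d a b = n" "tate_coeff F a b $$ (N - mon_wt d a b) \<noteq> 0"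
    by (rule expand_coeff_nonzero)
  then have "2 * (N - mon_wt d a b) = j - 2 * int a - 2 * int b"
    using F(2)[unfolded tate_hom_def nov_hom_def, rule_format, of a b "N - mon_wt d a b"] by simp
  then show ?thesis using ab(1) by (auto simp: mon_ex_def mon_wt_def split: if_splits)
qed

lemma ereal_le_limit:
  assumes "\<And>e :: real. 0 < e \<Longrightarrow> e < 1 \<Longrightarrow> x \<le> ereal (A + C * e)"
  shows "x \<le> ereal A"
proof (rule ccontr)
  assume "\<not> x \<le> ereal A"
  then have "ereal A < x" by simp
  then obtain B where B: "ereal A < ereal B" "ereal B < x" using ereal_dense2 by blast
  define e where "e = min (1 / 2) ((B - A) / (\<bar>C\<bar> + 1))"
  have e: "0 < e" "e < 1" using B(1) by (auto simp: e_def divide_pos_pos)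
  have "C * e \<le> \<bar>C\<bar> * e" using e(1) by (intro mult_right_mono) auto
  also have "\<dots> \<le> (\<bar>C\<bar> + 1) * e" using e(1) by (intro mult_right_mono) auto
  also have "\<dots> \<le> (\<bar>C\<bar> + 1) * ((B - A) / (\<bar>C\<bar> + 1))" by (intro mult_left_mono) (auto simp: e_def)
  also have "\<dots> = B - A" by (simp add: add_nonneg_eq_0_iff)
  finally have "ereal (A + C * e) \<le> ereal B" by simp
  then show False using assms[OF e] B(2) by (meson leD order_trans)
qed

text \<open>Test the norm on the two basis vectors at a zeta where y has weight - e. As e tends to 0
  the exponent of y loses its weight and only that of q remains; the rescaling in
  \<open>emat\<close> absorbs the valuation of e1 at the end.\<close>

lemma endo_val_le_emat:
  assumes "X \<in> {mat_11, mat_12, mat_21, mat_22}" "X (emat d \<phi>) $$ N $$ n \<noteq> 0"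
  shows "endo_val \<phi> \<le> ereal (of_int N / 2)"
proof (rule ereal_le_limit[where C = "\<bar>of_int n\<bar> + 1"])
  fix e :: real assume e: "0 < e" "e < 1"
  define \<zeta> where "\<zeta> = (if d then (1 - e, e) else (e, 1 - e))"
  have \<zeta>: "\<zeta> \<in> simplex" using e by (auto simp: \<zeta>_def simplex_def)
  show "endo_val \<phi> \<le> ereal (of_int N / 2 + (\<bar>of_int n\<bar> + 1) * e)"
  proof (cases "endo_val \<phi> = - \<infinity>")
    case False
    have *: "C \<le> of_int N / 2 + (\<bar>of_int n\<bar> + 1) * e" if C: "ereal C \<le> endo_val \<phi>" for C
    proof -
      have nz: "m_1 \<noteq> 0" "m_e1 \<noteq> 0" using m_coord_basis(1,4) by (metis m_coord_0 zero_neq_one)+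
      have one: "ereal 0 \<le> s_val \<zeta> 1"
        using s_val_const_ge[of 0 1 \<zeta>] by (simp add: s_const_hom nov_val_ge_iff)
      have "ereal 0 \<le> m_val \<zeta> m_1" "ereal (snd \<zeta> / 2) \<le> m_val \<zeta> m_e1"
        using one by (simp_all add: m_val_ge_iff[OF \<zeta>])
      then have "ereal (0 + C) \<le> m_val \<zeta> (endo_app \<phi> m_1)" "ereal (snd \<zeta> / 2 + C) \<le> m_val \<zeta> (endo_app \<phi> m_e1)"
        using endo_val_le[OF \<zeta> nz(1) C] endo_val_le[OF \<zeta> nz(2) C] by blast+
      then have v: "ereal C \<le> s_val \<zeta> (en11 \<phi>)" "ereal (C - snd \<zeta> / 2) \<le> s_val \<zeta> (en21 \<phi>)"
        "ereal (C + snd \<zeta> / 2) \<le> s_val \<zeta> (en12 \<phi>)" "ereal C \<le> s_val \<zeta> (en22 \<phi>)"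
        unfolding m_val_ge_iff[OF \<zeta>] en_defs by (simp_all add: add.commute)
      have k: "(if d then snd \<zeta> else fst \<zeta>) = e" by (simp add: \<zeta>_def)
      have s: "B \<le> of_int M / 2 - of_int n * e" if "ereal B \<le> s_val \<zeta> f" "expand d f $$ M $$ n \<noteq> 0" for B M f
        using that s_val_ge_iff[OF \<zeta>, of B f d] k by auto
      have ne: "- of_int n * e \<le> \<bar>of_int n\<bar> * e" using e by (intro mult_right_mono) auto
      consider "X = mat_11" | "X = mat_12" | "X = mat_21" | "X = mat_22" using assms(1) by blast
      then show ?thesis
      proof cases
        case 1
        then show ?thesis using s[OF v(1), of N] assms(2) ne e by (simp add: distrib_right)
      next
        case 2
        then have "expand d (en12 \<phi>) $$ (N + kap d) $$ n \<noteq> 0" using assms(2) by (simp add: qy_mult_nth)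
        then have "C + snd \<zeta> / 2 \<le> of_int (N + kap d) / 2 - of_int n * e" by (rule s[OF v(3)])
        then show ?thesis using ne e by (cases d) (simp_all add: \<zeta>_def kap_def distrib_right add_divide_distrib diff_divide_distrib)
      next
        case 3
        then have "expand d (en21 \<phi>) $$ (N - kap d) $$ n \<noteq> 0" using assms(2) by (simp add: qy_mult_nth)
        then have "C - snd \<zeta> / 2 \<le> of_int (N - kap d) / 2 - of_int n * e" by (rule s[OF v(2)])
        then show ?thesis using ne e by (cases d) (simp_all add: \<zeta>_def kap_def distrib_right add_divide_distrib diff_divide_distrib)
      next
        case 4
        then show ?thesis using s[OF v(4), of N] assms(2) ne e by (simp add: distrib_right)
      qed
    qed
    show ?thesis
    proof (rule ccontr)
      assume "\<not> ?thesis"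
      then obtain B where "ereal (of_int N / 2 + (\<bar>of_int n\<bar> + 1) * e) < ereal B" "ereal B < endo_val \<phi>"
        using ereal_dense2 by (metis linorder_not_le)
      then show False using *[of B] less_imp_le by fastforce
    qed
  qed simp
qed

text \<open>In the upper right entry degree forces N = n + 1 for a monomial q^N y^n, while
  positivity at the two ends forces N > 0 and N - 2n - 1 > 0, so - 1 < n < 0. The lower left entry
  similarly forces 0 < n < 1. Without an s^0 term, logarithms of \<open>b\<close> converge in powers
  of s.\<close>

lemma ends_val_pos_coeff_0:
  assumes "ends_hom 1 b" "ends_val b > 0"
  shows "b $ 0 = 0"
proof -
  let ?\<phi> = "b $ 0"
  have h: "endo_hom 1 ?\<phi>" using assms(1) by (simp add: ends_hom_def)
  have "ends_val b \<le> ereal (real 0) + endo_val ?\<phi>" unfolding ends_val_def by (rule INF_lower) simp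
  then have pos: "endo_val ?\<phi> > 0" using assms(2) by (simp add: zero_ereal_def[symmetric])
  have N: "N > 0" if "X \<in> {mat_11, mat_12, mat_21, mat_22}" "X (emat d ?\<phi>) $$ N $$ n \<noteq> 0" for X d N n
  proof -
    have "(0 :: ereal) < ereal (of_int N / 2)" using pos endo_val_le_emat[OF that] by (rule less_le_trans)
    then show ?thesis by simp
  qed
  have sh: "s_hom 2 (en12 ?\<phi>)" "s_hom 0 (en21 ?\<phi>)" using h by (simp_all add: endo_hom_iff)
  have 12: "expand True (en12 ?\<phi>) $$ N $$ n = 0" for N n
  proof (rule ccontr)
    assume a: "expand True (en12 ?\<phi>) $$ N $$ n \<noteq> 0"
    then have "N > 0" using N[of mat_12 True N n] by (simp add: qy_mult_nth kap_def)
    moreover have "expand False (en12 ?\<phi>) $$ (N - 2 * n) $$ (- n) \<noteq> 0" using a by (simp add: expand_flip)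
    then have "N - 2 * n - 1 > 0" using N[of mat_12 False "N - 2 * n - 1" "- n"] by (simp add: qy_mult_nth kap_def)
    moreover have "2 * (N - n) = 2" using s_hom_expand[OF sh(1) a] .
    ultimately show False by simp
  qed
  have 21: "expand True (en21 ?\<phi>) $$ N $$ n = 0" for N n
  proof (rule ccontr)
    assume a: "expand True (en21 ?\<phi>) $$ N $$ n \<noteq> 0"
    then have "N > 0" using N[of mat_21 True N n] by (simp add: qy_mult_nth kap_def)
    moreover have "expand False (en21 ?\<phi>) $$ (N - 2 * n) $$ (- n) \<noteq> 0" using a by (simp add: expand_flip)
    then have "N - 2 * n + 1 > 0" using N[of mat_21 False "N - 2 * n + 1" "- n"] by (simp add: qy_mult_nth kap_def)
    moreover have "2 * (N - n) = 0" using s_hom_expand[OF sh(2) a] .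
    ultimately show False by simp
  qed
  have "expand True (en12 ?\<phi>) = 0" "expand True (en21 ?\<phi>) = 0"
    using 12 21 by (auto intro!: fls_eqI)
  then have "en12 ?\<phi> = 0" "en21 ?\<phi> = 0" using expand_inject by blast+
  moreover have "en11 ?\<phi> = 0" "en22 ?\<phi> = 0" using endo_hom_parity(2)[OF h] by simp_all
  ultimately show ?thesis by (intro en_eqI) simp_all
qed

section \<open>The two contractions\<close>

definition inv_lin :: "complex fls" where "inv_lin = inverse (1 + fls_X)"

lemma inv_lin_eq: "inv_lin * (1 + fls_X) = 1"
proof -
  have "(1 + fls_X :: complex fls) $$ 0 \<noteq> 0" by simp
  then have "(1 + fls_X :: complex fls) \<noteq> 0" by (metis fls_zero_nth)
  then show ?thesis by (simp add: inv_lin_def)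
qed

lemma inv_lin_neg: "m < 0 \<Longrightarrow> inv_lin $$ m = 0"
proof -
  assume m: "m < 0"
  have "inv_lin = fps_to_fls (inverse (1 + fps_X))"
    unfolding inv_lin_def by (subst fls_inverse_fps_to_fls[symmetric]) (auto intro!: subdegreeI)
  then have "inv_lin $$ m = fps_to_fls (inverse (1 + fps_X)) $$ m" by (simp only:)
  then show ?thesis using m by (simp only: fps_to_fls_nth if_True)
qed

definition D12 :: "bool \<Rightarrow> cfls2" where "D12 d = (if d then qy 1 0 + qy 0 (- 1) else 1 + qy 1 1)"
definition D21 :: "bool \<Rightarrow> cfls2" where "D21 d = (if d then 1 - qy 1 1 else qy 1 0 - qy 0 (- 1))"
definition H12 :: "bool \<Rightarrow> cfls2" where "H12 d = (if d then 1 else qy 1 2) * diag inv_sq"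
definition H21 :: "bool \<Rightarrow> cfls2" where "H21 d = (if d then qy 1 2 else 1) * diag inv_sq"
text \<open>The inverse of \<open>D12 d\<close>: the strictly lower triangular matrix with this
  entry is a contraction of \<open>D\<close>.\<close>

definition G21 :: "bool \<Rightarrow> cfls2" where "G21 d = (if d then qy 0 1 else 1) * diag inv_lin"

lemma emb_Thalf: "emb Thalf = qy 1 0" "emb (inverse Thalf) = qy (- 1) 0"
proof -
  have "(Thalf :: real fls) = fls_X_intpow 1" by (rule fls_eqI) simp
  then show "emb Thalf = qy 1 0" using emb_X_power[of 1] by metis
qed (simp only: inverse_Thalf emb_X_power)

lemma emat_D: "emat d D_M = Mat22 0 (D12 d) (D21 d) 0"
  by (rule mat22_eqI; cases d)
    (simp_all add: en_D D12_def D21_def kap_def expand_add expand_diff expand_mult expand_const emb_Thalf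
      expand_z0 expand_z1 qy_mult distrib_left right_diff_distrib)

lemma emb_mult: "emb (r * r') = emb r * emb r'"
  using expand_mult[of True "s_const r" "s_const r'"] by (simp add: s_const_hom(2)[symmetric] expand_const)

lemma emat_d1D_H:
  "emat d d1D * Mat22 (inverse (expand d (s_d1 W_M))) 0 0 (inverse (expand d (s_d1 W_M)))
     = Mat22 0 (H12 d) (H21 d) 0"
  by (rule mat22_eqI; cases d)
    (simp_all add: en_d1D inverse_expand_dW H12_def H21_def kap_def expand_mult expand_const emb_mult
      emb_Thalf emb_inverse_TT expand_power expand_z0 qy_mult qy_power mult.assoc[symmetric])

text \<open>Differentiating D^2 = W shows that D anticommutes with its derivative up to the
  derivative of W; dividing by the latter makes the quotient a contraction.\<close>

lemma DH_anticomm: "D12 d * H21 d + D21 d * H12 d = 1"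
proof -
  have "D12 d * H21 d + D21 d * H12 d = diag inv_sq * (1 + qy 2 2)"
    by (cases d) (simp_all add: D12_def D21_def H12_def H21_def algebra_simps qy_mult mult.assoc[symmetric])
  then show ?thesis by (simp add: diag_inv_sq)
qed

lemma D12_G21: "D12 d * G21 d = 1"
proof -
  have "diag (inv_lin * (1 + fls_X)) = diag inv_lin * (1 + qy 1 1)"
    using diag_X_power[of 1] by (simp add: diag_mult diag_add)
  then have "diag inv_lin * (1 + qy 1 1) = 1" unfolding inv_lin_eq by simp
  then show ?thesis
    by (cases d) (simp_all add: D12_def G21_def algebra_simps qy_mult mult.assoc[symmetric])
qed

section \<open>Evaluation of chains\<close>

definition ends_mat :: "bool \<Rightarrow> ends \<Rightarrow> cfls2 fps mat22" where
  "ends_mat d a = Mat22 (Abs_fps (\<lambda>k. mat_11 (emat d (a $ k)))) (Abs_fps (\<lambda>k. mat_12 (emat d (a $ k))))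
     (Abs_fps (\<lambda>k. mat_21 (emat d (a $ k)))) (Abs_fps (\<lambda>k. mat_22 (emat d (a $ k))))"

lemma ends_mat_sel:
  "mat_11 (ends_mat d a) $ k = mat_11 (emat d (a $ k))" "mat_12 (ends_mat d a) $ k = mat_12 (emat d (a $ k))"
  "mat_21 (ends_mat d a) $ k = mat_21 (emat d (a $ k))" "mat_22 (ends_mat d a) $ k = mat_22 (emat d (a $ k))"
  by (simp_all add: ends_mat_def)

lemma ends_mat_eqI:
  assumes "\<And>k. mat_11 A $ k = mat_11 B $ k" "\<And>k. mat_12 A $ k = mat_12 B $ k"
    "\<And>k. mat_21 A $ k = mat_21 B $ k" "\<And>k. mat_22 A $ k = mat_22 B $ k"
  shows "A = B"
  by (rule mat22_eqI; rule fps_ext; rule assms)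

lemma ends_mat_add: "ends_mat d (a + b) = ends_mat d a + ends_mat d b"
  by (rule ends_mat_eqI) (simp_all add: ends_mat_sel emat_add del: emat_sel)

lemma mat22_sum:
  "mat_11 (\<Sum>i\<in>I. A i) = (\<Sum>i\<in>I. mat_11 (A i))" "mat_12 (\<Sum>i\<in>I. A i) = (\<Sum>i\<in>I. mat_12 (A i))"
  "mat_21 (\<Sum>i\<in>I. A i) = (\<Sum>i\<in>I. mat_21 (A i))" "mat_22 (\<Sum>i\<in>I. A i) = (\<Sum>i\<in>I. mat_22 (A i))"
  by (induction I rule: infinite_finite_induct) auto

lemma ends_mat_mult: "ends_mat d (a * b) = ends_mat d a * ends_mat d b"
  by (rule ends_mat_eqI)
    (simp_all add: ends_mat_sel fps_mult_nth emat_sum emat_mult mat22_sum sum.distrib del: emat_sel)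

lemma ends_mat_1 [simp]: "ends_mat d 1 = 1"
proof (rule ends_mat_eqI)
  fix k show "mat_11 (ends_mat d 1) $ k = mat_11 1 $ k" "mat_12 (ends_mat d 1) $ k = mat_12 1 $ k"
    "mat_21 (ends_mat d 1) $ k = mat_21 1 $ k" "mat_22 (ends_mat d 1) $ k = mat_22 1 $ k"
    by (cases k; simp add: ends_mat_sel del: emat_sel)+
qed

lemma ends_mat_const: "ends_mat d (fps_const \<phi>) = map22 fps_const (emat d \<phi>)"
proof (rule ends_mat_eqI)
  fix k show "mat_11 (ends_mat d (fps_const \<phi>)) $ k = mat_11 (map22 fps_const (emat d \<phi>)) $ k"
    "mat_12 (ends_mat d (fps_const \<phi>)) $ k = mat_12 (map22 fps_const (emat d \<phi>)) $ k"
    "mat_21 (ends_mat d (fps_const \<phi>)) $ k = mat_21 (map22 fps_const (emat d \<phi>)) $ k"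
    "mat_22 (ends_mat d (fps_const \<phi>)) $ k = mat_22 (map22 fps_const (emat d \<phi>)) $ k"
    by (cases k; simp add: ends_mat_sel del: emat_sel)+
qed

lemma ends_mat_scalar:
  "ends_mat d (ends_scalar r) = Mat22 (Abs_fps (\<lambda>k. emb (r $ k))) 0 0 (Abs_fps (\<lambda>k. emb (r $ k)))"
  by (rule ends_mat_eqI) (simp_all add: ends_mat_sel ends_scalar_def expand_const)

definition ends_pmat :: "bool \<Rightarrow> ends \<Rightarrow> cfls2 fps poly mat22" where
  "ends_pmat d a = map22 (\<lambda>x. [:x:]) (ends_mat d a)"

definition cst :: "cfls2 \<Rightarrow> cfls2 fps poly" where "cst x = [:fps_const x:]"

lemma cst_simps:
  "cst (x + y) = cst x + cst y" "cst (x - y) = cst x - cst y" "cst (x * y) = cst x * cst y"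
  "cst 1 = 1" "cst 0 = 0" "cst (- x) = - cst x"
  by (simp_all add: cst_def flip: fps_const_neg)

text \<open>The homotopy parameter, a polynomial variable: \<open>H_mat\<close> is the triangular
  contraction at 0 and the derivative of \<open>D\<close> over that of W at 1.\<close>

definition tvar :: "cfls2 fps poly" where "tvar = [:0, 1:]"

definition E_mat where "E_mat d = Mat22 0 (- cst (D12 d)) (cst (D21 d)) 0"
definition H_mat where "H_mat d = Mat22 0 (tvar * cst (H12 d)) (cst (G21 d) + tvar * (cst (H21 d) - cst (G21 d))) 0"
definition dH_mat where "dH_mat d = Mat22 0 (cst (H12 d)) (cst (H21 d) - cst (G21 d)) 0"
text \<open>Minus the product of the triangular contraction with \<open>dH_mat\<close>. The
  difference of two contractions is exact, and multiplying it by a contraction gives a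
  primitive.\<close>

definition K_mat where "K_mat d = Mat22 0 0 0 (- (cst (G21 d) * cst (H12 d)))"

lemma ends_pmat_add: "ends_pmat d (a + b) = ends_pmat d a + ends_pmat d b"
  by (rule mat22_eqI) (simp_all add: ends_pmat_def ends_mat_add)

lemma ends_pmat_mult: "ends_pmat d (a * b) = ends_pmat d a * ends_pmat d b"
  by (rule mat22_eqI) (simp_all add: ends_pmat_def ends_mat_mult)

lemma ends_pmat_1 [simp]: "ends_pmat d 1 = 1"
  by (rule mat22_eqI) (simp_all add: ends_pmat_def)

lemma ends_pmat_uminus: "ends_pmat d (- a) = - ends_pmat d a"
proof -
  have "ends_pmat d 0 = 0" using ends_pmat_add[of d 0 0] by simp
  then show ?thesis using ends_pmat_add[of d a "- a"] by (simp add: eq_neg_iff_add_eq_0 add.commute)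
qed

lemma ends_pmat_diff: "ends_pmat d (a - b) = ends_pmat d a - ends_pmat d b"
  using ends_pmat_add[of d a "- b"] by (simp add: ends_pmat_uminus)

lemma ends_pmat_D: "ends_pmat d (fps_const D_M) = Mat22 0 (cst (D12 d)) (cst (D21 d)) 0"
  by (rule mat22_eqI) (simp_all add: ends_pmat_def ends_mat_const emat_D cst_def del: emat_sel)

lemma ends_mat_parity:
  assumes "ends_hom j a"
  shows "even j \<Longrightarrow> mat_12 (ends_mat d a) = 0 \<and> mat_21 (ends_mat d a) = 0"
    "odd j \<Longrightarrow> mat_11 (ends_mat d a) = 0 \<and> mat_22 (ends_mat d a) = 0"
proof -
  have h: "endo_hom j (a $ k)" for k using assms by (simp add: ends_hom_def)
  show "even j \<Longrightarrow> mat_12 (ends_mat d a) = 0 \<and> mat_21 (ends_mat d a) = 0"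
    using endo_hom_parity(1)[OF h] by (auto intro!: fps_ext simp: ends_mat_sel)
  show "odd j \<Longrightarrow> mat_11 (ends_mat d a) = 0 \<and> mat_22 (ends_mat d a) = 0"
    using endo_hom_parity(2)[OF h] by (auto intro!: fps_ext simp: ends_mat_sel)
qed

lemma par22_ends_pmat:
  assumes "ends_hom j a"
  shows "par22 * ends_pmat d a = of_int (sign j) * (ends_pmat d a * par22)"
  using ends_mat_parity[OF assms, of d]
  by (intro mat22_eqI; cases "even j"; simp add: ends_pmat_def sign_def)

interpretation side: trace_homotopy "ends_pmat d" par22 "E_mat d" "H_mat d" "K_mat d" "dH_mat d" trace22 for d
proof
  have DG: "cst (D12 d) * cst (G21 d) = 1"
    using arg_cong[OF D12_G21, of cst] by (simp add: cst_simps)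
  have DH: "cst (D12 d) * cst (H21 d) + cst (D21 d) * cst (H12 d) = 1"
    using arg_cong[OF DH_anticomm, of cst] by (simp add: cst_simps)
  show "par22 * par22 = (1 :: cfls2 fps poly mat22)" by (rule mat22_eqI) simp_all
  show "par22 * E_mat d = - (E_mat d * par22)" by (rule mat22_eqI) (simp_all add: E_mat_def)
  show "par22 * H_mat d = - (H_mat d * par22)" by (rule mat22_eqI) (simp_all add: H_mat_def)
  show "par22 * K_mat d = K_mat d * par22" by (rule mat22_eqI) (simp_all add: K_mat_def)
  \<comment> \<open>Contractions form an affine space, so the relation persists along the whole
    path.\<close>
  have 1: "p * (g + t * (v - g)) + t * u * r = 1" if "p * g = 1" "p * v + r * u = 1"
    for p g t v u r :: "cfls2 fps poly"
  proof -
    have "p * (g + t * (v - g)) + t * u * r = p * g + t * (p * v + r * u) - t * (p * g)"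
      by (simp add: algebra_simps)
    then show ?thesis using that by simp
  qed
  note 1 = 1[OF DG DH, of tvar]
  show "E_mat d * H_mat d = H_mat d * E_mat d - par22"
    by (rule mat22_eqI) (use 1 in \<open>simp_all add: E_mat_def H_mat_def algebra_simps\<close>)
  have 2: "p * (g * u) = u" "g * u * r = g - v" if "p * g = 1" "p * v + r * u = 1"
    for p g v u r :: "cfls2 fps poly"
  proof -
    show "p * (g * u) = u" using that(1) by (simp flip: mult.assoc)
    have "g * u * r = g * (p * v + r * u) - (p * g) * v" by (simp add: algebra_simps)
    then show "g * u * r = g - v" using that by simp
  qed
  show "E_mat d * K_mat d = dH_mat d - K_mat d * E_mat d"
    by (rule mat22_eqI) (use 2[OF DG DH] in \<open>simp_all add: E_mat_def K_mat_def dH_mat_def\<close>)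
  show "ends_pmat d (a * b) = ends_pmat d a * ends_pmat d b" for a b by (rule ends_pmat_mult)
  show "ends_pmat d (a + b) = ends_pmat d a + ends_pmat d b" for a b by (rule ends_pmat_add)
  show "ends_pmat d (ends_scalar r) * x = x * ends_pmat d (ends_scalar r)" for r x
    by (rule mat22_eqI) (simp_all add: ends_pmat_def ends_mat_scalar)
  show par: "par22 * ends_pmat d a = of_int (sign j) * (ends_pmat d a * par22)" if "ends_hom j a" for j a
    by (rule par22_ends_pmat[OF that])
  show "par22 * ends_pmat d (delta a) = ends_pmat d a * E_mat d - E_mat d * ends_pmat d a" if "homog a" for a
  proof -
    let ?D = "Mat22 0 (cst (D12 d)) (cst (D21 d)) 0"
    have E: "E_mat d = ?D * par22" by (rule mat22_eqI) (simp_all add: E_mat_def)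
    have sD: "par22 * ?D = - (?D * par22)" by (rule mat22_eqI) simp_all
    have pa: "par22 * ends_pmat d a = of_int (sign (deg a)) * (ends_pmat d a * par22)"
      by (rule par[OF ends_hom_deg[OF that]])
    have "ends_pmat d (delta a) = ?D * ends_pmat d a - of_int (sign (deg a)) * ends_pmat d a * ?D"
      unfolding delta_def using sign_cases[of "deg a"]
      by (auto simp: ends_pmat_diff ends_pmat_add ends_pmat_mult ends_pmat_uminus ends_pmat_D)
    then have "par22 * ends_pmat d (delta a) = par22 * (?D * ends_pmat d a - of_int (sign (deg a)) * ends_pmat d a * ?D)"
      by (simp only:)
    also have "\<dots>
       = par22 * ?D * ends_pmat d a - of_int (sign (deg a)) * (par22 * ends_pmat d a * ?D)"
      using sign_cases[of "deg a"] by (auto simp: algebra_simps)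
    also have "of_int (sign (deg a)) * (par22 * ends_pmat d a * ?D) = ends_pmat d a * (par22 * ?D)"
      unfolding pa using sign_cases[of "deg a"] by (auto simp: mult.assoc)
    also have "par22 * ?D * ends_pmat d a = - (E_mat d * ends_pmat d a)" unfolding sD E by simp
    finally show ?thesis unfolding sD E[symmetric] by simp
  qed
  show "trace22 (x + y) = trace22 x + trace22 y" for x y :: "cfls2 fps poly mat22" by (rule trace22_add)
  show "trace22 (x * y) = trace22 (y * x)" for x y :: "cfls2 fps poly mat22" by (rule trace22_comm)
  show "(2 :: cfls2 fps poly) \<noteq> 0"
  proof
    assume "(2 :: cfls2 fps poly) = 0"
    then have "(1 + 1 :: cfls2 fps poly) = 0" by (simp only: one_add_one)
    then have "coeff (1 + 1 :: cfls2 fps poly) 0 $ 0 $$ 0 $$ 0 = coeff 0 0 $ 0 $$ 0 $$ 0" by (simp only:)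
    moreover have "coeff (1 + 1 :: cfls2 fps poly) 0 $ 0 $$ 0 $$ 0
        = coeff 1 0 $ 0 $$ 0 $$ 0 + (coeff 1 0 :: cfls2 fps) $ 0 $$ 0 $$ 0"
      by (simp only: coeff_add fps_add_nth fls_plus_nth)
    moreover have "(coeff 1 0 :: cfls2 fps) $ 0 $$ 0 $$ 0 = 1" by simp
    ultimately show False by simp
  qed
qed

definition word_trace :: "bool \<Rightarrow> ends list \<Rightarrow> cfls2 fps poly" where
  "word_trace d w = trace22 (par22 * side.wprod d w)"

definition word_prim :: "bool \<Rightarrow> ends list \<Rightarrow> cfls2 fps poly" where
  "word_prim d w = trace22 (side.wprod_K d w)"

definition homog_word :: "ends list \<Rightarrow> bool" where
  "homog_word w \<longleftrightarrow> w \<noteq> [] \<and> (\<forall>a\<in>set w. homog a)"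

lemma is_word_homog_word: "is_word w \<Longrightarrow> homog_word w"
  using is_word_homog by (auto simp: homog_word_def is_word_def)

lemma pderiv_mat_mult:
  "map22 pderiv (A * B) = map22 pderiv A * B + A * map22 pderiv (B :: cfls2 fps poly mat22)"
  by (rule mat22_eqI) (simp_all add: pderiv_mult pderiv_add algebra_simps)

lemma pderiv_word_trace: "pderiv (word_trace d w) = trace22 (par22 * side.wprod_h d w)"
proof -
  have a: "map22 pderiv (ends_pmat d a) = 0" for a
    by (rule mat22_eqI) (simp_all add: ends_pmat_def)
  have h: "map22 pderiv (H_mat d) = dH_mat d"
    by (rule mat22_eqI)
      (simp_all add: H_mat_def dH_mat_def pderiv_mult pderiv_add pderiv_diff tvar_def cst_def pderiv_pCons)
  have "map22 pderiv (side.wprod d w) = side.wprod_h d w"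
  proof (induction w)
    case Nil
    show ?case by (rule mat22_eqI) simp_all
  next
    case (Cons b w)
    then show ?case by (simp add: pderiv_mat_mult a h)
  qed
  then have "pderiv (mat_11 (side.wprod d w)) = mat_11 (side.wprod_h d w)"
    "pderiv (mat_22 (side.wprod d w)) = mat_22 (side.wprod_h d w)"
    by (metis map22_sel(1), metis map22_sel(4))
  then show ?thesis by (simp add: word_trace_def trace22_def pderiv_diff)
qed

text \<open>Along the path of contractions the trace changes only through the boundary of the chain;
  this is all that is used about the correction when passing from t = 0 to t = 1.\<close>

lemma pderiv_chain_trace:
  assumes "\<forall>w\<in>Poly_Mapping.keys x. homog_word w"
  shows "pderiv (chain_ext (word_trace d) x) = chain_ext (word_prim d) (d_cc x)"
proof -
  have s: "pderiv (\<Sum>w\<in>A. f w) = (\<Sum>w\<in>A. pderiv (f w :: cfls2 fps poly))" for A and f :: "ends list \<Rightarrow> _"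
    by (induction A rule: infinite_finite_induct) (auto simp: pderiv_add)
  have i: "pderiv (of_int n * p) = of_int n * pderiv (p :: cfls2 fps poly)" for n p
    by (simp add: pderiv_smult of_int_poly)
  have "pderiv (chain_ext (word_trace d) x) = chain_ext (\<lambda>w. pderiv (word_trace d w)) x"
    by (simp add: chain_ext_def s i)
  also have "\<dots> = chain_ext (\<lambda>w. chain_ext (word_prim d) (b_mu1 w + b_mu2 w)) x"
  proof (rule chain_ext_cong)
    fix w assume "w \<in> Poly_Mapping.keys x"
    then have "homog_word w" using assms by blast
    then show "pderiv (word_trace d w) = chain_ext (word_prim d) (b_mu1 w + b_mu2 w)"
      using side.homotopy_formula[of w d] unfolding pderiv_word_trace word_prim_def[abs_def] homog_word_def by simp
  qed
  also have "\<dots> = chain_ext (word_prim d) (d_cc x)" by (simp add: d_cc_def chain_ext_frag_extend)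
  finally show ?thesis .
qed

section \<open>The values of the trace at the two contractions\<close>

lemma wprod_at:
  "map22 (\<lambda>p. poly p c) (side.wprod d w)
     = prod_list (map (\<lambda>a. ends_mat d a * map22 (\<lambda>p. poly p c) (H_mat d)) w)"
proof (induction w)
  case Nil
  show ?case by (rule mat22_eqI) simp_all
next
  case (Cons a w)
  have "map22 (\<lambda>p. poly p c) (ends_pmat d a) = ends_mat d a"
    by (rule mat22_eqI) (simp_all add: ends_pmat_def)
  then show ?case by (simp add: map22_mult Cons)
qed

text \<open>The contraction at t = 0 has a single entry, in the lower left. Every partial product
  has a zero second column, so the trace is multiplicative in the upper right entries of the
  letters.\<close>

lemma word_trace_0:
  assumes "w \<noteq> []"
  shows "poly (word_trace d w) 0 = prod_list (map (\<lambda>a. mat_12 (ends_mat d a) * fps_const (G21 d)) w)"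
proof -
  let ?P = "\<lambda>w. prod_list (map (\<lambda>a. ends_mat d a * map22 (\<lambda>p. poly p 0) (H_mat d)) w)"
  have H: "mat_11 (map22 (\<lambda>p. poly p 0) (H_mat d)) = 0" "mat_12 (map22 (\<lambda>p. poly p 0) (H_mat d)) = 0"
    "mat_21 (map22 (\<lambda>p. poly p 0) (H_mat d)) = fps_const (G21 d)" "mat_22 (map22 (\<lambda>p. poly p 0) (H_mat d)) = 0"
    by (simp_all add: H_mat_def tvar_def cst_def)
  have "mat_12 (?P w) = 0 \<and> mat_22 (?P w) = 0
     \<and> mat_11 (?P w) = prod_list (map (\<lambda>a. mat_12 (ends_mat d a) * fps_const (G21 d)) w)"
    using assms
  proof (induction w rule: list_nonempty_induct)
    case (single a)
    then show ?case by (simp add: H del: map22_sel)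
  next
    case (cons a w)
    then show ?case by (simp add: H del: map22_sel)
  qed
  moreover have "poly (word_trace d w) 0 = mat_11 (?P w) - mat_22 (?P w)"
    unfolding wprod_at[symmetric] word_trace_def trace22_def by simp
  ultimately show ?thesis by simp
qed

definition laurent_endo :: "endo \<Rightarrow> bool" where
  "laurent_endo \<phi> \<longleftrightarrow> en11 \<phi> \<in> laurent_polys \<and> en12 \<phi> \<in> laurent_polys \<and> en21 \<phi> \<in> laurent_polys \<and> en22 \<phi> \<in> laurent_polys"

lemma laurent_endo_mult: "laurent_endo \<phi> \<Longrightarrow> laurent_endo \<psi> \<Longrightarrow> laurent_endo (\<phi> * \<psi>)"
  by (auto simp: laurent_endo_def en_mult intro!: laurent_polys.add laurent_mult)

lemma laurent_endo_sum: "(\<And>i. i \<in> I \<Longrightarrow> laurent_endo (f i)) \<Longrightarrow> laurent_endo (\<Sum>i\<in>I. f i)"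
proof (induction I rule: infinite_finite_induct)
  case (insert x F)
  then show ?case by (auto simp: laurent_endo_def en_add intro!: laurent_polys.add)
qed (auto simp: laurent_endo_def laurent_0)

lemma laurent_endo_0 [simp]: "laurent_endo 0"
  by (simp add: laurent_endo_def laurent_0)

lemma laurent_endo_d1D: "laurent_endo d1D"
  using laurent_const[of 1] laurent_polys.z0
  by (simp add: laurent_endo_def en_d1D laurent_0 s_const_hom(3))

text \<open>At t = 1 every letter brings the scalar inverse of the derivative of W; pulled out, they
  give the denominator of the integrand, and \<open>sum_res_at\<close> turns residues into constant
  terms.\<close>

lemma Theta_word_nth:
  assumes "homog_word w"
  shows "Theta_word w $ k = - (ct (poly (word_trace True w) 1 $ k) - ct (poly (word_trace False w) 1 $ k))"
proof -
  define P where "P = prod_list (map (\<lambda>a. a * fps_const d1D) w)"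
  obtain l where l: "length w = Suc l" using assms by (cases w) (auto simp: homog_word_def)
  have "laurent_endo (prod_list (map (\<lambda>a. a * fps_const d1D) w) $ k)" for k
    using assms[unfolded homog_word_def, THEN conjunct2]
  proof (induction w arbitrary: k)
    case Nil
    show ?case using laurent_const[of 1] laurent_0
      by (cases k) (simp_all add: laurent_endo_def s_const_hom(3))
  next
    case (Cons a w)
    obtain j where "ends_hom j a" using Cons.prems by (auto simp: homog_def)
    then have "laurent_endo (a $ i)" for i
      using endo_hom_laurent[of j "a $ i"] by (simp add: ends_hom_def laurent_endo_def)
    then show ?case using Cons laurent_endo_d1D
      by (auto simp: fps_mult_nth intro!: laurent_endo_sum laurent_endo_mult)
  qed
  then have lp: "laurent_endo (P $ k)" unfolding P_def .
  have str: "str \<phi> = en11 \<phi> + s_const (- 1) * en22 \<phi>" for \<phi>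
  proof -
    have "s_const (- 1) = - 1" using s_const_hom(1)[of 1 "- 1"] s_const_hom(3,4)
      by (simp add: eq_neg_iff_add_eq_0 add.commute)
    then show ?thesis by (simp add: str_def endo_mat_en)
  qed
  have "str (P $ k) \<in> laurent_polys"
    unfolding str using lp by (auto simp: laurent_endo_def intro!: laurent_polys.add laurent_mult laurent_const)
  note res = sum_res_at[OF this, of l]
  have "ct (expand d (str (P $ k)) * inverse (expand d (s_d1 W_M)) ^ Suc l) = ct (poly (word_trace d w) 1 $ k)" for d
  proof -
    define c where "c = inverse (expand d (s_d1 W_M))"
    let ?C = "Mat22 (fps_const c) 0 0 (fps_const c)"
    let ?H = "map22 (\<lambda>p. poly p 1) (H_mat d)"
    have "?H = map22 fps_const (Mat22 0 (H12 d) (H21 d) 0)"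
      by (rule mat22_eqI) (simp_all add: H_mat_def tvar_def cst_def)
    also have "\<dots> = map22 fps_const (emat d d1D) * ?C"
      unfolding emat_d1D_H[symmetric] c_def by (rule mat22_eqI) (simp_all del: emat_sel)
    finally have H: "?H = ends_mat d (fps_const d1D) * ?C" by (simp add: ends_mat_const)
    have C: "?C * A = A * ?C" for A by (rule mat22_eqI) (simp_all add: mult.commute)
    have f1: "prod_list (map (\<lambda>a. ends_mat d a * ?H) w)
        = ends_mat d (prod_list (map (\<lambda>a. a * fps_const d1D) w)) * ?C ^ length w" for w
    proof (induction w)
      case (Cons a w)
      let ?Pw = "prod_list (map (\<lambda>a. a * fps_const d1D) w)"
      have "prod_list (map (\<lambda>a. ends_mat d a * ?H) (a # w))
          = ends_mat d a * (ends_mat d (fps_const d1D) * ?C) * (ends_mat d ?Pw * ?C ^ length w)"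
        by (simp only: list.map prod_list.Cons H Cons.IH[unfolded H])
      also have "\<dots> = ends_mat d a * ends_mat d (fps_const d1D) * (?C * ends_mat d ?Pw) * ?C ^ length w"
        by (simp only: mult.assoc)
      also have "\<dots> = ends_mat d a * ends_mat d (fps_const d1D) * (ends_mat d ?Pw * ?C) * ?C ^ length w"
        by (simp only: C)
      finally show ?case
        by (simp only: list.map prod_list.Cons ends_mat_mult mult.assoc length_Cons power_Suc)
    qed simp
    have f2: "?C ^ n = Mat22 (fps_const (c ^ n)) 0 0 (fps_const (c ^ n))" for n
      by (induction n) (auto intro!: mat22_eqI)
    have e: "map22 (\<lambda>p. poly p 1) (side.wprod d w)
        = ends_mat d P * Mat22 (fps_const (c ^ Suc l)) 0 0 (fps_const (c ^ Suc l))"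
      unfolding wprod_at P_def by (simp only: f1 f2 l)
    have "poly (word_trace d w) 1 = mat_11 (map22 (\<lambda>p. poly p 1) (side.wprod d w))
        - mat_22 (map22 (\<lambda>p. poly p 1) (side.wprod d w))"
      unfolding word_trace_def trace22_def by simp
    then have "poly (word_trace d w) 1 $ k = (expand d (en11 (P $ k)) - expand d (en22 (P $ k))) * c ^ Suc l"
      unfolding e by (simp add: ends_mat_sel left_diff_distrib del: power_Suc)
    also have "expand d (en11 (P $ k)) - expand d (en22 (P $ k)) = expand d (str (P $ k))"
      by (simp add: str_def endo_mat_en expand_diff)
    finally show ?thesis unfolding c_def by simp
  qed
  then show ?thesis
    using res unfolding Theta_word_def P_def[symmetric] l by (simp del: power_Suc)
qed

lemma Theta_nth:
  assumes "\<forall>w\<in>Poly_Mapping.keys x. homog_word w"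
  shows "Theta x $ k = - (ct (poly (chain_ext (word_trace True) x) 1 $ k)
     - ct (poly (chain_ext (word_trace False) x) 1 $ k))"
proof -
  have n: "(of_int n * f) $ k = of_int n * f $ k" for n and f :: "'a::comm_ring_1 fps"
    by (metis fps_mult_left_const_nth fps_of_int)
  have c: "ct (of_int n * F) = of_int n * ct F" for n F
    by (rule fls_eqI) (simp add: ct_nth fls_of_int fls_const_mult_nth)
  have cs: "ct (\<Sum>w\<in>A. f w) = (\<Sum>w\<in>A. ct (f w))" for A and f :: "ends list \<Rightarrow> cfls2"
  proof (induction A rule: infinite_finite_induct)
    case (insert x F)
    then show ?case by (simp add: ct_add)
  qed (auto intro: fls_eqI simp: ct_nth)
  have "ct (poly (chain_ext (word_trace d) x) 1 $ k)
      = (\<Sum>w\<in>Poly_Mapping.keys x. of_int (Poly_Mapping.lookup x w) * ct (poly (word_trace d w) 1 $ k))" for d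
    by (simp add: chain_ext_def poly_sum fps_sum_nth n cs c)
  then show ?thesis
    using assms by (simp add: Theta_def fps_sum_nth n Theta_word_nth sum_subtractf[symmetric] sum_negf[symmetric]
        right_diff_distrib)
qed

section \<open>Continuity of the homotopy\<close>

text \<open>\<open>Q\<close> constrains the exponents of s, q and y of every coefficient in t;
  valuation bounds and bounds on the exponent of y become instances of one notion.\<close>

definition supp_in :: "(nat \<Rightarrow> int \<Rightarrow> int \<Rightarrow> bool) \<Rightarrow> cfls2 fps poly \<Rightarrow> bool" where
  "supp_in Q p \<longleftrightarrow> (\<forall>i k N n. coeff p i $ k $$ N $$ n \<noteq> 0 \<longrightarrow> Q k N n)"

lemma cfls2_mult_nonzeroD:
  fixes x y :: cfls2
  assumes "(x * y) $$ N $$ n \<noteq> 0"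
  shows "\<exists>i k. x $$ i $$ k \<noteq> 0 \<and> y $$ (N - i) $$ (n - k) \<noteq> 0"
proof -
  have "(\<Sum>i=fls_subdegree x..N - fls_subdegree y. (x $$ i * y $$ (N - i)) $$ n) \<noteq> 0"
    using assms by (simp add: fls_times_nth(2)[of x y N] fls_sum_nth)
  then obtain i where "(x $$ i * y $$ (N - i)) $$ n \<noteq> 0" by (meson sum.neutral)
  then show ?thesis using fls_mult_nth_nonzeroD by blast
qed

lemma supp_in_mult:
  assumes "supp_in Q p" "supp_in R r"
    and QR: "\<And>k N n k' N' n'. Q k N n \<Longrightarrow> R k' N' n' \<Longrightarrow> S (k + k') (N + N') (n + n')"
  shows "supp_in S (p * r)"
  unfolding supp_in_def
proof (intro allI impI)
  fix i k N n assume "coeff (p * r) i $ k $$ N $$ n \<noteq> 0"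
  then have "(\<Sum>j\<le>i. (\<Sum>l=0..k. (coeff p j $ l * coeff r (i - j) $ (k - l)) $$ N $$ n)) \<noteq> 0"
    by (simp add: coeff_mult fps_sum_nth fps_mult_nth fls_sum_nth)
  then obtain j where "(\<Sum>l=0..k. (coeff p j $ l * coeff r (i - j) $ (k - l)) $$ N $$ n) \<noteq> 0"
    by (meson sum.neutral)
  then obtain l where l: "l \<in> {0..k}" "(coeff p j $ l * coeff r (i - j) $ (k - l)) $$ N $$ n \<noteq> 0"
    by (meson sum.neutral)
  then obtain M m where "coeff p j $ l $$ M $$ m \<noteq> 0" "coeff r (i - j) $ (k - l) $$ (N - M) $$ (n - m) \<noteq> 0"
    using cfls2_mult_nonzeroD by blast
  then have "Q l M m" "R (k - l) (N - M) (n - m)" using assms(1,2) unfolding supp_in_def by blast+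
  from QR[OF this] show "S k N n" using l(1) by simp
qed

lemma supp_in_0 [simp]: "supp_in Q 0"
  by (simp add: supp_in_def)

lemma supp_in_add:
  assumes "supp_in Q p" "supp_in Q r"
  shows "supp_in Q (p + r)"
  unfolding supp_in_def
proof (intro allI impI)
  fix i k N n assume "coeff (p + r) i $ k $$ N $$ n \<noteq> 0"
  then have "coeff p i $ k $$ N $$ n \<noteq> 0 \<or> coeff r i $ k $$ N $$ n \<noteq> 0" by auto
  then show "Q k N n" using assms unfolding supp_in_def by blast
qed

lemma supp_in_uminus: "supp_in Q p \<Longrightarrow> supp_in Q (- p)"
  by (simp add: supp_in_def)

lemma supp_in_diff: "supp_in Q p \<Longrightarrow> supp_in Q r \<Longrightarrow> supp_in Q (p - r)"
  using supp_in_add[of Q p "- r"] by (simp add: supp_in_uminus)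

lemma supp_in_sum: "(\<And>i. i \<in> I \<Longrightarrow> supp_in Q (f i)) \<Longrightarrow> supp_in Q (\<Sum>i\<in>I. f i)"
  by (induction I rule: infinite_finite_induct) (auto intro: supp_in_add)

lemma supp_in_of_int: "supp_in Q p \<Longrightarrow> supp_in Q (of_int m * p)"
proof -
  assume p: "supp_in Q p"
  have n: "supp_in Q (of_nat n * p)" for n
    by (induction n) (auto simp: distrib_right p intro: supp_in_add)
  show ?thesis
    by (cases m rule: int_cases2) (use n in \<open>auto intro: supp_in_uminus\<close>)
qed

lemma supp_in_mono: "supp_in Q p \<Longrightarrow> (\<And>k N n. Q k N n \<Longrightarrow> R k N n) \<Longrightarrow> supp_in R p"
  by (auto simp: supp_in_def)

definition mat_supp_in :: "(nat \<Rightarrow> int \<Rightarrow> int \<Rightarrow> bool) \<Rightarrow> cfls2 fps poly mat22 \<Rightarrow> bool" where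
  "mat_supp_in Q A \<longleftrightarrow> supp_in Q (mat_11 A) \<and> supp_in Q (mat_12 A) \<and> supp_in Q (mat_21 A) \<and> supp_in Q (mat_22 A)"

lemma mat_supp_in_mult:
  assumes "mat_supp_in Q A" "mat_supp_in R B"
    and QR: "\<And>k N n k' N' n'. Q k N n \<Longrightarrow> R k' N' n' \<Longrightarrow> S (k + k') (N + N') (n + n')"
  shows "mat_supp_in S (A * B)"
  using assms(1,2) unfolding mat_supp_in_def
  by (auto intro!: supp_in_add intro: supp_in_mult[where Q = Q and R = R] QR)

lemma mat_supp_in_add: "mat_supp_in Q A \<Longrightarrow> mat_supp_in Q B \<Longrightarrow> mat_supp_in Q (A + B)"
  by (auto simp: mat_supp_in_def intro: supp_in_add)

lemma mat_supp_in_mono: "mat_supp_in Q p \<Longrightarrow> (\<And>k N n. Q k N n \<Longrightarrow> R k N n) \<Longrightarrow> mat_supp_in R p"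
  unfolding mat_supp_in_def by (auto intro: supp_in_mono)

definition val_ge :: "ereal \<Rightarrow> nat \<Rightarrow> int \<Rightarrow> int \<Rightarrow> bool" where
  "val_ge B k N n \<longleftrightarrow> B \<le> ereal (real k + of_int N / 2)"

definition exp_ge :: "int \<Rightarrow> nat \<Rightarrow> int \<Rightarrow> int \<Rightarrow> bool" where
  "exp_ge e k N n \<longleftrightarrow> e \<le> n"

lemma val_ge_add: "val_ge B k N n \<Longrightarrow> val_ge C k' N' n' \<Longrightarrow> val_ge (B + C) (k + k') (N + N') (n + n')"
  unfolding val_ge_def using add_mono[of B "ereal (real k + of_int N / 2)" C "ereal (real k' + of_int N' / 2)"]
  by (simp add: add_divide_distrib algebra_simps)

lemma exp_ge_add: "exp_ge e k N n \<Longrightarrow> exp_ge e' k' N' n' \<Longrightarrow> exp_ge (e + e') (k + k') (N + N') (n + n')"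
  by (simp add: exp_ge_def)

definition regular :: "int \<Rightarrow> cfls2 \<Rightarrow> bool" where
  "regular e x \<longleftrightarrow> (\<forall>N n. x $$ N $$ n \<noteq> 0 \<longrightarrow> 0 \<le> N \<and> e \<le> n)"

lemma regular_mult: "regular e x \<Longrightarrow> regular f y \<Longrightarrow> regular (e + f) (x * y)"
  unfolding regular_def using cfls2_mult_nonzeroD[of x y] by fastforce

lemma regular_qy: "0 \<le> N \<Longrightarrow> regular n (qy N n)"
  by (auto simp: regular_def qy_nth split: if_splits)

lemma regular_diag: "(\<And>m. m < 0 \<Longrightarrow> f $$ m = 0) \<Longrightarrow> regular 0 (diag f)"
  unfolding regular_def diag_nth by (auto split: if_splits simp: not_less[symmetric])

lemma regular_mono: "regular e x \<Longrightarrow> f \<le> e \<Longrightarrow> regular f x"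
  unfolding regular_def by force

text \<open>At each end one of the factors of \<open>G21 d * H12 d\<close> carries a positive power
  of y. This exponent 1 in \<open>regular_K\<close> removes scalar words from the constant
  term.\<close>

lemma regular_H12: "regular 0 (H12 d)" and regular_H21: "regular 0 (H21 d)"
  and regular_G21: "regular 0 (G21 d)" and regular_K: "regular 1 (G21 d * H12 d)"
proof -
  have s: "regular 0 (diag inv_sq)" and l: "regular 0 (diag inv_lin)"
    by (auto intro: regular_diag inv_sq_neg inv_lin_neg)
  have 2: "regular 2 (qy 1 2 * diag inv_sq)" and 1: "regular 1 (qy 0 1 * diag inv_lin)"
    using regular_mult[OF regular_qy s, of 1 2] regular_mult[OF regular_qy l, of 0 1] by simp_all
  show H: "regular 0 (H12 d)" "regular 0 (H21 d)" "regular 0 (G21 d)"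
    using s l regular_mono[OF 2, of 0] regular_mono[OF 1, of 0] by (simp_all add: H12_def H21_def G21_def)
  show "regular 1 (G21 d * H12 d)"
    using regular_mult[OF 1 s] regular_mono[OF regular_mult[OF l 2], of 1] by (cases d) (simp_all add: H12_def G21_def)
qed

definition reg_ge :: "int \<Rightarrow> nat \<Rightarrow> int \<Rightarrow> int \<Rightarrow> bool" where
  "reg_ge e k N n \<longleftrightarrow> 0 \<le> N \<and> e \<le> n"

lemma supp_in_cst: "regular e x \<Longrightarrow> supp_in (reg_ge e) (cst x)"
  unfolding supp_in_def cst_def regular_def reg_ge_def by (auto simp: coeff_pCons split: nat.splits if_splits)

lemma supp_in_1: "0 \<ge> e \<Longrightarrow> supp_in (reg_ge e) 1"
  using supp_in_cst[of e 1] regular_qy[of 0 0] regular_mono[of 0 1 e] by (simp add: cst_simps)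

lemma supp_in_tvar: "supp_in (reg_ge 0) tvar"
  unfolding supp_in_def tvar_def reg_ge_def by (auto simp: coeff_pCons split: nat.splits if_splits)

lemma H_mat_supp: "mat_supp_in (reg_ge 0) (H_mat d)"
proof -
  have t: "supp_in (reg_ge 0) (tvar * x)" if "supp_in (reg_ge 0) x" for x
    by (rule supp_in_mult[OF supp_in_tvar that]) (auto simp: reg_ge_def)
  show ?thesis
    unfolding mat_supp_in_def H_mat_def mat22.sel
    by (intro conjI supp_in_0 supp_in_add t supp_in_diff supp_in_cst regular_H12 regular_H21 regular_G21)
qed

lemma K_mat_supp: "mat_supp_in (reg_ge 1) (K_mat d)"
  using supp_in_cst[OF regular_K[of d]]
  by (simp add: mat_supp_in_def K_mat_def cst_simps supp_in_uminus)

lemma ends_pmat_val: "mat_supp_in (val_ge (ends_val a)) (ends_pmat d a)"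
proof -
  have *: "ends_val a \<le> ereal (real k + of_int N / 2)"
    if "X \<in> {mat_11, mat_12, mat_21, mat_22}" "X (emat d (a $ k)) $$ N $$ n \<noteq> 0" for X k N n
  proof -
    have "ends_val a \<le> ereal (real k) + endo_val (a $ k)" unfolding ends_val_def by (rule INF_lower) simp
    also have "\<dots> \<le> ereal (real k) + ereal (of_int N / 2)"
      using endo_val_le_emat[OF that] by (intro add_left_mono)
    finally show ?thesis by simp
  qed
  have "supp_in (val_ge (ends_val a)) [:Y:]"
    if "X \<in> {mat_11, mat_12, mat_21, mat_22}" "\<And>k. Y $ k = X (emat d (a $ k))" for X Y
    unfolding supp_in_def val_ge_def
  proof (intro allI impI)
    fix i k N n assume "coeff [:Y:] i $ k $$ N $$ n \<noteq> 0"
    then have "Y $ k $$ N $$ n \<noteq> 0" by (cases i) simp_all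
    then show "ends_val a \<le> ereal (real k + of_int N / 2)" using *[OF that(1)] that(2) by simp
  qed
  note h = this
  show ?thesis
    unfolding mat_supp_in_def ends_pmat_def map22_sel
    using h[of mat_11 "mat_11 (ends_mat d a)"] h[of mat_12 "mat_12 (ends_mat d a)"]
      h[of mat_21 "mat_21 (ends_mat d a)"] h[of mat_22 "mat_22 (ends_mat d a)"]
    by (simp add: ends_mat_sel del: emat_sel)
qed

lemma one_supp: "mat_supp_in (reg_ge 0) 1"
  by (simp add: mat_supp_in_def supp_in_1)

lemma wprod_val:
  "mat_supp_in (val_ge (word_val w)) (side.wprod d w)" "mat_supp_in (val_ge (word_val w)) (side.wprod_K d w)"
proof -
  have r: "val_ge 0 k N n" if "reg_ge e k N n" for k N n e
    using that by (simp add: val_ge_def reg_ge_def zero_ereal_def)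
  have H: "mat_supp_in (val_ge 0) (H_mat d)" by (rule mat_supp_in_mono[OF H_mat_supp r])
  have K: "mat_supp_in (val_ge 0) (K_mat d)" by (rule mat_supp_in_mono[OF K_mat_supp r])
  have one: "mat_supp_in (val_ge 0) 1" by (rule mat_supp_in_mono[OF one_supp r])
  have step: "mat_supp_in (val_ge (word_val (a # w))) (ends_pmat d a * X * Y)"
    if "mat_supp_in (val_ge 0) X" "mat_supp_in (val_ge (word_val w)) Y" for a w X Y
  proof -
    have "mat_supp_in (val_ge (ends_val a + 0)) (ends_pmat d a * X)"
      by (rule mat_supp_in_mult[OF ends_pmat_val that(1)]) (rule val_ge_add)
    then have "mat_supp_in (val_ge (ends_val a + 0 + word_val w)) (ends_pmat d a * X * Y)"
      by (rule mat_supp_in_mult[OF _ that(2)]) (rule val_ge_add)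
    then show ?thesis by (simp add: word_val_def)
  qed
  show 1: "mat_supp_in (val_ge (word_val w)) (side.wprod d w)" for w
    by (induction w) (use one step[OF H] in \<open>simp_all add: word_val_def\<close>)
  show "mat_supp_in (val_ge (word_val w)) (side.wprod_K d w)"
  proof (induction w)
    case (Cons a w)
    then show ?case using step[OF K 1] step[OF H Cons] by (simp add: mat_supp_in_add)
  qed (simp add: mat_supp_in_def)
qed

lemma supp_in_word_prim: "supp_in (val_ge (word_val w)) (word_prim d w)"
  using wprod_val(2)[of w d] by (auto simp: mat_supp_in_def word_prim_def trace22_def intro: supp_in_add)

text \<open>Scalars are constant in y, the contractions have no negative powers of y, and the single
  \<open>K\<close> raises the exponent by one, so the constant term in y is zero.\<close>

lemma word_prim_scalars:
  assumes "\<forall>a\<in>set w. mat_supp_in (exp_ge 0) (ends_pmat d a)"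
  shows "supp_in (exp_ge 1) (word_prim d w)"
proof -
  have H: "mat_supp_in (exp_ge 0) (H_mat d)" by (rule mat_supp_in_mono[OF H_mat_supp]) (simp add: reg_ge_def exp_ge_def)
  have K: "mat_supp_in (exp_ge 1) (K_mat d)" by (rule mat_supp_in_mono[OF K_mat_supp]) (simp add: reg_ge_def exp_ge_def)
  have one: "mat_supp_in (exp_ge 0) 1" by (rule mat_supp_in_mono[OF one_supp]) (simp add: reg_ge_def exp_ge_def)
  have step: "mat_supp_in (exp_ge (e + f)) (ends_pmat d a * X * Y)"
    if "mat_supp_in (exp_ge 0) (ends_pmat d a)" "mat_supp_in (exp_ge e) X" "mat_supp_in (exp_ge f) Y" for a e f X Y
  proof -
    have "mat_supp_in (exp_ge (0 + e)) (ends_pmat d a * X)"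
      by (rule mat_supp_in_mult[OF that(1,2)]) (rule exp_ge_add)
    then have "mat_supp_in (exp_ge (0 + e + f)) (ends_pmat d a * X * Y)"
      by (rule mat_supp_in_mult[OF _ that(3)]) (rule exp_ge_add)
    then show ?thesis by simp
  qed
  have "mat_supp_in (exp_ge 0) (side.wprod d w) \<and> mat_supp_in (exp_ge 1) (side.wprod_K d w)"
    using assms
  proof (induction w)
    case Nil
    show ?case using one by (simp add: mat_supp_in_def)
  next
    case (Cons a w)
    have a: "mat_supp_in (exp_ge 0) (ends_pmat d a)" using Cons.prems by simp
    have IH: "mat_supp_in (exp_ge 0) (side.wprod d w)" "mat_supp_in (exp_ge 1) (side.wprod_K d w)"
      using Cons by auto
    show ?case using step[OF a H IH(1)] step[OF a K IH(1)] step[OF a H IH(2)] by (simp add: mat_supp_in_add)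
  qed
  then show ?thesis by (auto simp: mat_supp_in_def word_prim_def trace22_def intro: supp_in_add)
qed

lemma ends_pmat_scalar_supp: "mat_supp_in (exp_ge 0) (ends_pmat d (ends_scalar r))"
  unfolding mat_supp_in_def supp_in_def exp_ge_def ends_pmat_def ends_mat_scalar
  by (auto simp: coeff_pCons emb_nth split: nat.splits if_splits)

text \<open>The difference of the values at 1 and 0 sums the positive coefficients of
  \<open>p\<close>, which are those of the derivative up to nonzero integer factors.\<close>

lemma poly_difference_supp:
  assumes "supp_in Q (pderiv p)" "(poly p 1 - poly p 0) $ k $$ N $$ n \<noteq> 0"
  shows "Q k N n"
proof -
  have "poly p 1 = (\<Sum>i\<le>degree p. coeff p i)" by (simp add: poly_altdef)
  also have "\<dots> = coeff p 0 + (\<Sum>i<degree p. coeff p (Suc i))" by (rule sum.atMost_shift)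
  finally have "(\<Sum>i<degree p. coeff p (Suc i) $ k $$ N $$ n) \<noteq> 0"
    using assms(2) by (simp add: poly_0_coeff_0 fps_sum_nth fls_sum_nth)
  then obtain i where i: "coeff p (Suc i) $ k $$ N $$ n \<noteq> 0" by (meson sum.neutral)
  have c: "(of_nat m * f) $ k = of_nat m * f $ k" for m and f :: "cfls2 fps"
    by (metis fps_mult_left_const_nth fps_of_nat)
  have "coeff (pderiv p) i $ k $$ N $$ n = of_nat (Suc i) * coeff p (Suc i) $ k $$ N $$ n"
    unfolding coeff_pderiv c by (simp add: fls_of_nat fls_const_mult_nth del: of_nat_Suc)
  then have "coeff (pderiv p) i $ k $$ N $$ n \<noteq> 0" using i by (simp del: of_nat_Suc)
  then show ?thesis using assms(1) unfolding supp_in_def by blast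
qed

section \<open>The limit of \<open>\<Theta>\<close> on the corrected exponential\<close>

lemma ends_scalar_const: "ends_scalar (fps_const r) = fps_const (endo_scalar (s_const r))"
proof (rule fps_ext)
  fix k
  have "endo_scalar 0 = 0" by (intro en_eqI) simp_all
  then show "ends_scalar (fps_const r) $ k = fps_const (endo_scalar (s_const r)) $ k"
    by (cases k) (simp_all add: ends_scalar_def s_const_hom(4))
qed

lemma endo_hom_scalar: "s_hom i f \<Longrightarrow> endo_hom j \<phi> \<Longrightarrow> endo_hom (i + j) (endo_scalar f * \<phi>)"
  using s_hom_mult[of i f j "en11 \<phi>"] s_hom_mult[of i f "j + 1" "en12 \<phi>"]
    s_hom_mult[of i f "j - 1" "en21 \<phi>"] s_hom_mult[of i f j "en22 \<phi>"]
  by (simp add: endo_hom_iff en_mult add.assoc add_diff_eq)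

lemma ends_hom_const_mult: "ends_hom j b \<Longrightarrow> ends_hom j (ends_scalar (fps_const (fls_const x)) * b)"
  using endo_hom_scalar[of 0 "s_const (fls_const x)" j] s_hom_const[of 0 "fls_const x"]
  by (simp add: ends_scalar_const ends_hom_def nov_hom_def)

lemma ends_hom_1: "ends_hom 0 1"
proof -
  have "endo_hom 0 (1 $ k)" for k by (cases k) (simp_all add: endo_hom_iff s_hom_z)
  then show ?thesis by (simp add: ends_hom_def)
qed

definition beta :: "ends \<Rightarrow> bool \<Rightarrow> cfls2 fps" where
  "beta b d = mat_12 (ends_mat d b) * fps_const (G21 d)"

text \<open>A partial sum of - log (1 - beta).\<close>

definition log_sum :: "ends \<Rightarrow> bool \<Rightarrow> nat \<Rightarrow> cfls2 fps" where
  "log_sum b d n = (\<Sum>k\<in>{1..<n}. fps_const (emb (fls_const (1 / real k))) * beta b d ^ k)"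

lemma word_trace_exp:
  "chain_ext (word_trace d) (exp_chain b k) = word_trace d (if k = 0 then [1]
     else ends_scalar (fps_const (fls_const (1 / real k))) * b # replicate (k - 1) b)"
  by (simp add: exp_chain_def)

lemma word_trace_exp_0:
  "poly (chain_ext (word_trace d) (exp_chain b k)) 0
     = (if k = 0 then 0 else fps_const (emb (fls_const (1 / real k))) * beta b d ^ k)"
proof (cases k)
  case 0
  then show ?thesis by (simp add: word_trace_exp word_trace_0)
next
  case (Suc m)
  have "Abs_fps (\<lambda>k. emb (fps_const r $ k)) = fps_const (emb r)" for r
    by (rule fps_ext) (simp add: emb_nth fls_eq_iff)
  then have "mat_12 (ends_mat d (ends_scalar (fps_const r) * b)) = fps_const (emb r) * mat_12 (ends_mat d b)" for r
    by (simp add: ends_mat_mult ends_mat_scalar)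
  moreover have "prod_list (map f (replicate m x)) = f x ^ m" for f :: "ends \<Rightarrow> cfls2 fps" and x
    by (induction m) simp_all
  ultimately show ?thesis
    unfolding word_trace_exp by (simp add: Suc word_trace_0 beta_def mult_ac)
qed

lemma word_trace_scalar_0:
  assumes "w \<noteq> []" "\<exists>a\<in>set w. a \<in> ends_scalar ` Rs"
  shows "poly (word_trace d w) 0 = 0"
proof -
  have "0 \<in> set (map (\<lambda>a. mat_12 (ends_mat d a) * fps_const (G21 d)) w)"
    using assms(2) by (force simp: ends_mat_scalar)
  then show ?thesis unfolding word_trace_0[OF assms(1)] by (metis prod_list_zero_iff)
qed

text \<open>At t = 0 the correction contributes nothing and the exponential contributes
  \<open>log_sum\<close>. The change up to t = 1 is \<open>word_prim\<close> of the boundary, where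
  cyclic differences and tensor relations give 0, scalar words have no constant term in y, and the
  rest has valuation at least \<open>B\<close>.\<close>

theorem Theta_partial_sums:
  assumes b: "ends_hom 1 b" and Y: "is_correction b Y"
  shows "eventually (\<lambda>n. \<forall>j N. real j + of_int N / 2 < B \<longrightarrow>
     (\<Sum>k<n. Theta (exp_chain b k - Y k)) $ j $$ N
       = - (log_sum b True n $ j $$ N $$ 0 - log_sum b False n $ j $$ N $$ 0)) sequentially"
proof -
  obtain Z U where Z: "in_C_lambda_Rs Z" and U: "is_chain U"
    and null: "chain_null (\<lambda>k. (d_cc (Y k) - d_cc (exp_chain b k) - Z k) - (U k - cyc_t (U k)))"
    using Y unfolding is_correction_def cyclic_null_def by blast
  have RY: "in_R_lambda Y" using Y by (simp add: is_correction_def)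
  have Yw: "homog_word w" "\<exists>a\<in>set w. a \<in> ends_scalar ` Rs" if "w \<in> Poly_Mapping.keys (Y k)" for w k
    using RY that is_word_homog_word by (auto simp: in_R_lambda_def is_chain_def)
  have Ew: "homog_word w" if "w \<in> Poly_Mapping.keys (exp_chain b k)" for w k
  proof -
    have "w = (if k = 0 then [1] else ends_scalar (fps_const (fls_const (1 / real k))) * b # replicate (k - 1) b)"
      using that by (auto simp: exp_chain_def split: if_splits)
    moreover have "homog 1" "homog b" "homog (ends_scalar (fps_const (fls_const x)) * b)" for x
      using b ends_hom_1 ends_hom_const_mult by (auto simp: homog_def)
    ultimately show ?thesis by (auto simp: homog_word_def)
  qed
  let ?X = "\<lambda>k. exp_chain b k - Y k"
  have Xw: "homog_word w" if "w \<in> Poly_Mapping.keys (?X k)" for w k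
    using that Poly_Mapping.keys_diff[of "exp_chain b k" "Y k"] Ew Yw(1) by blast
  define PX where "PX d n = chain_ext (word_trace d) (\<Sum>k<n. ?X k)" for d n
  have PX0: "poly (PX d n) 0 = log_sum b d n" for d n
  proof -
    have "poly (chain_ext (word_trace d) (Y k)) 0 = 0" for k
    proof -
      have "poly (word_trace d w) 0 = 0" if "w \<in> Poly_Mapping.keys (Y k)" for w
        using word_trace_scalar_0[of w d] Yw[OF that] by (simp add: homog_word_def)
      then show ?thesis by (simp add: chain_ext_def poly_sum)
    qed
    then have "poly (PX d n) 0 = (\<Sum>k<n. if k = 0 then 0 else fps_const (emb (fls_const (1 / real k))) * beta b d ^ k)"
      by (simp add: PX_def chain_ext_sum chain_ext_diff poly_sum word_trace_exp_0)
    also have "\<dots> = log_sum b d n"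
      unfolding log_sum_def by (rule sum.mono_neutral_cong_right) auto
    finally show ?thesis .
  qed
  have Th: "(\<Sum>k<n. Theta (?X k)) $ j = - (ct (poly (PX True n) 1 $ j) - ct (poly (PX False n) 1 $ j))" for n j
  proof -
    have cs: "ct (\<Sum>k\<in>A. f k) = (\<Sum>k\<in>A. ct (f k))" for A and f :: "nat \<Rightarrow> cfls2"
    proof (induction A rule: infinite_finite_induct)
      case (insert x F)
      then show ?case by (simp add: ct_add)
    qed (auto intro: fls_eqI simp: ct_nth)
    have "\<forall>w\<in>Poly_Mapping.keys (?X k). homog_word w" for k using Xw by blast
    then have "(\<Sum>k<n. Theta (?X k)) $ j = (\<Sum>k<n. - (ct (poly (chain_ext (word_trace True) (?X k)) 1 $ j)
        - ct (poly (chain_ext (word_trace False) (?X k)) 1 $ j)))"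
      by (simp add: fps_sum_nth Theta_nth)
    moreover have "ct (poly (PX d n) 1 $ j) = (\<Sum>k<n. ct (poly (chain_ext (word_trace d) (?X k)) 1 $ j))" for d
      unfolding PX_def chain_ext_sum poly_sum fps_sum_nth cs ..
    ultimately show ?thesis by (simp only: sum_subtractf sum_negf)
  qed
  have pd: "pderiv (PX d n) = (\<Sum>k<n. chain_ext (word_prim d) (d_cc (exp_chain b k)) - chain_ext (word_prim d) (d_cc (Y k)))" for d n
  proof -
    have s: "pderiv (\<Sum>k\<in>A. f k) = (\<Sum>k\<in>A. pderiv (f k))" for A and f :: "nat \<Rightarrow> cfls2 fps poly"
      by (induction A rule: infinite_finite_induct) (auto simp: pderiv_add)
    show ?thesis
      unfolding PX_def chain_ext_sum chain_ext_diff s pderiv_diff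
      using Ew Yw(1) by (intro sum.cong refl arg_cong2[of _ _ _ _ "(-)"] pderiv_chain_trace) blast+
  qed
  have "eventually (\<lambda>n. \<exists>y\<in>words_ge B.
      (\<Sum>k<n. (d_cc (Y k) - d_cc (exp_chain b k) - Z k) - (U k - cyc_t (U k))) - y \<in> tensor_relations) sequentially"
    using null unfolding chain_null_def by blast
  then show ?thesis
  proof (rule eventually_mono, intro allI impI)
    fix n j N
    assume "\<exists>y\<in>words_ge B.
      (\<Sum>k<n. (d_cc (Y k) - d_cc (exp_chain b k) - Z k) - (U k - cyc_t (U k))) - y \<in> tensor_relations"
      and small: "real j + of_int N / 2 < B"
    then obtain y where y: "y \<in> words_ge B" and
      rel: "(\<Sum>k<n. (d_cc (Y k) - d_cc (exp_chain b k) - Z k) - (U k - cyc_t (U k))) - y \<in> tensor_relations"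
      by blast
    \<comment> \<open>Only the constant term in y is controlled: scalar words may have small
      valuation away from it.\<close>
    let ?Q = "\<lambda>k N n. n = 0 \<longrightarrow> val_ge (ereal B) k N n"
    have sd: "supp_in ?Q (pderiv (PX d n))" for d
    proof -
      have u: "chain_ext (word_prim d) (cyc_t (U k)) = chain_ext (word_prim d) (U k)" for k
        using side.tr_wprod_K_cyclic[of "U k" d] U unfolding word_prim_def[abs_def] is_chain_def by blast
      have "chain_ext (word_prim d) ((\<Sum>k<n. (d_cc (Y k) - d_cc (exp_chain b k) - Z k) - (U k - cyc_t (U k))) - y) = 0"
        using side.tr_wprod_K_tensor[OF rel, of d] unfolding word_prim_def[abs_def] .
      then have "(\<Sum>k<n. (chain_ext (word_prim d) (d_cc (Y k)) - chain_ext (word_prim d) (d_cc (exp_chain b k))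
          - chain_ext (word_prim d) (Z k)) - (chain_ext (word_prim d) (U k) - chain_ext (word_prim d) (U k)))
          - chain_ext (word_prim d) y = 0"
        unfolding chain_ext_diff chain_ext_sum u .
      then have "(\<Sum>k<n. chain_ext (word_prim d) (d_cc (Y k))) - (\<Sum>k<n. chain_ext (word_prim d) (d_cc (exp_chain b k)))
          - (\<Sum>k<n. chain_ext (word_prim d) (Z k)) = chain_ext (word_prim d) y"
        by (simp add: sum_subtractf)
      then have "pderiv (PX d n) = - (chain_ext (word_prim d) y + (\<Sum>k<n. chain_ext (word_prim d) (Z k)))"
        unfolding pd sum_subtractf by (simp add: algebra_simps)
      moreover have "supp_in ?Q (chain_ext (word_prim d) y)"
        unfolding chain_ext_def
      proof (intro supp_in_sum supp_in_of_int)
        fix w assume "w \<in> Poly_Mapping.keys y"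
        then have "ereal B \<le> word_val w" using y by (auto simp: words_ge_def)
        then show "supp_in ?Q (word_prim d w)"
          by (intro supp_in_mono[OF supp_in_word_prim]) (metis order_trans val_ge_def)
      qed
      moreover have "supp_in ?Q (chain_ext (word_prim d) (Z k))" for k
        unfolding chain_ext_def
      proof (intro supp_in_sum supp_in_of_int)
        fix w assume "w \<in> Poly_Mapping.keys (Z k)"
        then obtain r l where w: "w = ends_scalar r # replicate l 1" using Z unfolding in_C_lambda_Rs_def by blast
        have "mat_supp_in (exp_ge 0) (ends_pmat d a)" if "a \<in> set w" for a
        proof -
          have "mat_supp_in (exp_ge 0) 1"
            by (rule mat_supp_in_mono[OF one_supp]) (simp add: reg_ge_def exp_ge_def)
          moreover have "a = ends_scalar r \<or> a = 1" using that w by auto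
          ultimately show ?thesis using ends_pmat_scalar_supp by auto
        qed
        then show "supp_in ?Q (word_prim d w)"
          by (intro supp_in_mono[OF word_prim_scalars]) (auto simp: exp_ge_def)
      qed
      ultimately show ?thesis
        by (simp only: supp_in_uminus supp_in_add supp_in_sum)
    qed
    have "(poly (PX d n) 1 - poly (PX d n) 0) $ j $$ N $$ 0 = 0" for d
    proof (rule ccontr)
      assume "(poly (PX d n) 1 - poly (PX d n) 0) $ j $$ N $$ 0 \<noteq> 0"
      from poly_difference_supp[OF sd this] show False using small by (simp add: val_ge_def)
    qed
    then have "poly (PX d n) 1 $ j $$ N $$ 0 = log_sum b d n $ j $$ N $$ 0" for d
      by (simp add: PX0)
    then show "(\<Sum>k<n. Theta (exp_chain b k - Y k)) $ j $$ N
       = - (log_sum b True n $ j $$ N $$ 0 - log_sum b False n $ j $$ N $$ 0)"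
      by (simp add: Th ct_nth)
  qed
qed

section \<open>Coefficientwise homomorphisms of power series\<close>

definition fps_map :: "('a \<Rightarrow> 'b) \<Rightarrow> 'a fps \<Rightarrow> 'b fps" where
  "fps_map f x = Abs_fps (\<lambda>k. f (x $ k))"

lemma fps_map_nth [simp]: "fps_map f x $ k = f (x $ k)"
  by (simp add: fps_map_def)

definition ring_map :: "('a::comm_ring_1 \<Rightarrow> 'b::comm_ring_1) \<Rightarrow> bool" where
  "ring_map f \<longleftrightarrow> (\<forall>x y. f (x + y) = f x + f y) \<and> (\<forall>x y. f (x * y) = f x * f y) \<and> f 1 = 1"

context
  fixes f :: "'a::comm_ring_1 \<Rightarrow> 'b::comm_ring_1"
  assumes f: "ring_map f"
begin

lemma ring_map_0: "f 0 = 0"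
  using f unfolding ring_map_def by (metis add_cancel_right_right add_0)

lemma ring_map_sum: "f (\<Sum>i\<in>I. g i) = (\<Sum>i\<in>I. f (g i))"
  by (induction I rule: infinite_finite_induct) (use f ring_map_0 in \<open>auto simp: ring_map_def\<close>)

lemma ring_map_of_nat: "f (of_nat n * x) = of_nat n * f x"
  by (induction n) (use f ring_map_0 in \<open>auto simp: ring_map_def distrib_right\<close>)

lemma fps_map_add: "fps_map f (x + y) = fps_map f x + fps_map f y"
  using f by (intro fps_ext) (simp add: ring_map_def)

lemma fps_map_diff: "fps_map f (x - y) = fps_map f x - fps_map f y"
  using fps_map_add[of "x - y" y] by (simp add: algebra_simps)

lemma fps_map_mult: "fps_map f (x * y) = fps_map f x * fps_map f y"
  using f by (intro fps_ext) (simp add: fps_mult_nth ring_map_sum ring_map_def)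

lemma fps_map_deriv: "fps_map f (fps_deriv x) = fps_deriv (fps_map f x)"
  by (intro fps_ext) (simp add: ring_map_of_nat del: of_nat_Suc of_nat_add)

lemma fps_map_const: "fps_map f (fps_const a) = fps_const (f a)"
  by (intro fps_ext) (simp add: ring_map_0)

lemma fps_map_1: "fps_map f 1 = 1"
  using fps_map_const[of 1] f by (simp add: ring_map_def)

end

lemma ring_map_expand: "ring_map (expand d)"
  by (simp add: ring_map_def expand_add expand_mult)

lemma ring_map_scal: "ring_map (\<lambda>x. s_const (fls_const x))"
proof -
  have "fls_const (x + y) = (fls_const x + fls_const y :: real fls)" for x y by (rule fls_eqI) simp
  then show ?thesis by (simp add: ring_map_def s_const_hom flip: s_const_hom(2))
qed

lemma ring_map_emb: "ring_map emb"
  by (simp add: ring_map_def emb_add emb_mult)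

section \<open>The equation for a bounding cochain\<close>

lemma en_sum:
  "en11 (\<Sum>i\<in>I. \<phi> i) = (\<Sum>i\<in>I. en11 (\<phi> i))" "en12 (\<Sum>i\<in>I. \<phi> i) = (\<Sum>i\<in>I. en12 (\<phi> i))"
  "en21 (\<Sum>i\<in>I. \<phi> i) = (\<Sum>i\<in>I. en21 (\<phi> i))" "en22 (\<Sum>i\<in>I. \<phi> i) = (\<Sum>i\<in>I. en22 (\<phi> i))"
  by (induction I rule: infinite_finite_induct) (auto simp: en_add)

text \<open>\<open>deg b\<close> is a choice. Were it even, each coefficient would be both diagonal
  and off-diagonal, so \<open>b\<close> would be zero and the formula trivial.\<close>

lemma delta_odd:
  assumes "ends_hom 1 b"
  shows "delta b = fps_const D_M * b + b * fps_const D_M"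
proof -
  have "homog b" using assms by (auto simp: homog_def)
  then have dg: "ends_hom (deg b) b" by (rule ends_hom_deg)
  show ?thesis
  proof (cases "even (deg b)")
    case True
    have "b $ k = 0" for k
    proof -
      have "endo_hom 1 (b $ k)" "endo_hom (deg b) (b $ k)" using assms dg by (simp_all add: ends_hom_def)
      then show ?thesis using endo_hom_parity(1)[of "deg b" "b $ k"] endo_hom_parity(2)[of 1 "b $ k"] True
        by (intro en_eqI) simp_all
    qed
    then have "b = 0" by (intro fps_ext) simp
    then show ?thesis by (simp add: delta_def)
  next
    case False
    then show ?thesis by (simp add: delta_def sign_def)
  qed
qed

definition off_P :: "ends \<Rightarrow> sring fps" where
  "off_P b = fps_const (s_const Thalf + z1) - fps_map en12 b"

definition off_Q :: "ends \<Rightarrow> sring fps" where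
  "off_Q b = fps_const (1 - s_const (inverse Thalf) * z0) - fps_map en21 b"

text \<open>This is the upper left entry of (D - b)^2 = W - c; both diagonal entries of D - b
  vanish.\<close>

lemma factorization:
  assumes b: "ends_hom 1 b" and c: "delta b - b * b = ends_scalar c"
  shows "off_P b * off_Q b = fps_const (z1 - z0) - fps_map s_const c"
proof (rule fps_ext)
  fix k
  let ?p = "s_const Thalf + z1" and ?q = "1 - s_const (inverse Thalf) * z0"
  have b0: "en11 (b $ i) = 0" "en22 (b $ i) = 0" for i
    using endo_hom_parity(2)[of 1 "b $ i"] b by (simp_all add: ends_hom_def)
  have "en11 ((delta b - b * b) $ k) = ?p * en21 (b $ k) + en12 (b $ k) * ?q
      - (\<Sum>i=0..k. en12 (b $ i) * en21 (b $ (k - i)))"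
  proof -
    have "en11 (\<phi> - \<psi>) = en11 \<phi> - en11 \<psi>" for \<phi> \<psi>
      using en_add(1)[of "\<phi> - \<psi>" \<psi>] by simp
    moreover have "(delta b - b * b) $ k = D_M * b $ k + b $ k * D_M - (\<Sum>i=0..k. b $ i * b $ (k - i))"
      unfolding delta_odd[OF b] by (simp add: fps_mult_nth[of b b])
    ultimately show ?thesis by (simp add: en_add en_mult en_D en_sum b0)
  qed
  then have e: "s_const (c $ k) = ?p * en21 (b $ k) + en12 (b $ k) * ?q
      - (\<Sum>i=0..k. en12 (b $ i) * en21 (b $ (k - i)))"
    unfolding c by (simp add: ends_scalar_def)
  have pq: "?p * ?q = z1 - z0"
    using s_const_Thalf by (simp add: algebra_simps)
      (metis (no_types, lifting) mult.assoc mult.commute mult.left_commute mult_1)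
  have "(off_P b * off_Q b) $ k = (if k = 0 then ?p * ?q else 0) - ?p * en21 (b $ k) - en12 (b $ k) * ?q
      + (\<Sum>i=0..k. en12 (b $ i) * en21 (b $ (k - i)))"
  proof -
    have "off_P b * off_Q b = fps_const (?p * ?q) - fps_const ?p * fps_map en21 b - fps_map en12 b * fps_const ?q
        + fps_map en12 b * fps_map en21 b"
      by (simp add: off_P_def off_Q_def algebra_simps del: fps_const_mult flip: fps_const_mult)
    then show ?thesis by (simp add: fps_mult_nth[of "fps_map en12 b"])
  qed
  then show "(off_P b * off_Q b) $ k = (fps_const (z1 - z0) - fps_map s_const c) $ k"
    by (simp add: e pq)
qed

section \<open>Logarithmic derivatives\<close>

definition log_deriv :: "'a::field fps \<Rightarrow> 'a fps" where
  "log_deriv x = fps_deriv x * inverse x"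

lemma log_deriv_mult:
  assumes "x $ 0 \<noteq> 0" "y $ 0 \<noteq> (0 :: 'a::field)"
  shows "log_deriv (x * y) = log_deriv x + log_deriv y"
proof -
  have "inverse x * x = 1" "inverse y * y = 1" using assms by (auto intro: inverse_mult_eq_1)
  moreover have "fps_deriv (x * y) * (inverse x * inverse y)
      = (inverse x * x) * (fps_deriv y * inverse y) + (inverse y * y) * (fps_deriv x * inverse x)"
    by (simp add: algebra_simps)
  ultimately show ?thesis by (simp add: log_deriv_def fps_inverse_mult)
qed

lemma log_deriv_const:
  assumes "a \<noteq> (0 :: 'a::field)"
  shows "log_deriv (fps_const a * x) = log_deriv x"
proof -
  have "fps_deriv (fps_const a * x) * inverse (fps_const a * x)
      = (fps_const a * fps_const (inverse a)) * (fps_deriv x * inverse x)"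
    by (simp only: fps_inverse_mult fps_const_inverse[symmetric] fps_deriv_mult_const_left) (simp only: mult_ac)
  also have "fps_const a * fps_const (inverse a) = 1" using assms by simp
  finally show ?thesis by (simp add: log_deriv_def)
qed

definition ct_map :: "cfls2 fps \<Rightarrow> complex fls fps" where "ct_map x = fps_map ct x"

lemma ct_map_nth [simp]: "ct_map x $ k = ct (x $ k)"
  by (simp add: ct_map_def)

lemma ct_map_add: "ct_map (x + y) = ct_map x + ct_map y"
  by (rule fps_ext) (simp add: ct_add)

lemma ct_expand: "ct (expand d f) = nov_complex (s_coeff f 0 0)"
  by (rule fls_eqI) (simp add: ct_nth expand_ct nov_complex_nth)

text \<open>For a unit over \<open>S\<close> the logarithmic derivative is the expansion of a series
  over \<open>S\<close>, whose constant term in y agrees at both ends. The right side does not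
  depend on \<open>d\<close>, so such factors cancel in differences.\<close>

lemma ct_log_deriv_unit:
  assumes "x $ 0 * y = 1"
  shows "ct_map (log_deriv (fps_map (expand d) x)) = fps_map (\<lambda>f. nov_complex (s_coeff f 0 0)) (fps_deriv x * fps_right_inverse x y)"
proof -
  let ?m = "fps_map (expand d)"
  have "x * fps_right_inverse x y = 1" by (rule fps_right_inverse[OF assms])
  then have a: "?m x * ?m (fps_right_inverse x y) = 1"
    by (simp add: fps_map_mult[OF ring_map_expand, symmetric] fps_map_1[OF ring_map_expand])
  then have "?m x $ 0 \<noteq> 0" by (metis fps_mult_nth_0 fps_one_nth mult_zero_left zero_neq_one)
  then have i: "inverse (?m x) * ?m x = 1" by (rule inverse_mult_eq_1)
  have "inverse (?m x) = inverse (?m x) * (?m x * ?m (fps_right_inverse x y))" using a by simp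
  also have "\<dots> = (inverse (?m x) * ?m x) * ?m (fps_right_inverse x y)" by (simp only: mult.assoc)
  finally have "inverse (?m x) = ?m (fps_right_inverse x y)" unfolding i by simp
  then have "log_deriv (?m x) = ?m (fps_deriv x * fps_right_inverse x y)"
    unfolding log_deriv_def fps_map_mult[OF ring_map_expand] fps_map_deriv[OF ring_map_expand] by simp
  then show ?thesis by (intro fps_ext) (simp add: ct_expand)
qed

text \<open>1 - beta is \<open>off_P b\<close> normalised to 1 at s = 0 by a factor free of s, so
  both have the same logarithmic derivative. The truncated geometric sum errs by a multiple of
  beta^(n-1), hence not below s^(n-1).\<close>

lemma deriv_log_sum:
  assumes b0: "b $ 0 = 0" and k: "Suc k < n"
  shows "fps_deriv (log_sum b d n) $ k = - log_deriv (fps_map (expand d) (off_P b)) $ k"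
proof -
  let ?b = "beta b d"
  have beta: "1 - ?b = fps_const (qy (- kap d) 0 * G21 d) * fps_map (expand d) (off_P b)"
  proof (rule fps_ext)
    fix i
    have "qy (- kap d) 0 * expand d (s_const Thalf + z1) = D12 d"
      using emat_sel(2)[of d D_M] unfolding emat_D en_D by simp
    then have "qy (- kap d) 0 * G21 d * expand d (s_const Thalf + z1) = 1"
      using D12_G21[of d] by (simp add: mult_ac)
    then show "(1 - ?b) $ i = (fps_const (qy (- kap d) 0 * G21 d) * fps_map (expand d) (off_P b)) $ i"
      by (cases i) (simp_all add: beta_def off_P_def ends_mat_sel expand_diff right_diff_distrib expand_uminus mult_ac)
  qed
  have c: "qy (- kap d) 0 * G21 d \<noteq> 0"
  proof
    assume "qy (- kap d) 0 * G21 d = 0"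
    moreover have "G21 d \<noteq> 0" using D12_G21[of d] by auto
    ultimately have "qy (- kap d) 0 = 0" by simp
    then have "qy (- kap d) 0 $$ (- kap d) $$ 0 = 0" by simp
    then show False by (simp add: qy_nth)
  qed
  have beta0: "?b $ 0 = 0" by (simp add: beta_def ends_mat_sel b0)
  have inv: "(1 - ?b) * inverse (1 - ?b) = 1" using beta0 by (intro inverse_mult_eq_1') simp
  have e: "fps_const (emb (fls_const (1 / real i))) * fps_deriv (?b ^ i) = ?b ^ (i - 1) * fps_deriv ?b" if "i \<ge> 1" for i
  proof -
    have "emb (fls_const (1 / real i)) * of_nat i = 1"
    proof -
      have "emb (fls_const (1 / real i)) * of_nat i = emb (fls_const (1 / real i) * of_nat i)"
        using ring_map_of_nat[OF ring_map_emb, of i "fls_const (1 / real i)"] by (simp add: mult.commute)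
      also have "fls_const (1 / real i) * of_nat i = (1 :: real fls)" using that by (simp add: fls_of_nat)
      finally show ?thesis by simp
    qed
    then have "fps_const (emb (fls_const (1 / real i))) * of_nat i = 1"
      by (simp add: fps_of_nat[symmetric])
    then show ?thesis by (simp add: fps_deriv_power mult.assoc[symmetric] fps_of_nat)
  qed
  have "fps_deriv (log_sum b d n) = (\<Sum>i\<in>{1..<n}. ?b ^ (i - 1) * fps_deriv ?b)"
    unfolding log_sum_def fps_deriv_sum by (intro sum.cong refl) (simp add: e)
  also have "\<dots> = fps_deriv ?b * (\<Sum>i<n - 1. ?b ^ i)"
    unfolding sum_distrib_left
    by (rule sum.reindex_bij_witness[of _ Suc "\<lambda>i. i - 1"]) (auto simp: mult.commute)
  finally have "(1 - ?b) * fps_deriv (log_sum b d n) = fps_deriv ?b * (1 - ?b ^ (n - 1))"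
    using one_diff_power_eq[of ?b "n - 1"] by (simp add: mult_ac)
  then have "inverse (1 - ?b) * (1 - ?b) * fps_deriv (log_sum b d n) = inverse (1 - ?b) * fps_deriv ?b * (1 - ?b ^ (n - 1))"
    by (simp only: mult.assoc)
  then have "fps_deriv (log_sum b d n) = inverse (1 - ?b) * fps_deriv ?b * (1 - ?b ^ (n - 1))"
    using inv by (simp add: mult.commute[of "inverse (1 - ?b)"])
  moreover have "inverse (1 - ?b) * fps_deriv ?b = - log_deriv (fps_map (expand d) (off_P b))"
  proof -
    have "log_deriv (1 - ?b) = log_deriv (fps_map (expand d) (off_P b))"
      unfolding beta by (rule log_deriv_const[OF c])
    moreover have "log_deriv (1 - ?b) = - (fps_deriv ?b * inverse (1 - ?b))" by (simp add: log_deriv_def)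
    ultimately show ?thesis by (metis minus_minus mult.commute)
  qed
  ultimately have "fps_deriv (log_sum b d n) = - log_deriv (fps_map (expand d) (off_P b)) * (1 - ?b ^ (n - 1))"
    by (simp only:)
  then have "fps_deriv (log_sum b d n)
     = - log_deriv (fps_map (expand d) (off_P b)) + log_deriv (fps_map (expand d) (off_P b)) * ?b ^ (n - 1)"
    by (simp add: algebra_simps)
  moreover have "(log_deriv (fps_map (expand d) (off_P b)) * ?b ^ (n - 1)) $ k = 0"
  proof -
    have "(?b ^ (n - 1)) $ i = 0" if "i < n - 1" for i using startsby_zero_power_prefix[OF beta0] that by simp
    then show ?thesis using k by (auto simp: fps_mult_nth intro!: sum.neutral)
  qed
  ultimately show ?thesis by simp
qed

section \<open>The root of the quadratic equation\<close>

text \<open>The quadratic formula with the square root that is 2 at s = 0. The sign selects the root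
  z1 = - T^(1/2), where \<open>off_P b\<close> vanishes at s = 0.\<close>

lemma quadratic_root:
  fixes c :: "real fps"
  assumes "c $ 0 = 0"
  obtains r where "r * (r - c) = 1" "r $ 0 = - 1"
proof
  let ?s = "fps_radical (\<lambda>n x. root n x) 2 (c ^ 2 + 4)" and ?r = "fps_const (1 / 2) * (c - fps_radical (\<lambda>n x. root n x) 2 (c ^ 2 + 4))"
  have c0: "(c ^ 2 + 4) $ 0 = 4" using assms by (simp add: power2_eq_square fps_mult_nth_0 fps_numeral_nth)
  have r4: "root 2 4 = 2" using real_root_power_cancel[of 2 2] by simp
  have "?s ^ 2 = c ^ 2 + 4"
    using power_radical[of "c ^ 2 + 4" "\<lambda>n x. root n x" 1] c0 r4 by (simp add: numeral_2_eq_2)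
  moreover have h: "fps_const (1 / 2) * (2 :: real fps) = 1"
    by (simp add: numeral_fps_const)
  have "?r * 2 = (fps_const (1 / 2) * 2) * (c - ?s)" by (simp only: mult_ac)
  then have r2: "?r * 2 = c - ?s" unfolding h by simp
  have "r * (r - c) * 4 = s ^ 2 - c ^ 2" if "r * 2 = c - s" for r s :: "real fps"
  proof -
    have "r * (r - c) * 4 = (r * 2) * (r * 2 - c * 2)" by (simp add: algebra_simps)
    also have "\<dots> = s ^ 2 - c ^ 2" unfolding that by (simp add: algebra_simps power2_eq_square)
    finally show ?thesis .
  qed
  from this[OF r2] have "?r * (?r - c) * 4 = ?s ^ 2 - c ^ 2" .
  ultimately have "?r * (?r - c) * 4 = 1 * 4" by simp
  moreover have "(4 :: real fps) $ 0 \<noteq> 0" by (simp add: numeral_fps_const)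
  then have "(4 :: real fps) \<noteq> 0" by (metis fps_zero_nth)
  ultimately show "?r * (?r - c) = 1" by (metis mult_right_cancel)
  have "?s $ 0 = 2" unfolding fps_radical_nth_0 c0 r4 by simp
  then show "?r $ 0 = - 1" unfolding fps_mult_left_const_nth fps_sub_nth assms by simp
qed

definition exp_ge2 :: "int \<Rightarrow> cfls2 \<Rightarrow> bool" where
  "exp_ge2 e x \<longleftrightarrow> (\<forall>N n. x $$ N $$ n \<noteq> 0 \<longrightarrow> e \<le> n)"

lemma exp_ge2_mult: "exp_ge2 e x \<Longrightarrow> exp_ge2 f y \<Longrightarrow> exp_ge2 (e + f) (x * y)"
  unfolding exp_ge2_def using cfls2_mult_nonzeroD[of x y] by force

lemma exp_ge2_add: "exp_ge2 e x \<Longrightarrow> exp_ge2 e y \<Longrightarrow> exp_ge2 e (x + y)"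
  unfolding exp_ge2_def by (metis add.right_neutral fls_plus_nth)

lemma exp_ge2_sum: "(\<And>i. i \<in> I \<Longrightarrow> exp_ge2 e (f i)) \<Longrightarrow> exp_ge2 e (\<Sum>i\<in>I. f i)"
  by (induction I rule: infinite_finite_induct) (auto intro: exp_ge2_add simp: exp_ge2_def[of _ 0])

lemma exp_ge2_emb: "exp_ge2 0 (emb r)"
  by (auto simp: exp_ge2_def emb_nth split: if_splits)

lemma exp_ge2_qy: "exp_ge2 n (qy N n)"
  by (auto simp: exp_ge2_def qy_nth split: if_splits)

lemma exp_ge2_lin: "exp_ge2 0 (diag inv_lin)"
  unfolding exp_ge2_def diag_nth using inv_lin_neg by (auto split: if_splits simp: not_less[symmetric])

lemma exp_ge2_ct: "exp_ge2 1 x \<Longrightarrow> ct x = 0"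
  unfolding exp_ge2_def by (intro fls_eqI) (force simp: ct_nth)

text \<open>Solving for the powers of s in turn divides only by 1 + qy, whose inverse has no
  negative powers of y.\<close>

lemma exp_ge2_solve:
  fixes X g h :: "cfls2 fps"
  assumes eq: "X * (fps_const (1 + qy 1 1) - g) = h"
    and g: "g $ 0 = 0" "\<And>k. exp_ge2 0 (g $ k)" and h: "\<And>k. exp_ge2 e (h $ k)"
  shows "exp_ge2 e (X $ k)"
proof (induction k rule: less_induct)
  case (less k)
  have L: "diag inv_lin * (1 + qy 1 1) = 1"
  proof -
    have "diag (inv_lin * (1 + fls_X)) = diag inv_lin * (1 + qy 1 1)"
      using diag_X_power[of 1] by (simp add: diag_mult diag_add)
    then show ?thesis unfolding inv_lin_eq by simp
  qed
  have "h $ k = X $ k * (1 + qy 1 1) - (\<Sum>i=0..k. X $ i * g $ (k - i))"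
    unfolding eq[symmetric] by (simp add: right_diff_distrib fps_mult_nth[of X g])
  also have "(\<Sum>i=0..k. X $ i * g $ (k - i)) = (\<Sum>i<k. X $ i * g $ (k - i))"
    by (rule sum.mono_neutral_right) (auto simp: g(1) le_less)
  finally have "X $ k * (1 + qy 1 1) = h $ k + (\<Sum>i<k. X $ i * g $ (k - i))" by (simp add: algebra_simps)
  then have "X $ k * (1 + qy 1 1) * diag inv_lin = (h $ k + (\<Sum>i<k. X $ i * g $ (k - i))) * diag inv_lin" by simp
  moreover have "X $ k * (1 + qy 1 1) * diag inv_lin = X $ k" using L by (simp add: mult.assoc mult.commute)
  moreover have "exp_ge2 (e + 0) (X $ i * g $ (k - i))" if "i < k" for i
    by (rule exp_ge2_mult[OF less[OF that] g(2)])
  then have "exp_ge2 (e + 0) ((h $ k + (\<Sum>i<k. X $ i * g $ (k - i))) * diag inv_lin)"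
    by (intro exp_ge2_mult exp_ge2_lin exp_ge2_add h exp_ge2_sum) simp
  ultimately show ?case by simp
qed

section \<open>The potential of a point-like bounding cochain\<close>

definition const_e :: "real \<Rightarrow> cfls2" where "const_e x = emb (fls_const x)"

lemma ring_map_const_e: "ring_map const_e"
proof -
  have "fls_const (x + y) = (fls_const x + fls_const y :: real fls)" for x y by (rule fls_eqI) simp
  then show ?thesis using ring_map_emb by (simp add: ring_map_def const_e_def flip: fls_const_mult_const)
qed

lemma exp_ge2_const_e: "exp_ge2 0 (const_e x)"
  unfolding const_e_def by (rule exp_ge2_emb)

lemma ct_const_e: "ct (const_e x) = fls_const (complex_of_real x)"
  by (rule fls_eqI) (simp add: ct_nth const_e_def emb_nth)

lemma exp_ge2_uminus: "exp_ge2 e x \<Longrightarrow> exp_ge2 e (- x)"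
  by (simp add: exp_ge2_def)

definition root_factor :: "real fps \<Rightarrow> sring fps" where
  "root_factor r = fps_const z1 - fps_const (s_const Thalf) * fps_map (\<lambda>x. s_const (fls_const x)) r"

lemma expand_root_factor:
  "fps_map (expand d) (root_factor r)
     = fps_const (if d then qy 0 (- 1) else qy 2 1) - fps_const (qy 1 0) * fps_map const_e r"
  by (rule fps_ext)
    (simp add: root_factor_def expand_diff expand_mult expand_const expand_z1 emb_Thalf const_e_def)

lemma s_const_minus_1: "s_const (- 1) = - 1"
  using s_const_hom(1)[of 1 "- 1"] s_const_hom(3,4) by (simp add: eq_neg_iff_add_eq_0 add.commute)

lemma root_factor_nz: "r $ 0 = - 1 \<Longrightarrow> root_factor r $ 0 = s_const Thalf + z1"
  by (simp add: root_factor_def s_const_minus_1)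

lemma expand_P0_nz: "expand d (s_const Thalf + z1) \<noteq> 0"
proof
  assume "expand d (s_const Thalf + z1) = 0"
  then have "D12 d = 0" using emat_sel(2)[of d D_M] unfolding emat_D en_D by simp
  then show False using D12_G21[of d] by simp
qed

lemma log_deriv_eq:
  assumes "x $ 0 \<noteq> (0 :: 'a::field)"
  shows "log_deriv x * x = fps_deriv x"
  using inverse_mult_eq_1[OF assms] by (simp add: log_deriv_def mult.assoc)

text \<open>Where z1 is large, z1 - T^(1/2) r is z1 times a series 1 + O(y), and the logarithmic
  derivative has only positive powers of y. Where z1 is small, the factor is - T^(1/2) r times such
  a series and contributes r' / r.\<close>

lemma ct_log_deriv_root_factor:
  assumes r: "r * ri = 1" "r $ 0 = - 1"
  shows "ct_map (log_deriv (fps_map (expand d) (root_factor r)))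
    = (if d then 0 else fps_map (\<lambda>x. fls_const (complex_of_real x)) (fps_deriv r * ri))"
proof -
  let ?F = "fps_map (expand d) (root_factor r)" and ?e = "fps_map const_e"
  let ?X = "log_deriv ?F"
  have "?F $ 0 \<noteq> 0" using expand_P0_nz root_factor_nz[OF r(2)] by simp
  then have X: "?X * ?F = fps_deriv ?F" by (rule log_deriv_eq)
  have dF: "fps_deriv ?F = - (fps_const (qy 1 0) * ?e (fps_deriv r))"
    unfolding expand_root_factor fps_map_deriv[OF ring_map_const_e] by simp
  have er: "?e r + 1 = ?e (r + 1)"
    by (simp add: fps_map_add[OF ring_map_const_e] fps_map_1[OF ring_map_const_e])
  have g: "exp_ge2 0 (?e x $ k)" for x k by (simp add: exp_ge2_const_e)
  have c0: "const_e 0 = 0" by (rule ring_map_0[OF ring_map_const_e])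
  show ?thesis
  proof (cases d)
    case True
    \<comment> \<open>The factor y normalises the root factor to the shape required by
      \<open>exp_ge2_solve\<close>; at the other end q^(-1) does so.\<close>
    have "?X * (fps_const (qy 0 1) * ?F) = fps_const (qy 0 1) * fps_deriv ?F"
      unfolding X[symmetric] by (simp only: mult_ac)
    moreover have "fps_const (qy 0 1) * ?F = fps_const (1 + qy 1 1) - fps_const (qy 1 1) * ?e (r + 1)"
      unfolding expand_root_factor er[symmetric] using True
      by (simp add: right_diff_distrib distrib_left qy_mult mult.assoc[symmetric] flip: fps_const_add)
    moreover have "fps_const (qy 0 1) * fps_deriv ?F = - (fps_const (qy 1 1) * ?e (fps_deriv r))"
      unfolding dF by (simp add: qy_mult mult.assoc[symmetric])
    ultimately have eq: "?X * (fps_const (1 + qy 1 1) - fps_const (qy 1 1) * ?e (r + 1))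
        = - (fps_const (qy 1 1) * ?e (fps_deriv r))" by simp
    have q: "exp_ge2 1 (qy 1 1 * ?e x $ k)" for x k
      using exp_ge2_mult[OF exp_ge2_qy[of 1 1] g] by simp
    have "exp_ge2 1 (?X $ k)" for k
    proof (rule exp_ge2_solve[OF eq])
      show "(fps_const (qy 1 1) * ?e (r + 1)) $ 0 = 0" using r(2) by (simp add: c0)
      show "exp_ge2 0 ((fps_const (qy 1 1) * ?e (r + 1)) $ k)" for k
        using q[of "r + 1" k] unfolding exp_ge2_def fps_mult_left_const_nth by force
      show "exp_ge2 1 ((- (fps_const (qy 1 1) * ?e (fps_deriv r))) $ k)" for k
        using q[of "fps_deriv r" k] unfolding fps_neg_nth fps_mult_left_const_nth by (rule exp_ge2_uminus)
    qed
    then show ?thesis using True by (intro fps_ext) (simp add: exp_ge2_ct)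
  next
    case False
    have "?X * (fps_const (qy (- 1) 0) * ?F) = fps_const (qy (- 1) 0) * fps_deriv ?F"
      unfolding X[symmetric] by (simp only: mult_ac)
    moreover have F': "fps_const (qy (- 1) 0) * ?F = fps_const (qy 1 1) - ?e r"
      unfolding expand_root_factor using False
      by (simp add: right_diff_distrib qy_mult mult.assoc[symmetric])
    moreover have "fps_const (qy (- 1) 0) * fps_deriv ?F = - ?e (fps_deriv r)"
      unfolding dF by (simp add: qy_mult mult.assoc[symmetric])
    ultimately have eq0: "?X * (fps_const (qy 1 1) - ?e r) = - ?e (fps_deriv r)" by simp
    have "fps_const (qy 1 1) - ?e r = fps_const (1 + qy 1 1) - ?e (r + 1)"
      unfolding er[symmetric] by (simp flip: fps_const_add)
    with eq0 have eq: "?X * (fps_const (1 + qy 1 1) - ?e (r + 1)) = - ?e (fps_deriv r)" by simp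
    have X0: "exp_ge2 0 (?X $ k)" for k
    proof (rule exp_ge2_solve[OF eq])
      show "?e (r + 1) $ 0 = 0" using r(2) by (simp add: c0)
      show "exp_ge2 0 (?e (r + 1) $ k)" for k by (rule g)
      show "exp_ge2 0 ((- ?e (fps_deriv r)) $ k)" for k
        unfolding fps_neg_nth by (intro exp_ge2_uminus g)
    qed
    have rr: "?e r * ?e ri = 1"
      by (simp add: fps_map_mult[OF ring_map_const_e, symmetric] r(1) fps_map_1[OF ring_map_const_e])
    have "?X * (fps_const (qy 1 1) - ?e r) * ?e ri = - ?e (fps_deriv r) * ?e ri" by (simp only: eq0)
    moreover have "?X * (fps_const (qy 1 1) - ?e r) * ?e ri = fps_const (qy 1 1) * (?X * ?e ri) - ?X * (?e r * ?e ri)"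
      by (simp add: algebra_simps)
    ultimately have "?X = ?e (fps_deriv r * ri) + fps_const (qy 1 1) * (?X * ?e ri)"
      unfolding rr by (simp add: fps_map_mult[OF ring_map_const_e] algebra_simps)
    then have "ct_map ?X = ct_map (?e (fps_deriv r * ri)) + ct_map (fps_const (qy 1 1) * (?X * ?e ri))"
      by (metis ct_map_add)
    moreover have "ct_map (fps_const (qy 1 1) * (?X * ?e ri)) = 0"
    proof (rule fps_ext)
      fix k
      have "exp_ge2 0 ((?X * ?e ri) $ k)"
        unfolding fps_mult_nth using exp_ge2_mult[OF X0 g] by (intro exp_ge2_sum) simp
      then have "exp_ge2 1 (qy 1 1 * (?X * ?e ri) $ k)"
        using exp_ge2_mult[OF exp_ge2_qy[of 1 1]] by fastforce
      then show "ct_map (fps_const (qy 1 1) * (?X * ?e ri)) $ k = 0 $ k"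
        by (simp add: exp_ge2_ct)
    qed
    moreover have "ct_map (?e x) = fps_map (\<lambda>x. fls_const (complex_of_real x)) x" for x
      by (rule fps_ext) (simp add: ct_const_e)
    ultimately show ?thesis using False by simp
  qed
qed

text \<open>\<open>P\<close> and the root factor differ by a unit over \<open>S\<close>. Indeed P Q
  = A B, where z1 B is the factor of the other root, so (P - z1 B) A = P (A - z1 Q). At s = 0 both
  brackets are 2 T^(1/2), the distance of the two roots, which is invertible; their contributions
  cancel.\<close>

lemma ct_log_deriv_P:
  assumes PQ: "P * Q = fps_const (z1 - z0) - fps_const (s_const Thalf) * fps_map (\<lambda>x. s_const (fls_const x)) c"
    and P0: "P $ 0 = s_const Thalf + z1" and Q0: "Q $ 0 = 1 - s_const (inverse Thalf) * z0"
    and r: "r * (r - c) = 1" "r $ 0 = - 1" "c $ 0 = 0"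
  shows "ct_map (log_deriv (fps_map (expand True) P)) - ct_map (log_deriv (fps_map (expand False) P))
    = - fps_map (\<lambda>x. fls_const (complex_of_real x)) (fps_deriv r * (r - c))"
proof -
  let ?q = "s_const Thalf" and ?qi = "s_const (inverse Thalf)"
  let ?s = "fps_map (\<lambda>x. s_const (fls_const x)) :: real fps \<Rightarrow> sring fps"
  let ?A = "root_factor r"
  define B where "B = 1 + fps_const (?qi * z0) * ?s (r - c)"
  define num where "num = P - fps_const z1 * B"
  define den where "den = ?A - fps_const z1 * Q"
  have qq: "?qi * z0 * z1 = ?q" "?q * (?qi * z0) = z0"
    using s_const_Thalf by (metis mult.assoc mult.commute mult_1)+
  have ss: "?s r * ?s (r - c) = 1"
    by (simp add: fps_map_mult[OF ring_map_scal, symmetric] r(1) fps_map_1[OF ring_map_scal])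
  have "?A * B = fps_const z1 - fps_const ?q * ?s r + fps_const (?qi * z0 * z1) * ?s (r - c)
      - fps_const (?q * (?qi * z0)) * (?s r * ?s (r - c))"
    by (simp add: root_factor_def B_def algebra_simps del: fps_const_mult flip: fps_const_mult)
  also have "\<dots> = P * Q"
    unfolding qq ss PQ unfolding fps_map_diff[OF ring_map_scal] by (simp add: algebra_simps flip: fps_const_sub)
  finally have AB: "?A * B = P * Q" .
  have e: "num * ?A = P * den"
  proof -
    have "num * ?A = P * ?A - fps_const z1 * (?A * B)" by (simp add: num_def algebra_simps)
    then show ?thesis unfolding AB by (simp add: den_def algebra_simps)
  qed
  have "B $ 0 = 1 - ?qi * z0" using r(2,3) by (simp add: B_def s_const_minus_1)
  then have "num $ 0 = ?q + ?q" "den $ 0 = ?q + ?q"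
    using qq(1) by (simp_all add: num_def den_def P0 Q0 root_factor_nz[OF r(2)] right_diff_distrib mult_ac)
  then have 0: "num $ 0 = s_const (Thalf + Thalf)" "den $ 0 = s_const (Thalf + Thalf)"
    by (simp_all only: s_const_hom(1))
  have "(Thalf + Thalf :: real fls) $$ 1 \<noteq> 0" by simp
  then have nz: "(Thalf + Thalf :: real fls) \<noteq> 0" by (metis fls_zero_nth)
  then have ui: "(Thalf + Thalf) * inverse (Thalf + Thalf) = (1 :: real fls)" by (rule right_inverse)
  then have u: "num $ 0 * s_const (inverse (Thalf + Thalf)) = 1" "den $ 0 * s_const (inverse (Thalf + Thalf)) = 1"
    unfolding 0 by (simp_all only: s_const_hom(2)[symmetric] ui s_const_hom(3))
  let ?m = "\<lambda>d. fps_map (expand d)"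
  have nz': "?m d num $ 0 \<noteq> 0" "?m d den $ 0 \<noteq> 0" "?m d ?A $ 0 \<noteq> 0" "?m d P $ 0 \<noteq> 0" for d
    using arg_cong[OF u(1), of "expand d"] arg_cong[OF u(2), of "expand d"] expand_P0_nz[of d]
    by (auto simp: expand_mult root_factor_nz[OF r(2)] P0)
  have "log_deriv (?m d num) + log_deriv (?m d ?A) = log_deriv (?m d P) + log_deriv (?m d den)" for d
  proof -
    have "?m d num * ?m d ?A = ?m d P * ?m d den"
      unfolding fps_map_mult[OF ring_map_expand, symmetric] e ..
    then show ?thesis using nz'[of d] by (simp add: log_deriv_mult[symmetric])
  qed
  then have L: "ct_map (log_deriv (?m d num)) + ct_map (log_deriv (?m d ?A))
      = ct_map (log_deriv (?m d P)) + ct_map (log_deriv (?m d den))" for d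
    by (metis ct_map_add)
  show ?thesis
    using L[of True] L[of False]
    unfolding ct_log_deriv_unit[OF u(1)] ct_log_deriv_unit[OF u(2)] ct_log_deriv_root_factor[OF r(1,2)]
    by (simp add: algebra_simps)
qed

lemma Rs_val_ge_nth: "ereal B \<le> Rs_val x \<Longrightarrow> real j + of_int N / 2 < B \<Longrightarrow> x $ j $$ N = 0"
proof (rule ccontr)
  assume B: "ereal B \<le> Rs_val x" "real j + of_int N / 2 < B" and nz: "x $ j $$ N \<noteq> 0"
  have "Rs_val x \<le> ereal (real j) + nov_val (x $ j)" unfolding Rs_val_def by (rule INF_lower) simp
  also have "nov_val (x $ j) \<le> ereal (of_int N / 2)" unfolding nov_val_def using nz by (intro INF_lower) simp
  finally have "Rs_val x \<le> ereal (real j + of_int N / 2)" by (simp add: add_left_mono)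
  with B(1) have "ereal B \<le> ereal (real j + of_int N / 2)" by (rule order_trans)
  then show False using B(2) by simp
qed

definition exp_potential :: "real fls fps" where
  "exp_potential = Abs_fps (\<lambda>k. fls_const ((fps_exp 1 - fps_exp (- 1)) $ k) * Thalf)"

theorem point_like_potential:
  assumes "point_like b" and c: "is_potential b c"
  shows "c = exp_potential"
proof -
  obtain Y where b: "bounding_cochain b" and Y: "is_correction b Y"
    and lim: "Theta_sums (\<lambda>k. exp_chain b k - Y k) fps_X"
    using assms(1) by (auto simp: point_like_def)
  have b1: "ends_hom 1 b" and "ends_val b > 0" using b by (auto simp: bounding_cochain_def)
  then have b0: "b $ 0 = 0" by (rule ends_val_pos_coeff_0)
  have ce: "delta b - b * b = ends_scalar c" and ch: "Rs_hom 2 c" using c by (auto simp: is_potential_def)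
  \<comment> \<open>In degree 2 only T^(1/2) occurs, so \<open>c\<close> is a real power series
    times \<open>Thalf\<close>.\<close>
  define c' where "c' = Abs_fps (\<lambda>k. c $ k $$ 1)"
  have ck: "c $ k = fls_const (c' $ k) * Thalf" for k
  proof (rule fls_eqI)
    fix m
    have "c $ k $$ m \<noteq> 0 \<longrightarrow> m = 1" using ch by (auto simp: Rs_hom_def nov_hom_def)
    then show "c $ k $$ m = (fls_const (c' $ k) * Thalf) $$ m" by (auto simp: c'_def fls_const_mult_nth)
  qed
  have "fps_map s_const c $ k = (fps_const (s_const Thalf) * fps_map (\<lambda>x. s_const (fls_const x)) c') $ k" for k
    by (simp add: ck s_const_hom mult.commute)
  then have "fps_map s_const c = fps_const (s_const Thalf) * fps_map (\<lambda>x. s_const (fls_const x)) c'"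
    by (rule fps_ext)
  note PQ = factorization[OF b1 ce, unfolded this]
  have c0: "c' $ 0 = 0"
  proof -
    have "endo_scalar (s_const (c $ 0)) = (delta b - b * b) $ 0" unfolding ce by (simp add: ends_scalar_def)
    also have "\<dots> = 0" unfolding delta_odd[OF b1] by (simp add: b0 fps_mult_nth_0)
    finally have "s_const (c $ 0) = 0" using en_scalar(1)[of "s_const (c $ 0)"] by simp
    then have "emb (c $ 0) = 0" using expand_const[of True "c $ 0"] by simp
    then have "emb (c $ 0) $$ 1 $$ 0 = 0" by simp
    then show ?thesis by (simp add: emb_nth c'_def)
  qed
  obtain r where r: "r * (r - c') = 1" "r $ 0 = - 1" using quadratic_root[OF c0] by blast
  note L = ct_log_deriv_P[OF PQ _ _ r c0]
  have L: "ct_map (log_deriv (fps_map (expand True) (off_P b))) - ct_map (log_deriv (fps_map (expand False) (off_P b)))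
    = - fps_map (\<lambda>x. fls_const (complex_of_real x)) (fps_deriv r * (r - c'))"
    by (rule L) (simp_all add: off_P_def off_Q_def b0)
  have key: "(fps_deriv r * (r - c')) $ k = (if k = 0 then - 1 else 0)" for k
  proof -
    let ?j = "Suc k"
    \<comment> \<open>The coefficient of s^(k+1) T^0 has valuation k + 1, just below this
      bound.\<close>
    define B where "B = real ?j + 1"
    define y where "y = (fps_deriv r * (r - c')) $ k"
    have "eventually (\<lambda>n. ereal B \<le> Rs_val ((\<Sum>k<n. Theta (exp_chain b k - Y k)) - fps_X)) sequentially"
      using lim unfolding Theta_sums_def by blast
    moreover note Theta_partial_sums[OF b1 Y, of B]
    moreover have "eventually (\<lambda>n. Suc ?j < n) sequentially" by (rule eventually_gt_at_top)
    ultimately have "eventually (\<lambda>n. (fps_deriv r * (r - c')) $ k = (if k = 0 then - 1 else 0)) sequentially"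
    proof eventually_elim
      case (elim n)
      have small: "real ?j + of_int 0 / 2 < B" by (simp add: B_def)
      let ?D = "\<lambda>d. of_nat ?j * log_sum b d n $ ?j $$ 0 $$ 0"
      have of_nat_nth: "(of_nat m * f) $$ i = of_nat m * f $$ i" for m i and f :: cfls2
        by (simp add: fls_of_nat fls_const_mult_nth)
      have of_nat_nth': "(of_nat m * f) $$ i = of_nat m * f $$ i" for m i and f :: "complex fls"
        by (simp add: fls_of_nat fls_const_mult_nth)
      have D: "?D d = - ct_map (log_deriv (fps_map (expand d) (off_P b))) $ k $$ 0" for d
      proof -
        have "fps_deriv (log_sum b d n) $ k $$ 0 $$ 0 = - log_deriv (fps_map (expand d) (off_P b)) $ k $$ 0 $$ 0"
          using deriv_log_sum[OF b0, of k n d] elim(3) by simp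
        then show ?thesis
          by (simp add: ct_nth of_nat_nth of_nat_nth' del: of_nat_Suc)
      qed
      have "(\<Sum>k<n. Theta (exp_chain b k - Y k)) $ ?j $$ 0 = fps_X $ ?j $$ 0"
        using Rs_val_ge_nth[OF elim(1) small] by simp
      moreover have "(\<Sum>k<n. Theta (exp_chain b k - Y k)) $ ?j $$ 0
          = - (log_sum b True n $ ?j $$ 0 $$ 0 - log_sum b False n $ ?j $$ 0 $$ 0)"
        using elim(2) small by blast
      ultimately have "of_nat ?j * (fps_X $ ?j $$ 0 :: complex) = - (?D True - ?D False)"
        by (simp add: algebra_simps del: of_nat_Suc)
      also have "\<dots> = (ct_map (log_deriv (fps_map (expand True) (off_P b)))
          - ct_map (log_deriv (fps_map (expand False) (off_P b)))) $ k $$ 0" unfolding D by simp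
      also have "\<dots> = - complex_of_real y" unfolding L fps_neg_nth fps_map_nth y_def[symmetric] by simp
      finally have "- complex_of_real y = complex_of_real (if k = 0 then 1 else 0)"
        by (cases "k = 0") (simp_all add: fps_X_def)
      then have "complex_of_real (- y) = complex_of_real (if k = 0 then 1 else 0)" by (simp only: of_real_minus)
      then have "- y = (if k = 0 then 1 else 0)" by (simp only: of_real_eq_iff)
      then show ?case unfolding y_def[symmetric] by (simp split: if_splits)
    qed
    then show ?thesis by simp
  qed
  have "fps_deriv r * (r - c') = - 1" by (rule fps_ext) (simp only: key fps_neg_nth fps_one_nth; simp)
  then have "fps_deriv r * (r - c') * r = - r" by simp
  then have "fps_deriv r * (r * (r - c')) = - r" by (simp only: mult_ac)
  then have "fps_deriv r = - r" using r(1) by simp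
  also have "- r = fps_const (- 1) * r" by (rule fps_ext) simp
  finally have re': "r = fps_const (- 1) * fps_exp (- 1)" unfolding fps_exp_unique_ODE r(2) .
  have re: "r = - fps_exp (- 1)" by (subst re', rule fps_ext) simp
  have ee: "fps_exp 1 * fps_exp (- 1) = (1 :: real fps)" by (simp add: fps_exp_add_mult[symmetric])
  have "r - c' = - fps_exp 1"
  proof -
    have "r - c' = (fps_exp 1 * fps_exp (- 1)) * (r - c')" by (simp add: ee)
    also have "\<dots> = - (fps_exp 1 * (r * (r - c')))" unfolding re by (simp add: mult_ac)
    finally show ?thesis unfolding r(1) by simp
  qed
  then have "c' = r + fps_exp 1" by (simp add: algebra_simps)
  then have "c' = fps_exp 1 - fps_exp (- 1)" unfolding re by simp
  then show ?thesis unfolding exp_potential_def by (intro fps_ext) (simp add: ck)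
qed

section \<open>Lower bounds for valuations\<close>

text \<open>A bound for \<open>endo_val\<close> without differences of extended reals, and directly
  compatible with sums and composition.\<close>

definition endo_ge :: "real \<Rightarrow> endo \<Rightarrow> bool" where
  "endo_ge x \<phi> \<longleftrightarrow> (\<forall>\<zeta>\<in>simplex. \<forall>m B. ereal B \<le> m_val \<zeta> m \<longrightarrow> ereal (x + B) \<le> m_val \<zeta> (endo_app \<phi> m))"

lemma endo_ge_val: "endo_ge x \<phi> \<Longrightarrow> ereal x \<le> endo_val \<phi>"
  unfolding endo_val_def
proof (intro INF_greatest)
  fix \<zeta> m assume g: "endo_ge x \<phi>" and \<zeta>: "\<zeta> \<in> simplex"
  show "ereal x \<le> m_val \<zeta> (endo_app \<phi> m) - m_val \<zeta> m"
  proof (cases "m_val \<zeta> m")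
    case (real r)
    then have "ereal (x + r) \<le> m_val \<zeta> (endo_app \<phi> m)" using g \<zeta> by (auto simp: endo_ge_def)
    then show ?thesis unfolding real by (cases "m_val \<zeta> (endo_app \<phi> m)") auto
  next
    case PInf
    have "ereal B \<le> m_val \<zeta> (endo_app \<phi> m)" for B
    proof -
      have "ereal (x + (B - x)) \<le> m_val \<zeta> (endo_app \<phi> m)" using g \<zeta> PInf unfolding endo_ge_def by (metis ereal_less_eq(1))
      then show ?thesis by simp
    qed
    then have "m_val \<zeta> (endo_app \<phi> m) = \<infinity>" by (metis ereal_top)
    then show ?thesis using PInf by simp
  next
    case MInf
    then show ?thesis by simp
  qed
qed

lemma endo_ge_mono: "endo_ge x \<phi> \<Longrightarrow> y \<le> x \<Longrightarrow> endo_ge y \<phi>"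
  unfolding endo_ge_def by (meson add_right_mono ereal_less_eq(3) order_trans)

lemma endo_ge_mult: "endo_ge x \<phi> \<Longrightarrow> endo_ge y \<psi> \<Longrightarrow> endo_ge (x + y) (\<phi> * \<psi>)"
  unfolding endo_ge_def times_endo.rep_eq by (simp add: add.assoc)

lemma endo_ge_add: "endo_ge x \<phi> \<Longrightarrow> endo_ge x \<psi> \<Longrightarrow> endo_ge x (\<phi> + \<psi>)"
  unfolding endo_ge_def plus_endo.rep_eq
proof (intro ballI allI impI)
  fix \<zeta> m B assume \<zeta>: "\<zeta> \<in> simplex" and m: "ereal B \<le> m_val \<zeta> m"
    and h: "\<forall>\<zeta>\<in>simplex. \<forall>m B. ereal B \<le> m_val \<zeta> m \<longrightarrow> ereal (x + B) \<le> m_val \<zeta> (endo_app \<phi> m)"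
      "\<forall>\<zeta>\<in>simplex. \<forall>m B. ereal B \<le> m_val \<zeta> m \<longrightarrow> ereal (x + B) \<le> m_val \<zeta> (endo_app \<psi> m)"
  have "ereal (x + B) \<le> m_val \<zeta> (endo_app \<phi> m)" "ereal (x + B) \<le> m_val \<zeta> (endo_app \<psi> m)"
    using h \<zeta> m by blast+
  then show "ereal (x + B) \<le> m_val \<zeta> (endo_app \<phi> m + endo_app \<psi> m)"
    unfolding m_val_ge_iff[OF \<zeta>] m_coord_simps by (blast intro: s_val_add_ge)
qed

lemma endo_ge_0 [simp]: "endo_ge x 0"
  unfolding endo_ge_def zero_endo.rep_eq by (auto simp: m_val_ge_iff)

lemma endo_ge_sum: "(\<And>i. i \<in> I \<Longrightarrow> endo_ge x (f i)) \<Longrightarrow> endo_ge x (\<Sum>i\<in>I. f i)"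
  by (induction I rule: infinite_finite_induct) (auto intro: endo_ge_add)

lemma endo_ge_scalar: "ereal x \<le> nov_val r \<Longrightarrow> endo_ge x (endo_scalar (s_const r))"
proof -
  assume r: "ereal x \<le> nov_val r"
  have "ereal (x + B) \<le> m_val \<zeta> (m_scale (s_const r) m)" if \<zeta>: "\<zeta> \<in> simplex" and m: "ereal B \<le> m_val \<zeta> m" for \<zeta> m B
  proof -
    have "ereal B \<le> s_val \<zeta> (m_coord_1 m)" "ereal (B - snd \<zeta> / 2) \<le> s_val \<zeta> (m_coord_e1 m)"
      using m by (simp_all add: m_val_ge_iff[OF \<zeta>])
    then have "ereal (x + B) \<le> s_val \<zeta> (s_const r * m_coord_1 m)"
      "ereal (x + (B - snd \<zeta> / 2)) \<le> s_val \<zeta> (s_const r * m_coord_e1 m)"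
      using s_val_mult_ge[OF \<zeta> s_val_const_ge[OF r]] by blast+
    then show ?thesis by (simp add: m_val_ge_iff[OF \<zeta>] m_coord_simps add_diff_eq)
  qed
  then show ?thesis by (simp add: endo_ge_def endo_scalar.rep_eq)
qed

lemma endo_ge_1: "endo_ge 0 1"
  unfolding endo_ge_def one_endo.rep_eq by simp

text \<open>The slope \<open>1/2\<close> in the power of \<open>s\<close> makes this bound multiplicative and implies membership in \<open>Ends\<close>.\<close>

definition ends_ge :: "real \<Rightarrow> ends \<Rightarrow> bool" where
  "ends_ge v a \<longleftrightarrow> (\<forall>k. endo_ge (v - real k / 2) (a $ k))"

lemma ends_ge_mult: "ends_ge v a \<Longrightarrow> ends_ge w b \<Longrightarrow> ends_ge (v + w) (a * b)"
  unfolding ends_ge_def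
proof
  fix k assume a: "\<forall>k. endo_ge (v - real k / 2) (a $ k)" and b: "\<forall>k. endo_ge (w - real k / 2) (b $ k)"
  show "endo_ge (v + w - real k / 2) ((a * b) $ k)"
    unfolding fps_mult_nth
  proof (rule endo_ge_sum)
    fix i assume "i \<in> {0..k}"
    then have "v - real i / 2 + (w - real (k - i) / 2) = v + w - real k / 2" by (simp add: of_nat_diff diff_divide_distrib)
    then show "endo_ge (v + w - real k / 2) (a $ i * b $ (k - i))" using endo_ge_mult a b by metis
  qed
qed

lemma ends_ge_val: "ends_ge v a \<Longrightarrow> ereal v \<le> ends_val a"
  unfolding ends_val_def
proof (rule INF_greatest)
  fix k assume "ends_ge v a"
  then have "ereal (v - real k / 2) \<le> endo_val (a $ k)" unfolding ends_ge_def by (intro endo_ge_val) blast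
  then have "ereal (real k) + ereal (v - real k / 2) \<le> ereal (real k) + endo_val (a $ k)" by (rule add_left_mono)
  moreover have "ereal v \<le> ereal (real k) + ereal (v - real k / 2)" by simp
  ultimately show "ereal v \<le> ereal (real k) + endo_val (a $ k)" by (rule order_trans[rotated])
qed

lemma ends_ge_Ends: "ends_ge v a \<Longrightarrow> a \<in> Ends"
  unfolding Ends_def
proof (intro CollectI allI)
  fix B assume a: "ends_ge v a"
  have "{k. ereal (real k) + endo_val (a $ k) \<le> ereal B} \<subseteq> {..nat \<lceil>2 * (B - v)\<rceil>}"
  proof
    fix k assume "k \<in> {k. ereal (real k) + endo_val (a $ k) \<le> ereal B}"
    then have k: "ereal (real k) + endo_val (a $ k) \<le> ereal B" by simp
    have "ereal (v - real k / 2) \<le> endo_val (a $ k)" using a unfolding ends_ge_def by (intro endo_ge_val) blast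
    then have "ereal (real k) + ereal (v - real k / 2) \<le> ereal B" using k by (meson add_left_mono order_trans)
    then have "real k \<le> 2 * (B - v)" by simp
    then show "k \<in> {..nat \<lceil>2 * (B - v)\<rceil>}" by (simp add: le_nat_iff) linarith
  qed
  then show "finite {k. ereal (real k) + endo_val (a $ k) \<le> ereal B}" by (rule finite_subset) simp
qed

lemma ends_ge_1: "ends_ge 0 1"
  unfolding ends_ge_def using endo_ge_mono[OF endo_ge_1] by (metis diff_0 divide_nonneg_nonneg endo_ge_0
    fps_one_nth neg_le_0_iff_le of_nat_0_le_iff zero_le_numeral)

section \<open>Scalars\<close>

text \<open>Models the powers of the potential. T^(n/2) supplies half of the valuation n and
  divisibility by s^n the other half; being nonzero determines the degree.\<close>

definition pure_scalar :: "nat \<Rightarrow> real fls fps \<Rightarrow> bool" where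
  "pure_scalar n r \<longleftrightarrow> (\<forall>k. \<exists>x. r $ k = fls_const x * Thalf ^ n) \<and> r \<noteq> 0 \<and> ends_ge (real n) (ends_scalar r)"

lemma ends_scalar_mult: "ends_scalar (r * r') = ends_scalar r * ends_scalar r'"
proof (rule fps_ext)
  fix k
  have "s_const (\<Sum>i\<in>I. f i) = (\<Sum>i\<in>I. s_const (f i))" for I :: "nat set" and f
    by (induction I rule: infinite_finite_induct) (auto simp: s_const_hom)
  then show "ends_scalar (r * r') $ k = (ends_scalar r * ends_scalar r') $ k"
    by (intro en_eqI) (simp_all add: ends_scalar_def fps_mult_nth en_sum en_mult s_const_hom)
qed

lemma ends_scalar_1 [simp]: "ends_scalar 1 = 1"
  by (rule fps_ext, rule en_eqI) (simp_all add: ends_scalar_def s_const_hom)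

lemma ends_scalar_central: "ends_scalar r * a = a * ends_scalar r"
proof (rule fps_ext)
  fix k
  have "endo_scalar f * \<phi> = \<phi> * endo_scalar f" for f \<phi>
    by (rule en_eqI) (simp_all add: en_mult mult.commute)
  then show "(ends_scalar r * a) $ k = (a * ends_scalar r) $ k"
    unfolding fps_mult_nth ends_scalar_def
    by (intro sum.reindex_bij_witness[of _ "\<lambda>i. k - i" "\<lambda>i. k - i"]) auto
qed

lemma pure_scalar_mult: "pure_scalar n r \<Longrightarrow> pure_scalar m r' \<Longrightarrow> pure_scalar (n + m) (r * r')"
proof -
  assume r: "pure_scalar n r" and r': "pure_scalar m r'"
  obtain f where f: "\<And>k. r $ k = fls_const (f k) * Thalf ^ n" using r unfolding pure_scalar_def by metis
  obtain g where g: "\<And>k. r' $ k = fls_const (g k) * Thalf ^ m" using r' unfolding pure_scalar_def by metis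
  have "(r * r') $ k = fls_const (\<Sum>i=0..k. f i * g (k - i)) * Thalf ^ (n + m)" for k
  proof -
    have "fls_const (\<Sum>i\<in>I. h i) = (\<Sum>i\<in>I. fls_const (h i) :: real fls)" for I :: "nat set" and h
      by (rule fls_eqI) (simp add: fls_sum_nth)
    then show ?thesis
      unfolding fps_mult_nth f g power_add
      by (simp add: sum_distrib_left sum_distrib_right mult_ac flip: fls_const_mult_const)
  qed
  moreover have "ends_ge (real (n + m)) (ends_scalar (r * r'))"
    using ends_ge_mult[of "real n" _ "real m"] r r' by (simp add: pure_scalar_def ends_scalar_mult)
  ultimately show ?thesis using r r' unfolding pure_scalar_def by auto
qed

lemma nov_val_const: "ereal 0 \<le> nov_val (fls_const x)"
  unfolding nov_val_ge_iff by auto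

lemma pure_scalar_const:
  assumes "x \<noteq> 0"
  shows "pure_scalar 0 (fps_const (fls_const x))"
proof -
  have "endo_ge 0 (endo_scalar (s_const (fls_const x)))"
    by (rule endo_ge_scalar[OF nov_val_const])
  then have "endo_ge (0 - real k / 2) (ends_scalar (fps_const (fls_const x)) $ k)" for k
    unfolding ends_scalar_const by (cases k) auto
  moreover have "\<exists>y. fps_const (fls_const x) $ k = fls_const y * Thalf ^ 0" for k
    by (cases k) (auto intro: exI[of _ x] exI[of _ 0])
  ultimately show ?thesis using assms by (simp add: pure_scalar_def ends_ge_def)
qed

lemma pure_scalar_nth_0:
  assumes "pure_scalar n r" "r $ k $$ m \<noteq> 0"
  shows "m = int n"
proof -
  obtain x where "r $ k = fls_const x * Thalf ^ n" using assms(1) unfolding pure_scalar_def by blast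
  then show ?thesis using assms(2) by (simp add: fls_const_mult_nth fls_X_power_nth split: if_splits)
qed

lemma pure_scalar_hom: "pure_scalar n r \<Longrightarrow> Rs_hom (2 * int n) r"
  using pure_scalar_nth_0 unfolding Rs_hom_def nov_hom_def by blast

lemma pure_scalar_Rs: "pure_scalar n r \<Longrightarrow> r \<in> Rs"
  unfolding Rs_def
proof (intro CollectI allI)
  fix B assume r: "pure_scalar n r"
  have "{k. ereal (real k) + nov_val (r $ k) \<le> ereal B} \<subseteq> {..nat \<lceil>B\<rceil>}"
  proof
    fix k assume "k \<in> {k. ereal (real k) + nov_val (r $ k) \<le> ereal B}"
    then have k: "ereal (real k) + nov_val (r $ k) \<le> ereal B" by simp
    have "ereal 0 \<le> nov_val (r $ k)" unfolding nov_val_ge_iff using pure_scalar_nth_0[OF r] by force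
    then have "ereal (real k) + ereal 0 \<le> ereal B" using k by (meson add_left_mono order_trans)
    then show "k \<in> {..nat \<lceil>B\<rceil>}" by (simp add: le_nat_iff) linarith
  qed
  then show "finite {k. ereal (real k) + nov_val (r $ k) \<le> ereal B}" by (rule finite_subset) simp
qed

lemma s_hom_sum: "(\<And>i. i \<in> I \<Longrightarrow> s_hom j (f i)) \<Longrightarrow> s_hom j (\<Sum>i\<in>I. f i)"
  by (induction I rule: infinite_finite_induct) (auto intro: s_hom_add)

lemma endo_hom_sum: "(\<And>i. i \<in> I \<Longrightarrow> endo_hom j (f i)) \<Longrightarrow> endo_hom j (\<Sum>i\<in>I. f i)"
  unfolding endo_hom_iff en_sum by (auto intro!: s_hom_sum)

lemma ends_hom_mult: "ends_hom i a \<Longrightarrow> ends_hom j b \<Longrightarrow> ends_hom (i + j) (a * b)"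
proof -
  have "endo_hom (i + j) (\<phi> * \<psi>)" if "endo_hom i \<phi>" "endo_hom j \<psi>" for \<phi> \<psi>
    unfolding endo_hom_def times_endo.rep_eq using that unfolding endo_hom_def by (metis add.assoc add.commute)
  then show "ends_hom i a \<Longrightarrow> ends_hom j b \<Longrightarrow> ends_hom (i + j) (a * b)"
    unfolding ends_hom_def fps_mult_nth by (intro allI endo_hom_sum) blast
qed

lemma ends_hom_scalar: "Rs_hom j r \<Longrightarrow> ends_hom j (ends_scalar r)"
  using s_hom_const by (simp add: ends_hom_def ends_scalar_def endo_hom_iff Rs_hom_def)

text \<open>Any nonzero coefficient of an expansion determines the degree. With this the chosen
  \<open>deg\<close> of a nonzero element becomes computable.\<close>

lemma ends_hom_unique:
  assumes "ends_hom i a" "ends_hom j a" "a \<noteq> 0"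
  shows "i = j"
proof -
  have s: "i' = j'" if "s_hom i' f" "s_hom j' f" "f \<noteq> 0" for i' j' f
  proof -
    have "expand True f \<noteq> 0" using expand_inject that(3) by blast
    then obtain N where "expand True f $$ N \<noteq> 0" using fls_eqI[of "expand True f" 0] by auto
    then obtain n where "expand True f $$ N $$ n \<noteq> 0" using fls_eqI[of "expand True f $$ N" 0] by auto
    then show ?thesis using s_hom_expand that by metis
  qed
  obtain k where k: "a $ k \<noteq> 0" using assms(3) fps_ext[of a 0] by auto
  have h: "endo_hom i (a $ k)" "endo_hom j (a $ k)" using assms by (simp_all add: ends_hom_def)
  have "en11 (a $ k) \<noteq> 0 \<or> en12 (a $ k) \<noteq> 0 \<or> en21 (a $ k) \<noteq> 0 \<or> en22 (a $ k) \<noteq> 0"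
    using k en_eqI[of "a $ k" 0] by auto
  then show ?thesis
    using h s[of i "en11 (a $ k)" j] s[of "i + 1" "en12 (a $ k)" "j + 1"] s[of "i - 1" "en21 (a $ k)" "j - 1"] s[of i "en22 (a $ k)" j]
    unfolding endo_hom_iff by auto
qed

lemma deg_eq: "ends_hom j a \<Longrightarrow> a \<noteq> 0 \<Longrightarrow> deg a = j"
  using ends_hom_unique ends_hom_deg homog_def by blast

text \<open>The entries expanded at one end are power series over a field, a domain, and the
  expansion is injective.\<close>

lemma ends_scalar_mult_nz:
  assumes "r \<noteq> 0" "a \<noteq> 0"
  shows "ends_scalar r * a \<noteq> 0"
proof
  assume z: "ends_scalar r * a = 0"
  let ?r = "Abs_fps (\<lambda>k. emb (r $ k))" and ?a = "ends_mat True a"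
  have "ends_mat True (ends_scalar r) * ?a = 0"
    unfolding ends_mat_mult[symmetric] z
    by (rule mat22.expand) (simp add: zero_mat22_def fps_eq_iff ends_mat_sel)
  then have e: "?r * mat_11 ?a = 0" "?r * mat_12 ?a = 0" "?r * mat_21 ?a = 0" "?r * mat_22 ?a = 0"
    unfolding ends_mat_scalar by (simp_all add: times_mat22_def zero_mat22_def)
  have "Abs_fps (\<lambda>k. emb (r $ k)) \<noteq> 0"
  proof
    assume "Abs_fps (\<lambda>k. emb (r $ k)) = 0"
    then have "emb (r $ k) $$ m $$ 0 = 0" for k m by (metis fls_zero_nth fps_nth_Abs_fps fps_zero_nth)
    then have "r = 0" by (intro fps_ext fls_eqI) (simp add: emb_nth)
    then show False using assms(1) by simp
  qed
  then have 0: "mat_11 ?a = 0" "mat_12 ?a = 0" "mat_21 ?a = 0" "mat_22 ?a = 0"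
    using e by simp_all
  have "a $ k = 0" for k
  proof -
    have "mat_11 (emat True (a $ k)) = 0" "mat_12 (emat True (a $ k)) = 0"
      "mat_21 (emat True (a $ k)) = 0" "mat_22 (emat True (a $ k)) = 0"
      unfolding ends_mat_sel[symmetric] by (simp_all add: 0)
    then have "expand True (en11 (a $ k)) = 0" "expand True (en12 (a $ k)) = 0"
      "expand True (en21 (a $ k)) = 0" "expand True (en22 (a $ k)) = 0" by (simp_all add: kap_def)
    then show ?thesis using expand_inject by (intro en_eqI) (metis en_0)+
  qed
  then have "a = 0" by (intro fps_ext) simp
  then show False using assms(2) by simp
qed

section \<open>An explicit bounding cochain\<close>

text \<open>For the root - e^(-s) the factors of W - c are P = z1 + T^(1/2) e^(-s) and Q = 1 -
  T^(-1/2) z0 e^s. Subtracting them from the entries of \<open>D\<close> leaves T^(1/2)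
  \<open>al\<close> and T^(-1/2) z0 \<open>be\<close>, the entries of \<open>b_exp\<close>.\<close>

definition al :: "real fps" where "al = 1 - fps_exp (- 1)"
definition be :: "real fps" where "be = fps_exp 1 - 1"

definition b_exp :: ends where
  "b_exp = Abs_fps (\<lambda>k. mat_endo ((0, s_const (fls_const (al $ k) * Thalf)),
     (s_const (fls_const (be $ k)) * (s_const (inverse Thalf) * z0), 0)))"

lemma b_exp_sel [simp]:
  "en11 (b_exp $ k) = 0" "en12 (b_exp $ k) = s_const (fls_const (al $ k) * Thalf)"
  "en21 (b_exp $ k) = s_const (fls_const (be $ k)) * (s_const (inverse Thalf) * z0)" "en22 (b_exp $ k) = 0"
  by (simp_all add: b_exp_def)

lemma b_exp_0: "b_exp $ 0 = 0"
  by (rule en_eqI) (simp_all add: al_def be_def s_const_hom(4))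

lemma b_exp_hom: "ends_hom 1 b_exp"
proof -
  have 1: "s_hom 2 (s_const (fls_const x * Thalf))" for x
    by (rule s_hom_const) (simp add: nov_hom_def fls_const_mult_nth)
  have "s_hom (0 + (- 2 + 2)) (s_const (fls_const x) * (s_const (inverse Thalf) * z0))" for x
    by (intro s_hom_mult s_hom_Thalf s_hom_z s_hom_const) (simp add: nov_hom_def)
  then show ?thesis using 1 by (simp add: ends_hom_def endo_hom_iff)
qed

text \<open>Both entries raise the valuation by zeta0 / 2, which is positive but has infimum 0 over
  the simplex. The gain must come from s: there is no s^0 term, and 1/2 - k/2 \<le> 0 for k \<ge>
  1.\<close>

lemma b_exp_ge: "ends_ge (1 / 2) b_exp"
  unfolding ends_ge_def
proof
  fix k
  have "endo_ge 0 (b_exp $ k)"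
    unfolding endo_ge_def
  proof (intro ballI allI impI)
    fix \<zeta> m B assume \<zeta>: "\<zeta> \<in> simplex" and m: "ereal B \<le> m_val \<zeta> m"
    obtain x y where z: "snd \<zeta> = y" "fst \<zeta> = x" "x + y = 1" "0 < x" "0 < y" using \<zeta> by (auto simp: simplex_def)
    have m': "ereal B \<le> s_val \<zeta> (m_coord_1 m)" "ereal (B - y / 2) \<le> s_val \<zeta> (m_coord_e1 m)"
      using m z(1) by (simp_all add: m_val_ge_iff[OF \<zeta>])
    have a: "ereal (0 + 1 / 2) \<le> s_val \<zeta> (s_const (fls_const (al $ k) * Thalf))"
      unfolding s_const_hom(2) by (intro s_val_mult_ge[OF \<zeta>] s_val_const_ge nov_val_const s_val_Thalf)
    have "ereal (B - y / 2 + (0 + 1 / 2)) \<le> s_val \<zeta> (m_coord_e1 m * en12 (b_exp $ k))"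
      unfolding b_exp_sel by (rule s_val_mult_ge[OF \<zeta> m'(2) a])
    moreover have "ereal B \<le> ereal (B - y / 2 + (0 + 1 / 2))" using z by simp
    ultimately have 1: "ereal B \<le> s_val \<zeta> (m_coord_e1 m * en12 (b_exp $ k))" by (rule order_trans[rotated])
    have "ereal (B + (0 + (- 1 / 2 + fst \<zeta>))) \<le> s_val \<zeta> (m_coord_1 m * en21 (b_exp $ k))"
      unfolding b_exp_sel
      by (intro s_val_mult_ge[OF \<zeta>] m' s_val_const_ge nov_val_const s_val_Thalf s_val_z0_ge)
    moreover have "ereal (B - y / 2) \<le> ereal (B + (0 + (- 1 / 2 + fst \<zeta>)))" using z by simp
    ultimately have "ereal (B - y / 2) \<le> s_val \<zeta> (m_coord_1 m * en21 (b_exp $ k))" by (rule order_trans[rotated])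
    then show "ereal (0 + B) \<le> m_val \<zeta> (endo_app (b_exp $ k) m)"
      using 1 z(1) unfolding m_val_ge_iff[OF \<zeta>] endo_app_coords[of _ m] en_defs[symmetric] by simp
  qed
  then show "endo_ge (1 / 2 - real k / 2) (b_exp $ k)"
    by (cases k) (auto simp: b_exp_0 intro: endo_ge_mono)
qed

lemma exp_al_be: "fps_exp 1 * fps_exp (- 1) = (1 :: real fps)"
  by (simp add: fps_exp_add_mult[symmetric])

lemma b_exp_potential_eq: "delta b_exp - b_exp * b_exp = ends_scalar exp_potential"
proof (rule fps_ext)
  fix k
  let ?p = "s_const Thalf + z1" and ?q = "1 - s_const (inverse Thalf) * z0" and ?z = "s_const (inverse Thalf) * z0"
  have minus: "en11 (\<phi> - \<psi>) = en11 \<phi> - en11 \<psi>" "en12 (\<phi> - \<psi>) = en12 \<phi> - en12 \<psi>"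
    "en21 (\<phi> - \<psi>) = en21 \<phi> - en21 \<psi>" "en22 (\<phi> - \<psi>) = en22 \<phi> - en22 \<psi>" for \<phi> \<psi>
    using en_add[of "\<phi> - \<psi>" \<psi>] by simp_all
  have nth: "(delta b_exp - b_exp * b_exp) $ k
      = D_M * b_exp $ k + b_exp $ k * D_M - (\<Sum>i=0..k. b_exp $ i * b_exp $ (k - i))"
    unfolding delta_odd[OF b_exp_hom] by (simp add: fps_mult_nth[of b_exp b_exp])
  let ?s = "\<lambda>x. s_const (fls_const x)"
  have m: "?s x * ?s y = ?s (x * y)" "?s x + ?s y = ?s (x + y)" "?s x - ?s y = ?s (x - y)" for x y
    using ring_map_scal fps_map_diff[OF ring_map_scal, of "fps_const x" "fps_const y"]
    by (simp_all add: ring_map_def fps_eq_iff) (metis)?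
  have zz: "s_const Thalf * ?z = z0" "z1 * ?z = s_const Thalf"
    using s_const_Thalf by (metis mult.assoc mult.commute mult_1)+
  have conv: "(\<Sum>i=0..k. s_const (fls_const (x $ i) * Thalf) * (?s (y $ (k - i)) * ?z)) = ?s ((x * y) $ k) * z0" for x y
  proof -
    have "(\<Sum>i=0..k. s_const (fls_const (x $ i) * Thalf) * (?s (y $ (k - i)) * ?z))
        = (\<Sum>i=0..k. ?s (x $ i) * ?s (y $ (k - i))) * (s_const Thalf * ?z)"
      unfolding sum_distrib_right by (intro sum.cong refl) (simp add: s_const_hom mult_ac)
    then show ?thesis unfolding zz fps_mult_nth ring_map_sum[OF ring_map_scal] m .
  qed
  \<comment> \<open>(1 - al) (1 + be) = 1 makes all terms with z0 cancel, and only a scalar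
    remains.\<close>
  have al_be: "be - al - al * be = 0" "al + be = fps_exp 1 - fps_exp (- 1)"
    using exp_al_be by (simp_all add: al_def be_def algebra_simps)
  have 11: "?p * (?s (be $ k) * ?z) + s_const (fls_const (al $ k) * Thalf) * ?q - ?s ((al * be) $ k) * z0
      = s_const (exp_potential $ k)"
  proof -
    have "?p * (?s (be $ k) * ?z) = ?s (be $ k) * (s_const Thalf * ?z + z1 * ?z)" by (simp add: algebra_simps)
    moreover have "s_const (fls_const (al $ k) * Thalf) * ?q = ?s (al $ k) * (s_const Thalf - s_const Thalf * ?z)"
      by (simp add: s_const_hom algebra_simps)
    ultimately have "?p * (?s (be $ k) * ?z) + s_const (fls_const (al $ k) * Thalf) * ?q - ?s ((al * be) $ k) * z0
        = (?s (be $ k) - ?s (al $ k) - ?s ((al * be) $ k)) * z0 + (?s (al $ k) + ?s (be $ k)) * s_const Thalf"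
      unfolding zz by (simp add: algebra_simps)
    also have "\<dots> = ?s ((be - al - al * be) $ k) * z0 + ?s ((al + be) $ k) * s_const Thalf"
      unfolding m by simp
    also have "\<dots> = s_const (exp_potential $ k)"
      unfolding al_be by (simp add: exp_potential_def s_const_hom)
    finally show ?thesis .
  qed
  have conv': "(\<Sum>i=0..k. (?s (be $ i) * ?z) * s_const (fls_const (al $ (k - i)) * Thalf)) = ?s ((al * be) $ k) * z0"
    unfolding conv[symmetric]
    by (rule sum.reindex_bij_witness[of _ "\<lambda>i. k - i" "\<lambda>i. k - i"]) (auto simp: mult_ac)
  show "(delta b_exp - b_exp * b_exp) $ k = ends_scalar exp_potential $ k"
  proof (rule en_eqI)
    show "en11 ((delta b_exp - b_exp * b_exp) $ k) = en11 (ends_scalar exp_potential $ k)"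
      using 11 unfolding nth minus en_add en_mult en_sum en_D b_exp_sel
      by (simp add: conv[of al be] ends_scalar_def)
    have "?q * s_const (fls_const (al $ k) * Thalf) + (?s (be $ k) * ?z) * ?p - ?s ((al * be) $ k) * z0
      = s_const (exp_potential $ k)"
      unfolding 11[symmetric] by (metis add.commute mult.commute)
    then show "en22 ((delta b_exp - b_exp * b_exp) $ k) = en22 (ends_scalar exp_potential $ k)"
      unfolding nth minus en_add en_mult en_sum en_D b_exp_sel
      by (simp add: conv' ends_scalar_def)
  qed (unfold nth minus en_add en_mult en_sum en_D b_exp_sel, simp_all add: ends_scalar_def)
qed

lemma exp_potential_pure: "pure_scalar 1 exp_potential"
proof -
  have "endo_ge (1 - real k / 2) (ends_scalar exp_potential $ k)" for k
  proof (cases k)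
    case 0
    have "ends_scalar exp_potential $ 0 = 0"
      by (rule en_eqI) (simp_all add: ends_scalar_def exp_potential_def s_const_hom)
    then show ?thesis using 0 by simp
  next
    case (Suc j)
    have "endo_ge (1 / 2) (endo_scalar (s_const (exp_potential $ k)))"
      by (rule endo_ge_scalar) (auto simp: exp_potential_def nov_val_ge_iff fls_const_mult_nth)
    then show ?thesis using Suc by (auto simp: ends_scalar_def intro: endo_ge_mono)
  qed
  moreover have "exp_potential \<noteq> 0"
  proof
    assume "exp_potential = 0"
    then have "exp_potential $ 1 $$ 1 = 0" by simp
    then show False by (simp add: exp_potential_def fls_const_mult_nth)
  qed
  ultimately show ?thesis by (auto simp: pure_scalar_def ends_ge_def exp_potential_def)
qed

lemma b_exp_bounding: "is_potential b_exp exp_potential" "bounding_cochain b_exp"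
proof -
  have "ereal (1 / 2) \<le> Rs_val exp_potential"
    unfolding Rs_val_def
  proof (rule INF_greatest)
    fix k
    have "ereal (1 / 2) \<le> nov_val (exp_potential $ k)"
      by (auto simp: exp_potential_def nov_val_ge_iff fls_const_mult_nth)
    then have "ereal 0 + ereal (1 / 2) \<le> ereal (real k) + nov_val (exp_potential $ k)" by (intro add_mono) auto
    then show "ereal (1 / 2) \<le> ereal (real k) + nov_val (exp_potential $ k)" by simp
  qed
  then have "0 < Rs_val exp_potential" by (rule less_le_trans[rotated]) simp
  then show 1: "is_potential b_exp exp_potential"
    using pure_scalar_Rs[OF exp_potential_pure] pure_scalar_hom[OF exp_potential_pure] b_exp_potential_eq
    by (simp add: is_potential_def)
  have "0 < ends_val b_exp" by (rule less_le_trans[OF _ ends_ge_val[OF b_exp_ge]]) simp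
  then show "bounding_cochain b_exp"
    using 1 b_exp_hom ends_ge_Ends[OF b_exp_ge] by (auto simp: bounding_cochain_def)
qed

section \<open>Congruence of chains\<close>

lemma relations_uminus: "x \<in> tensor_relations \<Longrightarrow> - x \<in> tensor_relations"
  using tensor_relations.diff[OF tensor_relations.zero, of x] by simp

lemma relations_add: "x \<in> tensor_relations \<Longrightarrow> y \<in> tensor_relations \<Longrightarrow> x + y \<in> tensor_relations"
  using tensor_relations.diff[of x "- y"] relations_uminus[of y] by simp

lemma relations_sum: "(\<And>i. i \<in> I \<Longrightarrow> f i \<in> tensor_relations) \<Longrightarrow> (\<Sum>i\<in>I. f i) \<in> tensor_relations"
  by (induction I rule: infinite_finite_induct) (auto intro: relations_add tensor_relations.zero)

lemma words_ge_add: "x \<in> words_ge B \<Longrightarrow> y \<in> words_ge B \<Longrightarrow> x + y \<in> words_ge B"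
  using keys_add[of x y] unfolding words_ge_def by (auto simp: subset_iff)

lemma words_ge_uminus: "x \<in> words_ge B \<Longrightarrow> - x \<in> words_ge B"
  by (simp add: words_ge_def)

lemma words_ge_0 [simp]: "0 \<in> words_ge B"
  by (simp add: words_ge_def)

lemma words_ge_sum: "(\<And>i. i \<in> I \<Longrightarrow> f i \<in> words_ge B) \<Longrightarrow> (\<Sum>i\<in>I. f i) \<in> words_ge B"
  by (induction I rule: infinite_finite_induct) (auto intro: words_ge_add)

lemma words_ge_cmul: "x \<in> words_ge B \<Longrightarrow> frag_cmul n x \<in> words_ge B"
  using keys_cmul[of n x] unfolding words_ge_def by (simp add: subset_iff)

lemma words_ge_mono: "x \<in> words_ge B \<Longrightarrow> C \<le> B \<Longrightarrow> x \<in> words_ge C"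
  unfolding words_ge_def using order_trans[of "ereal C" "ereal B"] by auto

lemma cyc_t_add: "cyc_t (x + y) = cyc_t x + cyc_t y"
  unfolding cyc_t_def by (rule frag_extend_add)

lemma cyc_t_uminus: "cyc_t (- x) = - cyc_t x"
  unfolding cyc_t_def by (rule frag_extend_minus)

text \<open>Equality in the quotient by the tensor relations and the image of \<open>id - t\<close> on words of valuation at least \<open>B\<close>.\<close>

definition cyc_eq :: "real \<Rightarrow> pre_chain \<Rightarrow> pre_chain \<Rightarrow> bool" where
  "cyc_eq B x y \<longleftrightarrow> (\<exists>u\<in>words_ge B. x - y - (u - cyc_t u) \<in> tensor_relations)"

lemma cyc_eq_relations: "x - y \<in> tensor_relations \<Longrightarrow> cyc_eq B x y"
  unfolding cyc_eq_def by (intro bexI[of _ 0]) (simp_all add: cyc_t_def)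

lemma cyc_eq_refl [simp]: "cyc_eq B x x"
  by (rule cyc_eq_relations) (simp add: tensor_relations.zero)

lemma cyc_eq_add:
  assumes "cyc_eq B x y" "cyc_eq B x' y'"
  shows "cyc_eq B (x + x') (y + y')"
proof -
  obtain u u' where u: "u \<in> words_ge B" "x - y - (u - cyc_t u) \<in> tensor_relations"
    and u': "u' \<in> words_ge B" "x' - y' - (u' - cyc_t u') \<in> tensor_relations"
    using assms unfolding cyc_eq_def by blast
  have "x + x' - (y + y') - (u + u' - cyc_t (u + u')) \<in> tensor_relations"
    using relations_add[OF u(2) u'(2)] by (simp add: cyc_t_add algebra_simps)
  then show ?thesis unfolding cyc_eq_def using words_ge_add[OF u(1) u'(1)] by blast
qed

lemma cyc_eq_uminus:
  assumes "cyc_eq B x y"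
  shows "cyc_eq B (- x) (- y)"
proof -
  obtain u where u: "u \<in> words_ge B" "x - y - (u - cyc_t u) \<in> tensor_relations"
    using assms unfolding cyc_eq_def by blast
  have "- x - (- y) - (- u - cyc_t (- u)) \<in> tensor_relations"
    using relations_uminus[OF u(2)] by (simp add: cyc_t_uminus algebra_simps)
  then show ?thesis unfolding cyc_eq_def using words_ge_uminus[OF u(1)] by blast
qed

lemma cyc_eq_diff: "cyc_eq B x y \<Longrightarrow> cyc_eq B x' y' \<Longrightarrow> cyc_eq B (x - x') (y - y')"
  using cyc_eq_add[of B x y "- x'" "- y'"] cyc_eq_uminus[of B x' y'] by simp

lemma cyc_eq_sym: "cyc_eq B x y \<Longrightarrow> cyc_eq B y x"
  using cyc_eq_uminus[of B "x - y" 0] unfolding cyc_eq_def by simp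

lemma cyc_eq_trans [trans]: "cyc_eq B x y \<Longrightarrow> cyc_eq B y z \<Longrightarrow> cyc_eq B x z"
  using cyc_eq_add[of B x y y z] unfolding cyc_eq_def by (simp add: algebra_simps)

lemma cyc_eq_sum: "(\<And>i. i \<in> I \<Longrightarrow> cyc_eq B (f i) (g i)) \<Longrightarrow> cyc_eq B (\<Sum>i\<in>I. f i) (\<Sum>i\<in>I. g i)"
  by (induction I rule: infinite_finite_induct) (auto intro: cyc_eq_add)

lemma cyc_eq_cmul:
  assumes "cyc_eq B x y"
  shows "cyc_eq B (frag_cmul n x) (frag_cmul n y)"
proof -
  have nat: "cyc_eq B (frag_cmul (int m) x) (frag_cmul (int m) y)" for m
    by (induction m) (simp_all add: frag_cmul_distrib cyc_eq_add[OF assms])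
  show ?thesis
  proof (cases "n \<ge> 0")
    case True then show ?thesis using nat[of "nat n"] by simp
  next
    case False then show ?thesis using cyc_eq_uminus[OF nat[of "nat (- n)"]] by simp
  qed
qed

text \<open>Additivity applied to 0 + 0 = 0 leaves minus the word itself.\<close>

lemma relations_zero_letter:
  assumes "is_word (u @ [0] @ v)"
  shows "frag_of (u @ [0] @ v) \<in> tensor_relations"
  using relations_uminus[OF tensor_relations.additive[OF assms assms, of 0]] by (simp add: ends_hom_def endo_hom_iff)

section \<open>Words in the unit and a curved Maurer--Cartan element\<close>

text \<open>Symbols for id, b, b * b and c id, closed under what one application of
  \<open>d_cc\<close> does to words in id and b. On symbols the degrees and the lower bounds of
  valuations can be computed.\<close>

datatype letter = E | Bt | BB | CC

definition ldeg :: "letter \<Rightarrow> int" where "ldeg x = (case x of E \<Rightarrow> 0 | Bt \<Rightarrow> 1 | BB \<Rightarrow> 2 | CC \<Rightarrow> 2)"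
definition lval :: "letter \<Rightarrow> real" where "lval x = (case x of E \<Rightarrow> 0 | Bt \<Rightarrow> 1 / 2 | BB \<Rightarrow> 1 | CC \<Rightarrow> 1)"
definition wdeg :: "letter list \<Rightarrow> int" where "wdeg ws = (\<Sum>x\<leftarrow>ws. ldeg x - 1)"

lemmas letter_simps = ldeg_def lval_def

lemma wdeg_simps [simp]: "wdeg [] = 0" "wdeg (x # ws) = ldeg x - 1 + wdeg ws" "wdeg (us @ ws) = wdeg us + wdeg ws"
  by (simp_all add: wdeg_def)

text \<open>A product only when both arguments are \<open>E\<close> or \<open>Bt\<close>; on other
  pairs without \<open>E\<close> the value \<open>BB\<close> is a default.\<close>

fun lmult :: "letter \<Rightarrow> letter \<Rightarrow> letter" where
  "lmult E y = y" | "lmult x E = x" | "lmult x y = BB"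

lemma sign_even: "even n \<Longrightarrow> sign n = 1"
  by (simp add: sign_def)

lemma sign_cong: "even (m - n) \<Longrightarrow> sign m = sign n"
  by (auto simp: sign_def)

text \<open>Nonvanishing of \<open>b * b\<close> forces \<open>deg\<close> to be 1 on b and 2 on its
  square; for zero letters the signs would be undetermined.\<close>

locale curved_cochain =
  fixes b :: ends and c :: "real fls fps"
  assumes b_hom: "ends_hom 1 b" and b_ge: "ends_ge (1 / 2) b" and c_pure: "pure_scalar 1 c"
    and curved: "delta b = b * b + ends_scalar c" and bb_nz: "b * b \<noteq> 0"
begin

definition lev :: "letter \<Rightarrow> ends" where
  "lev x = (case x of E \<Rightarrow> 1 | Bt \<Rightarrow> b | BB \<Rightarrow> b * b | CC \<Rightarrow> ends_scalar c)"

lemma lev_simps [simp]: "lev E = 1" "lev Bt = b" "lev BB = b * b" "lev CC = ends_scalar c"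
  by (simp_all add: lev_def)

lemma lev_hom: "ends_hom (ldeg x) (lev x)"
  using ends_hom_1 b_hom ends_hom_mult[OF b_hom b_hom] ends_hom_scalar[OF pure_scalar_hom[OF c_pure]]
  by (cases x) (simp_all add: letter_simps)

lemma lev_ge: "ends_ge (lval x) (lev x)"
  using ends_ge_1 b_ge ends_ge_mult[OF b_ge b_ge] c_pure
  by (cases x) (simp_all add: letter_simps pure_scalar_def)

lemma lev_nz: "lev x \<noteq> 0"
proof (cases x)
  case CC
  have "ends_scalar c * 1 \<noteq> 0" using c_pure by (intro ends_scalar_mult_nz) (auto simp: pure_scalar_def)
  then show ?thesis using CC by simp
qed (use bb_nz in auto)

lemma lev_lmult: "x \<in> {E, Bt} \<Longrightarrow> y \<in> {E, Bt} \<Longrightarrow> lev (lmult x y) = lev x * lev y"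
  by auto

lemma deg_lev: "deg (lev x) = ldeg x"
  by (rule deg_eq[OF lev_hom lev_nz])

lemma scaled_hom: "pure_scalar n r \<Longrightarrow> ends_hom (2 * int n + ldeg x) (ends_scalar r * lev x)"
  by (intro ends_hom_mult ends_hom_scalar pure_scalar_hom lev_hom)

lemma scaled_ge: "pure_scalar n r \<Longrightarrow> ends_ge (real n + lval x) (ends_scalar r * lev x)"
  by (intro ends_ge_mult lev_ge) (simp add: pure_scalar_def)

lemma deg_scaled: "pure_scalar n r \<Longrightarrow> deg (ends_scalar r * lev x) = 2 * int n + ldeg x"
  by (intro deg_eq scaled_hom ends_scalar_mult_nz lev_nz) (simp_all add: pure_scalar_def)

lemma sdeg_map_lev: "sdeg (map lev ws) = wdeg ws"
  by (induction ws) (simp_all add: sdeg_Cons deg_lev)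

text \<open>By balancing a scalar may sit at any letter; keeping it at the first one gives a normal
  form.\<close>

definition raw :: "real fls fps \<Rightarrow> letter list \<Rightarrow> ends list" where
  "raw r ws = (ends_scalar r * lev (hd ws)) # map lev (tl ws)"

definition wterm :: "real fls fps \<Rightarrow> letter list \<Rightarrow> pre_chain" where
  "wterm r ws = frag_of (raw r ws)"

lemma raw_Cons: "raw r (x # ws) = (ends_scalar r * lev x) # map lev ws"
  by (simp add: raw_def)

lemma raw_append: "us \<noteq> [] \<Longrightarrow> raw r (us @ ws) = raw r us @ map lev ws"
  by (cases us) (simp_all add: raw_Cons)

lemma length_raw [simp]: "ws \<noteq> [] \<Longrightarrow> length (raw r ws) = length ws"
  by (cases ws) (simp_all add: raw_Cons)

lemma sdeg_raw: "pure_scalar n r \<Longrightarrow> ws \<noteq> [] \<Longrightarrow> sdeg (raw r ws) = 2 * int n + wdeg ws"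
  by (cases ws) (simp_all add: raw_Cons sdeg_Cons sdeg_map_lev deg_scaled)

definition good :: "ends \<Rightarrow> bool" where "good a \<longleftrightarrow> a \<in> Ends \<and> (\<exists>j. ends_hom j a)"

lemma good_lev: "good (lev x)"
  unfolding good_def using ends_ge_Ends[OF lev_ge] lev_hom by blast

lemma good_scaled: "pure_scalar n r \<Longrightarrow> good (ends_scalar r * lev x)"
  unfolding good_def using ends_ge_Ends[OF scaled_ge] scaled_hom by blast

lemma good_0: "good 0"
proof -
  have "ends_ge 0 0" by (simp add: ends_ge_def)
  then show ?thesis unfolding good_def using ends_ge_Ends by (auto simp: ends_hom_def endo_hom_iff)
qed

lemma is_word_good: "is_word w \<longleftrightarrow> w \<noteq> [] \<and> (\<forall>a\<in>set w. good a)"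
  by (simp add: is_word_def good_def)

lemma good_raw: "pure_scalar n r \<Longrightarrow> a \<in> set (raw r ws) \<Longrightarrow> good a"
  using good_lev good_scaled by (auto simp: raw_def)

lemma is_word_raw: "pure_scalar n r \<Longrightarrow> is_word (raw r ws)"
  unfolding is_word_good using good_raw by (auto simp: raw_def)

lemma word_val_map_lev: "ereal (\<Sum>x\<leftarrow>ws. lval x) \<le> word_val (map lev ws)"
proof (induction ws)
  case Nil
  then show ?case by (simp add: word_val_def)
next
  case (Cons x ws)
  have "ereal (lval x) + ereal (\<Sum>x\<leftarrow>ws. lval x) \<le> ends_val (lev x) + word_val (map lev ws)"
    by (intro add_mono ends_ge_val lev_ge Cons.IH)
  then show ?case by (simp add: word_val_def)
qed

definition tval :: "nat \<Rightarrow> letter list \<Rightarrow> real" where "tval n ws = real n + (\<Sum>x\<leftarrow>ws. lval x)"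

lemma word_val_raw:
  assumes "pure_scalar n r" "ws \<noteq> []"
  shows "ereal (tval n ws) \<le> word_val (raw r ws)"
proof (cases ws)
  case (Cons x vs)
  have "ereal (real n + lval x) + ereal (\<Sum>x\<leftarrow>vs. lval x) \<le> ends_val (ends_scalar r * lev x) + word_val (map lev vs)"
    by (intro add_mono ends_ge_val scaled_ge[OF assms(1)] word_val_map_lev)
  then show ?thesis by (simp add: Cons raw_Cons word_val_def tval_def add.assoc)
qed (use assms in simp)

lemma term_ge: "pure_scalar n r \<Longrightarrow> ws \<noteq> [] \<Longrightarrow> B \<le> tval n ws \<Longrightarrow> wterm r ws \<in> words_ge B"
  unfolding wterm_def words_ge_def using word_val_raw[of n r ws] is_word_raw[of n r ws]
  by (auto intro: order_trans[of "ereal B" "ereal (tval n ws)"])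

lemma term_swap_scalar:
  assumes r: "pure_scalar n r"
  shows "frag_of (map lev (y # ws) @ [ends_scalar r * lev x]) - wterm r (y # ws @ [x]) \<in> tensor_relations"
proof -
  have "is_word ([] @ [lev y] @ map lev ws @ [lev x] @ [])"
    unfolding is_word_good using good_lev by auto
  then have "frag_of ([] @ [ends_scalar r * lev y] @ map lev ws @ [lev x] @ [])
      - frag_of ([] @ [lev y] @ map lev ws @ [ends_scalar r * lev x] @ []) \<in> tensor_relations"
    by (rule tensor_relations.balanced[OF _ pure_scalar_Rs[OF r] pure_scalar_hom[OF r]])
  from relations_uminus[OF this] show ?thesis by (simp add: wterm_def raw_Cons)
qed

text \<open>Rotation carries the scalar away with the first letter; balancing brings it back to the
  front.\<close>

lemma rotate_letter:
  assumes r: "pure_scalar n r" and B: "B \<le> tval n (x # ws)"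
  shows "cyc_eq B (wterm r (x # ws)) (frag_cmul (sign ((ldeg x - 1) * wdeg ws)) (wterm r (ws @ [x])))"
proof (cases ws)
  case Nil
  then show ?thesis by simp
next
  case (Cons y vs)
  let ?s = "sign ((ldeg x - 1) * wdeg ws)"
  have s: "sign ((deg (ends_scalar r * lev x) - 1) * sdeg (map lev ws)) = ?s"
    unfolding deg_scaled[OF r] sdeg_map_lev by (rule sign_cong) (simp add: algebra_simps)
  have "cyc_t (wterm r (x # ws)) = frag_cmul ?s (frag_of (map lev ws @ [ends_scalar r * lev x]))"
    unfolding wterm_def raw_Cons cyc_t_def frag_extend_of list.sel s ..
  then have "cyc_eq B (wterm r (x # ws)) (frag_cmul ?s (frag_of (map lev ws @ [ends_scalar r * lev x])))"
    unfolding cyc_eq_def using term_ge[OF r _ B] by (intro bexI[of _ "wterm r (x # ws)"]) (simp_all add: tensor_relations.zero)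
  also have "cyc_eq B \<dots> (frag_cmul ?s (wterm r (ws @ [x])))"
    using term_swap_scalar[OF r, of y vs x] unfolding Cons by (intro cyc_eq_cmul cyc_eq_relations) simp
  finally show ?thesis .
qed

lemma rotate_block:
  assumes r: "pure_scalar n r" and B: "B \<le> tval n (us @ ws)"
  shows "cyc_eq B (wterm r (us @ ws)) (frag_cmul (sign (wdeg us * wdeg ws)) (wterm r (ws @ us)))"
  using B
proof (induction us arbitrary: ws)
  case Nil
  then show ?case by simp
next
  case (Cons x us)
  let ?s = "sign ((ldeg x - 1) * wdeg (us @ ws))" and ?t = "sign (wdeg us * wdeg (ws @ [x]))"
  have B: "B \<le> tval n (us @ (ws @ [x]))" "B \<le> tval n (x # (us @ ws))"
    using Cons.prems by (simp_all add: tval_def)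
  have "cyc_eq B (wterm r (x # (us @ ws))) (frag_cmul ?s (wterm r ((us @ ws) @ [x])))"
    by (rule rotate_letter[OF r B(2)])
  moreover have "cyc_eq B (frag_cmul ?s (wterm r (us @ (ws @ [x])))) (frag_cmul ?s (frag_cmul ?t (wterm r ((ws @ [x]) @ us))))"
    by (rule cyc_eq_cmul[OF Cons.IH[OF B(1)]])
  ultimately have "cyc_eq B (wterm r (x # (us @ ws))) (frag_cmul ?s (frag_cmul ?t (wterm r ((ws @ [x]) @ us))))"
    unfolding append_assoc by (rule cyc_eq_trans)
  moreover have "?s * ?t = sign (wdeg (x # us) * wdeg ws)"
    unfolding sign_add[symmetric] by (rule sign_cong) (simp add: algebra_simps)
  ultimately show ?case unfolding frag_cmul_cmul append_assoc append_Cons append_Nil by (simp only:)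
qed

lemma rotate_even:
  assumes "pure_scalar n r" "B \<le> tval n (us @ ws)" "even (wdeg us)"
  shows "cyc_eq B (wterm r (us @ ws)) (wterm r (ws @ us))"
  using rotate_block[OF assms(1,2)] assms(3) by (simp add: sign_even)

text \<open>The curvature letter is a scalar times the unit: the scalar moves into the coefficient
  and a unit stays in its place.\<close>

lemma term_CC:
  assumes r: "pure_scalar n r"
  shows "wterm r (us @ CC # ws) - wterm (r * c) (us @ E # ws) \<in> tensor_relations"
proof (cases us)
  case Nil
  have "wterm r (us @ CC # ws) = wterm (r * c) (us @ E # ws)"
    unfolding Nil wterm_def append_Nil raw_Cons by (simp add: ends_scalar_mult)
  then show ?thesis by (simp add: tensor_relations.zero)
next
  case (Cons x vs)
  have "is_word ([] @ [ends_scalar r * lev x] @ map lev vs @ [1] @ map lev ws)"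
    unfolding is_word_good using good_lev good_lev[of E] good_scaled[OF r] by auto
  from tensor_relations.balanced[OF this pure_scalar_Rs[OF c_pure] pure_scalar_hom[OF c_pure]]
  have "frag_of ([] @ [ends_scalar c * (ends_scalar r * lev x)] @ map lev vs @ [1] @ map lev ws)
      - frag_of ([] @ [ends_scalar r * lev x] @ map lev vs @ [ends_scalar c * 1] @ map lev ws) \<in> tensor_relations" .
  from relations_uminus[OF this] show ?thesis
    unfolding Cons wterm_def append_Cons raw_Cons mult.commute[of r c] by (simp add: ends_scalar_mult mult.assoc)
qed

section \<open>The differential of a word\<close>

lemma delta_scaled: "pure_scalar n r \<Longrightarrow> delta (ends_scalar r * lev x) = ends_scalar r * delta (lev x)"
proof -
  assume r: "pure_scalar n r"
  have s: "sign (deg (ends_scalar r * lev x)) = sign (deg (lev x))"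
    unfolding deg_scaled[OF r] deg_lev by (rule sign_cong) simp
  have "fps_const D_M * (ends_scalar r * lev x) = ends_scalar r * (fps_const D_M * lev x)"
    by (metis ends_scalar_central mult.assoc)
  moreover have "of_int m * (ends_scalar r * lev x) * fps_const D_M = ends_scalar r * (of_int m * lev x * fps_const D_M)" for m
    by (metis mult.assoc mult_of_int_commute)
  ultimately show ?thesis unfolding delta_def s by (simp add: right_diff_distrib)
qed

lemma delta_unit: "delta (lev E) = 0"
  using deg_lev[of E] by (simp add: delta_def ldeg_def)

definition delta_term :: "real fls fps \<Rightarrow> letter list \<Rightarrow> letter \<Rightarrow> letter list \<Rightarrow> pre_chain" where
  "delta_term r us x ws = (if x = Bt then wterm r (us @ BB # ws) + wterm r (us @ CC # ws) else 0)"

lemma frag_delta: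
  assumes r: "pure_scalar n r" and x: "x \<in> {E, Bt}"
  shows "frag_of ((raw r (us @ x # ws))[length us := delta (raw r (us @ x # ws) ! length us)])
      - delta_term r us x ws \<in> tensor_relations"
proof -
  obtain u a j where u: "raw r (us @ x # ws) = u @ [ends_scalar a * lev x] @ map lev ws" "length u = length us"
    "\<forall>a\<in>set u. good a" "\<And>y. raw r (us @ y # ws) = u @ [ends_scalar a * lev y] @ map lev ws" "pure_scalar j a"
  proof (cases us)
    case Nil
    then show ?thesis using that[of "[]" r n] r by (simp add: raw_Cons)
  next
    case (Cons y vs)
    have "pure_scalar 0 1" using pure_scalar_const[of 1] by simp
    moreover have ra: "raw r (us @ y # ws) = raw r us @ [ends_scalar 1 * lev y] @ map lev ws" for y
      using Cons by (subst raw_append) simp_all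
    ultimately show ?thesis by (intro that[OF ra _ _ ra, of 0]) (use Cons good_raw[OF r] in auto)
  qed
  have w: "(raw r (us @ x # ws))[length us := delta (raw r (us @ x # ws) ! length us)]
      = u @ [ends_scalar a * delta (lev x)] @ map lev ws"
    unfolding u(1) u(2)[symmetric] delta_scaled[OF u(5), symmetric] by simp
  show ?thesis
  proof (cases "x = Bt")
    case True
    have "is_word (u @ [ends_scalar a * lev y] @ map lev ws)" for y
      unfolding is_word_good using good_lev good_scaled[OF u(5)] u(3) by auto
    moreover have "ends_hom (2 * int j + 2) (ends_scalar a * lev BB)" "ends_hom (2 * int j + 2) (ends_scalar a * lev CC)"
      using scaled_hom[OF u(5), of BB] scaled_hom[OF u(5), of CC] by (simp_all only: ldeg_def letter.case)
    ultimately have "frag_of (u @ [ends_scalar a * lev BB + ends_scalar a * lev CC] @ map lev ws)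
        - frag_of (u @ [ends_scalar a * lev BB] @ map lev ws) - frag_of (u @ [ends_scalar a * lev CC] @ map lev ws) \<in> tensor_relations"
      by (intro tensor_relations.additive)
    moreover have "ends_scalar a * lev BB + ends_scalar a * lev CC = ends_scalar a * delta (lev x)"
      unfolding True lev_simps curved by (simp add: distrib_left)
    ultimately show ?thesis unfolding w unfolding delta_term_def wterm_def u(4) using True by (simp add: diff_diff_eq)
  next
    case False
    then have "x = E" using x by simp
    moreover have "is_word (u @ [0] @ map lev ws)"
      unfolding is_word_good using good_lev good_0 u(3) by auto
    ultimately show ?thesis using relations_zero_letter False unfolding w unfolding delta_term_def \<open>x = E\<close> delta_unit by simp
  qed
qed

section \<open>The boundary operators on symbolic words\<close>

definition delta_words :: "(letter list \<Rightarrow> letter \<Rightarrow> letter list \<Rightarrow> pre_chain) \<Rightarrow> letter list \<Rightarrow> pre_chain" where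
  "delta_words f ws = (\<Sum>p<length ws. frag_cmul (sign (wdeg (take p ws))) (f (take p ws) (ws ! p) (drop (Suc p) ws)))"

definition merge_words :: "(letter list \<Rightarrow> pre_chain) \<Rightarrow> letter list \<Rightarrow> pre_chain" where
  "merge_words f ws = (\<Sum>p<length ws - 1. frag_cmul (sign (wdeg (take (Suc p) ws)))
     (f (take p ws @ lmult (ws ! p) (ws ! Suc p) # drop (Suc (Suc p)) ws)))"

definition wrap_word :: "letter list \<Rightarrow> letter list" where
  "wrap_word ws = lmult (last ws) (hd ws) # butlast (tl ws)"

lemma sign_sdeg_take:
  assumes r: "pure_scalar n r" and "ws \<noteq> []"
  shows "sign (sdeg (take p (raw r ws))) = sign (wdeg (take p ws))"
proof (cases p)
  case (Suc q)
  obtain x vs where w: "ws = x # vs" using assms(2) by (cases ws) auto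
  have t: "take p (raw r ws) = raw r (take p ws)" and nz: "take p ws \<noteq> []"
    unfolding Suc w by (simp_all add: raw_Cons take_map)
  show ?thesis unfolding t sdeg_raw[OF r nz] by (rule sign_cong) simp
qed simp

lemma b_mu1_raw:
  assumes r: "pure_scalar n r" and ws: "ws \<noteq> []" "set ws \<subseteq> {E, Bt}"
  shows "cyc_eq B (b_mu1 (raw r ws)) (delta_words (delta_term r) ws)"
  unfolding b_mu1_def delta_words_def length_raw[OF ws(1)] sign_sdeg_take[OF r ws(1)]
proof (intro cyc_eq_sum cyc_eq_cmul cyc_eq_relations)
  fix p assume "p \<in> {..<length ws}"
  then have p: "p < length ws" by simp
  then have d: "ws = take p ws @ ws ! p # drop (Suc p) ws" "length (take p ws) = p" "ws ! p \<in> {E, Bt}"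
    using subsetD[OF ws(2) nth_mem[OF p]] by (simp_all add: id_take_nth_drop[symmetric])
  from frag_delta[OF r d(3), of "take p ws" "drop (Suc p) ws", unfolded d(1)[symmetric] d(2)]
  show "frag_of ((raw r ws)[p := delta (raw r ws ! p)]) - delta_term r (take p ws) (ws ! p) (drop (Suc p) ws) \<in> tensor_relations" .
qed

lemma raw_merge:
  assumes ws: "set ws \<subseteq> {E, Bt}" and p: "Suc p < length ws"
  shows "take p (raw r ws) @ [raw r ws ! p * raw r ws ! Suc p] @ drop (Suc (Suc p)) (raw r ws)
    = raw r (take p ws @ lmult (ws ! p) (ws ! Suc p) # drop (Suc (Suc p)) ws)"
proof -
  have l: "lev (lmult (ws ! p) (ws ! Suc p)) = lev (ws ! p) * lev (ws ! Suc p)"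
    using p by (intro lev_lmult subsetD[OF ws nth_mem]) simp_all
  obtain x vs where w: "ws = x # vs" using p by (cases ws) auto
  show ?thesis
  proof (cases p)
    case 0
    then show ?thesis using p l unfolding w raw_Cons by (cases vs) (auto simp: raw_Cons mult.assoc)
  next
    case (Suc q)
    then show ?thesis using p l unfolding w by (simp add: raw_Cons take_map drop_map)
  qed
qed

text \<open>The last letter b has shifted degree 0, so the wrap-around product carries no sign of
  its own.\<close>

lemma b_mu2_raw:
  assumes r: "pure_scalar n r" and ws: "ws \<noteq> []" "set ws \<subseteq> {E, Bt}" "even (wdeg ws)" "last ws = Bt"
  shows "b_mu2 (raw r ws) = - merge_words (wterm r) ws - (if length ws \<le> 1 then 0 else wterm r (wrap_word ws))"
proof (cases "length ws \<le> 1")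
  case True
  then show ?thesis using ws by (simp add: b_mu2_def merge_words_def)
next
  case False
  obtain x vs where w: "ws = x # vs" "vs \<noteq> []" using False by (cases ws) auto
  have last: "last (raw r ws) = lev (last ws)" and hd: "hd (raw r ws) = ends_scalar r * lev (hd ws)"
    using w by (simp_all add: raw_Cons last_map)
  have "lev (lmult (last ws) (hd ws)) = lev (last ws) * lev (hd ws)"
    by (intro lev_lmult subsetD[OF ws(2)] last_in_set hd_in_set ws(1))
  moreover have "lev (last ws) * (ends_scalar r * lev (hd ws)) = ends_scalar r * (lev (last ws) * lev (hd ws))"
    by (simp only: mult.assoc[symmetric] ends_scalar_central[of r "lev (last ws)"])
  ultimately have "(last (raw r ws) * hd (raw r ws)) # butlast (tl (raw r ws)) = raw r (wrap_word ws)"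
    unfolding last hd wrap_word_def raw_Cons by (simp add: w raw_Cons map_butlast)
  moreover have "sign ((deg (last (raw r ws)) - 1) * (sdeg (butlast (raw r ws)) + 1)) = 1"
    unfolding last deg_lev ws(4) by (simp add: ldeg_def)
  moreover have "(\<Sum>p<length ws - 1. frag_cmul (sign (sdeg (take (Suc p) (raw r ws))))
          (frag_of (take p (raw r ws) @ [raw r ws ! p * raw r ws ! Suc p] @ drop (Suc (Suc p)) (raw r ws))))
      = merge_words (wterm r) ws"
    unfolding merge_words_def wterm_def sign_sdeg_take[OF r ws(1)]
    by (intro sum.cong refl arg_cong2[of _ _ _ _ frag_cmul] arg_cong[of _ _ frag_of] raw_merge ws) auto
  ultimately show ?thesis using False unfolding b_mu2_def by (simp add: length_raw[OF ws(1)] wterm_def)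
qed

end

section \<open>Words with even powers of the unit\<close>

text \<open>A list of block sizes encodes a monomial of a power of kappa \<otimes> b: each b is
  preceded by an even block of units.\<close>

fun block_word :: "nat list \<Rightarrow> letter list" where
  "block_word [] = []"
| "block_word (a # as) = replicate (2 * a) E @ Bt # block_word as"

lemma block_word_append: "block_word (as @ cs) = block_word as @ block_word cs"
  by (induction as) simp_all

lemma set_block_word: "set (block_word as) \<subseteq> {E, Bt}"
  by (induction as) auto

lemma length_block_word: "length (block_word as) = length as + 2 * sum_list as"
  by (induction as) simp_all

lemma block_word_eq_Nil [simp]: "block_word as = [] \<longleftrightarrow> as = []"
  by (cases as) simp_all

lemma last_block_word: "as \<noteq> [] \<Longrightarrow> last (block_word as) = Bt"
  by (induction as) simp_all

lemma wdeg_replicate [simp]: "wdeg (replicate k E) = - int k"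
  by (induction k) (simp_all add: ldeg_def)

lemma even_wdeg_block_word: "even (wdeg (block_word as))"
  by (induction as) (simp_all add: ldeg_def)

lemma butlast_block_word: "butlast (block_word (as @ [a])) = block_word as @ replicate (2 * a) E"
  unfolding block_word_append by (simp add: butlast_append)

definition lsum :: "letter list \<Rightarrow> real" where "lsum ws = (\<Sum>x\<leftarrow>ws. lval x)"

lemma lsum_simps [simp]: "lsum [] = 0" "lsum (x # ws) = lval x + lsum ws" "lsum (us @ ws) = lsum us + lsum ws"
  by (simp_all add: lsum_def)

lemma lsum_replicate [simp]: "lsum (replicate k E) = 0"
  by (induction k) (simp_all add: lval_def)

lemma lsum_block_word [simp]: "lsum (block_word as) = real (length as) / 2"
  by (induction as) (simp_all add: lval_def add_divide_distrib)

lemma lsum_split: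
  assumes "ws \<noteq> []"
  shows "lsum ws = lval (hd ws) + lsum (tl ws)" "lsum ws = lsum (butlast ws) + lval (last ws)"
proof -
  show "lsum ws = lval (hd ws) + lsum (tl ws)" using assms by (cases ws) simp_all
  have "lsum ws = lsum (butlast ws @ [last ws])" using assms by simp
  then show "lsum ws = lsum (butlast ws) + lval (last ws)" by (simp only: lsum_simps add_0_right)
qed

context curved_cochain
begin

lemma tval_lsum: "tval n ws = real n + lsum ws"
  by (simp add: tval_def lsum_def)

lemma delta_words_Cons:
  "delta_words f (x # ws) = f [] x ws + frag_cmul (sign (ldeg x - 1)) (delta_words (\<lambda>u. f (x # u)) ws)"
  unfolding delta_words_def length_Cons sum.lessThan_Suc_shift by (simp add: frag_cmul_sum sign_add)

lemma merge_words_Cons: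
  "merge_words f (x # y # ws) = frag_cmul (sign (ldeg x - 1)) (f (lmult x y # ws)) +
    frag_cmul (sign (ldeg x - 1)) (merge_words (\<lambda>w. f (x # w)) (y # ws))"
proof -
  have "sign (k + (l + m) - 2) = sign (k - 1) * (sign (l - 1) * sign m)" for k l m
    unfolding sign_add[symmetric] by (rule sign_cong) simp
  then show ?thesis
    unfolding merge_words_def length_Cons diff_Suc_1 sum.lessThan_Suc_shift by (simp add: frag_cmul_sum sign_add)
qed

lemma sign_letters: "sign (ldeg E - 1) = - 1" "sign (ldeg Bt - 1) = 1"
  by (simp_all add: sign_def ldeg_def)

lemma delta_words_units:
  assumes "\<And>u v. f u E v = 0"
  shows "delta_words f (replicate (2 * a) E @ ws) = delta_words (\<lambda>u. f (replicate (2 * a) E @ u)) ws"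
  using assms
proof (induction a arbitrary: f)
  case (Suc a)
  show ?case
    using Suc.IH[of "\<lambda>u. f (E # E # u)"] Suc.prems by (simp add: delta_words_Cons sign_letters)
qed simp

lemma delta_words_block_word:
  assumes "\<And>u v. f u E v = 0"
  shows "delta_words f (block_word as) =
    (\<Sum>i<length as. f (block_word (take i as) @ replicate (2 * (as ! i)) E) Bt (block_word (drop (Suc i) as)))"
  using assms
proof (induction as arbitrary: f)
  case Nil
  then show ?case by (simp add: delta_words_def)
next
  case (Cons a as)
  have "delta_words f (block_word (a # as)) = delta_words (\<lambda>u. f (replicate (2 * a) E @ u)) (Bt # block_word as)"
    unfolding block_word.simps by (rule delta_words_units) (rule Cons.prems)
  also have "\<dots> = f (replicate (2 * a) E) Bt (block_word as)
      + delta_words (\<lambda>u. f (replicate (2 * a) E @ Bt # u)) (block_word as)"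
    by (simp add: delta_words_Cons sign_letters)
  also have "delta_words (\<lambda>u. f (replicate (2 * a) E @ Bt # u)) (block_word as) = (\<Sum>i<length as.
      f (replicate (2 * a) E @ Bt # block_word (take i as) @ replicate (2 * (as ! i)) E) Bt (block_word (drop (Suc i) as)))"
    by (rule Cons.IH) (rule Cons.prems)
  finally show ?case unfolding length_Cons sum.lessThan_Suc_shift by simp
qed

text \<open>Multiplying a unit into its right neighbour merely deletes it. The 2a deletions from a
  block give the same word with alternating signs and cancel.\<close>

lemma merge_words_units:
  assumes "ws \<noteq> []"
  shows "merge_words f (replicate (2 * a) E @ ws) = merge_words (\<lambda>w. f (replicate (2 * a) E @ w)) ws"
proof (induction a arbitrary: f)
  case (Suc a)
  obtain y vs where v: "replicate (2 * a) E @ ws = y # vs" using assms by (cases "replicate (2 * a) E @ ws") auto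
  have "merge_words f (E # E # (y # vs)) = merge_words (\<lambda>w. f (E # E # w)) (y # vs)"
    unfolding merge_words_Cons sign_letters lmult.simps by simp
  then show ?case using Suc.IH[of "\<lambda>w. f (E # E # w)"] unfolding v[symmetric] by simp
qed simp

definition bmerge :: "letter list \<Rightarrow> letter list" where
  "bmerge ws = lmult Bt (hd ws) # tl ws"

text \<open>By \<open>merge_words_units\<close> only the products of a b with the letter to its
  right survive.\<close>

lemma merge_words_block_word:
  "merge_words f (block_word as) =
    (\<Sum>i<length as - 1. f (butlast (block_word (take (Suc i) as)) @ bmerge (block_word (drop (Suc i) as))))"
proof (induction as arbitrary: f)
  case Nil
  then show ?case by (simp add: merge_words_def)
next
  case (Cons a as)
  let ?r = "replicate (2 * a) E"
  have 1: "merge_words f (block_word (a # as)) = merge_words (\<lambda>w. f (?r @ w)) (Bt # block_word as)"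
    unfolding block_word.simps by (rule merge_words_units) simp
  show ?case
  proof (cases as)
    case Nil
    then show ?thesis unfolding 1 by (simp add: merge_words_def)
  next
    case (Cons d ds)
    obtain y vs where v: "block_word as = y # vs" using Cons by (cases "block_word as") auto
    have "merge_words (\<lambda>w. f (?r @ w)) (Bt # block_word as)
        = f (?r @ bmerge (block_word as)) + merge_words (\<lambda>w. f (?r @ Bt # w)) (block_word as)"
      unfolding v merge_words_Cons sign_letters bmerge_def by simp
    also have "merge_words (\<lambda>w. f (?r @ Bt # w)) (block_word as)
        = (\<Sum>i<length as - 1. f (?r @ Bt # butlast (block_word (take (Suc i) as)) @ bmerge (block_word (drop (Suc i) as))))"
      unfolding Cons.IH by simp
    also have "\<dots> = (\<Sum>i<length as - 1. f (butlast (block_word (take (Suc (Suc i)) (a # as))) @ bmerge (block_word (drop (Suc (Suc i)) (a # as)))))"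
    proof (intro sum.cong refl arg_cong[of _ _ f])
      fix i
      have "block_word (take (Suc i) as) \<noteq> []" using Cons by simp
      then show "?r @ Bt # butlast (block_word (take (Suc i) as)) @ bmerge (block_word (drop (Suc i) as))
          = butlast (block_word (take (Suc (Suc i)) (a # as))) @ bmerge (block_word (drop (Suc (Suc i)) (a # as)))"
        unfolding take_Suc_Cons drop_Suc_Cons block_word.simps by (simp add: butlast_append)
    qed
    moreover have "length (a # as) - 1 = Suc (length as - 1)" using Cons by simp
    moreover have "butlast (block_word (take (Suc 0) (a # as))) = ?r" by (simp add: butlast_append)
    ultimately show ?thesis unfolding 1 by (simp only: sum.lessThan_Suc_shift drop_Suc_Cons drop_0)
  qed
qed

text \<open>Cyclic normal forms of boundary words: here the last b is rotated to the front and
  doubled, in \<open>unit_word\<close> the first b is turned into a unit and makes its block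
  odd.\<close>

definition double_word :: "nat list \<Rightarrow> letter list" where
  "double_word as = BB # butlast (block_word as)"

definition unit_word :: "nat list \<Rightarrow> letter list" where
  "unit_word as = replicate (2 * hd as + 1) E @ block_word (tl as)"

text \<open>The differential of the first b and the product of the last b with its cyclic successor;
  the other letters give the same for rotated lists. The single letter b, the list
  \<open>[0]\<close>, admits no product.\<close>

definition block_diff :: "real fls fps \<Rightarrow> nat list \<Rightarrow> pre_chain" where
  "block_diff r as = wterm r (double_word (rotate1 as)) + wterm (r * c) (unit_word as)
     - (if as = [0] then 0 else wterm r (wrap_word (block_word as)))"

lemma wrap_rotate:
  assumes r: "pure_scalar n r" and i: "0 < i" "i < length as" and B: "B \<le> real n + real (length as) / 2"
  shows "cyc_eq B (wterm r (butlast (block_word (take i as)) @ bmerge (block_word (drop i as))))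
    (wterm r (wrap_word (block_word (rotate i as))))"
proof -
  let ?u = "block_word (take i as)" and ?v = "block_word (drop i as)"
  have nz: "?u \<noteq> []" "?v \<noteq> []" using i by auto
  have l: "last ?u = Bt" by (rule last_block_word) (use i in auto)
  have split: "?u = butlast ?u @ [Bt]" using nz(1) l append_butlast_last_id[of ?u] by simp
  have "wdeg ?u = wdeg (butlast ?u @ [Bt])" using split by (rule arg_cong)
  then have "even (wdeg (butlast ?u))" using even_wdeg_block_word[of "take i as"] by (simp add: ldeg_def)
  moreover have "B \<le> tval n (butlast ?u @ bmerge ?v)"
  proof -
    have y: "hd ?v \<in> {E, Bt}" using set_block_word hd_in_set[OF nz(2)] by blast
    then have "lval (lmult Bt (hd ?v)) = 1 / 2 + lval (hd ?v)" by (auto simp: lval_def)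
    then have "lsum (bmerge ?v) = 1 / 2 + lsum ?v" unfolding bmerge_def lsum_split(1)[OF nz(2)] by simp
    moreover have "lsum ?u = lsum (butlast ?u) + 1 / 2" using lsum_split(2)[OF nz(1)] unfolding l by (simp add: lval_def)
    ultimately have "tval n (butlast ?u @ bmerge ?v) = real n + (lsum ?u + lsum ?v)" by (simp add: tval_lsum)
    also have "lsum ?u + lsum ?v = real (length as) / 2"
      unfolding lsum_block_word using i by (simp add: of_nat_diff add_divide_distrib[symmetric])
    finally show ?thesis using B by simp
  qed
  ultimately have "cyc_eq B (wterm r (butlast ?u @ bmerge ?v)) (wterm r (bmerge ?v @ butlast ?u))"
    by (intro rotate_even[OF r])
  moreover have "bmerge ?v @ butlast ?u = wrap_word (block_word (rotate i as))"
  proof -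
    have w: "block_word (rotate i as) = ?v @ ?u" using i by (simp add: rotate_drop_take block_word_append)
    have "wrap_word (?v @ ?u) = lmult Bt (hd ?v) # butlast (tl ?v @ ?u)"
      unfolding wrap_word_def using nz l by simp
    then show ?thesis unfolding w bmerge_def using nz(1) by (simp add: butlast_append)
  qed
  ultimately show ?thesis by simp
qed

lemma delta_rotate:
  assumes r: "pure_scalar n r" and i: "i < length as" and B: "B \<le> real n + real (length as) / 2"
  shows "cyc_eq B (delta_term r (block_word (take i as) @ replicate (2 * (as ! i)) E) Bt (block_word (drop (Suc i) as)))
    (wterm r (double_word (rotate1 (rotate i as))) + wterm (r * c) (unit_word (rotate i as)))"
proof -
  let ?t = "block_word (take i as)" and ?e = "replicate (2 * (as ! i)) E" and ?v = "block_word (drop (Suc i) as)"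
  have rot: "rotate i as = as ! i # drop (Suc i) as @ take i as"
    using i by (simp add: rotate_drop_take Cons_nth_drop_Suc)
  have len: "real (length as) / 2 = lsum ?t + 1 / 2 + lsum ?v"
    unfolding lsum_block_word using i by (simp add: of_nat_diff field_simps)
  have "cyc_eq B (wterm r ((?t @ ?e) @ BB # ?v)) (wterm r ((BB # ?v) @ ?t @ ?e))"
    by (rule rotate_even[OF r]) (use B even_wdeg_block_word in \<open>simp_all add: tval_lsum len lval_def\<close>)
  also have "(BB # ?v) @ ?t @ ?e = double_word (rotate1 (rotate i as))"
  proof -
    have "rotate1 (rotate i as) = (drop (Suc i) as @ take i as) @ [as ! i]" unfolding rot by simp
    then have "butlast (block_word (rotate1 (rotate i as))) = block_word (drop (Suc i) as @ take i as) @ ?e"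
      by (simp only: butlast_block_word)
    then show ?thesis by (simp add: double_word_def block_word_append)
  qed
  finally have BB: "cyc_eq B (wterm r ((?t @ ?e) @ BB # ?v)) (wterm r (double_word (rotate1 (rotate i as))))" .
  have "cyc_eq B (wterm r ((?t @ ?e) @ CC # ?v)) (wterm (r * c) ((?t @ ?e) @ E # ?v))"
    by (rule cyc_eq_relations[OF term_CC[OF r]])
  also have "(?t @ ?e) @ E # ?v = ?t @ (?e @ E # ?v)" by simp
  also have "cyc_eq B (wterm (r * c) \<dots>) (wterm (r * c) ((?e @ E # ?v) @ ?t))"
    by (rule rotate_even[OF pure_scalar_mult[OF r c_pure]])
      (use B even_wdeg_block_word in \<open>simp_all add: tval_lsum len lval_def\<close>)
  also have "(?e @ E # ?v) @ ?t = unit_word (rotate i as)"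
    unfolding unit_word_def rot by (simp add: block_word_append replicate_add replicate_append_same[symmetric])
  finally have CC: "cyc_eq B (wterm r ((?t @ ?e) @ CC # ?v)) (wterm (r * c) (unit_word (rotate i as)))" .
  show ?thesis using cyc_eq_add[OF BB CC] by (simp add: delta_term_def)
qed

text \<open>Every block followed by its b has even shifted degree, so rotating whole blocks costs no
  sign and the boundary becomes a sum over the rotations of the list.\<close>

lemma d_cc_block_word:
  assumes r: "pure_scalar n r" and as: "as \<noteq> []" and B: "B \<le> real n + real (length as) / 2"
  shows "cyc_eq B (d_cc (wterm r (block_word as))) (\<Sum>i<length as. block_diff r (rotate i as))"
proof -
  let ?w = "block_word as" and ?W = "\<lambda>as. if as = [0] then 0 else wterm r (wrap_word (block_word as))"
  have nz: "?w \<noteq> []" using as by simp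
  have d: "d_cc (wterm r ?w) = b_mu1 (raw r ?w) + b_mu2 (raw r ?w)"
    by (simp add: d_cc_def wterm_def)
  have 1: "cyc_eq B (b_mu1 (raw r ?w))
      (\<Sum>i<length as. wterm r (double_word (rotate1 (rotate i as))) + wterm (r * c) (unit_word (rotate i as)))"
  proof (rule cyc_eq_trans[OF b_mu1_raw[OF r nz set_block_word]])
    have "delta_words (delta_term r) ?w = (\<Sum>i<length as.
        delta_term r (block_word (take i as) @ replicate (2 * (as ! i)) E) Bt (block_word (drop (Suc i) as)))"
      by (rule delta_words_block_word) (simp add: delta_term_def)
    then show "cyc_eq B (delta_words (delta_term r) ?w)
      (\<Sum>i<length as. wterm r (double_word (rotate1 (rotate i as))) + wterm (r * c) (unit_word (rotate i as)))"
      by (simp only:) (intro cyc_eq_sum delta_rotate[OF r _ B]; simp)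
  qed
  have short: "length ?w \<le> 1 \<longleftrightarrow> as = [0]"
    unfolding length_block_word using as by (cases as) auto
  have "b_mu2 (raw r ?w) = - (\<Sum>i<length as - 1. wterm r (butlast (block_word (take (Suc i) as)) @ bmerge (block_word (drop (Suc i) as)))) - ?W as"
    unfolding b_mu2_raw[OF r nz set_block_word even_wdeg_block_word last_block_word[OF as]] merge_words_block_word short ..
  also have "cyc_eq B \<dots> (- (\<Sum>i<length as - 1. wterm r (wrap_word (block_word (rotate (Suc i) as)))) - ?W as)"
    by (intro cyc_eq_diff cyc_eq_uminus cyc_eq_sum cyc_eq_refl wrap_rotate[OF r _ _ B]) auto
  also have "- (\<Sum>i<length as - 1. wterm r (wrap_word (block_word (rotate (Suc i) as)))) - ?W as = - (\<Sum>i<length as. ?W (rotate i as))"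
  proof -
    obtain m where m: "length as = Suc m" using as by (cases as) auto
    have "rotate (Suc i) as \<noteq> [0]" if "i < m" for i
    proof
      assume e: "rotate (Suc i) as = [0]"
      have "length as = length (rotate (Suc i) as)" by (simp only: length_rotate)
      then show False using that m unfolding e by simp
    qed
    then show ?thesis unfolding m sum.lessThan_Suc_shift by (simp del: rotate_Suc)
  qed
  finally have "cyc_eq B (d_cc (wterm r ?w)) ((\<Sum>i<length as. wterm r (double_word (rotate1 (rotate i as))) + wterm (r * c) (unit_word (rotate i as)))
      + - (\<Sum>i<length as. ?W (rotate i as)))"
    unfolding d by (rule cyc_eq_add[OF 1])
  then show ?thesis by (simp add: block_diff_def sum_subtractf)
qed

end

section \<open>Catalan corrections\<close>

text \<open>The generating function solves C = 1 + x C^2. With x = c id \<otimes> id this is the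
  equation on kappa that makes curvature, joining two even blocks into an odd one, balance a product
  that removes a unit from an even block.\<close>

fun catalan :: "nat \<Rightarrow> int" where
  "catalan 0 = 1"
| "catalan (Suc n) = (\<Sum>i\<le>n. catalan i * catalan (n - i))"

declare catalan.simps(2) [simp del]

definition cat_weight :: "nat list \<Rightarrow> int" where
  "cat_weight as = prod_list (map catalan as)"

lemma cat_weight_simps [simp]:
  "cat_weight [] = 1" "cat_weight (a # as) = catalan a * cat_weight as"
  "cat_weight (as @ ds) = cat_weight as * cat_weight ds"
  by (simp_all add: cat_weight_def)

text \<open>Lists are grouped by the length \<open>L\<close> of their block word, which measures
  valuation.\<close>

definition block_lists :: "nat \<Rightarrow> nat list set" where
  "block_lists L = {as. as \<noteq> [] \<and> length as + 2 * sum_list as = L}"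

lemma finite_block_lists: "finite (block_lists L)"
proof (rule finite_subset)
  show "block_lists L \<subseteq> {as. set as \<subseteq> {..L} \<and> length as \<le> L}"
    unfolding block_lists_def using member_le_sum_list[where 'a = nat] by fastforce
  show "finite {as. set as \<subseteq> {..L} \<and> length as \<le> L}"
    by (rule finite_lists_length_le) simp
qed

lemma block_lists_0 [simp]: "block_lists 0 = {}"
  by (auto simp: block_lists_def)

lemma rotate_invariant:
  "length (rotate i as) = length as" "sum_list (rotate i as) = sum_list as" "cat_weight (rotate i as) = cat_weight as"
  for as :: "nat list"
proof -
  have "sum_list (rotate i as) = sum_list (drop (i mod length as) as @ take (i mod length as) as)"
    "cat_weight (rotate i as) = cat_weight (drop (i mod length as) as @ take (i mod length as) as)"
    by (simp_all add: rotate_drop_take)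
  moreover have "sum_list (take m as @ drop m as) = sum_list as" "cat_weight (take m as @ drop m as) = cat_weight as" for m
    by simp_all
  ultimately show "sum_list (rotate i as) = sum_list as" "cat_weight (rotate i as) = cat_weight as"
    by (simp_all only: sum_list_append cat_weight_simps add.commute mult.commute)
qed simp

lemma sum_rotate:
  fixes h :: "nat list \<Rightarrow> 'v::comm_monoid_add"
  shows "(\<Sum>as | as \<in> block_lists L \<and> P (length as). h (rotate i as)) = (\<Sum>as | as \<in> block_lists L \<and> P (length as). h as)"
proof -
  let ?S = "{as. as \<in> block_lists L \<and> P (length as)}"
  have fin: "finite ?S" using finite_block_lists by simp
  have inj: "inj_on (rotate i) ?S"
    unfolding rotate_def by (rule inj_on_subset[OF inj_fn[OF inj_rotate1]]) simp
  have "rotate i ` ?S \<subseteq> ?S"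
    using rotate_invariant[of i] by (auto simp: block_lists_def)
  then have "bij_betw (rotate i) ?S ?S" using inj fin by (simp add: bij_betw_def endo_inj_surj)
  then show ?thesis by (rule sum.reindex_bij_betw)
qed

text \<open>Rotation permutes the lists of given word length and list length, so each rotation index
  contributes equally.\<close>

lemma sum_rotations:
  fixes h :: "nat list \<Rightarrow> 'v::comm_monoid_add"
  shows "(\<Sum>as\<in>block_lists L. \<Sum>i<length as. h (rotate i as)) = (\<Sum>as\<in>block_lists L. \<Sum>i<length as. h as)"
proof -
  have *: "(\<Sum>as\<in>block_lists L. \<Sum>i<length as. f i as) = (\<Sum>i<L. \<Sum>as | as \<in> block_lists L \<and> i < length as. f i as)"
    for f :: "nat \<Rightarrow> nat list \<Rightarrow> 'v"
  proof -
    have "(\<Sum>as\<in>block_lists L. \<Sum>i<length as. f i as) = (\<Sum>as\<in>block_lists L. \<Sum>i | i \<in> {..<L} \<and> i < length as. f i as)"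
      by (intro sum.cong refl) (auto simp: block_lists_def)
    also have "\<dots> = (\<Sum>i<L. \<Sum>as | as \<in> block_lists L \<and> i < length as. f i as)"
      by (rule sum.swap_restrict[OF finite_block_lists]) simp
    finally show ?thesis .
  qed
  show ?thesis unfolding *
  proof (rule sum.cong[OF refl])
    fix i
    show "(\<Sum>as | as \<in> block_lists L \<and> i < length as. h (rotate i as)) = (\<Sum>as | as \<in> block_lists L \<and> i < length as. h as)"
      by (rule sum_rotate[where P = "\<lambda>l. i < l"])
  qed
qed

text \<open>Splits by whether the first block is empty. This organises the products, and the second
  index set is the one of \<open>block_lists_sum_split\<close>.\<close>

lemma block_lists_Suc_sum:
  fixes h :: "nat list \<Rightarrow> 'v::comm_monoid_add"
  shows "(\<Sum>as\<in>block_lists (Suc L) - {[0]}. h as) = (\<Sum>as\<in>block_lists L. h (0 # as)) +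
    (\<Sum>(x, w) | 2 * x + 2 + length w + 2 * sum_list w = L. h (Suc x # w))"
proof -
  let ?Q = "{(x, w). 2 * x + 2 + length w + 2 * sum_list w = L}"
  have eq: "block_lists (Suc L) - {[0]} = (\<lambda>as. 0 # as) ` block_lists L \<union> (\<lambda>(x, w). Suc x # w) ` ?Q" (is "?A = ?B")
  proof (intro equalityI subsetI)
    fix as assume as: "as \<in> ?A"
    then obtain a w where w: "as = a # w" by (cases as) (auto simp: block_lists_def)
    show "as \<in> ?B"
    proof (cases a)
      case 0
      then have "w \<in> block_lists L" using as by (auto simp: w block_lists_def)
      then show ?thesis using w 0 by blast
    next
      case (Suc x)
      then have "(x, w) \<in> ?Q" using as by (simp add: w block_lists_def)
      then show ?thesis unfolding w Suc by (intro UnI2 image_eqI[of _ _ "(x, w)"]) simp_all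
    qed
  qed (auto simp: block_lists_def)
  have fin: "finite ?B" unfolding eq[symmetric] using finite_block_lists by simp
  have "sum h ?B = (\<Sum>as\<in>(\<lambda>as. 0 # as) ` block_lists L. h as) + (\<Sum>as\<in>(\<lambda>(x, w). Suc x # w) ` ?Q. h as)"
    by (rule sum.union_disjoint) (use fin in auto)
  also have "(\<Sum>as\<in>(\<lambda>as. 0 # as) ` block_lists L. h as) = (\<Sum>as\<in>block_lists L. h (0 # as))"
    by (subst sum.reindex) (simp_all add: inj_on_def)
  also have "(\<Sum>as\<in>(\<lambda>(x, w). Suc x # w) ` ?Q. h as) = (\<Sum>(x, w)\<in>?Q. h (Suc x # w))"
    by (subst sum.reindex) (simp_all add: inj_on_def case_prod_unfold)
  finally show ?thesis unfolding eq .
qed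

text \<open>Splits off the lists with one block and groups the others by the sum x of their first
  two blocks, which curvature joins.\<close>

lemma block_lists_sum_split:
  fixes h :: "nat list \<Rightarrow> 'v::comm_monoid_add"
  shows "(\<Sum>as\<in>block_lists L. h as) = (if odd L then h [L div 2] else 0) +
    (\<Sum>(x, w) | 2 * x + 2 + length w + 2 * sum_list w = L. \<Sum>a\<le>x. h (a # (x - a) # w))"
proof -
  let ?Q = "{(x, w). 2 * x + 2 + length w + 2 * sum_list w = L}"
  let ?f = "\<lambda>((x, w), a). a # (x - a) # w"
  let ?P = "if odd L then {[L div 2]} else {}"
  have eq: "block_lists L = ?P \<union> ?f ` Sigma ?Q (\<lambda>(x, w). {..x})" (is "_ = ?B")
  proof (intro equalityI subsetI)
    fix as assume as: "as \<in> block_lists L"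
    then obtain a w where w: "as = a # w" by (cases as) (auto simp: block_lists_def)
    show "as \<in> ?B"
    proof (cases w)
      case Nil
      then show ?thesis using as by (auto simp: w block_lists_def)
    next
      case (Cons y v)
      have "((a + y, v), a) \<in> Sigma ?Q (\<lambda>(x, w). {..x})" using as by (simp add: w Cons block_lists_def)
      then show ?thesis unfolding w Cons by (intro UnI2 image_eqI[of _ _ "((a + y, v), a)"]) simp_all
    qed
  next
    fix as assume "as \<in> ?B"
    then show "as \<in> block_lists L" by (auto simp: block_lists_def split: if_splits)
  qed
  have inj: "inj_on ?f (Sigma ?Q (\<lambda>(x, w). {..x}))"
    by (auto simp: inj_on_def)
  let ?S = "Sigma ?Q (\<lambda>(x, w). {..x})"
  have "finite (?f ` ?S)" using finite_block_lists[of L] unfolding eq finite_Un by blast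
  then have finS: "finite ?S" by (rule finite_imageD[OF _ inj])
  have "?Q \<subseteq> fst ` ?S"
  proof
    fix q assume "q \<in> ?Q"
    then have "(q, 0) \<in> ?S" by (cases q) simp
    then show "q \<in> fst ` ?S" by (rule image_eqI[rotated]) simp
  qed
  then have finQ: "finite ?Q" by (rule finite_subset[OF _ finite_imageI[OF finS]])
  have "sum h ?B = sum h ?P + sum h (?f ` ?S)"
    by (rule sum.union_disjoint[OF _ finite_imageI[OF finS]]) auto
  also have "sum h (?f ` ?S) = (\<Sum>p\<in>?S. h (?f p))"
    unfolding sum.reindex[OF inj] o_def ..
  also have "\<dots> = (\<Sum>(q, a)\<in>?S. h (?f (q, a)))"
    by (intro sum.cong refl) (simp add: case_prod_unfold)
  also have "\<dots> = (\<Sum>q\<in>?Q. \<Sum>a\<in>(\<lambda>(x, w). {..x}) q. h (?f (q, a)))"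
    by (rule sum.Sigma[symmetric, OF finQ]) (simp add: case_prod_unfold)
  also have "\<dots> = (\<Sum>(x, w)\<in>?Q. \<Sum>a\<le>x. h (a # (x - a) # w))"
    by (rule sum.cong[OF refl]) (simp add: case_prod_unfold)
  also have "sum h ?P = (if odd L then h [L div 2] else 0)" by simp
  finally show ?thesis unfolding eq .
qed

lemma frag_cmul_sum_left: "frag_cmul (\<Sum>i\<in>I. f i) x = (\<Sum>i\<in>I. frag_cmul (f i) x)"
  by (induction I rule: infinite_finite_induct) (simp_all add: frag_cmul_distrib)

context curved_cochain
begin

lemma pure_scalar_power: "pure_scalar k (c ^ k)"
proof (induction k)
  case 0
  then show ?case using pure_scalar_const[of 1] by simp
next
  case (Suc k)
  then show ?case using pure_scalar_mult[OF Suc c_pure] by (simp add: mult.commute)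
qed

text \<open>The power of c that belongs to the blocks, with the factor 1/r of the logarithmic series
  for r letters b.\<close>

definition scale :: "nat list \<Rightarrow> real fls fps" where
  "scale as = c ^ sum_list as * fps_const (fls_const (1 / real (length as)))"

lemma scale_pure: "as \<noteq> [] \<Longrightarrow> pure_scalar (sum_list as) (scale as)"
  using pure_scalar_mult[OF pure_scalar_power pure_scalar_const[of "1 / real (length as)"]] by (simp add: scale_def)

lemma of_nat_scale: "as \<noteq> [] \<Longrightarrow> of_nat (length as) * scale as = c ^ sum_list as"
proof -
  assume "as \<noteq> []"
  then have "of_nat (length as) * fps_const (fls_const (1 / real (length as))) = (1 :: real fls fps)"
    unfolding fps_of_nat[symmetric] fls_of_nat by (simp add: fls_const_mult_const)
  then show ?thesis unfolding scale_def mult.left_commute[of _ "c ^ sum_list as"] by simp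
qed

lemma wterm_add:
  assumes "pure_scalar n r" "pure_scalar n r'" "ws \<noteq> []"
  shows "wterm (r + r') ws - wterm r ws - wterm r' ws \<in> tensor_relations"
proof -
  obtain x vs where w: "ws = x # vs" using assms(3) by (cases ws) auto
  have "is_word ([] @ [ends_scalar r * lev x] @ map lev vs)" "is_word ([] @ [ends_scalar r' * lev x] @ map lev vs)"
    unfolding is_word_good using good_lev good_scaled assms(1,2) by auto
  from tensor_relations.additive[OF this scaled_hom[OF assms(1)] scaled_hom[OF assms(2)]]
  have "frag_of ([] @ [ends_scalar r * lev x + ends_scalar r' * lev x] @ map lev vs)
      - frag_of ([] @ [ends_scalar r * lev x] @ map lev vs) - frag_of ([] @ [ends_scalar r' * lev x] @ map lev vs) \<in> tensor_relations" .
  moreover have "ends_scalar (r + r') = ends_scalar r + ends_scalar r'"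
    by (rule fps_ext, rule en_eqI) (simp_all add: ends_scalar_def en_add s_const_hom)
  ultimately show ?thesis by (simp add: w wterm_def raw_Cons distrib_right)
qed

text \<open>Chains have integer coefficients; a multiple of a word and the word with a scaled letter
  agree only modulo additivity.\<close>

lemma wterm_of_nat:
  assumes r: "pure_scalar n r" and ws: "ws \<noteq> []" and m: "m > 0"
  shows "cyc_eq B (frag_cmul (int m) (wterm r ws)) (wterm (of_nat m * r) ws)"
  using m
proof (induction m rule: nat_induct_non_zero)
  case 1
  then show ?case by simp
next
  case (Suc m)
  have "pure_scalar (0 + n) (fps_const (fls_const (real m)) * r)"
    using Suc.hyps by (intro pure_scalar_mult pure_scalar_const r) simp
  then have m: "pure_scalar n (of_nat m * r)" by (simp add: fls_of_nat flip: fps_of_nat)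
  have "cyc_eq B (frag_cmul (int m) (wterm r ws) + wterm r ws) (wterm (of_nat m * r) ws + wterm r ws)"
    by (intro cyc_eq_add Suc.IH cyc_eq_refl)
  moreover have "cyc_eq B (wterm (of_nat m * r) ws + wterm r ws) (wterm (of_nat m * r + r) ws)"
    using wterm_add[OF m r ws] by (intro cyc_eq_sym[OF cyc_eq_relations]) (simp add: diff_diff_eq)
  ultimately have "cyc_eq B (frag_cmul (int m) (wterm r ws) + wterm r ws) (wterm (of_nat m * r + r) ws)"
    by (rule cyc_eq_trans)
  moreover have "frag_cmul (int (Suc m)) (wterm r ws) = frag_cmul (int m) (wterm r ws) + wterm r ws"
    by (simp add: frag_cmul_distrib add.commute)
  moreover have "of_nat (Suc m) * r = of_nat m * r + r" by (simp add: distrib_right add.commute)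
  ultimately show ?case by (simp only:)
qed

definition corrected_exp :: "nat \<Rightarrow> pre_chain" where
  "corrected_exp L = (if L = 0 then frag_of [1]
     else (\<Sum>as\<in>block_lists L. frag_cmul (cat_weight as) (wterm (scale as) (block_word as))))"

definition double_part :: "nat \<Rightarrow> pre_chain" where
  "double_part L = (\<Sum>as\<in>block_lists L. frag_cmul (cat_weight as) (wterm (c ^ sum_list as) (double_word as)))"

definition unit_part :: "nat \<Rightarrow> pre_chain" where
  "unit_part L = (\<Sum>as\<in>block_lists L. frag_cmul (cat_weight as) (wterm (c ^ Suc (sum_list as)) (unit_word as)))"

text \<open>The last b multiplied into the first letter: an empty first block gives b * b, otherwise
  one unit is lost and the block becomes odd.\<close>

definition merged_word :: "nat list \<Rightarrow> letter list" where
  "merged_word as = (if hd as = 0 then double_word (tl as) else replicate (2 * hd as - 1) E @ Bt # block_word (tl as))"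

definition merged_part :: "nat \<Rightarrow> pre_chain" where
  "merged_part L = (\<Sum>as\<in>block_lists L - {[0]}. frag_cmul (cat_weight as) (wterm (c ^ sum_list as) (merged_word as)))"

definition scalar_part :: "nat \<Rightarrow> pre_chain" where
  "scalar_part L = (if odd L then frag_cmul (catalan (L div 2)) (wterm (c ^ Suc (L div 2)) (replicate L E)) else 0)"

text \<open>A product shortens the word, so length L + 1 is compared with length L. Empty first
  blocks match \<open>double_part\<close>. An odd block of 2x + 1 units arises from a first block x
  + 1 by a product and from blocks a and x - a by curvature, with equal weights by the Catalan
  recursion. Only words made of a single odd block of units remain.\<close>

lemma parts_cancel: "double_part L + unit_part L - merged_part (Suc L) = scalar_part L"
proof -
  let ?Q = "{(x, w). 2 * x + 2 + length w + 2 * sum_list w = L}"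
  let ?g = "\<lambda>(x, w). frag_cmul (catalan (Suc x) * cat_weight w)
    (wterm (c ^ (Suc x + sum_list w)) (replicate (2 * x + 1) E @ Bt # block_word w))"
  have m: "merged_part (Suc L) = double_part L + sum ?g ?Q"
    unfolding merged_part_def block_lists_Suc_sum double_part_def
    by (intro arg_cong2[of _ _ _ _ plus] sum.cong refl) (auto simp: merged_word_def)
  have "unit_part L = (if odd L then frag_cmul (cat_weight [L div 2]) (wterm (c ^ Suc (L div 2)) (unit_word [L div 2])) else 0)
      + (\<Sum>(x, w)\<in>?Q. \<Sum>a\<le>x. frag_cmul (cat_weight (a # (x - a) # w))
          (wterm (c ^ Suc (sum_list (a # (x - a) # w))) (unit_word (a # (x - a) # w))))"
    unfolding unit_part_def block_lists_sum_split by simp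
  also have "(\<Sum>(x, w)\<in>?Q. \<Sum>a\<le>x. frag_cmul (cat_weight (a # (x - a) # w))
      (wterm (c ^ Suc (sum_list (a # (x - a) # w))) (unit_word (a # (x - a) # w)))) = sum ?g ?Q"
  proof (intro sum.cong refl, clarify)
    fix x w
    have u: "unit_word (a # (x - a) # w) = replicate (2 * x + 1) E @ Bt # block_word w" if "a \<le> x" for a
    proof -
      have "2 * a + 1 + 2 * (x - a) = 2 * x + 1" using that by simp
      then have "replicate (2 * a + 1) E @ replicate (2 * (x - a)) E = replicate (2 * x + 1) E"
        by (simp only: replicate_add[symmetric])
      then show ?thesis unfolding unit_word_def list.sel block_word.simps by (simp only: append_assoc[symmetric])
    qed
    have "(\<Sum>a\<le>x. frag_cmul (cat_weight (a # (x - a) # w))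
        (wterm (c ^ Suc (sum_list (a # (x - a) # w))) (unit_word (a # (x - a) # w))))
      = (\<Sum>a\<le>x. frag_cmul (catalan a * catalan (x - a) * cat_weight w)
          (wterm (c ^ (Suc x + sum_list w)) (replicate (2 * x + 1) E @ Bt # block_word w)))"
    proof (intro sum.cong refl)
      fix a assume "a \<in> {..x}"
      then have a: "a \<le> x" by simp
      have s: "Suc (sum_list (a # (x - a) # w)) = Suc x + sum_list w" using a by simp
      show "frag_cmul (cat_weight (a # (x - a) # w)) (wterm (c ^ Suc (sum_list (a # (x - a) # w))) (unit_word (a # (x - a) # w)))
        = frag_cmul (catalan a * catalan (x - a) * cat_weight w)
          (wterm (c ^ (Suc x + sum_list w)) (replicate (2 * x + 1) E @ Bt # block_word w))"
        unfolding s u[OF a] by (simp only: cat_weight_simps mult.assoc)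
    qed
    also have "\<dots> = frag_cmul (\<Sum>a\<le>x. catalan a * catalan (x - a) * cat_weight w)
          (wterm (c ^ (Suc x + sum_list w)) (replicate (2 * x + 1) E @ Bt # block_word w))"
      by (rule frag_cmul_sum_left[symmetric])
    also have "(\<Sum>a\<le>x. catalan a * catalan (x - a) * cat_weight w) = catalan (Suc x) * cat_weight w"
      unfolding catalan.simps(2) sum_distrib_right ..
    finally show "(\<Sum>a\<le>x. frag_cmul (cat_weight (a # (x - a) # w))
        (wterm (c ^ Suc (sum_list (a # (x - a) # w))) (unit_word (a # (x - a) # w))))
      = frag_cmul (catalan (Suc x) * cat_weight w)
          (wterm (c ^ (Suc x + sum_list w)) (replicate (2 * x + 1) E @ Bt # block_word w))" .
  qed
  also have "(if odd L then frag_cmul (cat_weight [L div 2]) (wterm (c ^ Suc (L div 2)) (unit_word [L div 2])) else 0) = scalar_part L"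
  proof (cases "odd L")
    case True
    then have "2 * (L div 2) + 1 = L" by presburger
    then have "unit_word [L div 2] = replicate L E" by (simp add: unit_word_def del: replicate_Suc)
    then show ?thesis using True by (simp add: scalar_part_def)
  qed (simp add: scalar_part_def)
  finally have u: "unit_part L = scalar_part L + sum ?g ?Q" .
  have "x + (y + z) - (x + z) = y" for x y z :: pre_chain by simp
  then show ?thesis unfolding m u .
qed

end

section \<open>The corrected exponential\<close>

lemma keys_sum_frag:
  assumes "w \<in> Poly_Mapping.keys (\<Sum>i\<in>I. frag_cmul (m i) (frag_of (f i)))"
  shows "\<exists>i\<in>I. w = f i"
proof -
  have "w \<in> (\<Union>i\<in>I. Poly_Mapping.keys (frag_cmul (m i) (frag_of (f i))))"
    using assms keys_sum[of "\<lambda>i. frag_cmul (m i) (frag_of (f i))" I] by blast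
  then show ?thesis using keys_cmul by fastforce
qed

lemma frag_cmul_uminus: "frag_cmul (- m) x = - frag_cmul m x"
  using frag_cmul_distrib[of m "- m" x] by (simp add: eq_neg_iff_add_eq_0 add.commute)

lemma frag_cmul_diff_distrib2: "frag_cmul m (x - y) = frag_cmul m x - frag_cmul m y"
  using frag_cmul_distrib2[of m "x - y" y] by simp

lemma one_in_Rs: "1 \<in> Rs"
  using pure_scalar_Rs[OF pure_scalar_const[of 1]] by simp

context curved_cochain
begin

lemma scale_rotate: "scale (rotate i as) = scale as"
  by (simp add: scale_def rotate_invariant)

text \<open>The number of rotations cancels the factor 1/r in \<open>scale\<close>. When the first
  block is nonempty, rotating the product b to the end gives the form of
  \<open>merged_word\<close>.\<close>

lemma block_diff_scale:
  assumes as: "as \<noteq> []" and B: "B \<le> real (sum_list as) + real (length as) / 2"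
  shows "cyc_eq B (frag_cmul (int (length as)) (block_diff (scale as) as))
    (wterm (c ^ sum_list as) (double_word (rotate1 as)) + wterm (c ^ Suc (sum_list as)) (unit_word as)
      - (if as = [0] then 0 else wterm (c ^ sum_list as) (merged_word as)))"
proof -
  let ?k = "sum_list as" and ?n = "int (length as)"
  have r: "pure_scalar ?k (scale as)" by (rule scale_pure[OF as])
  have D: "cyc_eq B (frag_cmul ?n (wterm (scale as) (double_word (rotate1 as)))) (wterm (c ^ ?k) (double_word (rotate1 as)))"
    using wterm_of_nat[OF r, of "double_word (rotate1 as)" "length as" B] as
    unfolding of_nat_scale[OF as] by (simp add: double_word_def)
  have eq: "of_nat (length as) * (scale as * c) = c ^ Suc ?k"
    unfolding mult.assoc[symmetric] of_nat_scale[OF as] power_Suc2 ..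
  have "unit_word as \<noteq> []" "0 < length as" using as by (simp_all add: unit_word_def)
  then have U: "cyc_eq B (frag_cmul ?n (wterm (scale as * c) (unit_word as))) (wterm (c ^ Suc ?k) (unit_word as))"
    unfolding eq[symmetric] by (rule wterm_of_nat[OF pure_scalar_mult[OF r c_pure]])
  have W: "cyc_eq B (frag_cmul ?n (if as = [0] then 0 else wterm (scale as) (wrap_word (block_word as))))
    (if as = [0] then 0 else wterm (c ^ ?k) (merged_word as))"
  proof (cases "as = [0]")
    case False
    obtain a w where w: "as = a # w" using as by (cases as) auto
    have 1: "cyc_eq B (frag_cmul ?n (wterm (scale as) (wrap_word (block_word as)))) (wterm (c ^ ?k) (wrap_word (block_word as)))"
      using wterm_of_nat[OF r, of "wrap_word (block_word as)" "length as" B] as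
      unfolding of_nat_scale[OF as] by (simp add: wrap_word_def)
    have "cyc_eq B (wterm (c ^ ?k) (wrap_word (block_word as))) (wterm (c ^ ?k) (merged_word as))"
    proof (cases a)
      case 0
      then have "w \<noteq> []" using False w by auto
      then have "wrap_word (block_word as) = merged_word as"
        unfolding w 0 by (simp add: wrap_word_def merged_word_def double_word_def last_block_word)
      then show ?thesis by simp
    next
      case (Suc x)
      let ?m = "replicate (2 * x + 1) E @ Bt # block_word w"
      have m: "merged_word as = ?m" unfolding w Suc by (simp add: merged_word_def)
      have bw: "block_word as = E # ?m" unfolding w Suc by simp
      have l: "last ?m = Bt" by (cases "w = []") (simp_all add: last_block_word)
      have "wrap_word (block_word as) = Bt # butlast ?m"
        unfolding bw wrap_word_def list.sel using l by (simp del: replicate_Suc)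
      then have wr: "wrap_word (block_word as) = [Bt] @ butlast ?m" by simp
      have bl: "butlast ?m @ [Bt] = ?m" using l append_butlast_last_id[of ?m] by simp
      have "lsum ([Bt] @ butlast ?m) = lsum (butlast ?m @ [Bt])" by simp
      also have "\<dots> = real (length as) / 2" unfolding bl by (simp add: w lval_def add_divide_distrib)
      finally have "B \<le> tval ?k ([Bt] @ butlast ?m)" using B by (simp only: tval_lsum)
      then have "cyc_eq B (wterm (c ^ ?k) ([Bt] @ butlast ?m)) (wterm (c ^ ?k) (butlast ?m @ [Bt]))"
        by (rule rotate_even[OF pure_scalar_power]) (simp add: ldeg_def)
      then show ?thesis unfolding wr m bl .
    qed
    then show ?thesis using cyc_eq_trans[OF 1] False by simp
  qed (simp only: if_True frag_cmul_zero2 cyc_eq_refl simp_thms)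
  show ?thesis
    unfolding block_diff_def frag_cmul_diff_distrib2 frag_cmul_distrib2
    by (rule cyc_eq_diff[OF cyc_eq_add[OF D U] W])
qed

lemma d_cc_sum: "finite I \<Longrightarrow> d_cc (\<Sum>i\<in>I. frag_cmul (m i) (x i)) = (\<Sum>i\<in>I. frag_cmul (m i) (d_cc (x i)))"
  unfolding d_cc_def by (simp add: frag_extend_sum frag_extend_cmul o_def)

lemma d_cc_diff: "d_cc (x - y) = d_cc x - d_cc y"
  unfolding d_cc_def by (rule frag_extend_diff)

text \<open>Each b has valuation at least 1/2, and each pair of units comes with a factor c of
  valuation at least 1: this is 1/2 per letter, which makes the series converge.\<close>

lemma block_lists_weight: "as \<in> block_lists L \<Longrightarrow> real (sum_list as) + real (length as) / 2 = real L / 2"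
  by (auto simp: block_lists_def)

lemma d_cc_corrected_exp:
  "cyc_eq (real L / 2) (d_cc (corrected_exp L)) (double_part L + unit_part L - merged_part L)"
proof (cases "L = 0")
  case True
  have "d_cc (frag_of [1]) = frag_of ([] @ [0] @ [])"
    using delta_unit by (simp add: d_cc_def b_mu1_def b_mu2_def)
  moreover have "frag_of ([] @ [0] @ []) \<in> tensor_relations"
    by (rule relations_zero_letter) (simp add: is_word_good good_0)
  ultimately show ?thesis using True
    by (intro cyc_eq_relations) (simp add: corrected_exp_def double_part_def unit_part_def merged_part_def)
next
  case False
  let ?B = "real L / 2"
  let ?w = "\<lambda>as. wterm (c ^ sum_list as) (double_word (rotate1 as)) + wterm (c ^ Suc (sum_list as)) (unit_word as)
      - (if as = [0] then 0 else wterm (c ^ sum_list as) (merged_word as))"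
  have nz: "as \<noteq> []" and B: "?B \<le> real (sum_list as) + real (length as) / 2" if "as \<in> block_lists L" for as
    using that block_lists_weight[OF that] by (auto simp: block_lists_def)
  have "d_cc (corrected_exp L) = (\<Sum>as\<in>block_lists L. frag_cmul (cat_weight as) (d_cc (wterm (scale as) (block_word as))))"
    unfolding corrected_exp_def using False by (simp add: d_cc_sum[OF finite_block_lists])
  also have "cyc_eq ?B \<dots> (\<Sum>as\<in>block_lists L. frag_cmul (cat_weight as) (\<Sum>i<length as. block_diff (scale as) (rotate i as)))"
    using nz B by (intro cyc_eq_sum cyc_eq_cmul d_cc_block_word[OF scale_pure]) auto
  also have "(\<Sum>as\<in>block_lists L. frag_cmul (cat_weight as) (\<Sum>i<length as. block_diff (scale as) (rotate i as)))
      = (\<Sum>as\<in>block_lists L. \<Sum>i<length as. frag_cmul (cat_weight (rotate i as)) (block_diff (scale (rotate i as)) (rotate i as)))"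
    by (simp only: frag_cmul_sum scale_rotate rotate_invariant)
  also have "\<dots> = (\<Sum>as\<in>block_lists L. \<Sum>i<length as. frag_cmul (cat_weight as) (block_diff (scale as) as))"
    by (rule sum_rotations)
  also have "\<dots> = (\<Sum>as\<in>block_lists L. frag_cmul (cat_weight as) (frag_cmul (int (length as)) (block_diff (scale as) as)))"
  proof (intro sum.cong refl)
    fix as :: "nat list"
    have "(\<Sum>i<n. y) = frag_cmul (int n) y" for n and y :: pre_chain
      by (induction n) (simp_all add: frag_cmul_distrib add.commute)
    then show "(\<Sum>i<length as. frag_cmul (cat_weight as) (block_diff (scale as) as))
        = frag_cmul (cat_weight as) (frag_cmul (int (length as)) (block_diff (scale as) as))"
      by (simp add: mult.commute)
  qed
  also have "cyc_eq ?B \<dots> (\<Sum>as\<in>block_lists L. frag_cmul (cat_weight as) (?w as))"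
    using nz B by (intro cyc_eq_sum cyc_eq_cmul block_diff_scale) auto
  also have "(\<Sum>as\<in>block_lists L. frag_cmul (cat_weight as) (?w as)) = double_part L + unit_part L - merged_part L"
  proof -
    have "(\<Sum>as\<in>block_lists L. frag_cmul (cat_weight as) (wterm (c ^ sum_list as) (double_word (rotate1 as))))
        = (\<Sum>as | as \<in> block_lists L \<and> True. frag_cmul (cat_weight (rotate 1 as)) (wterm (c ^ sum_list (rotate 1 as)) (double_word (rotate 1 as))))"
      unfolding rotate_invariant by simp
    also have "\<dots> = double_part L"
      unfolding double_part_def
      using sum_rotate[where P = "\<lambda>_. True" and i = 1 and L = L
          and h = "\<lambda>as. frag_cmul (cat_weight as) (wterm (c ^ sum_list as) (double_word as))"] by simp
    moreover have "(\<Sum>as\<in>block_lists L. frag_cmul (cat_weight as) (if as = [0] then 0 else wterm (c ^ sum_list as) (merged_word as)))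
        = merged_part L"
      unfolding merged_part_def using finite_block_lists by (intro sum.mono_neutral_cong_right) auto
    ultimately show ?thesis
      unfolding unit_part_def by (simp only: frag_cmul_diff_distrib2 frag_cmul_distrib2 sum.distrib sum_subtractf)
  qed
  finally show ?thesis .
qed

lemma corrected_exp_ge: "L > 0 \<Longrightarrow> corrected_exp L \<in> words_ge (real L / 2)"
  unfolding corrected_exp_def using block_lists_weight[of _ L]
  by (auto simp: tval_lsum block_lists_def intro!: words_ge_sum words_ge_cmul term_ge scale_pure)

lemma merged_part_ge: "merged_part L \<in> words_ge (real L / 2)"
  unfolding merged_part_def
proof (intro words_ge_sum words_ge_cmul term_ge[OF pure_scalar_power])
  fix as assume as: "as \<in> block_lists L - {[0]}"
  then obtain a w where w: "as = a # w" by (cases as) (auto simp: block_lists_def)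
  show "merged_word as \<noteq> []" by (simp add: merged_word_def double_word_def)
  have "lsum (merged_word as) = real (length as) / 2"
  proof (cases a)
    case 0
    then have nz: "w \<noteq> []" using as w by auto
    have "lsum (block_word w) = lsum (butlast (block_word w)) + 1 / 2"
      using lsum_split(2)[of "block_word w"] nz by (simp add: last_block_word lval_def)
    then show ?thesis unfolding w 0 by (simp add: merged_word_def double_word_def lval_def add_divide_distrib)
  qed (simp add: w merged_word_def lval_def add_divide_distrib)
  then show "real L / 2 \<le> tval (sum_list as) (merged_word as)"
    using block_lists_weight[of as L] as by (simp add: tval_lsum)
qed

lemma scalar_part_ge: "scalar_part L \<in> words_ge (real L / 2)"
proof (cases "odd L")
  case True
  have "real L \<le> real (2 * (L div 2) + 1)" unfolding of_nat_le_iff by presburger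
  then have "wterm (c ^ Suc (L div 2)) (replicate L E) \<in> words_ge (real L / 2)"
    using True by (intro term_ge[OF pure_scalar_power]) (auto simp: tval_lsum odd_pos)
  then show ?thesis using True by (simp add: scalar_part_def words_ge_cmul del: power_Suc)
qed (simp add: scalar_part_def)

lemma exp_chain_eq: "k > 0 \<Longrightarrow> exp_chain b k =
    frag_cmul (cat_weight (replicate k 0)) (wterm (scale (replicate k 0)) (block_word (replicate k 0)))"
proof -
  assume k: "k > 0"
  have "block_word (replicate k 0) = replicate k Bt" "cat_weight (replicate k 0) = 1" for k
    by (induction k) simp_all
  then show ?thesis using k by (cases k) (simp_all add: exp_chain_def scale_def wterm_def raw_Cons sum_list_replicate)
qed

text \<open>The exponential is the part of \<open>corrected_exp\<close> with all blocks empty, so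
  every word left here contains a unit.\<close>

definition correction :: "nat \<Rightarrow> pre_chain" where
  "correction k = exp_chain b k - corrected_exp k"

lemma correction_0: "correction 0 = 0"
  by (simp add: correction_def exp_chain_def corrected_exp_def)

lemma replicate_block_lists: "k > 0 \<Longrightarrow> replicate k 0 \<in> block_lists k"
  by (simp add: block_lists_def sum_list_replicate)

lemma correction_eq:
  assumes k: "k > 0"
  shows "correction k = (\<Sum>as\<in>block_lists k - {replicate k 0}. frag_cmul (- cat_weight as) (frag_of (raw (scale as) (block_word as))))"
proof -
  let ?f = "\<lambda>as. frag_cmul (cat_weight as) (frag_of (raw (scale as) (block_word as)))"
  have "corrected_exp k = sum ?f (block_lists k)" using k by (simp add: corrected_exp_def wterm_def)
  also have "\<dots> = ?f (replicate k 0) + sum ?f (block_lists k - {replicate k 0})"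
    by (rule sum.remove[OF finite_block_lists replicate_block_lists[OF k]])
  finally have c: "corrected_exp k = ?f (replicate k 0) + sum ?f (block_lists k - {replicate k 0})" .
  have e: "exp_chain b k = ?f (replicate k 0)" unfolding exp_chain_eq[OF k] wterm_def ..
  show ?thesis
    unfolding correction_def c e frag_cmul_uminus sum_negf
    by (simp only: diff_diff_eq[symmetric] diff_self diff_0)
qed

lemma correction_keys:
  assumes "w \<in> Poly_Mapping.keys (correction k)"
  shows "is_word w" "\<exists>a\<in>set w. a \<in> ends_scalar ` Rs"
proof -
  have k: "k > 0" using assms correction_0 by (cases k) auto
  obtain as where as: "as \<in> block_lists k" "as \<noteq> replicate k 0" "w = raw (scale as) (block_word as)"
    using keys_sum_frag[OF assms[unfolded correction_eq[OF k]]] by blast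
  have nz: "as \<noteq> []" using as(1) by (simp add: block_lists_def)
  show "is_word w" unfolding as(3) by (rule is_word_raw[OF scale_pure[OF nz]])
  have "\<exists>a\<in>set as. a \<noteq> 0"
  proof (rule ccontr)
    assume z: "\<not> (\<exists>a\<in>set as. a \<noteq> 0)"
    then have s: "sum_list as = 0" by simp
    have "length as = k" using as(1) unfolding block_lists_def mem_Collect_eq s by simp
    then have "as = replicate k 0" using z by (intro replicate_eqI) auto
    then show False using as(2) by blast
  qed
  then have E: "E \<in> set (block_word as)"
  proof (induction as)
    case (Cons a as)
    then show ?case by (cases a) auto
  qed simp
  obtain x vs where v: "block_word as = x # vs" using nz by (cases "block_word as") auto
  show "\<exists>a\<in>set w. a \<in> ends_scalar ` Rs"
  \<comment> \<open>A unit in front carries the scalar of the word; any other unit occurs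
    unchanged.\<close>
  proof (cases "x = E")
    case True
    then show ?thesis unfolding as(3) v raw_Cons using pure_scalar_Rs[OF scale_pure[OF nz]] by simp
  next
    case False
    then have "E \<in> set vs" using E v by auto
    then have "lev E \<in> set (map lev vs)" unfolding set_map by (rule imageI)
    then have "lev E \<in> set w" unfolding as(3) v raw_Cons by (rule list.set_intros(2))
    moreover have "lev E \<in> ends_scalar ` Rs" using one_in_Rs image_eqI[of "lev E" ends_scalar 1 Rs] by simp
    ultimately show ?thesis by blast
  qed
qed

lemma words_geI:
  assumes "\<And>k. k > 0 \<Longrightarrow> x k \<in> words_ge (real k / 2)"
  shows "eventually (\<lambda>k. x k \<in> words_ge B) sequentially"
  using eventually_ge_at_top[of "nat \<lceil>2 * \<bar>B\<bar>\<rceil> + 1"]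
proof eventually_elim
  case (elim k)
  then have "k > 0" "B \<le> real k / 2" by linarith+
  then show ?case using words_ge_mono[OF assms] by blast
qed

lemma is_chainI:
  assumes "\<And>k. x k \<in> words_ge (real k / 2)"
  shows "is_chain x"
  unfolding is_chain_def using words_geI[of x] assms by (auto simp: words_ge_def)

text \<open>By \<open>parts_cancel\<close> the boundary equals a scalar chain up to differences of
  consecutive \<open>merged_part\<close>. These telescope, and the remaining term of length n has
  valuation at least n/2.\<close>

lemma correction_is_correction: "is_correction b correction"
proof -
  have exp_ge: "exp_chain b k \<in> words_ge (real k / 2)" if k: "k > 0" for k
    unfolding exp_chain_eq[OF k] using block_lists_weight[OF replicate_block_lists[OF k]] k
    by (intro words_ge_cmul term_ge[OF scale_pure]) (simp_all add: tval_lsum)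
  have corr_ge: "correction k \<in> words_ge (real k / 2)" for k
  proof (cases "k = 0")
    case False
    then show ?thesis
      using words_ge_add[OF exp_ge words_ge_uminus[OF corrected_exp_ge]] by (simp add: correction_def)
  qed (simp add: correction_0)
  have R: "in_R_lambda correction"
    unfolding in_R_lambda_def using is_chainI[of correction, OF corr_ge] correction_keys by blast
  let ?Z = "\<lambda>k. - scalar_part k"
  have Z: "in_C_lambda_Rs ?Z"
    unfolding in_C_lambda_Rs_def
  proof (intro conjI allI ballI)
    show "is_chain ?Z" using scalar_part_ge by (intro is_chainI words_ge_uminus)
    fix k w assume w: "w \<in> Poly_Mapping.keys (- scalar_part k)"
    then have k: "odd k" by (cases "odd k") (simp_all add: scalar_part_def)
    have "w \<in> Poly_Mapping.keys (frag_cmul (catalan (k div 2)) (frag_of (raw (c ^ Suc (k div 2)) (replicate k E))))"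
      using w k by (simp add: scalar_part_def wterm_def)
    then have "w \<in> Poly_Mapping.keys (frag_of (raw (c ^ Suc (k div 2)) (replicate k E)))"
      using keys_cmul by blast
    then have "w = raw (c ^ Suc (k div 2)) (replicate k E)" by simp
    moreover obtain l where "k = Suc l" using k by (cases k) auto
    ultimately have "w = ends_scalar (c ^ Suc (k div 2)) # replicate l 1" by (simp add: raw_Cons)
    then show "\<exists>r\<in>Rs. \<exists>l. w = ends_scalar r # replicate l 1"
      using pure_scalar_Rs[OF pure_scalar_power] by blast
  qed
  let ?X = "\<lambda>k. d_cc (correction k) - d_cc (exp_chain b k) - ?Z k"
  let ?M = "\<lambda>k. merged_part k - merged_part (Suc k)"
  have X: "?X k = scalar_part k - d_cc (corrected_exp k)" for k
    by (simp add: correction_def d_cc_diff)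
  have "\<forall>k. \<exists>u. u \<in> words_ge (real k / 2) \<and> ?X k - ?M k - (u - cyc_t u) \<in> tensor_relations"
  proof
    fix k
    have "cyc_eq (real k / 2) (scalar_part k - d_cc (corrected_exp k)) (scalar_part k - (double_part k + unit_part k - merged_part k))"
      by (intro cyc_eq_diff cyc_eq_refl d_cc_corrected_exp)
    moreover have "scalar_part k - (double_part k + unit_part k - merged_part k) = ?M k"
      unfolding parts_cancel[symmetric] by simp
    ultimately show "\<exists>u. u \<in> words_ge (real k / 2) \<and> ?X k - ?M k - (u - cyc_t u) \<in> tensor_relations"
      unfolding X cyc_eq_def by (simp only: Bex_def)
  qed
  then obtain U where U: "\<And>k. U k \<in> words_ge (real k / 2)" "\<And>k. ?X k - ?M k - (U k - cyc_t (U k)) \<in> tensor_relations"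
    using choice[of "\<lambda>k u. u \<in> words_ge (real k / 2) \<and> ?X k - ?M k - (u - cyc_t u) \<in> tensor_relations"] by blast
  have "chain_null (\<lambda>k. ?X k - (U k - cyc_t (U k)))"
    unfolding chain_null_def
  proof
    fix B
    have "eventually (\<lambda>n. - merged_part n \<in> words_ge B) sequentially"
      by (intro words_geI words_ge_uminus merged_part_ge)
    then show "eventually (\<lambda>n. \<exists>y\<in>words_ge B. (\<Sum>k<n. ?X k - (U k - cyc_t (U k))) - y \<in> tensor_relations) sequentially"
    proof eventually_elim
      case (elim n)
      have M: "(\<Sum>k<n. ?M k) = - merged_part n"
        by (induction n) (simp_all add: merged_part_def[of 0])
      have "(\<Sum>k<n. ?X k - (U k - cyc_t (U k))) - - merged_part n = (\<Sum>k<n. ?X k - ?M k - (U k - cyc_t (U k)))"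
        unfolding M[symmetric] sum_subtractf[symmetric] by (intro sum.cong refl) (simp add: algebra_simps)
      moreover have "\<dots> \<in> tensor_relations" by (intro relations_sum U(2))
      ultimately show ?case using elim by (intro bexI[of _ "- merged_part n"]) simp_all
    qed
  qed
  moreover have "is_chain U" by (rule is_chainI[OF U(1)])
  ultimately have "cyclic_null ?X" unfolding cyclic_null_def by (intro exI[of _ U] conjI)
  then show ?thesis unfolding is_correction_def using R Z by (intro conjI exI[of _ ?Z])
qed

end

section \<open>The explicit point-like bounding cochain\<close>

text \<open>\<open>al\<close> and \<open>be\<close> both start with s, so the upper left entry of
  the square starts with s^2 z0.\<close>

lemma b_exp_square_nz: "b_exp * b_exp \<noteq> 0"
proof
  assume "b_exp * b_exp = 0"
  then have "en11 ((b_exp * b_exp) $ 2) = 0" by simp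
  moreover have "en11 ((b_exp * b_exp) $ 2) = s_const Thalf * (s_const (inverse Thalf) * z0)"
    unfolding fps_mult_nth
    by (simp add: numeral_2_eq_2 b_exp_0 en_add en_mult al_def be_def s_const_hom(3))
  moreover have "s_const Thalf * (s_const (inverse Thalf) * z0) = z0"
    using s_const_Thalf by (metis mult.assoc mult_1)
  moreover have "z0 \<noteq> 0"
  proof
    assume "z0 = 0"
    then have "qy 2 1 = (0 :: cfls2)" using expand_z0[of True] by simp
    then have "qy 2 1 $$ 2 $$ 1 = 0" by simp
    then show False unfolding qy_nth by simp
  qed
  ultimately show False by simp
qed

interpretation exp_cochain: curved_cochain b_exp exp_potential
proof
  show "delta b_exp = b_exp * b_exp + ends_scalar exp_potential"
    using b_exp_potential_eq by (metis add.commute diff_add_cancel)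
qed (rule b_exp_hom b_exp_ge exp_potential_pure b_exp_square_nz)+

text \<open>\<open>beta\<close> of the explicit cochain is \<open>al\<close> times X / (1 + X) or 1
  / (1 + X) evaluated at X = qy.\<close>

definition side_factor :: "bool \<Rightarrow> complex fps" where
  "side_factor d = (if d then fps_X else 1) * inverse (1 + fps_X)"

lemma const_e_mult_nth: "(const_e x * f) $$ N $$ n = complex_of_real x * f $$ N $$ n"
proof -
  have "const_e x = fls_const (fls_const (complex_of_real x))"
    unfolding const_e_def by (rule fls_eqI, rule fls_eqI) (simp add: emb_nth)
  then show ?thesis by (simp add: fls_const_mult_nth)
qed

lemma beta_b_exp: "beta b_exp d = fps_map const_e al * fps_const (diag (fps_to_fls (side_factor d)))"
proof (rule fps_ext)
  fix k
  have inv: "inv_lin = fps_to_fls (inverse (1 + fps_X))"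
    unfolding inv_lin_def by (subst fls_inverse_fps_to_fls[symmetric]) (auto intro!: subdegreeI)
  have G: "diag (fps_to_fls (side_factor d)) = qy (1 - kap d) 0 * G21 d"
  proof (cases d)
    case True
    have "diag (fps_to_fls (side_factor d)) = qy 1 1 * diag inv_lin"
      unfolding side_factor_def inv using True diag_X_power[of 1] by (simp add: fls_times_fps_to_fls diag_mult)
    also have "qy 1 1 = qy 1 0 * qy 0 1" by (simp add: qy_mult)
    finally show ?thesis using True by (simp add: kap_def G21_def mult.assoc)
  qed (simp add: side_factor_def inv kap_def G21_def)
  have "mat_12 (ends_mat d b_exp) $ k = qy (- kap d) 0 * (const_e (al $ k) * qy 1 0)"
    by (simp add: ends_mat_sel expand_const emb_mult emb_Thalf const_e_def)
  also have "\<dots> = const_e (al $ k) * qy (1 - kap d) 0"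
    by (simp add: qy_mult mult.left_commute)
  finally show "beta b_exp d $ k = (fps_map const_e al * fps_const (diag (fps_to_fls (side_factor d)))) $ k"
    unfolding beta_def G by (simp add: mult.assoc)
qed

text \<open>On series in qy the constant term in y is the value at 0, which for positive powers of
  \<open>side_factor d\<close> is 0 at one end and 1 at the other.\<close>

lemma log_sum_b_exp:
  "log_sum b_exp d n $ j $$ N $$ 0 =
    (if d \<or> N \<noteq> 0 then 0 else complex_of_real ((\<Sum>k\<in>{1..<n}. fps_const (1 / real k) * al ^ k) $ j))"
proof -
  have pow: "beta b_exp d ^ k = fps_map const_e (al ^ k) * fps_const (diag (fps_to_fls (side_factor d ^ k)))" for k
  proof (induction k)
    case 0
    then show ?case by (simp add: fps_map_1[OF ring_map_const_e])
  next
    case (Suc k)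
    then show ?case
      by (simp add: beta_b_exp fps_map_mult[OF ring_map_const_e] fls_times_fps_to_fls diag_mult mult_ac)
  qed
  have summand: "(fps_const (emb (fls_const (1 / real k))) * beta b_exp d ^ k) $ j $$ N $$ 0
      = (if d \<or> N \<noteq> 0 then 0 else complex_of_real ((fps_const (1 / real k) * al ^ k) $ j))" if "k \<in> {1..<n}" for k
  proof -
    have "(fps_const (emb (fls_const (1 / real k))) * beta b_exp d ^ k) $ j
        = const_e (1 / real k) * (const_e ((al ^ k) $ j) * diag (fps_to_fls (side_factor d ^ k)))"
      unfolding pow by (simp add: const_e_def)
    moreover have "(side_factor d ^ k) $ 0 = (if d then 0 else 1)"
      using that by (simp add: fps_power_zeroth side_factor_def)
    ultimately show ?thesis by (auto simp: const_e_mult_nth diag_nth)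
  qed
  have "log_sum b_exp d n $ j $$ N $$ 0
      = (\<Sum>k\<in>{1..<n}. (fps_const (emb (fls_const (1 / real k))) * beta b_exp d ^ k) $ j $$ N $$ 0)"
    unfolding log_sum_def by (simp only: fps_sum_nth fls_sum_nth)
  also have "\<dots> = (\<Sum>k\<in>{1..<n}. if d \<or> N \<noteq> 0 then 0 else complex_of_real ((fps_const (1 / real k) * al ^ k) $ j))"
    by (rule sum.cong[OF refl summand])
  also have "\<dots> = (if d \<or> N \<noteq> 0 then 0 else complex_of_real ((\<Sum>k\<in>{1..<n}. fps_const (1 / real k) * al ^ k) $ j))"
    by (simp add: fps_sum_nth)
  finally show ?thesis .
qed

text \<open>The series \<open>\<Sum> al\<^sup>k / k = - log (1 - al)\<close> equals \<open>s\<close>, because \<open>al' = 1 - al\<close>.\<close>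

lemma log_series_al:
  assumes "j < n"
  shows "(\<Sum>k\<in>{1..<n}. fps_const (1 / real k) * al ^ k) $ j = fps_X $ j"
proof -
  obtain m where n: "n = Suc m" using assms by (cases n) auto
  let ?S = "\<Sum>k\<in>{1..<n}. fps_const (1 / real k) * al ^ k"
  have S: "?S = (\<Sum>i<m. fps_const (1 / real (Suc i)) * al ^ Suc i)"
    unfolding n by (rule sum.reindex_bij_witness[of _ Suc "\<lambda>k. k - 1"]) auto
  have al0: "al $ 0 = 0" by (simp add: al_def)
  have dal: "fps_deriv al = 1 - al" by (simp add: al_def flip: fps_const_neg)
  have dt: "fps_deriv (fps_const (1 / real (Suc i)) * al ^ Suc i) = (1 - al) * al ^ i" for i
  proof -
    have "fps_const (1 / real (Suc i)) * of_nat (Suc i) = (1 :: real fps)"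
      unfolding fps_of_nat[symmetric] by simp
    then show ?thesis unfolding fps_deriv_mult fps_deriv_power dal
      by (simp add: fps_of_nat mult_ac del: of_nat_Suc)
  qed
  have dS: "fps_deriv ?S = 1 - al ^ m"
    unfolding S fps_deriv_sum dt sum_distrib_left[symmetric] by (rule one_diff_power_eq[symmetric])
  show ?thesis
  proof (cases j)
    case 0
    show ?thesis unfolding 0 fps_sum_nth using al0 by (auto intro!: sum.neutral simp: fps_power_zeroth)
  next
    case (Suc i)
    have "(al ^ m) $ i = 0"
      using assms Suc n by (intro startsby_zero_power_prefix[OF al0, rule_format]) simp
    then have "fps_deriv ?S $ i = 1 $ i" unfolding dS by simp
    then show ?thesis unfolding Suc by (cases i) (auto simp: fps_X_def)
  qed
qed

lemma b_exp_point_like: "point_like b_exp"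
  unfolding point_like_def
proof (intro conjI exI)
  show "bounding_cochain b_exp" by (rule b_exp_bounding)
  show corr: "is_correction b_exp exp_cochain.correction" by (rule exp_cochain.correction_is_correction)
  let ?T = "\<lambda>n. \<Sum>k<n. Theta (exp_chain b_exp k - exp_cochain.correction k)"
  show "Theta_sums (\<lambda>k. exp_chain b_exp k - exp_cochain.correction k) fps_X"
    unfolding Theta_sums_def
  proof
    fix B :: real
    show "eventually (\<lambda>n. ereal B \<le> Rs_val (?T n - fps_X)) sequentially"
      using Theta_partial_sums[OF b_exp_hom corr, of B] eventually_ge_at_top[of "nat \<lceil>B\<rceil>"]
    proof eventually_elim
      case (elim n)
      have "ereal B \<le> ereal (real j) + nov_val ((?T n - fps_X) $ j)" for j
      proof -
        have "ereal (B - real j) \<le> nov_val ((?T n - fps_X) $ j)"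
          unfolding nov_val_ge_iff
        proof (intro allI impI, rule ccontr)
          fix N assume nz: "(?T n - fps_X) $ j $$ N \<noteq> 0" and "\<not> B - real j \<le> of_int N / 2"
          then have lt: "real j + of_int N / 2 < B" by simp
          have T: "?T n $ j $$ N = - (log_sum b_exp True n $ j $$ N $$ 0 - log_sum b_exp False n $ j $$ N $$ 0)"
            using elim(1) lt by blast
          show False
          proof (cases "N = 0")
            case True
            \<comment> \<open>For N = 0 only coefficients with j < B are in question, and n is at
              least B.\<close>
            then have "j < n" using lt elim(2) by linarith
            then show False using nz T True unfolding log_sum_b_exp log_series_al[OF \<open>j < n\<close>]
              by (auto simp: fps_X_def split: if_splits)
          next
            case False
            then show False using nz T unfolding log_sum_b_exp by (auto simp: fps_X_def split: if_splits)
          qed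
        qed
        then have "ereal (real j) + ereal (B - real j) \<le> ereal (real j) + nov_val ((?T n - fps_X) $ j)"
          by (rule add_left_mono)
        then show ?thesis by simp
      qed
      then show ?case unfolding Rs_val_def by (intro INF_greatest)
    qed
  qed
qed

lemma point_potential_eq: "point_potential = exp_potential"
  unfolding point_potential_def
proof (rule the_equality)
  show "\<exists>b. point_like b \<and> is_potential b exp_potential"
    using b_exp_point_like b_exp_bounding(1) by blast
qed (use point_like_potential in blast)

theorem corollary23:
  fixes d :: rat and k :: nat
  assumes "2 * d \<in> \<int>" and "k \<ge> 1"
  shows "num_inv d k = (if d = 1 / 2 \<and> even k then 2 else 0)"
proof -
  obtain m where m: "2 * d = of_int m" using assms(1) by (elim Ints_cases)
  obtain j where j: "k = Suc j" using assms(2) by (cases k) auto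
  have d: "d = 1 / 2 \<longleftrightarrow> m = 1"
  proof -
    have "d = 1 / 2 \<longleftrightarrow> 2 * d = 1" by auto
    then show ?thesis unfolding m by simp
  qed
  have "num_inv d k = fact j * ((fps_exp 1 - fps_exp (- 1)) $ j * (if m = 1 then 1 else 0))"
    unfolding num_inv_def point_potential_eq m j by (simp add: exp_potential_def fls_const_mult_nth)
  \<comment> \<open>The factorial cancels the denominators of e^s - e^(-s); odd j = k - 1 gives 2,
    even j gives 0.\<close>
  also have "\<dots> = (if m = 1 then 1 - (- 1) ^ j else 0)"
    by (simp add: field_simps)
  also have "\<dots> = (if d = 1 / 2 \<and> even k then 2 else 0)"
    unfolding d j by (cases "even j") simp_all
  finally show ?thesis .
qed

end
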